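(* Let $\Lambda$ be an artin algebra with $\operatorname{gldim}\Lambda<\infty$. Let $\widetilde{Q}$ be the direct sum of representatives of the isomorphism classes of all indecomposable projective-injective $\Lambda$-modules, and let $\mathcal{C}_\Lambda=(\operatorname{Gen}\widetilde{Q})\cap(\operatorname{Cogen}\widetilde{Q})$. Then the subcategory $\mathcal{C}_\Lambda$ contains a tilting-cotilting module (a module which is both tilting and cotilting) if and only if $\Lambda$ is an Auslander algebra.
   Context: All modules are finitely generated left modules. $\operatorname{Gen}(X)$ (resp. $\operatorname{Cogen}(X)$) is the full subcategory of modules $M$ admitting an epimorphism $X^m\to M$ (resp. a monomorphism $M\to X^m$) for some $m$. An Auslander algebra is an artin algebra $\Lambda$ with $\operatorname{gldim}\Lambda\le 2\le\operatorname{domdim}\Lambda$, where for a minimal injective resolution $0\to{}_\Lambda\Lambda\to I_0\to I_1\to\cdots$, $\operatorname{domdim}\Lambda=\sup\{k\mid I_i\text{ is projective for all }0\le i<k\}$. A basic $\Lambda$-module $T$ is tilting if (1) $\operatorname{projdim}T\le 1$, (2) $\operatorname{Ext}^1_\Lambda(T,T)=0$, (3) there is an exact sequence $0\to\Lambda\to T_0\to T_1\to 0$ with $T_0,T_1\in\operatorname{add}T$. A $\Lambda$-module $C$ is cotilting if (1) $\operatorname{injdim}C\le 1$, (2) $\operatorname{Ext}^1_\Lambda(C,C)=0$, (3) there is an exact sequence $0\to C_0\to C_1\to D\Lambda\to 0$ with $C_0,C_1\in\operatorname{add}C$, where $D$ is the standard duality. *)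

theory Defs
  imports "HOL-Library.Extended_Nat" "HOL-Algebra.Module" "HOL-Algebra.QuotRing"
begin

section \<open>Left modules over rings that need not be commutative\<close>

text \<open>
  Modules are records of type \<^typ>\<open>('a, 'm) module\<close>, as for the library locale
  \<^locale>\<open>module\<close>, which however requires a commutative ring of scalars. The fields \<open>mult\<close> and
  \<open>one\<close> of such a record play no role in what follows.
\<close>

locale left_module = R?: ring R + M?: abelian_group M
  for R :: "('a, 'x) ring_scheme" (structure) and M :: "('a, 'm, 'y) module_scheme" (structure) +
  assumes smult_closed [simp, intro]:
      "\<lbrakk>a \<in> carrier R; x \<in> carrier M\<rbrakk> \<Longrightarrow> a \<odot>\<^bsub>M\<^esub> x \<in> carrier M"
    and smult_l_distr:
      "\<lbrakk>a \<in> carrier R; b \<in> carrier R; x \<in> carrier M\<rbrakk> \<Longrightarrow>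
        (a \<oplus> b) \<odot>\<^bsub>M\<^esub> x = a \<odot>\<^bsub>M\<^esub> x \<oplus>\<^bsub>M\<^esub> b \<odot>\<^bsub>M\<^esub> x"
    and smult_r_distr:
      "\<lbrakk>a \<in> carrier R; x \<in> carrier M; y \<in> carrier M\<rbrakk> \<Longrightarrow>
        a \<odot>\<^bsub>M\<^esub> (x \<oplus>\<^bsub>M\<^esub> y) = a \<odot>\<^bsub>M\<^esub> x \<oplus>\<^bsub>M\<^esub> a \<odot>\<^bsub>M\<^esub> y"
    and smult_assoc1:
      "\<lbrakk>a \<in> carrier R; b \<in> carrier R; x \<in> carrier M\<rbrakk> \<Longrightarrow>
        (a \<otimes> b) \<odot>\<^bsub>M\<^esub> x = a \<odot>\<^bsub>M\<^esub> (b \<odot>\<^bsub>M\<^esub> x)"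
    and smult_one [simp]:
      "x \<in> carrier M \<Longrightarrow> \<one> \<odot>\<^bsub>M\<^esub> x = x"

lemma module_iff_left_module: "module R M \<longleftrightarrow> cring R \<and> left_module R M"
  by (auto simp: module_def left_module_def module_axioms_def left_module_axioms_def
      cring.axioms(1))

definition fg_module :: "('a, 'x) ring_scheme \<Rightarrow> ('a, 'm) module \<Rightarrow> bool" where
  "fg_module A M \<longleftrightarrow> left_module A M \<and>
     (\<exists>S. finite S \<and> S \<subseteq> carrier M \<and>
       (\<forall>x\<in>carrier M. \<exists>c\<in>S \<rightarrow> carrier A. x = (\<Oplus>\<^bsub>M\<^esub>s\<in>S. c s \<odot>\<^bsub>M\<^esub> s)))"

definition mod_hom ::
    "('a, 'x) ring_scheme \<Rightarrow> ('a, 'm) module \<Rightarrow> ('a, 'n) module \<Rightarrow> ('m \<Rightarrow> 'n) set" where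
  "mod_hom A M N =
     {f \<in> carrier M \<rightarrow> carrier N.
        (\<forall>x\<in>carrier M. \<forall>y\<in>carrier M. f (x \<oplus>\<^bsub>M\<^esub> y) = f x \<oplus>\<^bsub>N\<^esub> f y) \<and>
        (\<forall>a\<in>carrier A. \<forall>x\<in>carrier M. f (a \<odot>\<^bsub>M\<^esub> x) = a \<odot>\<^bsub>N\<^esub> f x)}"

definition mod_mono ::
    "('a, 'x) ring_scheme \<Rightarrow> ('a, 'm) module \<Rightarrow> ('a, 'n) module \<Rightarrow> ('m \<Rightarrow> 'n) set" where
  "mod_mono A M N = {f \<in> mod_hom A M N. inj_on f (carrier M)}"

definition mod_epi ::
    "('a, 'x) ring_scheme \<Rightarrow> ('a, 'm) module \<Rightarrow> ('a, 'n) module \<Rightarrow> ('m \<Rightarrow> 'n) set" where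
  "mod_epi A M N = {f \<in> mod_hom A M N. f ` carrier M = carrier N}"

definition mod_iso ::
    "('a, 'x) ring_scheme \<Rightarrow> ('a, 'm) module \<Rightarrow> ('a, 'n) module \<Rightarrow> ('m \<Rightarrow> 'n) set" where
  "mod_iso A M N = {f \<in> mod_hom A M N. bij_betw f (carrier M) (carrier N)}"

definition isomorphic_modules ::
    "('a, 'x) ring_scheme \<Rightarrow> ('a, 'm) module \<Rightarrow> ('a, 'n) module \<Rightarrow> bool" where
  "isomorphic_modules A M N \<longleftrightarrow> mod_iso A M N \<noteq> {}"

definition hom_kernel :: "('a, 'm) module \<Rightarrow> ('a, 'n) module \<Rightarrow> ('m \<Rightarrow> 'n) \<Rightarrow> 'm set" where
  "hom_kernel M N f = {x \<in> carrier M. f x = \<zero>\<^bsub>N\<^esub>}"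

definition short_exact ::
    "('a, 'x) ring_scheme \<Rightarrow> ('a, 'l) module \<Rightarrow> ('l \<Rightarrow> 'm) \<Rightarrow> ('a, 'm) module \<Rightarrow> ('m \<Rightarrow> 'n) \<Rightarrow>
      ('a, 'n) module \<Rightarrow> bool" where
  "short_exact A L f M g N \<longleftrightarrow>
     f \<in> mod_mono A L M \<and> g \<in> mod_epi A M N \<and> f ` carrier L = hom_kernel M N g"


subsection \<open>The modules over which the theory quantifies\<close>

text \<open>
  HOL cannot quantify over modules with carriers in all types at once. Every finitely generated
  module over a ring with carrier in \<^typ>\<open>'a\<close> is a quotient of some finite power of the ring, so
  up to isomorphism it has its carrier in \<^typ>\<open>(nat \<Rightarrow> 'a) set\<close> (lemma \<open>fg_module_universe\<close>
  below). The finitely generated modules of the following type thus represent all isomorphism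
  classes, and notions that refer to ``all finitely generated modules'' quantify over them.
\<close>

type_synonym 'a umod = "('a, (nat \<Rightarrow> 'a) set) module"

lemma fg_module_transport:
  fixes A :: "('a, 'x) ring_scheme" and M :: "('a, 'm) module" and h :: "'m \<Rightarrow> 'n"
  assumes fg: "fg_module A M" and inj: "inj_on h (carrier M)"
  shows "\<exists>N :: ('a, 'n) module. fg_module A N \<and> isomorphic_modules A M N"
proof -
  interpret left_module A M
    using fg by (simp add: fg_module_def)
  define k where "k = the_inv_into (carrier M) h"
  have k [simp]: "k (h x) = x" if "x \<in> carrier M" for x
    using the_inv_into_f_f[OF inj that] by (simp add: k_def)
  define N :: "('a, 'n) module" where
    "N = \<lparr>carrier = h ` carrier M, mult = undefined, one = undefined, zero = h \<zero>\<^bsub>M\<^esub>,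
          add = (\<lambda>x y. h (k x \<oplus>\<^bsub>M\<^esub> k y)), smult = (\<lambda>a x. h (a \<odot>\<^bsub>M\<^esub> k x))\<rparr>"
  have N [simp]: "carrier N = h ` carrier M" "\<zero>\<^bsub>N\<^esub> = h \<zero>\<^bsub>M\<^esub>"
    "x \<oplus>\<^bsub>N\<^esub> y = h (k x \<oplus>\<^bsub>M\<^esub> k y)" "a \<odot>\<^bsub>N\<^esub> x = h (a \<odot>\<^bsub>M\<^esub> k x)" for a x y
    by (simp_all add: N_def)
  have "abelian_group N"
  proof (rule abelian_groupI)
    fix x assume "x \<in> carrier N"
    then obtain u where u: "u \<in> carrier M" "x = h u"
      by auto
    then show "\<exists>y\<in>carrier N. y \<oplus>\<^bsub>N\<^esub> x = \<zero>\<^bsub>N\<^esub>"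
      by (intro bexI[of _ "h (\<ominus>\<^bsub>M\<^esub> u)"]) (auto simp: M.l_neg)
  qed (auto simp: M.a_ac)
  then have lm: "left_module A N"
    by (intro left_module.intro left_module_axioms.intro R.ring_axioms)
       (auto simp: smult_l_distr smult_r_distr smult_assoc1)
  interpret N: left_module A N
    by (fact lm)
  have sum: "h (\<Oplus>\<^bsub>M\<^esub>s\<in>S. f s) = (\<Oplus>\<^bsub>N\<^esub>s\<in>S. h (f s))"
    if "finite S" "f \<in> S \<rightarrow> carrier M" for S and f :: "'m \<Rightarrow> 'm"
    using that
  proof (induction S)
    case (insert x F)
    then have "(\<Oplus>\<^bsub>M\<^esub>s\<in>F. f s) \<in> carrier M"
      by (intro M.finsum_closed) auto
    moreover have "f x \<in> carrier M" "f \<in> F \<rightarrow> carrier M" "(\<lambda>s. h (f s)) \<in> F \<rightarrow> carrier N"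
      using insert.prems by auto
    moreover from this insert have "(\<Oplus>\<^bsub>N\<^esub>s\<in>F. h (f s)) = h (\<Oplus>\<^bsub>M\<^esub>s\<in>F. f s)"
      by simp
    ultimately show ?case
      using insert(1,2) by simp
  qed simp
  obtain S where S: "finite S" "S \<subseteq> carrier M"
    "\<forall>x\<in>carrier M. \<exists>c\<in>S \<rightarrow> carrier A. x = (\<Oplus>\<^bsub>M\<^esub>s\<in>S. c s \<odot>\<^bsub>M\<^esub> s)"
    using fg by (auto simp: fg_module_def)
  have "\<exists>c\<in>h ` S \<rightarrow> carrier A. x = (\<Oplus>\<^bsub>N\<^esub>s\<in>h ` S. c s \<odot>\<^bsub>N\<^esub> s)" if "x \<in> carrier N" for x
  proof -
    from that obtain u where u: "u \<in> carrier M" "x = h u"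
      by auto
    with S obtain c where c: "c \<in> S \<rightarrow> carrier A" "u = (\<Oplus>\<^bsub>M\<^esub>s\<in>S. c s \<odot>\<^bsub>M\<^esub> s)"
      by blast
    have kS: "k (h s) = s" if "s \<in> S" for s
      using S(2) that by auto
    have "x = (\<Oplus>\<^bsub>N\<^esub>s\<in>S. h (c s \<odot>\<^bsub>M\<^esub> s))"
      unfolding u(2) c(2) by (rule sum) (use S c in auto)
    also have "\<dots> = (\<Oplus>\<^bsub>N\<^esub>s\<in>S. c (k (h s)) \<odot>\<^bsub>N\<^esub> h s)"
      by (rule N.M.finsum_cong') (use S c kS in \<open>auto simp: Pi_iff subset_iff\<close>)
    also have "\<dots> = (\<Oplus>\<^bsub>N\<^esub>s\<in>h ` S. c (k s) \<odot>\<^bsub>N\<^esub> s)"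
      by (rule N.M.finsum_reindex[symmetric])
         (use S c kS inj in \<open>auto simp: Pi_iff subset_iff intro: inj_on_subset\<close>)
    finally show ?thesis
      using c(1) kS by (intro bexI[of _ "c \<circ> k"]) auto
  qed
  with S(1,2) lm have "fg_module A N"
    unfolding fg_module_def by (intro conjI exI[of _ "h ` S"]) auto
  moreover have "h \<in> mod_iso A M N"
    using inj by (auto simp: mod_iso_def mod_hom_def bij_betw_def)
  ultimately show ?thesis
    by (auto simp: isomorphic_modules_def)
qed

lemma fg_module_universe:
  fixes A :: "('a, 'x) ring_scheme" and M :: "('a, 'm) module"
  assumes "fg_module A M"
  shows "\<exists>N :: 'a umod. fg_module A N \<and> isomorphic_modules A M N"
proof -
  obtain S where S: "finite S" "S \<subseteq> carrier M"
    "\<forall>x\<in>carrier M. \<exists>c\<in>S \<rightarrow> carrier A. x = (\<Oplus>\<^bsub>M\<^esub>s\<in>S. c s \<odot>\<^bsub>M\<^esub> s)"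
    using assms by (auto simp: fg_module_def)
  interpret left_module A M
    using assms by (simp add: fg_module_def)
  obtain b :: "'m \<Rightarrow> nat" where b: "inj_on b S"
    using finite_imp_inj_to_nat_seg[OF S(1)] by blast
  define h :: "'m \<Rightarrow> (nat \<Rightarrow> 'a) set" where
    "h x = {u. x = (\<Oplus>\<^bsub>M\<^esub>s\<in>S. u (b s) \<odot>\<^bsub>M\<^esub> s)}" for x
  have "h x \<noteq> {}" if x: "x \<in> carrier M" for x
  proof -
    obtain c where c: "c \<in> S \<rightarrow> carrier A" "x = (\<Oplus>\<^bsub>M\<^esub>s\<in>S. c s \<odot>\<^bsub>M\<^esub> s)"
      using S(3) x by blast
    have "(\<lambda>i. c (the_inv_into S b i)) \<in> h x"
      unfolding h_def mem_Collect_eq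
      by (subst c(2), rule M.finsum_cong) (use c(1) S(2) in \<open>auto simp: the_inv_into_f_f[OF b] simp_implies_def Pi_iff subset_iff\<close>)
    then show ?thesis
      by blast
  qed
  then have "inj_on h (carrier M)"
    by (intro inj_onI) (auto simp: h_def set_eq_iff)
  from fg_module_transport[OF assms this] show ?thesis .
qed


subsection \<open>Basic constructions\<close>

definition regular_module :: "('a, 'x) ring_scheme \<Rightarrow> ('a, 'a) module" where
  "regular_module A =
     \<lparr>carrier = carrier A, mult = mult A, one = \<one>\<^bsub>A\<^esub>, zero = \<zero>\<^bsub>A\<^esub>, add = add A,
      smult = mult A\<rparr>"

definition opposite_ring :: "('a, 'x) ring_scheme \<Rightarrow> ('a, 'x) ring_scheme" where
  "opposite_ring A = A\<lparr>mult := (\<lambda>x y. y \<otimes>\<^bsub>A\<^esub> x)\<rparr>"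

definition restrict_scalars :: "('r \<Rightarrow> 'a) \<Rightarrow> ('a, 'm) module \<Rightarrow> ('r, 'm) module" where
  "restrict_scalars \<phi> M =
     \<lparr>carrier = carrier M, mult = mult M, one = \<one>\<^bsub>M\<^esub>, zero = \<zero>\<^bsub>M\<^esub>, add = add M,
      smult = (\<lambda>r x. \<phi> r \<odot>\<^bsub>M\<^esub> x)\<rparr>"

definition quotient_module :: "('a, 'x) ring_scheme \<Rightarrow> 'a set \<Rightarrow> ('a, 'a set) module" where
  "quotient_module A I =
     \<lparr>carrier = carrier (A Quot I), mult = mult (A Quot I), one = \<one>\<^bsub>A Quot I\<^esub>,
      zero = \<zero>\<^bsub>A Quot I\<^esub>, add = add (A Quot I),
      smult = (\<lambda>a X. (I +>\<^bsub>A\<^esub> a) \<otimes>\<^bsub>A Quot I\<^esub> X)\<rparr>"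

definition direct_sum2 :: "('a, 'm) module \<Rightarrow> ('a, 'n) module \<Rightarrow> ('a, 'm \<times> 'n) module" where
  "direct_sum2 M N =
     \<lparr>carrier = carrier M \<times> carrier N, mult = undefined, one = undefined,
      zero = (\<zero>\<^bsub>M\<^esub>, \<zero>\<^bsub>N\<^esub>),
      add = (\<lambda>(x, y) (x', y'). (x \<oplus>\<^bsub>M\<^esub> x', y \<oplus>\<^bsub>N\<^esub> y')),
      smult = (\<lambda>a (x, y). (a \<odot>\<^bsub>M\<^esub> x, a \<odot>\<^bsub>N\<^esub> y))\<rparr>"

definition direct_sum :: "nat \<Rightarrow> (nat \<Rightarrow> ('a, 'm) module) \<Rightarrow> ('a, nat \<Rightarrow> 'm) module" where
  "direct_sum n X =
     \<lparr>carrier = (\<Pi>\<^sub>E i\<in>{..<n}. carrier (X i)), mult = undefined, one = undefined,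
      zero = (\<lambda>i\<in>{..<n}. \<zero>\<^bsub>X i\<^esub>),
      add = (\<lambda>u v. \<lambda>i\<in>{..<n}. u i \<oplus>\<^bsub>X i\<^esub> v i),
      smult = (\<lambda>a u. \<lambda>i\<in>{..<n}. a \<odot>\<^bsub>X i\<^esub> u i)\<rparr>"

abbreviation power_module :: "('a, 'm) module \<Rightarrow> nat \<Rightarrow> ('a, nat \<Rightarrow> 'm) module" where
  "power_module M n \<equiv> direct_sum n (\<lambda>_. M)"

definition zero_module :: "('a, 'm) module \<Rightarrow> bool" where
  "zero_module M \<longleftrightarrow> carrier M = {\<zero>\<^bsub>M\<^esub>}"

definition indecomposable_module :: "('a, 'x) ring_scheme \<Rightarrow> ('a, 'm) module \<Rightarrow> bool" where
  "indecomposable_module A M \<longleftrightarrow> fg_module A M \<and> \<not> zero_module M \<and>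
     (\<forall>(X :: 'a umod) (Y :: 'a umod). fg_module A X \<longrightarrow> fg_module A Y \<longrightarrow>
        isomorphic_modules A M (direct_sum2 X Y) \<longrightarrow> zero_module X \<or> zero_module Y)"

definition basic_module :: "('a, 'x) ring_scheme \<Rightarrow> ('a, 'm) module \<Rightarrow> bool" where
  "basic_module A M \<longleftrightarrow>
     (\<exists>n (X :: nat \<Rightarrow> 'a umod).
        (\<forall>i<n. indecomposable_module A (X i)) \<and>
        (\<forall>i<n. \<forall>j<n. i \<noteq> j \<longrightarrow> \<not> isomorphic_modules A (X i) (X j)) \<and>
        isomorphic_modules A M (direct_sum n X))"

definition add_closure :: "('a, 'x) ring_scheme \<Rightarrow> ('a, 'm) module \<Rightarrow> 'a umod set" where
  "add_closure A T =
     {X. fg_module A X \<and>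
        (\<exists>n (Y :: 'a umod). fg_module A Y \<and>
           isomorphic_modules A (direct_sum2 X Y) (power_module T n))}"

definition Gen :: "('a, 'x) ring_scheme \<Rightarrow> ('a, 'm) module \<Rightarrow> 'a umod set" where
  "Gen A X = {M. fg_module A M \<and> (\<exists>m. mod_epi A (power_module X m) M \<noteq> {})}"

definition Cogen :: "('a, 'x) ring_scheme \<Rightarrow> ('a, 'm) module \<Rightarrow> 'a umod set" where
  "Cogen A X = {M. fg_module A M \<and> (\<exists>m. mod_mono A M (power_module X m) \<noteq> {})}"


section \<open>Homological notions\<close>

definition projective_module :: "('a, 'x) ring_scheme \<Rightarrow> ('a, 'm) module \<Rightarrow> bool" where
  "projective_module A P \<longleftrightarrow> fg_module A P \<and>
     (\<forall>(M :: 'a umod) (N :: 'a umod). fg_module A M \<longrightarrow> fg_module A N \<longrightarrow>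
        (\<forall>g\<in>mod_epi A M N. \<forall>h\<in>mod_hom A P N. \<exists>k\<in>mod_hom A P M.
           \<forall>x\<in>carrier P. g (k x) = h x))"

definition injective_module :: "('a, 'x) ring_scheme \<Rightarrow> ('a, 'm) module \<Rightarrow> bool" where
  "injective_module A I \<longleftrightarrow> fg_module A I \<and>
     (\<forall>(M :: 'a umod) (N :: 'a umod). fg_module A M \<longrightarrow> fg_module A N \<longrightarrow>
        (\<forall>g\<in>mod_mono A M N. \<forall>h\<in>mod_hom A M I. \<exists>k\<in>mod_hom A N I.
           \<forall>x\<in>carrier M. k (g x) = h x))"

definition essential_submodule ::
    "('a, 'x) ring_scheme \<Rightarrow> 'm set \<Rightarrow> ('a, 'm) module \<Rightarrow> bool" where
  "essential_submodule A N E \<longleftrightarrow> submodule N A E \<and>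
     (\<forall>H. submodule H A E \<longrightarrow> H \<inter> N = {\<zero>\<^bsub>E\<^esub>} \<longrightarrow> H = {\<zero>\<^bsub>E\<^esub>})"

definition injective_envelope ::
    "('a, 'x) ring_scheme \<Rightarrow> ('a, 'm) module \<Rightarrow> ('a, 'n) module \<Rightarrow> bool" where
  "injective_envelope A M E \<longleftrightarrow> injective_module A E \<and>
     (\<exists>e\<in>mod_mono A M E. essential_submodule A (e ` carrier M) E)"

definition projective_resolution ::
    "('a, 'x) ring_scheme \<Rightarrow> ('a, 'm) module \<Rightarrow> (nat \<Rightarrow> 'a umod) \<Rightarrow>
      ((nat \<Rightarrow> 'a) set \<Rightarrow> 'm) \<Rightarrow> (nat \<Rightarrow> (nat \<Rightarrow> 'a) set \<Rightarrow> (nat \<Rightarrow> 'a) set) \<Rightarrow> bool" where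
  "projective_resolution A M P e d \<longleftrightarrow>
     (\<forall>i. projective_module A (P i)) \<and>
     e \<in> mod_epi A (P 0) M \<and>
     (\<forall>i. d i \<in> mod_hom A (P (Suc i)) (P i)) \<and>
     d 0 ` carrier (P 1) = hom_kernel (P 0) M e \<and>
     (\<forall>i. d (Suc i) ` carrier (P (Suc (Suc i))) = hom_kernel (P (Suc i)) (P i) (d i))"

definition injective_resolution ::
    "('a, 'x) ring_scheme \<Rightarrow> ('a, 'm) module \<Rightarrow> (nat \<Rightarrow> 'a umod) \<Rightarrow>
      ('m \<Rightarrow> (nat \<Rightarrow> 'a) set) \<Rightarrow> (nat \<Rightarrow> (nat \<Rightarrow> 'a) set \<Rightarrow> (nat \<Rightarrow> 'a) set) \<Rightarrow> bool" where
  "injective_resolution A M I e d \<longleftrightarrow>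
     (\<forall>i. injective_module A (I i)) \<and>
     e \<in> mod_mono A M (I 0) \<and>
     (\<forall>i. d i \<in> mod_hom A (I i) (I (Suc i))) \<and>
     e ` carrier M = hom_kernel (I 0) (I 1) (d 0) \<and>
     (\<forall>i. d i ` carrier (I i) = hom_kernel (I (Suc i)) (I (Suc (Suc i))) (d (Suc i)))"

text \<open>
  Minimality: each term is an injective envelope of the cokernel of the preceding map, i.e. of the
  image of the map leading into the term.
\<close>

definition minimal_injective_resolution ::
    "('a, 'x) ring_scheme \<Rightarrow> ('a, 'm) module \<Rightarrow> (nat \<Rightarrow> 'a umod) \<Rightarrow>
      ('m \<Rightarrow> (nat \<Rightarrow> 'a) set) \<Rightarrow> (nat \<Rightarrow> (nat \<Rightarrow> 'a) set \<Rightarrow> (nat \<Rightarrow> 'a) set) \<Rightarrow> bool" where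
  "minimal_injective_resolution A M I e d \<longleftrightarrow> injective_resolution A M I e d \<and>
     essential_submodule A (e ` carrier M) (I 0) \<and>
     (\<forall>i. essential_submodule A (d i ` carrier (I i)) (I (Suc i)))"

text \<open>In \<^typ>\<open>enat\<close> the infimum of the empty set is \<open>\<infinity>\<close>.\<close>

definition projdim :: "('a, 'x) ring_scheme \<Rightarrow> ('a, 'm) module \<Rightarrow> enat" where
  "projdim A M =
     Inf {enat n | n. \<exists>P e d. projective_resolution A M P e d \<and> (\<forall>i>n. zero_module (P i))}"

definition injdim :: "('a, 'x) ring_scheme \<Rightarrow> ('a, 'm) module \<Rightarrow> enat" where
  "injdim A M =
     Inf {enat n | n. \<exists>I e d. injective_resolution A M I e d \<and> (\<forall>i>n. zero_module (I i))}"

definition gldim :: "('a, 'x) ring_scheme \<Rightarrow> enat" where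
  "gldim A = Sup {projdim A M | M :: 'a umod. fg_module A M}"

definition domdim :: "('a, 'x) ring_scheme \<Rightarrow> enat" where
  "domdim A =
     Sup {enat k | k. \<exists>I e d. minimal_injective_resolution A (regular_module A) I e d \<and>
                               (\<forall>i<k. projective_module A (I i))}"

text \<open>
  Yoneda's description of the first extension group: equivalence classes of short exact sequences
  \<open>0 \<longrightarrow> N \<longrightarrow> E \<longrightarrow> M \<longrightarrow> 0\<close>. The group is zero iff its underlying set has exactly one element, so
  the Baer sum need not be defined.
\<close>

definition extensions ::
    "('a, 'x) ring_scheme \<Rightarrow> ('a, 'm) module \<Rightarrow> ('a, 'n) module \<Rightarrow>
      ('a umod \<times> ('n \<Rightarrow> (nat \<Rightarrow> 'a) set) \<times> ((nat \<Rightarrow> 'a) set \<Rightarrow> 'm)) set" where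
  "extensions A M N = {(E, f, g). fg_module A E \<and> short_exact A N f E g M}"

definition extension_equiv ::
    "('a, 'x) ring_scheme \<Rightarrow> ('a, 'm) module \<Rightarrow> ('a, 'n) module \<Rightarrow>
      ('a umod \<times> ('n \<Rightarrow> (nat \<Rightarrow> 'a) set) \<times> ((nat \<Rightarrow> 'a) set \<Rightarrow> 'm)) rel" where
  "extension_equiv A M N =
     {((E, f, g), (E', f', g')).
        (E, f, g) \<in> extensions A M N \<and> (E', f', g') \<in> extensions A M N \<and>
        (\<exists>h\<in>mod_iso A E E'.
           (\<forall>x\<in>carrier N. h (f x) = f' x) \<and> (\<forall>y\<in>carrier E. g' (h y) = g y))}"

definition Ext1 ::
    "('a, 'x) ring_scheme \<Rightarrow> ('a, 'm) module \<Rightarrow> ('a, 'n) module \<Rightarrow>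
      ('a umod \<times> ('n \<Rightarrow> (nat \<Rightarrow> 'a) set) \<times> ((nat \<Rightarrow> 'a) set \<Rightarrow> 'm)) set set" where
  "Ext1 A M N = extensions A M N // extension_equiv A M N"


section \<open>Artin algebras and the standard duality\<close>

definition artinian_cring :: "('r, 'x) ring_scheme \<Rightarrow> bool" where
  "artinian_cring R \<longleftrightarrow> cring R \<and>
     (\<forall>I :: nat \<Rightarrow> 'r set. (\<forall>n. ideal (I n) R \<and> I (Suc n) \<subseteq> I n) \<longrightarrow> (\<exists>N. \<forall>n\<ge>N. I n = I N))"

text \<open>The structure map is part of the data of an algebra.\<close>

definition artin_algebra ::
    "('r, 'x) ring_scheme \<Rightarrow> ('r \<Rightarrow> 'a) \<Rightarrow> ('a, 'y) ring_scheme \<Rightarrow> bool" where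
  "artin_algebra R \<phi> A \<longleftrightarrow>
     artinian_cring R \<and> ring A \<and> \<phi> \<in> ring_hom R A \<and>
     (\<forall>r\<in>carrier R. \<forall>a\<in>carrier A. \<phi> r \<otimes>\<^bsub>A\<^esub> a = a \<otimes>\<^bsub>A\<^esub> \<phi> r) \<and>
     fg_module R (restrict_scalars \<phi> (regular_module A))"

definition auslander_algebra ::
    "('r, 'x) ring_scheme \<Rightarrow> ('r \<Rightarrow> 'a) \<Rightarrow> ('a, 'y) ring_scheme \<Rightarrow> bool" where
  "auslander_algebra R \<phi> A \<longleftrightarrow> artin_algebra R \<phi> A \<and> gldim A \<le> 2 \<and> 2 \<le> domdim A"

text \<open>The intersection with the carrier matters only for the zero ring.\<close>

definition jacobson_radical :: "('r, 'x) ring_scheme \<Rightarrow> 'r set" where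
  "jacobson_radical R = carrier R \<inter> \<Inter>{I. maximalideal I R}"

text \<open>
  The standard duality is \<open>D = Hom\<^sub>R(-, J)\<close>, where \<open>J\<close> is an injective envelope of \<open>R / rad R\<close>.
  For a left module \<open>M\<close> over an algebra \<open>B\<close> it yields a right \<open>B\<close>-module, that is a left module
  over the opposite of \<open>B\<close>, by \<open>(b f)(x) = f(b x)\<close>. The left \<open>A\<close>-module \<open>D A\<close> arises from \<open>A\<close> as a
  right module over itself, so from the regular left module over the opposite of \<open>A\<close>.
\<close>

definition dualizing_module :: "('r, 'x) ring_scheme \<Rightarrow> ('r, 'j) module \<Rightarrow> bool" where
  "dualizing_module R J \<longleftrightarrow> injective_envelope R (quotient_module R (jacobson_radical R)) J"

definition standard_dual ::
    "('r, 'x) ring_scheme \<Rightarrow> ('r \<Rightarrow> 'a) \<Rightarrow> ('r, 'j) module \<Rightarrow> ('a, 'm) module \<Rightarrow>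
      ('a, 'm \<Rightarrow> 'j) module" where
  "standard_dual R \<phi> J M =
     \<lparr>carrier = mod_hom R (restrict_scalars \<phi> M) J \<inter> extensional (carrier M),
      mult = undefined, one = undefined,
      zero = (\<lambda>x\<in>carrier M. \<zero>\<^bsub>J\<^esub>),
      add = (\<lambda>f g. \<lambda>x\<in>carrier M. f x \<oplus>\<^bsub>J\<^esub> g x),
      smult = (\<lambda>b f. \<lambda>x\<in>carrier M. f (b \<odot>\<^bsub>M\<^esub> x))\<rparr>"

definition dual_of_algebra ::
    "('r, 'x) ring_scheme \<Rightarrow> ('r \<Rightarrow> 'a) \<Rightarrow> ('r, 'j) module \<Rightarrow> ('a, 'y) ring_scheme \<Rightarrow>
      ('a, 'a \<Rightarrow> 'j) module" where
  "dual_of_algebra R \<phi> J A = standard_dual R \<phi> J (regular_module (opposite_ring A))"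


section \<open>Tilting and cotilting modules\<close>

definition tilting_module :: "('a, 'y) ring_scheme \<Rightarrow> ('a, 'm) module \<Rightarrow> bool" where
  "tilting_module A T \<longleftrightarrow> fg_module A T \<and> basic_module A T \<and>
     projdim A T \<le> 1 \<and>
     is_singleton (Ext1 A T T) \<and>
     (\<exists>T0\<in>add_closure A T. \<exists>T1\<in>add_closure A T. \<exists>f g.
        short_exact A (regular_module A) f T0 g T1)"

definition cotilting_module ::
    "('r, 'x) ring_scheme \<Rightarrow> ('r \<Rightarrow> 'a) \<Rightarrow> ('r, 'j) module \<Rightarrow> ('a, 'y) ring_scheme \<Rightarrow>
      ('a, 'm) module \<Rightarrow> bool" where
  "cotilting_module R \<phi> J A C \<longleftrightarrow> fg_module A C \<and>
     injdim A C \<le> 1 \<and>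
     is_singleton (Ext1 A C C) \<and>
     (\<exists>C0\<in>add_closure A C. \<exists>C1\<in>add_closure A C. \<exists>f g.
        short_exact A C0 f C1 g (dual_of_algebra R \<phi> J A))"

definition indec_proj_inj_representatives ::
    "('a, 'y) ring_scheme \<Rightarrow> nat \<Rightarrow> (nat \<Rightarrow> 'a umod) \<Rightarrow> bool" where
  "indec_proj_inj_representatives A n Q \<longleftrightarrow>
     (\<forall>i<n. indecomposable_module A (Q i) \<and> projective_module A (Q i) \<and> injective_module A (Q i)) \<and>
     (\<forall>i<n. \<forall>j<n. i \<noteq> j \<longrightarrow> \<not> isomorphic_modules A (Q i) (Q j)) \<and>
     (\<forall>M :: 'a umod. indecomposable_module A M \<longrightarrow> projective_module A M \<longrightarrow> injective_module A M \<longrightarrow>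
        (\<exists>i<n. isomorphic_modules A M (Q i)))"

end

theory Submission
  imports Defs
begin

text \<open>
  For one direction, let \<open>T\<close> be tilting and cotilting, a quotient and a submodule of projective-injective
  modules. The envelope \<open>I\<^sub>0\<close> of \<open>\<Lambda>\<close> is projective, as \<open>\<Lambda>\<close> embeds in a power of \<open>T\<close>. Every map \<open>\<Lambda> \<rightarrow> T\<close>
  factors through a projective-injective module and so extends to \<open>I\<^sub>0\<close>; hence \<open>Ext\<^sup>1(I\<^sub>0/\<Lambda>, T) = 0\<close>, which
  by the cotilting sequence embeds \<open>I\<^sub>0/\<Lambda>\<close> in a power of \<open>T\<close>, and the dominant dimension is at least 2.
  As \<open>T\<close> has injective dimension at most 1, the tilting sequence gives \<open>Ext\<^sup>1(K, \<Lambda>) = 0\<close> for second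
  syzygies \<open>K\<close>; since projective dimensions are finite, second syzygies are projective.

  Conversely, \<open>0 \<rightarrow> \<Lambda> \<rightarrow> I\<^sub>0 \<rightarrow> X \<rightarrow> 0\<close> with \<open>X \<subseteq> I\<^sub>1\<close> makes \<open>I\<^sub>0 \<oplus> X\<close> a tilting module, and \<open>gldim \<Lambda> \<le> 2\<close> bounds
  its injective dimension by 1. For the cotilting sequence take an epimorphism \<open>I\<^sub>0\<^sup>m \<rightarrow> D\<Lambda>\<close>. Its
  kernel \<open>C\<close> has a projective resolution \<open>0 \<rightarrow> K \<rightarrow> P \<rightarrow> C \<rightarrow> 0\<close>. Embedding \<open>P\<close> in \<open>E = I\<^sub>0\<^sup>b\<close> yields
  \<open>0 \<rightarrow> C \<rightarrow> E/K \<rightarrow> E/P \<rightarrow> 0\<close> with \<open>E/K\<close> and \<open>E/P\<close> in \<open>add (I\<^sub>0 \<oplus> X)\<close>. This splits: \<open>E/P\<close> embeds in a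
  projective-injective module, so every map \<open>E/P \<rightarrow> D\<Lambda>\<close> lifts to \<open>I\<^sub>0\<^sup>m\<close>.
\<close>

section \<open>Left modules over an arbitrary ring: factorisation of maps, direct sums and summands,
  splitting of extensions, comparison of presentations\<close>

section \<open>Modules over a fixed ring\<close>

text \<open>Only first extension groups are available. Higher vanishing is therefore stated as
  \<open>ext_van\<close> of syzygies, and every dimension shift becomes an explicit extension or
  lift of a map. Membership in add T is read as being a retract of a power of T, so complements need
  not be named, and comparing two presentations yields retracts instead of isomorphisms. "All
  modules" means all modules with one fixed carrier type, while sums, powers and duals live in other
  types; \<open>umod_ex\<close> brings them back. Projective and injective modules are finitely
  generated by definition, so kernels must be too: \<Lambda> has to be left noetherian. This comes
  from the dualizing module: being finitely generated it satisfies the descending chain condition,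
  and annihilators in it turn this into the ascending one for R. A tilting module must be basic, so
  I0 + X is replaced by the sum of one representative for each isomorphism class in a decomposition
  of it. Its place in the subcategory is tested against arbitrary projective-injective modules,
  which are summands of powers of the sum of the Q i.\<close>

locale modules_over = A?: ring A for A :: "('a, 'x) ring_scheme" (structure)
begin

abbreviation "lm \<equiv> left_module A"
abbreviation "fg \<equiv> fg_module A"
abbreviation "Hom \<equiv> mod_hom A"
abbreviation "Monic \<equiv> mod_mono A"
abbreviation "Epic \<equiv> mod_epi A"
abbreviation "Iso \<equiv> mod_iso A"
abbreviation "sub \<equiv> \<lambda>H M. submodule H A M"
abbreviation "ses \<equiv> short_exact A"

lemma fg_lm [simp]: "fg M \<Longrightarrow> lm M"
  by (simp add: fg_module_def)

text \<open>Each fact takes the module as an explicit premise, so the simplifier can treat several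
  modules of different types at once without an interpretation for each.\<close>

lemma
  assumes "lm M"
  shows m_zero_closed [simp]: "\<zero>\<^bsub>M\<^esub> \<in> carrier M"
    and m_add_closed [simp]: "\<lbrakk>x \<in> carrier M; y \<in> carrier M\<rbrakk> \<Longrightarrow> x \<oplus>\<^bsub>M\<^esub> y \<in> carrier M"
    and m_neg_closed [simp]: "x \<in> carrier M \<Longrightarrow> \<ominus>\<^bsub>M\<^esub> x \<in> carrier M"
    and m_minus_closed [simp]: "\<lbrakk>x \<in> carrier M; y \<in> carrier M\<rbrakk> \<Longrightarrow> x \<ominus>\<^bsub>M\<^esub> y \<in> carrier M"
    and m_smult_closed [simp]: "\<lbrakk>a \<in> carrier A; x \<in> carrier M\<rbrakk> \<Longrightarrow> a \<odot>\<^bsub>M\<^esub> x \<in> carrier M"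
    and m_l_zero [simp]: "x \<in> carrier M \<Longrightarrow> \<zero>\<^bsub>M\<^esub> \<oplus>\<^bsub>M\<^esub> x = x"
    and m_r_zero [simp]: "x \<in> carrier M \<Longrightarrow> x \<oplus>\<^bsub>M\<^esub> \<zero>\<^bsub>M\<^esub> = x"
    and m_l_neg [simp]: "x \<in> carrier M \<Longrightarrow> \<ominus>\<^bsub>M\<^esub> x \<oplus>\<^bsub>M\<^esub> x = \<zero>\<^bsub>M\<^esub>"
    and m_r_neg [simp]: "x \<in> carrier M \<Longrightarrow> x \<oplus>\<^bsub>M\<^esub> \<ominus>\<^bsub>M\<^esub> x = \<zero>\<^bsub>M\<^esub>"
    and m_l_neg' [simp]: "\<lbrakk>x \<in> carrier M; y \<in> carrier M\<rbrakk> \<Longrightarrow> \<ominus>\<^bsub>M\<^esub> x \<oplus>\<^bsub>M\<^esub> (x \<oplus>\<^bsub>M\<^esub> y) = y"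
    and m_r_neg' [simp]: "\<lbrakk>x \<in> carrier M; y \<in> carrier M\<rbrakk> \<Longrightarrow> x \<oplus>\<^bsub>M\<^esub> (\<ominus>\<^bsub>M\<^esub> x \<oplus>\<^bsub>M\<^esub> y) = y"
    and m_minus_minus [simp]: "x \<in> carrier M \<Longrightarrow> \<ominus>\<^bsub>M\<^esub> (\<ominus>\<^bsub>M\<^esub> x) = x"
    and m_neg_zero [simp]: "\<ominus>\<^bsub>M\<^esub> \<zero>\<^bsub>M\<^esub> = \<zero>\<^bsub>M\<^esub>"
    and m_neg_add: "\<lbrakk>x \<in> carrier M; y \<in> carrier M\<rbrakk> \<Longrightarrow> \<ominus>\<^bsub>M\<^esub> (x \<oplus>\<^bsub>M\<^esub> y) = \<ominus>\<^bsub>M\<^esub> x \<oplus>\<^bsub>M\<^esub> \<ominus>\<^bsub>M\<^esub> y"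
    and m_assoc: "\<lbrakk>x \<in> carrier M; y \<in> carrier M; z \<in> carrier M\<rbrakk> \<Longrightarrow>
      (x \<oplus>\<^bsub>M\<^esub> y) \<oplus>\<^bsub>M\<^esub> z = x \<oplus>\<^bsub>M\<^esub> (y \<oplus>\<^bsub>M\<^esub> z)"
    and m_comm: "\<lbrakk>x \<in> carrier M; y \<in> carrier M\<rbrakk> \<Longrightarrow> x \<oplus>\<^bsub>M\<^esub> y = y \<oplus>\<^bsub>M\<^esub> x"
    and m_lcomm: "\<lbrakk>x \<in> carrier M; y \<in> carrier M; z \<in> carrier M\<rbrakk> \<Longrightarrow>
      x \<oplus>\<^bsub>M\<^esub> (y \<oplus>\<^bsub>M\<^esub> z) = y \<oplus>\<^bsub>M\<^esub> (x \<oplus>\<^bsub>M\<^esub> z)"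
    and m_diff_eq_zero [simp]: "\<lbrakk>x \<in> carrier M; y \<in> carrier M\<rbrakk> \<Longrightarrow> x \<ominus>\<^bsub>M\<^esub> y = \<zero>\<^bsub>M\<^esub> \<longleftrightarrow> x = y"
    and m_diff_self [simp]: "x \<in> carrier M \<Longrightarrow> x \<ominus>\<^bsub>M\<^esub> x = \<zero>\<^bsub>M\<^esub>"
    and m_diff_zero [simp]: "x \<in> carrier M \<Longrightarrow> x \<ominus>\<^bsub>M\<^esub> \<zero>\<^bsub>M\<^esub> = x"
    and m_diff_add [simp]: "\<lbrakk>x \<in> carrier M; y \<in> carrier M\<rbrakk> \<Longrightarrow> (x \<ominus>\<^bsub>M\<^esub> y) \<oplus>\<^bsub>M\<^esub> y = x"
    and m_add_diff [simp]: "\<lbrakk>x \<in> carrier M; y \<in> carrier M\<rbrakk> \<Longrightarrow> (x \<oplus>\<^bsub>M\<^esub> y) \<ominus>\<^bsub>M\<^esub> y = x"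
    and m_diff_diff [simp]: "\<lbrakk>x \<in> carrier M; y \<in> carrier M\<rbrakk> \<Longrightarrow> x \<ominus>\<^bsub>M\<^esub> (x \<ominus>\<^bsub>M\<^esub> y) = y"
    and m_neg_eq_zero [simp]: "x \<in> carrier M \<Longrightarrow> \<ominus>\<^bsub>M\<^esub> x = \<zero>\<^bsub>M\<^esub> \<longleftrightarrow> x = \<zero>\<^bsub>M\<^esub>"
    and m_smult_l_distr: "\<lbrakk>a \<in> carrier A; b \<in> carrier A; x \<in> carrier M\<rbrakk> \<Longrightarrow>
      (a \<oplus> b) \<odot>\<^bsub>M\<^esub> x = a \<odot>\<^bsub>M\<^esub> x \<oplus>\<^bsub>M\<^esub> b \<odot>\<^bsub>M\<^esub> x"
    and m_smult_r_distr: "\<lbrakk>a \<in> carrier A; x \<in> carrier M; y \<in> carrier M\<rbrakk> \<Longrightarrow>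
      a \<odot>\<^bsub>M\<^esub> (x \<oplus>\<^bsub>M\<^esub> y) = a \<odot>\<^bsub>M\<^esub> x \<oplus>\<^bsub>M\<^esub> a \<odot>\<^bsub>M\<^esub> y"
    and m_smult_assoc: "\<lbrakk>a \<in> carrier A; b \<in> carrier A; x \<in> carrier M\<rbrakk> \<Longrightarrow>
      (a \<otimes> b) \<odot>\<^bsub>M\<^esub> x = a \<odot>\<^bsub>M\<^esub> (b \<odot>\<^bsub>M\<^esub> x)"
    and m_smult_one [simp]: "x \<in> carrier M \<Longrightarrow> \<one> \<odot>\<^bsub>M\<^esub> x = x"
proof -
  interpret left_module A M by fact
  show "\<zero>\<^bsub>M\<^esub> \<in> carrier M" by simp
  show "x \<oplus>\<^bsub>M\<^esub> y \<in> carrier M" if "x \<in> carrier M" "y \<in> carrier M" using that by simp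
  show "\<ominus>\<^bsub>M\<^esub> x \<in> carrier M" if "x \<in> carrier M" using that by simp
  show "x \<ominus>\<^bsub>M\<^esub> y \<in> carrier M" if "x \<in> carrier M" "y \<in> carrier M" using that by simp
  show "a \<odot>\<^bsub>M\<^esub> x \<in> carrier M" if "a \<in> carrier A" "x \<in> carrier M" using that by simp
  show "\<zero>\<^bsub>M\<^esub> \<oplus>\<^bsub>M\<^esub> x = x" if "x \<in> carrier M" using that by simp
  show "x \<oplus>\<^bsub>M\<^esub> \<zero>\<^bsub>M\<^esub> = x" if "x \<in> carrier M" using that by simp
  show "\<ominus>\<^bsub>M\<^esub> x \<oplus>\<^bsub>M\<^esub> x = \<zero>\<^bsub>M\<^esub>" if "x \<in> carrier M" using that by (simp add: M.l_neg)
  show "x \<oplus>\<^bsub>M\<^esub> \<ominus>\<^bsub>M\<^esub> x = \<zero>\<^bsub>M\<^esub>" if "x \<in> carrier M" using that by (simp add: M.r_neg)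
  show "\<ominus>\<^bsub>M\<^esub> x \<oplus>\<^bsub>M\<^esub> (x \<oplus>\<^bsub>M\<^esub> y) = y" if "x \<in> carrier M" "y \<in> carrier M"
    using that by (simp add: M.a_assoc[symmetric] M.l_neg)
  show "x \<oplus>\<^bsub>M\<^esub> (\<ominus>\<^bsub>M\<^esub> x \<oplus>\<^bsub>M\<^esub> y) = y" if "x \<in> carrier M" "y \<in> carrier M"
    using that by (simp add: M.a_assoc[symmetric] M.r_neg)
  show mm: "\<ominus>\<^bsub>M\<^esub> (\<ominus>\<^bsub>M\<^esub> x) = x" if "x \<in> carrier M" for x using that by simp
  show z: "\<ominus>\<^bsub>M\<^esub> \<zero>\<^bsub>M\<^esub> = \<zero>\<^bsub>M\<^esub>" by simp
  show "\<ominus>\<^bsub>M\<^esub> (x \<oplus>\<^bsub>M\<^esub> y) = \<ominus>\<^bsub>M\<^esub> x \<oplus>\<^bsub>M\<^esub> \<ominus>\<^bsub>M\<^esub> y" if "x \<in> carrier M" "y \<in> carrier M"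
    using that by (simp add: M.minus_add)
  show "(x \<oplus>\<^bsub>M\<^esub> y) \<oplus>\<^bsub>M\<^esub> z = x \<oplus>\<^bsub>M\<^esub> (y \<oplus>\<^bsub>M\<^esub> z)"
    if "x \<in> carrier M" "y \<in> carrier M" "z \<in> carrier M" using that by (simp add: M.a_assoc)
  show "x \<oplus>\<^bsub>M\<^esub> y = y \<oplus>\<^bsub>M\<^esub> x" if "x \<in> carrier M" "y \<in> carrier M" using that by (simp add: M.a_comm)
  show "x \<oplus>\<^bsub>M\<^esub> (y \<oplus>\<^bsub>M\<^esub> z) = y \<oplus>\<^bsub>M\<^esub> (x \<oplus>\<^bsub>M\<^esub> z)"
    if "x \<in> carrier M" "y \<in> carrier M" "z \<in> carrier M" using that by (simp add: M.a_lcomm)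
  show "x \<ominus>\<^bsub>M\<^esub> y = \<zero>\<^bsub>M\<^esub> \<longleftrightarrow> x = y" if "x \<in> carrier M" "y \<in> carrier M"
    using that by (metis M.a_inv_closed M.l_neg M.minus_equality M.minus_minus a_minus_def)
  show "x \<ominus>\<^bsub>M\<^esub> x = \<zero>\<^bsub>M\<^esub>" if "x \<in> carrier M" using that by (simp add: a_minus_def M.r_neg)
  show "x \<ominus>\<^bsub>M\<^esub> \<zero>\<^bsub>M\<^esub> = x" if "x \<in> carrier M" using that by (simp add: a_minus_def)
  show "(x \<ominus>\<^bsub>M\<^esub> y) \<oplus>\<^bsub>M\<^esub> y = x" if "x \<in> carrier M" "y \<in> carrier M"
    using that by (simp add: a_minus_def M.a_assoc M.l_neg)
  show "(x \<oplus>\<^bsub>M\<^esub> y) \<ominus>\<^bsub>M\<^esub> y = x" if "x \<in> carrier M" "y \<in> carrier M"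
    using that by (simp add: a_minus_def M.a_assoc M.r_neg)
  show "x \<ominus>\<^bsub>M\<^esub> (x \<ominus>\<^bsub>M\<^esub> y) = y" if "x \<in> carrier M" "y \<in> carrier M"
    using that by (simp add: a_minus_def M.minus_add M.a_assoc[symmetric] M.r_neg)
  show "\<ominus>\<^bsub>M\<^esub> x = \<zero>\<^bsub>M\<^esub> \<longleftrightarrow> x = \<zero>\<^bsub>M\<^esub>" if "x \<in> carrier M"
    using that mm z by metis
qed (use assms in \<open>simp_all add: left_module.smult_l_distr left_module.smult_r_distr
      left_module.smult_assoc1 left_module.smult_one\<close>)

lemmas m_ac = m_assoc m_comm m_lcomm

lemma m_smult_l_zero [simp]: "\<lbrakk>lm M; x \<in> carrier M\<rbrakk> \<Longrightarrow> \<zero> \<odot>\<^bsub>M\<^esub> x = \<zero>\<^bsub>M\<^esub>"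
  by (metis m_add_diff m_diff_self m_smult_closed m_smult_l_distr A.r_zero A.zero_closed)

lemma m_smult_r_zero [simp]: "\<lbrakk>lm M; a \<in> carrier A\<rbrakk> \<Longrightarrow> a \<odot>\<^bsub>M\<^esub> \<zero>\<^bsub>M\<^esub> = \<zero>\<^bsub>M\<^esub>"
  by (metis m_add_diff m_diff_self m_smult_closed m_smult_r_distr m_r_zero m_zero_closed)

lemma m_minus_unique:
  "\<lbrakk>lm M; x \<in> carrier M; y \<in> carrier M; x \<oplus>\<^bsub>M\<^esub> y = \<zero>\<^bsub>M\<^esub>\<rbrakk> \<Longrightarrow> x = \<ominus>\<^bsub>M\<^esub> y"
  by (metis m_add_diff a_minus_def m_l_zero m_neg_closed)

lemma m_smult_neg:
  assumes "lm M" "a \<in> carrier A" "x \<in> carrier M"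
  shows "a \<odot>\<^bsub>M\<^esub> (\<ominus>\<^bsub>M\<^esub> x) = \<ominus>\<^bsub>M\<^esub> (a \<odot>\<^bsub>M\<^esub> x)"
proof (rule m_minus_unique[OF assms(1)])
  have "a \<odot>\<^bsub>M\<^esub> (\<ominus>\<^bsub>M\<^esub> x) \<oplus>\<^bsub>M\<^esub> a \<odot>\<^bsub>M\<^esub> x = a \<odot>\<^bsub>M\<^esub> (\<ominus>\<^bsub>M\<^esub> x \<oplus>\<^bsub>M\<^esub> x)"
    by (rule m_smult_r_distr[symmetric]) (use assms in simp_all)
  then show "a \<odot>\<^bsub>M\<^esub> (\<ominus>\<^bsub>M\<^esub> x) \<oplus>\<^bsub>M\<^esub> a \<odot>\<^bsub>M\<^esub> x = \<zero>\<^bsub>M\<^esub>"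
    using assms by simp
qed (use assms in simp_all)

lemma m_neg_eq_smult:
  assumes "lm M" "x \<in> carrier M"
  shows "\<ominus>\<^bsub>M\<^esub> x = (\<ominus> \<one>) \<odot>\<^bsub>M\<^esub> x"
proof (rule m_minus_unique[OF assms(1), symmetric])
  have "(\<ominus> \<one>) \<odot>\<^bsub>M\<^esub> x \<oplus>\<^bsub>M\<^esub> \<one> \<odot>\<^bsub>M\<^esub> x = (\<ominus> \<one> \<oplus> \<one>) \<odot>\<^bsub>M\<^esub> x"
    by (rule m_smult_l_distr[symmetric]) (use assms in simp_all)
  then show "(\<ominus> \<one>) \<odot>\<^bsub>M\<^esub> x \<oplus>\<^bsub>M\<^esub> x = \<zero>\<^bsub>M\<^esub>"
    using assms by (simp add: A.l_neg)
qed (use assms in simp_all)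

lemma lmI:
  assumes "\<And>x y. \<lbrakk>x \<in> carrier M; y \<in> carrier M\<rbrakk> \<Longrightarrow> x \<oplus>\<^bsub>M\<^esub> y \<in> carrier M"
    and "\<zero>\<^bsub>M\<^esub> \<in> carrier M"
    and "\<And>x y z. \<lbrakk>x \<in> carrier M; y \<in> carrier M; z \<in> carrier M\<rbrakk> \<Longrightarrow>
      (x \<oplus>\<^bsub>M\<^esub> y) \<oplus>\<^bsub>M\<^esub> z = x \<oplus>\<^bsub>M\<^esub> (y \<oplus>\<^bsub>M\<^esub> z)"
    and "\<And>x y. \<lbrakk>x \<in> carrier M; y \<in> carrier M\<rbrakk> \<Longrightarrow> x \<oplus>\<^bsub>M\<^esub> y = y \<oplus>\<^bsub>M\<^esub> x"
    and "\<And>x. x \<in> carrier M \<Longrightarrow> \<zero>\<^bsub>M\<^esub> \<oplus>\<^bsub>M\<^esub> x = x"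
    and "\<And>x. x \<in> carrier M \<Longrightarrow> \<exists>y\<in>carrier M. y \<oplus>\<^bsub>M\<^esub> x = \<zero>\<^bsub>M\<^esub>"
    and "\<And>a x. \<lbrakk>a \<in> carrier A; x \<in> carrier M\<rbrakk> \<Longrightarrow> a \<odot>\<^bsub>M\<^esub> x \<in> carrier M"
    and "\<And>a b x. \<lbrakk>a \<in> carrier A; b \<in> carrier A; x \<in> carrier M\<rbrakk> \<Longrightarrow>
      (a \<oplus> b) \<odot>\<^bsub>M\<^esub> x = a \<odot>\<^bsub>M\<^esub> x \<oplus>\<^bsub>M\<^esub> b \<odot>\<^bsub>M\<^esub> x"
    and "\<And>a x y. \<lbrakk>a \<in> carrier A; x \<in> carrier M; y \<in> carrier M\<rbrakk> \<Longrightarrow>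
      a \<odot>\<^bsub>M\<^esub> (x \<oplus>\<^bsub>M\<^esub> y) = a \<odot>\<^bsub>M\<^esub> x \<oplus>\<^bsub>M\<^esub> a \<odot>\<^bsub>M\<^esub> y"
    and "\<And>a b x. \<lbrakk>a \<in> carrier A; b \<in> carrier A; x \<in> carrier M\<rbrakk> \<Longrightarrow>
      (a \<otimes> b) \<odot>\<^bsub>M\<^esub> x = a \<odot>\<^bsub>M\<^esub> (b \<odot>\<^bsub>M\<^esub> x)"
    and "\<And>x. x \<in> carrier M \<Longrightarrow> \<one> \<odot>\<^bsub>M\<^esub> x = x"
  shows "lm M"
  by (intro left_module.intro left_module_axioms.intro abelian_groupI A.ring_axioms) (use assms in auto)

text \<open>\<open>N\<close> is only a record here; surjectivity of \<open>f\<close> carries every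
  module law over from \<open>M\<close>. Quotients become modules in this way.\<close>

lemma lm_image:
  assumes M: "lm M" and im: "f ` carrier M = carrier N" and z: "f \<zero>\<^bsub>M\<^esub> = \<zero>\<^bsub>N\<^esub>"
    and add: "\<And>x y. \<lbrakk>x \<in> carrier M; y \<in> carrier M\<rbrakk> \<Longrightarrow> f (x \<oplus>\<^bsub>M\<^esub> y) = f x \<oplus>\<^bsub>N\<^esub> f y"
    and sm: "\<And>a x. \<lbrakk>a \<in> carrier A; x \<in> carrier M\<rbrakk> \<Longrightarrow> f (a \<odot>\<^bsub>M\<^esub> x) = a \<odot>\<^bsub>N\<^esub> f x"
  shows "lm N"
proof (rule lmI, unfold im[symmetric] z[symmetric], goal_cases)
  case (1 x y)
  then show ?case using M add by (auto simp flip: add)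
next
  case (3 x y z)
  then obtain u v w where "u \<in> carrier M" "v \<in> carrier M" "w \<in> carrier M" "x = f u" "y = f v" "z = f w"
    by blast
  then show ?case using M by (simp add: m_assoc flip: add)
next
  case (4 x y)
  then obtain u v where "u \<in> carrier M" "v \<in> carrier M" "x = f u" "y = f v" by blast
  then show ?case using M m_comm[OF M] by (simp flip: add)
next
  case (6 x)
  then obtain u where "u \<in> carrier M" "x = f u" by blast
  then show ?case using M by (intro bexI[of _ "f (\<ominus>\<^bsub>M\<^esub> u)"]) (simp_all flip: add)
next
  case (8 a b x)
  then obtain u where "u \<in> carrier M" "x = f u" by blast
  then show ?case using M 8 by (simp add: m_smult_l_distr flip: add sm)
next
  case (9 a x y)
  then obtain u v where "u \<in> carrier M" "v \<in> carrier M" "x = f u" "y = f v" by blast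
  then show ?case using M 9 by (simp add: m_smult_r_distr flip: add sm)
next
  case (10 a b x)
  then obtain u where "u \<in> carrier M" "x = f u" by blast
  then show ?case using M 10 by (simp add: m_smult_assoc flip: sm)
qed (use M in \<open>auto simp flip: add sm\<close>)


subsection \<open>Homomorphisms\<close>

lemma homI:
  assumes "\<And>x. x \<in> carrier M \<Longrightarrow> f x \<in> carrier N"
    and "\<And>x y. \<lbrakk>x \<in> carrier M; y \<in> carrier M\<rbrakk> \<Longrightarrow> f (x \<oplus>\<^bsub>M\<^esub> y) = f x \<oplus>\<^bsub>N\<^esub> f y"
    and "\<And>a x. \<lbrakk>a \<in> carrier A; x \<in> carrier M\<rbrakk> \<Longrightarrow> f (a \<odot>\<^bsub>M\<^esub> x) = a \<odot>\<^bsub>N\<^esub> f x"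
  shows "f \<in> Hom M N"
  using assms by (auto simp: mod_hom_def)

lemma hom_closed [simp]: "\<lbrakk>f \<in> Hom M N; x \<in> carrier M\<rbrakk> \<Longrightarrow> f x \<in> carrier N"
  by (auto simp: mod_hom_def)

lemma hom_add [simp]:
  "\<lbrakk>f \<in> Hom M N; x \<in> carrier M; y \<in> carrier M\<rbrakk> \<Longrightarrow> f (x \<oplus>\<^bsub>M\<^esub> y) = f x \<oplus>\<^bsub>N\<^esub> f y"
  unfolding mod_hom_def by blast

lemma hom_smult [simp]:
  "\<lbrakk>f \<in> Hom M N; a \<in> carrier A; x \<in> carrier M\<rbrakk> \<Longrightarrow> f (a \<odot>\<^bsub>M\<^esub> x) = a \<odot>\<^bsub>N\<^esub> f x"
  unfolding mod_hom_def by blast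

lemma hom_zero [simp]: "\<lbrakk>f \<in> Hom M N; lm M; lm N\<rbrakk> \<Longrightarrow> f \<zero>\<^bsub>M\<^esub> = \<zero>\<^bsub>N\<^esub>"
  by (metis hom_closed hom_smult m_smult_l_zero A.zero_closed m_zero_closed)

lemma hom_neg [simp]:
  "\<lbrakk>f \<in> Hom M N; lm M; lm N; x \<in> carrier M\<rbrakk> \<Longrightarrow> f (\<ominus>\<^bsub>M\<^esub> x) = \<ominus>\<^bsub>N\<^esub> f x"
  by (simp add: m_neg_eq_smult)

lemma hom_minus [simp]:
  "\<lbrakk>f \<in> Hom M N; lm M; lm N; x \<in> carrier M; y \<in> carrier M\<rbrakk> \<Longrightarrow> f (x \<ominus>\<^bsub>M\<^esub> y) = f x \<ominus>\<^bsub>N\<^esub> f y"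
  by (simp add: a_minus_def)

lemma hom_id [simp]: "id \<in> Hom M M" "(\<lambda>x. x) \<in> Hom M M"
  by (rule homI; simp)+

lemma hom_comp [intro]: "\<lbrakk>f \<in> Hom L M; g \<in> Hom M N\<rbrakk> \<Longrightarrow> (\<lambda>x. g (f x)) \<in> Hom L N"
  by (rule homI) simp_all

lemma hom_const_zero [simp]: "lm N \<Longrightarrow> (\<lambda>_. \<zero>\<^bsub>N\<^esub>) \<in> Hom M N"
  by (rule homI) simp_all

lemma hom_plus: "\<lbrakk>f \<in> Hom M N; g \<in> Hom M N; lm N\<rbrakk> \<Longrightarrow> (\<lambda>x. f x \<oplus>\<^bsub>N\<^esub> g x) \<in> Hom M N"
  by (rule homI) (simp_all add: m_smult_r_distr m_ac)

lemma hom_uminus: "\<lbrakk>f \<in> Hom M N; lm N\<rbrakk> \<Longrightarrow> (\<lambda>x. \<ominus>\<^bsub>N\<^esub> f x) \<in> Hom M N"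
  by (rule homI) (simp_all add: m_neg_add m_smult_neg)

lemma hom_diff: "\<lbrakk>f \<in> Hom M N; g \<in> Hom M N; lm N\<rbrakk> \<Longrightarrow> (\<lambda>x. f x \<ominus>\<^bsub>N\<^esub> g x) \<in> Hom M N"
  unfolding a_minus_def by (intro hom_plus hom_uminus)

lemma hom_cong: "\<lbrakk>f \<in> Hom M N; \<And>x. x \<in> carrier M \<Longrightarrow> g x = f x; lm M\<rbrakk> \<Longrightarrow> g \<in> Hom M N"
  by (rule homI) simp_all

lemma mono_inj: "f \<in> Monic M N \<Longrightarrow> inj_on f (carrier M)"
  by (simp add: mod_mono_def)

lemma epi_image: "f \<in> Epic M N \<Longrightarrow> f ` carrier M = carrier N"
  by (simp add: mod_epi_def)

lemma injI_mono: "\<lbrakk>f \<in> Hom M N; inj_on f (carrier M)\<rbrakk> \<Longrightarrow> f \<in> Monic M N"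
  by (simp add: mod_mono_def)

lemma imageI_epi: "\<lbrakk>f \<in> Hom M N; f ` carrier M = carrier N\<rbrakk> \<Longrightarrow> f \<in> Epic M N"
  by (simp add: mod_epi_def)

lemma iso_iff: "f \<in> Iso M N \<longleftrightarrow> f \<in> Monic M N \<and> f \<in> Epic M N"
  by (auto simp: mod_iso_def mod_mono_def mod_epi_def bij_betw_def)

lemma mono_hom [simp]: "f \<in> Monic M N \<Longrightarrow> f \<in> Hom M N"
  by (simp add: mod_mono_def)

lemma epi_hom [simp]: "f \<in> Epic M N \<Longrightarrow> f \<in> Hom M N"
  by (simp add: mod_epi_def)

lemma iso_mono [simp]: "f \<in> Iso M N \<Longrightarrow> f \<in> Monic M N"
  unfolding iso_iff by blast

lemma iso_epi [simp]: "f \<in> Iso M N \<Longrightarrow> f \<in> Epic M N"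
  unfolding iso_iff by blast

lemma iso_hom [simp]: "f \<in> Iso M N \<Longrightarrow> f \<in> Hom M N"
  by simp

lemma mono_epi_iso: "\<lbrakk>f \<in> Monic M N; f \<in> Epic M N\<rbrakk> \<Longrightarrow> f \<in> Iso M N"
  unfolding iso_iff by blast

lemma mono_eq: "\<lbrakk>f \<in> Monic M N; x \<in> carrier M; y \<in> carrier M\<rbrakk> \<Longrightarrow> f x = f y \<longleftrightarrow> x = y"
  using mono_inj[of f M N] by (auto simp: inj_on_def)

lemma monoI:
  assumes "f \<in> Hom M N" "lm M" "lm N" "\<And>x. \<lbrakk>x \<in> carrier M; f x = \<zero>\<^bsub>N\<^esub>\<rbrakk> \<Longrightarrow> x = \<zero>\<^bsub>M\<^esub>"
  shows "f \<in> Monic M N"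
proof -
  have "x = y" if "x \<in> carrier M" "y \<in> carrier M" "f x = f y" for x y
    using assms(4)[of "x \<ominus>\<^bsub>M\<^esub> y"] assms(1-3) that by simp
  then show ?thesis
    using assms(1) by (intro injI_mono inj_onI)
qed

lemma mono_zero_iff: "\<lbrakk>f \<in> Monic M N; lm M; lm N; x \<in> carrier M\<rbrakk> \<Longrightarrow> f x = \<zero>\<^bsub>N\<^esub> \<longleftrightarrow> x = \<zero>\<^bsub>M\<^esub>"
  by (metis hom_zero m_zero_closed mono_eq mono_hom)

lemma mono_comp: "\<lbrakk>f \<in> Monic L M; g \<in> Monic M N\<rbrakk> \<Longrightarrow> (\<lambda>x. g (f x)) \<in> Monic L N"
  by (rule injI_mono, rule hom_comp[of f L M], simp, simp)
     (rule comp_inj_on[of f _ g, unfolded comp_def], rule mono_inj, simp,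
      rule inj_on_subset[OF mono_inj[of g M N]],
      simp, rule image_subsetI, rule hom_closed[of f L M], simp, simp)

lemma epi_comp: "\<lbrakk>f \<in> Epic L M; g \<in> Epic M N\<rbrakk> \<Longrightarrow> (\<lambda>x. g (f x)) \<in> Epic L N"
  by (rule imageI_epi, rule hom_comp[of f L M], simp, simp)
     (simp only: image_image[symmetric, of g f] epi_image[of f L M] epi_image[of g M N])

lemma iso_comp: "\<lbrakk>f \<in> Iso L M; g \<in> Iso M N\<rbrakk> \<Longrightarrow> (\<lambda>x. g (f x)) \<in> Iso L N"
  by (rule mono_epi_iso, rule mono_comp[of f L M], simp, simp, rule epi_comp[of f L M], simp, simp)

lemma epi_ex: "\<lbrakk>f \<in> Epic M N; y \<in> carrier N\<rbrakk> \<Longrightarrow> \<exists>x\<in>carrier M. f x = y"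
  using epi_image[of f M N] by (simp only: image_iff[symmetric]) (metis imageE)

lemma epiI: "\<lbrakk>f \<in> Hom M N; \<And>y. y \<in> carrier N \<Longrightarrow> \<exists>x\<in>carrier M. f x = y\<rbrakk> \<Longrightarrow> f \<in> Epic M N"
  by (intro imageI_epi) force+


text \<open>Universal property of a cokernel, for an arbitrary epimorphism. The preimages
  \<open>r y\<close> may be chosen freely because \<open>f\<close> agrees on elements with the same
  image under \<open>g\<close>.\<close>

lemma epi_factor:
  assumes g: "g \<in> Epic P M" and f: "f \<in> Hom P N" and lm: "lm P" "lm M" "lm N"
    and ker: "\<And>x. \<lbrakk>x \<in> carrier P; g x = \<zero>\<^bsub>M\<^esub>\<rbrakk> \<Longrightarrow> f x = \<zero>\<^bsub>N\<^esub>"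
  shows "\<exists>h\<in>Hom M N. \<forall>x\<in>carrier P. h (g x) = f x"
proof -
  define r where "r y = (SOME x. x \<in> carrier P \<and> g x = y)" for y
  have r: "r y \<in> carrier P" "g (r y) = y" if "y \<in> carrier M" for y
    using someI_ex[OF epi_ex[OF g that, unfolded Bex_def]] by (auto simp: r_def)
  have eq: "f x = f y" if "x \<in> carrier P" "y \<in> carrier P" "g x = g y" for x y
    using ker[of "x \<ominus>\<^bsub>P\<^esub> y"] that f lm epi_hom[OF g] by simp
  have gh: "g \<in> Hom P M" using g by simp
  have "(\<lambda>y. f (r y)) \<in> Hom M N"
  proof (rule homI)
    show "f (r (x \<oplus>\<^bsub>M\<^esub> y)) = f (r x) \<oplus>\<^bsub>N\<^esub> f (r y)" if "x \<in> carrier M" "y \<in> carrier M" for x y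
      using eq[of "r (x \<oplus>\<^bsub>M\<^esub> y)" "r x \<oplus>\<^bsub>P\<^esub> r y"] that r gh f lm by simp
    show "f (r (a \<odot>\<^bsub>M\<^esub> x)) = a \<odot>\<^bsub>N\<^esub> f (r x)" if "a \<in> carrier A" "x \<in> carrier M" for a x
      using eq[of "r (a \<odot>\<^bsub>M\<^esub> x)" "a \<odot>\<^bsub>P\<^esub> r x"] that r gh f lm by simp
  qed (use r f in auto)
  moreover have "f (r (g x)) = f x" if "x \<in> carrier P" for x
    using eq[of "r (g x)" x] r[OF hom_closed[OF gh that]] that by simp
  ultimately show ?thesis by (intro bexI[of _ "\<lambda>y. f (r y)"]) simp_all
qed

text \<open>Universal property of a kernel, for an arbitrary monomorphism. The chosen preimages are
  unique, and uniqueness forces linearity.\<close>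

lemma mono_factor:
  assumes g: "g \<in> Monic L M" and f: "f \<in> Hom P M" and lm: "lm P" "lm M" "lm L"
    and im: "\<And>x. x \<in> carrier P \<Longrightarrow> f x \<in> g ` carrier L"
  shows "\<exists>h\<in>Hom P L. \<forall>x\<in>carrier P. g (h x) = f x"
proof -
  define h where "h x = (SOME y. y \<in> carrier L \<and> g y = f x)" for x
  have h: "h x \<in> carrier L" "g (h x) = f x" if "x \<in> carrier P" for x
  proof -
    have "\<exists>y. y \<in> carrier L \<and> g y = f x" using im[OF that] by (metis imageE)
    from someI_ex[OF this] show "h x \<in> carrier L" "g (h x) = f x" by (auto simp: h_def)
  qed
  have gh: "g \<in> Hom L M" using g by simp
  have eq: "x = y" if "x \<in> carrier L" "y \<in> carrier L" "g x = g y" for x y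
    using mono_eq[OF g that(1,2)] that by simp
  have "h \<in> Hom P L"
  proof (rule homI)
    show "h (x \<oplus>\<^bsub>P\<^esub> y) = h x \<oplus>\<^bsub>L\<^esub> h y" if "x \<in> carrier P" "y \<in> carrier P" for x y
      by (rule eq) (use that h f gh lm in simp_all)
    show "h (a \<odot>\<^bsub>P\<^esub> x) = a \<odot>\<^bsub>L\<^esub> h x" if "a \<in> carrier A" "x \<in> carrier P" for a x
      by (rule eq) (use that h f gh lm in simp_all)
  qed (use h in auto)
  with h show ?thesis by blast
qed

lemma iso_inverse:
  assumes "f \<in> Iso M N" "lm M" "lm N"
  shows "\<exists>g\<in>Iso N M. (\<forall>x\<in>carrier M. g (f x) = x) \<and> (\<forall>y\<in>carrier N. f (g y) = y)"
proof -
  have "f ` carrier M = carrier N" using epi_image[OF iso_epi[OF assms(1)]] .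
  then obtain g where g: "g \<in> Hom N M" "\<forall>y\<in>carrier N. f (g y) = y"
    using mono_factor[OF iso_mono[OF assms(1)], of "\<lambda>x. x" N] assms by auto
  have gf: "g (f x) = x" if "x \<in> carrier M" for x
    using mono_eq[OF iso_mono[OF assms(1)], of "g (f x)" x] g that iso_hom[OF assms(1)] by simp
  have "g \<in> Monic N M"
    using g by (intro injI_mono inj_onI) metis+
  moreover have "g \<in> Epic N M"
    by (rule epiI[OF g(1)]) (use gf hom_closed[OF iso_hom[OF assms(1)]] in blast)
  ultimately show ?thesis
    using g gf mono_epi_iso by blast
qed

lemma isomorphic_refl: "isomorphic_modules A M M"
proof -
  have "id \<in> Iso M M" by (intro mono_epi_iso injI_mono imageI_epi) simp_all
  then show ?thesis unfolding isomorphic_modules_def by blast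
qed

lemma isomorphic_sym: "\<lbrakk>isomorphic_modules A M N; lm M; lm N\<rbrakk> \<Longrightarrow> isomorphic_modules A N M"
  unfolding isomorphic_modules_def using iso_inverse by blast

lemma isomorphic_trans:
  "\<lbrakk>isomorphic_modules A L M; isomorphic_modules A M N\<rbrakk> \<Longrightarrow> isomorphic_modules A L N"
  unfolding isomorphic_modules_def using iso_comp by blast


subsection \<open>Submodules and quotients\<close>

text \<open>Closure under negation comes from closure under scalars, since
  \<open>\<ominus> x\<close> is the multiple of \<open>x\<close> by
  \<open>\<ominus> \<one>\<close>.\<close>

lemma subI:
  assumes "lm M" "H \<subseteq> carrier M" "\<zero>\<^bsub>M\<^esub> \<in> H"
    and add: "\<And>a b. \<lbrakk>a \<in> H; b \<in> H\<rbrakk> \<Longrightarrow> a \<oplus>\<^bsub>M\<^esub> b \<in> H"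
    and sm: "\<And>a x. \<lbrakk>a \<in> carrier A; x \<in> H\<rbrakk> \<Longrightarrow> a \<odot>\<^bsub>M\<^esub> x \<in> H"
  shows "sub H M"
proof -
  have "\<ominus>\<^bsub>M\<^esub> x \<in> H" if "x \<in> H" for x
    using sm[of "\<ominus> \<one>" x] that assms(1,2) by (auto simp: m_neg_eq_smult)
  then show ?thesis
    using assms by (auto simp: submodule_def subgroup_def submodule_axioms_def a_inv_def[symmetric])
qed

lemma
  assumes "sub H M"
  shows sub_carrier: "x \<in> H \<Longrightarrow> x \<in> carrier M"
    and sub_subset: "H \<subseteq> carrier M"
    and sub_zero [simp]: "\<zero>\<^bsub>M\<^esub> \<in> H"
    and sub_add [simp]: "\<lbrakk>x \<in> H; y \<in> H\<rbrakk> \<Longrightarrow> x \<oplus>\<^bsub>M\<^esub> y \<in> H"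
    and sub_smult [simp]: "\<lbrakk>a \<in> carrier A; x \<in> H\<rbrakk> \<Longrightarrow> a \<odot>\<^bsub>M\<^esub> x \<in> H"
    and sub_neg [simp]: "x \<in> H \<Longrightarrow> \<ominus>\<^bsub>M\<^esub> x \<in> H"
    and sub_minus [simp]: "\<lbrakk>x \<in> H; y \<in> H\<rbrakk> \<Longrightarrow> x \<ominus>\<^bsub>M\<^esub> y \<in> H"
  using assms by (auto simp: submodule_def subgroup_def submodule_axioms_def a_inv_def[symmetric] a_minus_def)

lemma sub_carrier_self [simp]: "lm M \<Longrightarrow> sub (carrier M) M"
  by (rule subI) simp_all

lemma sub_zero_self [simp]: "lm M \<Longrightarrow> sub {\<zero>\<^bsub>M\<^esub>} M"
  by (rule subI) simp_all

lemma sub_preimage: "\<lbrakk>f \<in> Hom M N; lm M; lm N; sub H N\<rbrakk> \<Longrightarrow> sub {x \<in> carrier M. f x \<in> H} M"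
  by (rule subI) simp_all

lemma sub_kernel: "\<lbrakk>f \<in> Hom M N; lm M; lm N\<rbrakk> \<Longrightarrow> sub (hom_kernel M N f) M"
  using sub_preimage[of f M N "{\<zero>\<^bsub>N\<^esub>}"] by (simp add: hom_kernel_def)

lemma sub_image:
  assumes f: "f \<in> Hom M N" and lm: "lm M" "lm N" and H: "sub H M"
  shows "sub (f ` H) N"
proof (rule subI[OF lm(2)])
  have HM: "x \<in> carrier M" if "x \<in> H" for x using sub_carrier[OF H that] .
  show "f ` H \<subseteq> carrier N" using f HM by auto
  show "\<zero>\<^bsub>N\<^esub> \<in> f ` H"
    using hom_zero[OF f lm] sub_zero[OF H] by (metis image_eqI)
  show "a \<oplus>\<^bsub>N\<^esub> b \<in> f ` H" if "a \<in> f ` H" "b \<in> f ` H" for a b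
  proof -
    from that obtain u v where "u \<in> H" "v \<in> H" "a = f u" "b = f v" by auto
    with f H show ?thesis by (intro image_eqI[of _ _ "u \<oplus>\<^bsub>M\<^esub> v"]) (simp_all add: HM)
  qed
  show "a \<odot>\<^bsub>N\<^esub> b \<in> f ` H" if "a \<in> carrier A" "b \<in> f ` H" for a b
  proof -
    from that obtain v where "v \<in> H" "b = f v" by auto
    with f H that show ?thesis by (intro image_eqI[of _ _ "a \<odot>\<^bsub>M\<^esub> v"]) (simp_all add: HM)
  qed
qed

lemma sub_range: "\<lbrakk>f \<in> Hom M N; lm M; lm N\<rbrakk> \<Longrightarrow> sub (f ` carrier M) N"
  by (simp add: sub_image)

lemma sub_Int: "\<lbrakk>lm M; sub H M; sub K M\<rbrakk> \<Longrightarrow> sub (H \<inter> K) M"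
  by (rule subI) (simp_all add: sub_subset le_infI1)

definition submod :: "('a, 'm) module \<Rightarrow> 'm set \<Rightarrow> ('a, 'm) module" where
  "submod M H = M\<lparr>carrier := H\<rparr>"

lemma submod_simps [simp]:
  "carrier (submod M H) = H" "add (submod M H) = add M" "zero (submod M H) = zero M"
  "smult (submod M H) = smult M"
  by (simp_all add: submod_def)

lemma lm_submod [simp]:
  assumes M: "lm M" and H: "sub H M"
  shows "lm (submod M H)"
proof -
  have HM: "x \<in> carrier M" if "x \<in> H" for x using sub_carrier[OF H that] .
  show ?thesis
  proof (rule lmI, goal_cases)
    case (6 x)
    then show ?case
      by (intro bexI[of _ "\<ominus>\<^bsub>M\<^esub> x"]) (use M H in \<open>simp_all add: HM\<close>)
  qed (use M H in \<open>simp_all add: HM m_ac m_smult_l_distr m_smult_r_distr m_smult_assoc\<close>)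
qed

lemma submod_incl: "sub H M \<Longrightarrow> (\<lambda>x. x) \<in> Monic (submod M H) M"
  by (rule injI_mono, rule homI) (simp_all add: sub_carrier)

lemma hom_into_submod:
  "sub H N \<Longrightarrow> f \<in> Hom M (submod N H) \<longleftrightarrow> f \<in> Hom M N \<and> f ` carrier M \<subseteq> H"
  using sub_subset[of H N] unfolding mod_hom_def Pi_iff image_subset_iff by (simp add: subset_iff) blast

lemma hom_from_submod: "\<lbrakk>f \<in> Hom M N; sub H M\<rbrakk> \<Longrightarrow> f \<in> Hom (submod M H) N"
  by (rule homI) (simp_all add: sub_carrier)

lemma sub_submod:
  assumes M: "lm M" and H: "sub H M"
  shows "sub K (submod M H) \<longleftrightarrow> sub K M \<and> K \<subseteq> H"
proof (intro iffI conjI)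
  assume K: "sub K (submod M H)"
  show KH: "K \<subseteq> H" using sub_subset[OF K] by simp
  show "sub K M"
    by (rule subI[OF M])
       (use KH sub_subset[OF H] sub_zero[OF K] sub_add[OF K] sub_smult[OF K] in \<open>simp_all add: subset_iff\<close>)
next
  assume *: "sub K M \<and> K \<subseteq> H"
  show "sub K (submod M H)" by (rule subI) (use * M H in simp_all)
qed

text \<open>Quotients are realised on chosen representatives, so that they stay in the same type.\<close>

definition qrep :: "('a, 'm) module \<Rightarrow> 'm set \<Rightarrow> 'm \<Rightarrow> 'm" where
  "qrep M H x = (SOME y. y \<in> carrier M \<and> y \<ominus>\<^bsub>M\<^esub> x \<in> H)"

definition quot :: "('a, 'm) module \<Rightarrow> 'm set \<Rightarrow> ('a, 'm) module" where
  "quot M H = \<lparr>carrier = qrep M H ` carrier M, mult = undefined, one = undefined,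
     zero = qrep M H \<zero>\<^bsub>M\<^esub>, add = (\<lambda>x y. qrep M H (x \<oplus>\<^bsub>M\<^esub> y)),
     smult = (\<lambda>a x. qrep M H (a \<odot>\<^bsub>M\<^esub> x))\<rparr>"

lemma
  assumes M: "lm M" and H: "sub H M"
  shows lm_quot [simp]: "lm (quot M H)"
    and qrep_epi: "qrep M H \<in> Epic M (quot M H)"
    and qrep_kernel: "hom_kernel M (quot M H) (qrep M H) = H"
proof -
  let ?q = "qrep M H"
  have q1: "?q x \<in> carrier M" "?q x \<ominus>\<^bsub>M\<^esub> x \<in> H" if "x \<in> carrier M" for x
  proof -
    have "\<exists>y. y \<in> carrier M \<and> y \<ominus>\<^bsub>M\<^esub> x \<in> H"
      using M H that by (intro exI[of _ x]) simp
    from someI_ex[OF this] show "?q x \<in> carrier M" "?q x \<ominus>\<^bsub>M\<^esub> x \<in> H"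
      by (auto simp: qrep_def)
  qed
  have q2: "?q x = ?q y \<longleftrightarrow> x \<ominus>\<^bsub>M\<^esub> y \<in> H" if x: "x \<in> carrier M" and y: "y \<in> carrier M" for x y
  proof
    assume e: "?q x = ?q y"
    have "(?q y \<ominus>\<^bsub>M\<^esub> y) \<ominus>\<^bsub>M\<^esub> (?q x \<ominus>\<^bsub>M\<^esub> x) = x \<ominus>\<^bsub>M\<^esub> y"
      unfolding e a_minus_def using q1[OF y] x y M
      by (simp add: m_neg_add m_ac)
    then show "x \<ominus>\<^bsub>M\<^esub> y \<in> H"
      using q1[OF x] q1[OF y] H by (metis sub_minus)
  next
    assume e: "x \<ominus>\<^bsub>M\<^esub> y \<in> H"
    \<comment> \<open>The two predicates under the choice operator of \<open>qrep\<close> then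
      coincide, so the representatives are literally equal.\<close>
    have "z \<ominus>\<^bsub>M\<^esub> x \<in> H \<longleftrightarrow> z \<ominus>\<^bsub>M\<^esub> y \<in> H" if z: "z \<in> carrier M" for z
    proof -
      have "z \<ominus>\<^bsub>M\<^esub> y = (z \<ominus>\<^bsub>M\<^esub> x) \<oplus>\<^bsub>M\<^esub> (x \<ominus>\<^bsub>M\<^esub> y)" "z \<ominus>\<^bsub>M\<^esub> x = (z \<ominus>\<^bsub>M\<^esub> y) \<ominus>\<^bsub>M\<^esub> (x \<ominus>\<^bsub>M\<^esub> y)"
        unfolding a_minus_def using x y z M by (simp_all add: m_neg_add m_assoc)
           (simp_all add: m_comm[of M "\<ominus>\<^bsub>M\<^esub> x"] m_comm[of M "\<ominus>\<^bsub>M\<^esub> y" "y \<oplus>\<^bsub>M\<^esub> \<ominus>\<^bsub>M\<^esub> x"] m_assoc)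
      then show ?thesis using e H by (metis sub_add sub_minus)
    qed
    then show "?q x = ?q y"
      unfolding qrep_def by (metis (no_types, lifting))
  qed
  have qadd: "?q (?q x \<oplus>\<^bsub>M\<^esub> ?q y) = ?q (x \<oplus>\<^bsub>M\<^esub> y)" if x: "x \<in> carrier M" and y: "y \<in> carrier M" for x y
  proof -
    have "(?q x \<oplus>\<^bsub>M\<^esub> ?q y) \<ominus>\<^bsub>M\<^esub> (x \<oplus>\<^bsub>M\<^esub> y) = (?q x \<ominus>\<^bsub>M\<^esub> x) \<oplus>\<^bsub>M\<^esub> (?q y \<ominus>\<^bsub>M\<^esub> y)"
      unfolding a_minus_def using q1(1) x y M by (simp add: m_neg_add m_ac)
    then show ?thesis using q1 x y H M by (simp add: q2)
  qed
  have qsm: "?q (a \<odot>\<^bsub>M\<^esub> ?q x) = ?q (a \<odot>\<^bsub>M\<^esub> x)" if a: "a \<in> carrier A" and x: "x \<in> carrier M" for a x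
  proof -
    have "a \<odot>\<^bsub>M\<^esub> ?q x \<ominus>\<^bsub>M\<^esub> a \<odot>\<^bsub>M\<^esub> x = a \<odot>\<^bsub>M\<^esub> (?q x \<ominus>\<^bsub>M\<^esub> x)"
      unfolding a_minus_def using q1(1) x a M by (simp add: m_smult_r_distr m_smult_neg)
    then show ?thesis using q1 x a H M by (simp add: q2)
  qed
  have S: "carrier (quot M H) = ?q ` carrier M" "\<zero>\<^bsub>quot M H\<^esub> = ?q \<zero>\<^bsub>M\<^esub>"
    "x \<oplus>\<^bsub>quot M H\<^esub> y = ?q (x \<oplus>\<^bsub>M\<^esub> y)" "a \<odot>\<^bsub>quot M H\<^esub> x = ?q (a \<odot>\<^bsub>M\<^esub> x)" for a x y
    by (simp_all add: quot_def)
  show lmQ: "lm (quot M H)"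
    by (rule lm_image[OF M, of "?q"]) (simp_all add: S qadd qsm)
  show "?q \<in> Epic M (quot M H)"
    by (rule epiI, rule homI) (auto simp: S qadd qsm)
  show "hom_kernel M (quot M H) ?q = H"
    using sub_subset[OF H] by (auto simp: hom_kernel_def S q2 M)
qed

lemma qrep_hom [simp]: "\<lbrakk>lm M; sub H M\<rbrakk> \<Longrightarrow> qrep M H \<in> Hom M (quot M H)"
  by (simp add: qrep_epi)

lemma qrep_zero_iff: "\<lbrakk>lm M; sub H M; x \<in> carrier M\<rbrakk> \<Longrightarrow> qrep M H x = \<zero>\<^bsub>quot M H\<^esub> \<longleftrightarrow> x \<in> H"
  using qrep_kernel[of M H] by (auto simp: hom_kernel_def set_eq_iff)


subsection \<open>Finite generation\<close>

text \<open>Generation is tested by submodules instead of linear combinations, so later arguments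
  only take images and preimages of submodules. For the converse, the combinations of
  \<open>S\<close> form a submodule containing \<open>S\<close>, hence everything.\<close>

lemma fg_iff_generators:
  "fg M \<longleftrightarrow> lm M \<and> (\<exists>S. finite S \<and> S \<subseteq> carrier M \<and> (\<forall>H. sub H M \<longrightarrow> S \<subseteq> H \<longrightarrow> H = carrier M))"
proof (intro iffI conjI; (elim conjE)?)
  assume fg: "fg M"
  show lm: "lm M" using fg by simp
  interpret left_module A M by fact
  obtain S where S: "finite S" "S \<subseteq> carrier M"
    "\<forall>x\<in>carrier M. \<exists>c\<in>S \<rightarrow> carrier A. x = (\<Oplus>\<^bsub>M\<^esub>s\<in>S. c s \<odot>\<^bsub>M\<^esub> s)"
    using fg by (auto simp: fg_module_def)
  have "H = carrier M" if H: "sub H M" "S \<subseteq> H" for H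
  proof
    have comb: "(\<Oplus>\<^bsub>M\<^esub>s\<in>T. c s \<odot>\<^bsub>M\<^esub> s) \<in> H" if "c \<in> T \<rightarrow> carrier A" "finite T" "T \<subseteq> H" for c T
      using that(2,1,3)
    proof (induction T)
      case (insert x F)
      then have cF: "(\<lambda>s. c s \<odot>\<^bsub>M\<^esub> s) \<in> F \<rightarrow> carrier M" "c x \<odot>\<^bsub>M\<^esub> x \<in> carrier M"
        using sub_subset[OF H(1)] by auto
      have "(\<Oplus>\<^bsub>M\<^esub>s\<in>F. c s \<odot>\<^bsub>M\<^esub> s) \<in> H" "c x \<odot>\<^bsub>M\<^esub> x \<in> H"
        using insert.IH insert.prems sub_smult[OF H(1)] by (auto simp: Pi_iff)
      then show ?case
        using M.finsum_insert[OF insert(1,2) cF] sub_add[OF H(1)] by metis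
    qed (simp add: sub_zero[OF H(1)])
    show "carrier M \<subseteq> H"
    proof
      fix x assume "x \<in> carrier M"
      with S(3) obtain c where "c \<in> S \<rightarrow> carrier A" "x = (\<Oplus>\<^bsub>M\<^esub>s\<in>S. c s \<odot>\<^bsub>M\<^esub> s)"
        by blast
      then show "x \<in> H" using comb[OF _ S(1) H(2)] by simp
    qed
  qed (simp add: sub_subset[OF H(1)])
  with S show "\<exists>S. finite S \<and> S \<subseteq> carrier M \<and> (\<forall>H. sub H M \<longrightarrow> S \<subseteq> H \<longrightarrow> H = carrier M)" by blast
next
  assume lm: "lm M"
  assume "\<exists>S. finite S \<and> S \<subseteq> carrier M \<and> (\<forall>H. sub H M \<longrightarrow> S \<subseteq> H \<longrightarrow> H = carrier M)"
  then obtain S where S: "finite S" "S \<subseteq> carrier M" "\<And>H. sub H M \<Longrightarrow> S \<subseteq> H \<Longrightarrow> H = carrier M"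
    by blast
  interpret left_module A M by fact
  define H where "H = {\<Oplus>\<^bsub>M\<^esub>s\<in>S. c s \<odot>\<^bsub>M\<^esub> s | c. c \<in> S \<rightarrow> carrier A}"
  have cl: "(\<lambda>s. c s \<odot>\<^bsub>M\<^esub> s) \<in> S \<rightarrow> carrier M" if "c \<in> S \<rightarrow> carrier A" for c
    using that S by auto
  have "sub H M"
  proof (rule subI[OF lm])
    show "H \<subseteq> carrier M" using cl by (auto simp: H_def intro!: M.finsum_closed)
    have "(\<Oplus>\<^bsub>M\<^esub>s\<in>S. \<zero> \<odot>\<^bsub>M\<^esub> s) = (\<Oplus>\<^bsub>M\<^esub>s\<in>S. \<zero>\<^bsub>M\<^esub>)"
      by (rule M.finsum_cong') (use S lm in auto)
    then show "\<zero>\<^bsub>M\<^esub> \<in> H"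
      unfolding H_def using S by (intro CollectI exI[of _ "\<lambda>_. \<zero>"]) simp
    show "a \<oplus>\<^bsub>M\<^esub> b \<in> H" if "a \<in> H" "b \<in> H" for a b
    proof -
      from that obtain c d where *: "c \<in> S \<rightarrow> carrier A" "d \<in> S \<rightarrow> carrier A"
        "a = (\<Oplus>\<^bsub>M\<^esub>s\<in>S. c s \<odot>\<^bsub>M\<^esub> s)" "b = (\<Oplus>\<^bsub>M\<^esub>s\<in>S. d s \<odot>\<^bsub>M\<^esub> s)"
        by (auto simp: H_def)
      have "a \<oplus>\<^bsub>M\<^esub> b = (\<Oplus>\<^bsub>M\<^esub>s\<in>S. c s \<odot>\<^bsub>M\<^esub> s \<oplus>\<^bsub>M\<^esub> d s \<odot>\<^bsub>M\<^esub> s)"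
        using M.finsum_addf[OF cl[OF *(1)] cl[OF *(2)]] * by simp
      also have "\<dots> = (\<Oplus>\<^bsub>M\<^esub>s\<in>S. (c s \<oplus> d s) \<odot>\<^bsub>M\<^esub> s)"
        by (rule M.finsum_cong') (use S * in \<open>auto simp: smult_l_distr Pi_iff subset_iff\<close>)
      finally show ?thesis
        unfolding H_def using * by (intro CollectI exI[of _ "\<lambda>s. c s \<oplus> d s"]) auto
    qed
    show "a \<odot>\<^bsub>M\<^esub> x \<in> H" if a: "a \<in> carrier A" and "x \<in> H" for a x
    proof -
      from that obtain c where *: "c \<in> S \<rightarrow> carrier A" "x = (\<Oplus>\<^bsub>M\<^esub>s\<in>S. c s \<odot>\<^bsub>M\<^esub> s)"
        by (auto simp: H_def)
      have sm: "a \<odot>\<^bsub>M\<^esub> (\<Oplus>\<^bsub>M\<^esub>s\<in>T. f s) = (\<Oplus>\<^bsub>M\<^esub>s\<in>T. a \<odot>\<^bsub>M\<^esub> f s)" if "finite T" "f \<in> T \<rightarrow> carrier M" for T f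
        using that
      proof (induction T)
        case (insert x F)
        have "f \<in> F \<rightarrow> carrier M" "f x \<in> carrier M" using insert.prems by auto
        moreover from this have "(\<lambda>s. a \<odot>\<^bsub>M\<^esub> f s) \<in> F \<rightarrow> carrier M" using a by auto
        moreover have "(\<Oplus>\<^bsub>M\<^esub>s\<in>F. f s) \<in> carrier M" using calculation by (intro M.finsum_closed) auto
        ultimately show ?case using insert a by (simp add: smult_r_distr)
      qed (simp add: a lm)
      have "a \<odot>\<^bsub>M\<^esub> x = (\<Oplus>\<^bsub>M\<^esub>s\<in>S. a \<odot>\<^bsub>M\<^esub> (c s \<odot>\<^bsub>M\<^esub> s))"
        unfolding *(2) by (rule sm) (use S cl * in auto)
      also have "\<dots> = (\<Oplus>\<^bsub>M\<^esub>s\<in>S. (a \<otimes> c s) \<odot>\<^bsub>M\<^esub> s)"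
        by (rule M.finsum_cong') (use S * a in \<open>auto simp: smult_assoc1 Pi_iff subset_iff\<close>)
      finally show ?thesis
        unfolding H_def using * a by (intro CollectI exI[of _ "\<lambda>s. a \<otimes> c s"]) auto
    qed
  qed
  moreover have "S \<subseteq> H"
  proof
    fix s assume s: "s \<in> S"
    have "s = (\<Oplus>\<^bsub>M\<^esub>t\<in>S. if s = t then t else \<zero>\<^bsub>M\<^esub>)"
      by (rule M.finsum_singleton[of s S "\<lambda>t. t", symmetric]) (use s S(1,2) in auto)
    also have "\<dots> = (\<Oplus>\<^bsub>M\<^esub>t\<in>S. (if t = s then \<one> else \<zero>) \<odot>\<^bsub>M\<^esub> t)"
      by (rule M.finsum_cong') (use S lm in auto)
    finally show "s \<in> H"
      unfolding H_def by (intro CollectI exI[of _ "\<lambda>t. if t = s then \<one> else \<zero>"]) auto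
  qed
  ultimately have "H = carrier M" by (rule S)
  then show "fg M"
    unfolding fg_module_def using lm S H_def by (auto intro!: exI[of _ S])
qed

lemma fg_epi:
  assumes M: "fg M" and f: "f \<in> Epic M N" and N: "lm N"
  shows "fg N"
proof -
  obtain S where S: "finite S" "S \<subseteq> carrier M" "\<And>H. sub H M \<Longrightarrow> S \<subseteq> H \<Longrightarrow> H = carrier M"
    using M by (auto simp: fg_iff_generators)
  have "H = carrier N" if H: "sub H N" "f ` S \<subseteq> H" for H
  proof
    have "{x \<in> carrier M. f x \<in> H} = carrier M"
      by (rule S(3)) (use H S(2) N M epi_hom[OF f] in \<open>auto intro: sub_preimage\<close>)
    then have "f x \<in> H" if "x \<in> carrier M" for x using that by blast
    then show "carrier N \<subseteq> H" unfolding epi_image[OF f, symmetric] by (rule image_subsetI)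
  qed (rule sub_subset[OF H(1)])
  with S N epi_hom[OF f] show ?thesis
    unfolding fg_iff_generators by (intro conjI exI[of _ "f ` S"]) auto
qed

lemma fg_quot [simp]: "\<lbrakk>fg M; sub H M\<rbrakk> \<Longrightarrow> fg (quot M H)"
  using fg_epi[of M "qrep M H" "quot M H"] qrep_epi[of M H] by simp

lemma fg_iso: "\<lbrakk>fg M; isomorphic_modules A M N; lm N\<rbrakk> \<Longrightarrow> fg N"
  unfolding isomorphic_modules_def using fg_epi iso_epi by blast

text \<open>Images of generators of \<open>L\<close> together with preimages of generators of
  \<open>N\<close> generate \<open>M\<close>: a submodule containing them contains the kernel of
  \<open>g\<close> and maps onto \<open>N\<close>.\<close>

lemma fg_extension:
  assumes L: "fg L" and N: "fg N" and M: "lm M"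
    and f: "f \<in> Hom L M" and g: "g \<in> Epic M N" and ex: "hom_kernel M N g \<subseteq> f ` carrier L"
  shows "fg M"
proof -
  have gh: "g \<in> Hom M N" using g by simp
  have lmLN: "lm L" "lm N" using L N by simp_all
  obtain S where S: "finite S" "S \<subseteq> carrier L" "\<And>H. sub H L \<Longrightarrow> S \<subseteq> H \<Longrightarrow> H = carrier L"
    using L by (auto simp: fg_iff_generators)
  obtain U where U: "finite U" "U \<subseteq> carrier N" "\<And>H. sub H N \<Longrightarrow> U \<subseteq> H \<Longrightarrow> H = carrier N"
    using N by (auto simp: fg_iff_generators)
  obtain V where V: "V \<subseteq> carrier M" "g ` V = U" "finite V"
    using U(1,2) epi_image[OF g] by (metis finite_subset_image)
  have "H = carrier M" if H: "sub H M" "f ` S \<union> V \<subseteq> H" for H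
  proof
    have "{x \<in> carrier L. f x \<in> H} = carrier L"
      by (rule S(3)) (use H S(2) lmLN M f in \<open>auto intro: sub_preimage\<close>)
    then have fH: "f ` carrier L \<subseteq> H" by auto
    have gH: "g ` H = carrier N"
      by (rule U(3)) (use H V lmLN M gh in \<open>auto intro: sub_image\<close>)
    show "carrier M \<subseteq> H"
    proof
      fix x assume x: "x \<in> carrier M"
      then obtain h where h: "h \<in> H" "g x = g h" using gH gh by (metis hom_closed imageE)
      then have "x \<ominus>\<^bsub>M\<^esub> h \<in> hom_kernel M N g"
        using x gh M lmLN sub_carrier[OF H(1)] by (simp add: hom_kernel_def)
      then have "(x \<ominus>\<^bsub>M\<^esub> h) \<oplus>\<^bsub>M\<^esub> h \<in> H"
        using ex fH h H by (intro sub_add[OF H(1)]) auto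
      then show "x \<in> H" using x h M sub_carrier[OF H(1)] by simp
    qed
  qed (rule sub_subset[OF H(1)])
  then show ?thesis
    unfolding fg_iff_generators using M S(1,2) V(1,3) f by (intro conjI exI[of _ "f ` S \<union> V"]) auto
qed


subsection \<open>Short exact sequences\<close>

lemma
  assumes "ses L f M g N"
  shows ses_mono: "f \<in> Monic L M" and ses_epi: "g \<in> Epic M N"
    and ses_ker: "f ` carrier L = hom_kernel M N g"
    and ses_hom1 [simp]: "f \<in> Hom L M" and ses_hom2 [simp]: "g \<in> Hom M N"
  using assms by (simp_all add: short_exact_def)

lemma ses_comp: "\<lbrakk>ses L f M g N; x \<in> carrier L\<rbrakk> \<Longrightarrow> g (f x) = \<zero>\<^bsub>N\<^esub>"
  using ses_ker[of L f M g N] unfolding hom_kernel_def by blast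

lemma ses_exact: "\<lbrakk>ses L f M g N; y \<in> carrier M; g y = \<zero>\<^bsub>N\<^esub>\<rbrakk> \<Longrightarrow> y \<in> f ` carrier L"
  using ses_ker[of L f M g N] unfolding hom_kernel_def by blast

lemma sesI:
  assumes "f \<in> Monic L M" "g \<in> Epic M N" "\<And>x. x \<in> carrier L \<Longrightarrow> g (f x) = \<zero>\<^bsub>N\<^esub>"
    and "\<And>y. \<lbrakk>y \<in> carrier M; g y = \<zero>\<^bsub>N\<^esub>\<rbrakk> \<Longrightarrow> y \<in> f ` carrier L"
  shows "ses L f M g N"
proof -
  have "f ` carrier L = hom_kernel M N g"
  proof
    show "f ` carrier L \<subseteq> hom_kernel M N g"
      using assms(3) hom_closed[OF mono_hom[OF assms(1)]] by (auto simp: hom_kernel_def)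
    show "hom_kernel M N g \<subseteq> f ` carrier L"
      using assms(4) by (auto simp: hom_kernel_def)
  qed
  with assms(1,2) show ?thesis by (simp add: short_exact_def)
qed

lemma ses_quot: "\<lbrakk>f \<in> Monic L M; lm L; lm M\<rbrakk> \<Longrightarrow>
  ses L f M (qrep M (f ` carrier L)) (quot M (f ` carrier L))"
  using sub_range[of f L M] by (auto simp: short_exact_def qrep_epi qrep_kernel)

lemma ses_submod: "\<lbrakk>g \<in> Epic M N; lm M; lm N\<rbrakk> \<Longrightarrow>
  ses (submod M (hom_kernel M N g)) (\<lambda>x. x) M g N"
  using sub_kernel[of g M N] by (auto simp: short_exact_def submod_incl)

lemma ses_iso_right:
  assumes s: "ses L f M g N" and h: "h \<in> Iso N N'" and lm: "lm N" "lm N'"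
  shows "ses L f M (\<lambda>x. h (g x)) N'"
proof (rule sesI)
  show "(\<lambda>x. h (g x)) \<in> Epic M N'" by (rule epi_comp[OF ses_epi[OF s]]) (use h in simp)
  show "h (g (f x)) = \<zero>\<^bsub>N'\<^esub>" if "x \<in> carrier L" for x
    using ses_comp[OF s that] iso_hom[OF h] lm by simp
  show "y \<in> f ` carrier L" if "y \<in> carrier M" "h (g y) = \<zero>\<^bsub>N'\<^esub>" for y
    using ses_exact[OF s that(1)] mono_zero_iff[OF iso_mono[OF h] lm, of "g y"] that
      hom_closed[OF ses_hom2[OF s] that(1)] by simp
qed (use ses_mono[OF s] in simp)

text \<open>Used to replace the middle term of an extension by a copy whose carrier lies in the
  universe.\<close>

lemma ses_iso_middle:
  assumes s: "ses L f M g N" and h: "h \<in> Iso M M'" and h': "h' \<in> Iso M' M"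
    and inv: "\<And>x. x \<in> carrier M \<Longrightarrow> h' (h x) = x" "\<And>y. y \<in> carrier M' \<Longrightarrow> h (h' y) = y"
  shows "ses L (\<lambda>x. h (f x)) M' (\<lambda>y. g (h' y)) N"
proof (rule sesI)
  have fh: "f \<in> Hom L M" using s by simp
  show "(\<lambda>x. h (f x)) \<in> Monic L M'" by (rule mono_comp[OF ses_mono[OF s]]) (use h in simp)
  show "(\<lambda>y. g (h' y)) \<in> Epic M' N" by (rule epi_comp[OF _ ses_epi[OF s]]) (use h' in simp)
  show "g (h' (h (f x))) = \<zero>\<^bsub>N\<^esub>" if "x \<in> carrier L" for x
    using ses_comp[OF s that] inv hom_closed[OF fh that] by simp
  show "y \<in> (\<lambda>x. h (f x)) ` carrier L" if y: "y \<in> carrier M'" "g (h' y) = \<zero>\<^bsub>N\<^esub>" for y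
  proof -
    have "h' y \<in> f ` carrier L"
      by (rule ses_exact[OF s _ y(2)]) (use y(1) iso_hom[OF h'] in simp)
    then obtain x where "x \<in> carrier L" "h' y = f x" by blast
    then show ?thesis using inv(2)[OF y(1)] by (metis image_eqI)
  qed
qed

text \<open>The difference of \<open>y\<close> and \<open>t (g y)\<close> lies in the kernel of
  \<open>g\<close>, so it has a unique preimage \<open>r y\<close> under \<open>f\<close>. The
  formula for \<open>f (r y)\<close> is kept for the comparison of two extensions in
  \<open>Ext1_singleton_iff\<close>.\<close>

lemma section_imp_retraction:
  assumes s: "ses L f M g N" and lm: "lm L" "lm M" "lm N"
    and t: "t \<in> Hom N M" "\<And>x. x \<in> carrier N \<Longrightarrow> g (t x) = x"
  shows "\<exists>r\<in>Hom M L. (\<forall>x\<in>carrier L. r (f x) = x) \<and> (\<forall>y\<in>carrier M. f (r y) = y \<ominus>\<^bsub>M\<^esub> t (g y))"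
proof -
  have gh: "g \<in> Hom M N" and fh: "f \<in> Hom L M" using s by simp_all
  have "(\<lambda>y. y \<ominus>\<^bsub>M\<^esub> t (g y)) \<in> Hom M M"
    by (rule hom_diff) (use hom_comp[OF gh t(1)] lm in simp_all)
  moreover have "y \<ominus>\<^bsub>M\<^esub> t (g y) \<in> f ` carrier L" if "y \<in> carrier M" for y
    by (rule ses_exact[OF s]) (use that gh t lm in simp_all)
  ultimately obtain r where r: "r \<in> Hom M L" "\<forall>y\<in>carrier M. f (r y) = y \<ominus>\<^bsub>M\<^esub> t (g y)"
    using mono_factor[OF ses_mono[OF s], of "\<lambda>y. y \<ominus>\<^bsub>M\<^esub> t (g y)" M] lm by blast
  have "r (f x) = x" if "x \<in> carrier L" for x
  proof -
    have "f (r (f x)) = f x" using r(2) that fh ses_comp[OF s that] t(1) lm by simp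
    then show ?thesis using mono_eq[OF ses_mono[OF s], of "r (f x)" x] that r(1) fh by simp
  qed
  with r show ?thesis by blast
qed

text \<open>The difference of \<open>y\<close> and \<open>f (r y)\<close> vanishes on the kernel of
  \<open>g\<close>, hence descends to \<open>N\<close>.\<close>

lemma retraction_imp_section:
  assumes s: "ses L f M g N" and lm: "lm L" "lm M" "lm N"
    and r: "r \<in> Hom M L" "\<And>x. x \<in> carrier L \<Longrightarrow> r (f x) = x"
  shows "\<exists>t\<in>Hom N M. \<forall>x\<in>carrier N. g (t x) = x"
proof -
  have gh: "g \<in> Hom M N" and fh: "f \<in> Hom L M" using s by simp_all
  have d: "(\<lambda>y. y \<ominus>\<^bsub>M\<^esub> f (r y)) \<in> Hom M M"
    by (rule hom_diff) (use hom_comp[OF r(1) fh] lm in simp_all)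
  have k: "y \<ominus>\<^bsub>M\<^esub> f (r y) = \<zero>\<^bsub>M\<^esub>" if y: "y \<in> carrier M" "g y = \<zero>\<^bsub>N\<^esub>" for y
  proof -
    obtain x where "x \<in> carrier L" "y = f x" using ses_exact[OF s y] by blast
    then show ?thesis using r fh lm by simp
  qed
  obtain t where t: "t \<in> Hom N M" "\<forall>y\<in>carrier M. t (g y) = y \<ominus>\<^bsub>M\<^esub> f (r y)"
    using epi_factor[OF ses_epi[OF s] d] lm k by blast
  have "g (t x) = x" if x: "x \<in> carrier N" for x
  proof -
    obtain y where y: "y \<in> carrier M" "g y = x" using epi_ex[OF ses_epi[OF s] x] by blast
    then have "g (t x) = g (y \<ominus>\<^bsub>M\<^esub> f (r y))" using t(2) by auto
    also have "\<dots> = x" using y gh fh r(1) lm x ses_comp[OF s, of "r y"] by simp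
    finally show ?thesis .
  qed
  with t(1) show ?thesis by blast
qed

lemma lm_regular [simp]: "lm (regular_module A)"
  by (rule lmI) (auto simp: regular_module_def A.a_ac A.l_distr A.r_distr A.m_assoc intro!: bexI[of _ "\<ominus> _"] A.l_neg)

lemma regular_simps [simp]: "carrier (regular_module A) = carrier A" "add (regular_module A) = add A"
  "zero (regular_module A) = \<zero>" "smult (regular_module A) = mult A"
  by (simp_all add: regular_module_def)

lemma fg_regular [simp]: "fg (regular_module A)"
proof -
  have "H = carrier (regular_module A)" if H: "sub H (regular_module A)" "{\<one>} \<subseteq> H" for H
  proof
    show "carrier (regular_module A) \<subseteq> H"
    proof
      fix x assume "x \<in> carrier (regular_module A)"
      then show "x \<in> H" using sub_smult[OF H(1), of x \<one>] H(2) by simp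
    qed
  qed (rule sub_subset[OF H(1)])
  then show ?thesis
    unfolding fg_iff_generators by (intro conjI exI[of _ "{\<one>}"]) auto
qed

lemma hom_from_regular: "\<lbrakk>lm M; x \<in> carrier M\<rbrakk> \<Longrightarrow> (\<lambda>a. a \<odot>\<^bsub>M\<^esub> x) \<in> Hom (regular_module A) M"
  by (rule homI) (simp_all add: m_smult_l_distr m_smult_assoc)

lemma hom_regular_eq: "\<lbrakk>f \<in> Hom (regular_module A) M; a \<in> carrier A\<rbrakk> \<Longrightarrow> f a = a \<odot>\<^bsub>M\<^esub> f \<one>"
  using hom_smult[of f "regular_module A" M a \<one>] by simp


subsection \<open>Representatives in the universe, lifting and extension\<close>

text \<open>The gate between arbitrary carrier types and the universe: with both inverse
  isomorphisms at hand, a statement about universe modules can be applied to a copy and pulled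
  back.\<close>

lemma umod_ex:
  fixes M :: "('a, 'm) module"
  assumes "fg M"
  obtains N :: "'a umod" and h k where "fg N" "h \<in> Iso M N" "k \<in> Iso N M"
    "\<forall>x\<in>carrier M. k (h x) = x" "\<forall>y\<in>carrier N. h (k y) = y"
proof -
  obtain N :: "'a umod" and h where N: "fg N" "h \<in> Iso M N"
    using fg_module_universe[OF assms] unfolding isomorphic_modules_def by blast
  then obtain k where "k \<in> Iso N M" "\<forall>x\<in>carrier M. k (h x) = x" "\<forall>y\<in>carrier N. h (k y) = y"
    using iso_inverse[OF N(2) fg_lm[OF assms] fg_lm[OF N(1)]] by blast
  with N show ?thesis by (rule that)
qed

abbreviation "proj \<equiv> projective_module A"
abbreviation "inje \<equiv> injective_module A"

lemma proj_fg: "proj P \<Longrightarrow> fg P"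
  by (simp add: projective_module_def)

lemma inje_fg: "inje P \<Longrightarrow> fg P"
  by (simp add: injective_module_def)

text \<open>The definition tests projectivity only in the universe; conjugation with isomorphisms
  frees the types of \<open>M\<close> and \<open>N\<close>. The lemma \<open>inje_extend\<close>
  does the same for injectivity.\<close>

lemma proj_lift:
  assumes P: "proj P" and MN: "fg M" "fg N" and g: "g \<in> Epic M N" and h: "h \<in> Hom P N"
  shows "\<exists>k\<in>Hom P M. \<forall>x\<in>carrier P. g (k x) = h x"
proof -
  obtain M' :: "'a umod" and a a' where a: "fg M'" "a \<in> Iso M M'" "a' \<in> Iso M' M"
    "\<forall>x\<in>carrier M. a' (a x) = x" "\<forall>y\<in>carrier M'. a (a' y) = y"
    using umod_ex[OF MN(1)] .
  obtain N' :: "'a umod" and b b' where b: "fg N'" "b \<in> Iso N N'" "b' \<in> Iso N' N"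
    "\<forall>x\<in>carrier N. b' (b x) = x" "\<forall>y\<in>carrier N'. b (b' y) = y"
    using umod_ex[OF MN(2)] .
  have g': "(\<lambda>x. b (g (a' x))) \<in> Epic M' N'"
    by (rule epi_comp[of "\<lambda>x. g (a' x)" M' N], rule epi_comp[of a' M' M]) (use a b g in simp_all)
  have h': "(\<lambda>x. b (h x)) \<in> Hom P N'"
    by (rule hom_comp[OF h]) (use b in simp)
  obtain k where k: "k \<in> Hom P M'" "\<forall>x\<in>carrier P. b (g (a' (k x))) = b (h x)"
    using P g' h' a(1) b(1) unfolding projective_module_def by meson
  have "g (a' (k x)) = h x" if x: "x \<in> carrier P" for x
    using k(2) x hom_closed[OF k(1) x] hom_closed[OF iso_hom[OF a(3)]] hom_closed[OF epi_hom[OF g]]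
      hom_closed[OF h x] mono_eq[OF iso_mono[OF b(2)]] by blast
  moreover have "(\<lambda>x. a' (k x)) \<in> Hom P M"
    by (rule hom_comp[OF k(1)]) (use a in simp)
  ultimately show ?thesis by (intro bexI[of _ "\<lambda>x. a' (k x)"] ballI)
qed

lemma projI:
  assumes "fg P"
    and "\<And>(M :: 'a umod) (N :: 'a umod) g h. \<lbrakk>fg M; fg N; g \<in> Epic M N; h \<in> Hom P N\<rbrakk> \<Longrightarrow>
      \<exists>k\<in>Hom P M. \<forall>x\<in>carrier P. g (k x) = h x"
  shows "proj P"
  unfolding projective_module_def using assms by meson

lemma inje_extend:
  assumes I: "inje I" and MN: "fg M" "fg N" and g: "g \<in> Monic M N" and h: "h \<in> Hom M I"
  shows "\<exists>k\<in>Hom N I. \<forall>x\<in>carrier M. k (g x) = h x"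
proof -
  obtain M' :: "'a umod" and a a' where a: "fg M'" "a \<in> Iso M M'" "a' \<in> Iso M' M"
    "\<forall>x\<in>carrier M. a' (a x) = x" "\<forall>y\<in>carrier M'. a (a' y) = y"
    using umod_ex[OF MN(1)] .
  obtain N' :: "'a umod" and b b' where b: "fg N'" "b \<in> Iso N N'" "b' \<in> Iso N' N"
    "\<forall>x\<in>carrier N. b' (b x) = x" "\<forall>y\<in>carrier N'. b (b' y) = y"
    using umod_ex[OF MN(2)] .
  have g': "(\<lambda>x. b (g (a' x))) \<in> Monic M' N'"
    by (rule mono_comp[of "\<lambda>x. g (a' x)" M' N], rule mono_comp[of a' M' M]) (use a b g in simp_all)
  have h': "(\<lambda>x. h (a' x)) \<in> Hom M' I"
    by (rule hom_comp[OF _ h]) (use a in simp)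
  obtain k where k: "k \<in> Hom N' I" "\<forall>x\<in>carrier M'. k (b (g (a' x))) = h (a' x)"
    using I g' h' a(1) b(1) unfolding injective_module_def by meson
  have "k (b (g x)) = h x" if x: "x \<in> carrier M" for x
    using k(2) bspec[OF a(4) x] hom_closed[OF iso_hom[OF a(2)] x] by metis
  moreover have "(\<lambda>x. k (b x)) \<in> Hom N I"
    by (rule hom_comp[OF _ k(1)]) (use b in simp)
  ultimately show ?thesis by (intro bexI[of _ "\<lambda>x. k (b x)"] ballI)
qed

lemma injeI:
  assumes "fg I"
    and "\<And>(M :: 'a umod) (N :: 'a umod) g h. \<lbrakk>fg M; fg N; g \<in> Monic M N; h \<in> Hom M I\<rbrakk> \<Longrightarrow>
      \<exists>k\<in>Hom N I. \<forall>x\<in>carrier M. k (g x) = h x"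
  shows "inje I"
  unfolding injective_module_def using assms by meson

text \<open>A direct summand up to isomorphism, without a named complement; the two modules may have
  different carrier types.\<close>

definition retract :: "('a, 'm) module \<Rightarrow> ('a, 'n) module \<Rightarrow> bool" where
  "retract X Z \<longleftrightarrow> (\<exists>i\<in>Hom X Z. \<exists>p\<in>Hom Z X. \<forall>x\<in>carrier X. p (i x) = x)"

lemma retractI: "\<lbrakk>i \<in> Hom X Z; p \<in> Hom Z X; \<And>x. x \<in> carrier X \<Longrightarrow> p (i x) = x\<rbrakk> \<Longrightarrow> retract X Z"
  unfolding retract_def by blast

lemma retractE:
  assumes "retract X Z"
  obtains i p where "i \<in> Hom X Z" "p \<in> Hom Z X" "\<forall>x\<in>carrier X. p (i x) = x"
  using assms unfolding retract_def by blast

lemma retract_refl: "retract X X"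
  by (rule retractI[of "\<lambda>x. x" _ _ "\<lambda>x. x"]) simp_all

lemma retract_trans: "\<lbrakk>retract X Y; retract Y Z\<rbrakk> \<Longrightarrow> retract X Z"
proof -
  assume "retract X Y" "retract Y Z"
  then obtain i p j q where *: "i \<in> Hom X Y" "p \<in> Hom Y X" "\<forall>x\<in>carrier X. p (i x) = x"
    "j \<in> Hom Y Z" "q \<in> Hom Z Y" "\<forall>x\<in>carrier Y. q (j x) = x"
    by (metis retractE)
  show ?thesis
    by (rule retractI[of "\<lambda>x. j (i x)" _ _ "\<lambda>x. p (q x)"]) (use * hom_comp in simp_all)
qed

lemma retract_iso:
  assumes "isomorphic_modules A M N" "lm M" "lm N"
  shows "retract M N" "retract N M"
proof -
  obtain h where h: "h \<in> Iso M N" using assms unfolding isomorphic_modules_def by blast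
  obtain k where "k \<in> Iso N M" "\<forall>x\<in>carrier M. k (h x) = x" "\<forall>y\<in>carrier N. h (k y) = y"
    using iso_inverse[OF h assms(2,3)] by blast
  with h show "retract M N" "retract N M" by (auto intro!: retractI)
qed

lemma retract_mono: "\<lbrakk>i \<in> Hom X Z; \<And>x. x \<in> carrier X \<Longrightarrow> p (i x) = x\<rbrakk> \<Longrightarrow> i \<in> Monic X Z"
  by (rule injI_mono, simp, rule inj_on_inverseI[of _ p], simp)

lemma retract_epi: "\<lbrakk>i \<in> Hom X Z; p \<in> Hom Z X; \<And>x. x \<in> carrier X \<Longrightarrow> p (i x) = x\<rbrakk> \<Longrightarrow> p \<in> Epic Z X"
  by (rule epiI) (auto intro: hom_closed)

lemma retract_fg: "\<lbrakk>retract X Z; fg Z; lm X\<rbrakk> \<Longrightarrow> fg X"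
  by (metis retractE retract_epi fg_epi)

lemma retract_proj:
  assumes r: "retract X P" and P: "proj P" and X: "lm X"
  shows "proj X"
proof (rule projI)
  obtain i p where ip: "i \<in> Hom X P" "p \<in> Hom P X" "\<forall>x\<in>carrier X. p (i x) = x"
    using r by (rule retractE)
  show "fg X" using retract_fg[OF r proj_fg[OF P] X] .
  fix M N :: "'a umod" and g h assume *: "fg M" "fg N" "g \<in> Epic M N" "h \<in> Hom X N"
  obtain k where k: "k \<in> Hom P M" "\<forall>x\<in>carrier P. g (k x) = h (p x)"
    using proj_lift[OF P *(1-3) hom_comp[OF ip(2) *(4)]] by blast
  show "\<exists>k\<in>Hom X M. \<forall>x\<in>carrier X. g (k x) = h x"
    by (rule bexI[OF _ hom_comp[OF ip(1) k(1)]]) (use k(2) ip hom_closed[OF ip(1)] in simp)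
qed

lemma retract_inje:
  assumes r: "retract X P" and P: "inje P" and X: "lm X"
  shows "inje X"
proof (rule injeI)
  obtain i p where ip: "i \<in> Hom X P" "p \<in> Hom P X" "\<forall>x\<in>carrier X. p (i x) = x"
    using r by (rule retractE)
  show "fg X" using retract_fg[OF r inje_fg[OF P] X] .
  fix M N :: "'a umod" and g h assume *: "fg M" "fg N" "g \<in> Monic M N" "h \<in> Hom M X"
  obtain k where k: "k \<in> Hom N P" "\<forall>x\<in>carrier M. k (g x) = i (h x)"
    using inje_extend[OF P *(1-3) hom_comp[OF *(4) ip(1)]] by blast
  show "\<exists>k\<in>Hom N X. \<forall>x\<in>carrier M. k (g x) = h x"
    by (rule bexI[OF _ hom_comp[OF k(1) ip(2)]]) (use k(2) ip hom_closed[OF *(4)] in simp)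
qed

text \<open>A map out of the regular module is determined by its value at \<open>\<one>\<close>, so
  a preimage of that value gives the lift.\<close>

lemma proj_regular [simp]: "proj (regular_module A)"
proof (rule projI)
  fix M N :: "'a umod" and g h
  assume *: "fg M" "fg N" "g \<in> Epic M N" "h \<in> Hom (regular_module A) N"
  have "h \<one> \<in> carrier N" using hom_closed[OF *(4), of \<one>] by simp
  then obtain y where y: "y \<in> carrier M" "g y = h \<one>" using epi_ex[OF *(3)] by blast
  show "\<exists>k\<in>Hom (regular_module A) M. \<forall>x\<in>carrier (regular_module A). g (k x) = h x"
    by (rule bexI[OF _ hom_from_regular[OF fg_lm[OF *(1)] y(1)]])
       (use y epi_hom[OF *(3)] hom_regular_eq[OF *(4), symmetric] in simp)
qed simp

lemma epi_to_proj_section: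
  assumes "proj P" "fg M" "g \<in> Epic M P"
  shows "\<exists>s\<in>Hom P M. \<forall>x\<in>carrier P. g (s x) = x"
  using proj_lift[OF assms(1,2) proj_fg[OF assms(1)] assms(3), of "\<lambda>x. x"] by simp

lemma mono_from_inje_retraction:
  assumes "inje I" "fg M" "g \<in> Monic I M"
  shows "\<exists>r\<in>Hom M I. \<forall>x\<in>carrier I. r (g x) = x"
  using inje_extend[OF assms(1) inje_fg[OF assms(1)] assms(2,3), of "\<lambda>x. x"] by simp


subsection \<open>Binary direct sums\<close>

lemma ds2_simps [simp]:
  "carrier (direct_sum2 M N) = carrier M \<times> carrier N"
  "\<zero>\<^bsub>direct_sum2 M N\<^esub> = (\<zero>\<^bsub>M\<^esub>, \<zero>\<^bsub>N\<^esub>)"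
  "(x, y) \<oplus>\<^bsub>direct_sum2 M N\<^esub> (x', y') = (x \<oplus>\<^bsub>M\<^esub> x', y \<oplus>\<^bsub>N\<^esub> y')"
  "a \<odot>\<^bsub>direct_sum2 M N\<^esub> (x, y) = (a \<odot>\<^bsub>M\<^esub> x, a \<odot>\<^bsub>N\<^esub> y)"
  by (simp_all add: direct_sum2_def)

lemma lm_ds2 [simp]: "\<lbrakk>lm M; lm N\<rbrakk> \<Longrightarrow> lm (direct_sum2 M N)"
proof (rule lmI, goal_cases)
  case (6 x)
  then show ?case
    by (intro bexI[of _ "(\<ominus>\<^bsub>M\<^esub> fst x, \<ominus>\<^bsub>N\<^esub> snd x)"]) auto
qed (auto simp: m_smult_l_distr m_smult_r_distr m_smult_assoc m_ac)

lemma ds2_fst [simp]: "fst \<in> Hom (direct_sum2 M N) M"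
  by (rule homI) auto

lemma ds2_snd [simp]: "snd \<in> Hom (direct_sum2 M N) N"
  by (rule homI) auto

lemma ds2_inl [simp]: "lm N \<Longrightarrow> (\<lambda>x. (x, \<zero>\<^bsub>N\<^esub>)) \<in> Hom M (direct_sum2 M N)"
  by (rule homI) auto

lemma ds2_inr [simp]: "lm M \<Longrightarrow> (\<lambda>x. (\<zero>\<^bsub>M\<^esub>, x)) \<in> Hom N (direct_sum2 M N)"
  by (rule homI) auto

lemma ds2_pair: "\<lbrakk>f \<in> Hom L M; g \<in> Hom L N\<rbrakk> \<Longrightarrow> (\<lambda>x. (f x, g x)) \<in> Hom L (direct_sum2 M N)"
  by (rule homI) auto

lemma ds2_copair:
  assumes f: "f \<in> Hom M L" and g: "g \<in> Hom N L" and L: "lm L"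
  shows "(\<lambda>z. f (fst z) \<oplus>\<^bsub>L\<^esub> g (snd z)) \<in> Hom (direct_sum2 M N) L"
  by (rule hom_plus[OF hom_comp[OF ds2_fst f] hom_comp[OF ds2_snd g] L])

lemma ds2_map: "\<lbrakk>f \<in> Hom M M'; g \<in> Hom N N'\<rbrakk> \<Longrightarrow>
  (\<lambda>z. (f (fst z), g (snd z))) \<in> Hom (direct_sum2 M N) (direct_sum2 M' N')"
  by (intro ds2_pair hom_comp[OF ds2_fst] hom_comp[OF ds2_snd])

lemma ses_ds2: "\<lbrakk>lm M; lm N\<rbrakk> \<Longrightarrow> ses M (\<lambda>x. (x, \<zero>\<^bsub>N\<^esub>)) (direct_sum2 M N) snd N"
  by (rule sesI, rule injI_mono, simp, rule inj_onI, simp, rule epiI, simp)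
     (auto intro: bexI[of _ "(\<zero>\<^bsub>M\<^esub>, _)"] m_zero_closed)

lemma fg_ds2 [simp]: "\<lbrakk>fg M; fg N\<rbrakk> \<Longrightarrow> fg (direct_sum2 M N)"
  using fg_extension[of M N "direct_sum2 M N" "\<lambda>x. (x, \<zero>\<^bsub>N\<^esub>)" snd] ses_ds2[of M N]
    ses_ker[of M _ "direct_sum2 M N" snd N] ses_epi[of M _ "direct_sum2 M N" snd N] by simp

lemma retract_ds2_left: "lm N \<Longrightarrow> retract M (direct_sum2 M N)"
  by (rule retractI[of "\<lambda>x. (x, \<zero>\<^bsub>N\<^esub>)" _ _ fst]) simp_all

lemma retract_ds2_right: "lm M \<Longrightarrow> retract N (direct_sum2 M N)"
  by (rule retractI[of "\<lambda>x. (\<zero>\<^bsub>M\<^esub>, x)" _ _ snd]) simp_all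

lemma retract_ds2: "\<lbrakk>retract M M'; retract N N'\<rbrakk> \<Longrightarrow> retract (direct_sum2 M N) (direct_sum2 M' N')"
proof -
  assume "retract M M'" "retract N N'"
  then obtain i p j q where *: "i \<in> Hom M M'" "p \<in> Hom M' M" "\<forall>x\<in>carrier M. p (i x) = x"
    "j \<in> Hom N N'" "q \<in> Hom N' N" "\<forall>x\<in>carrier N. q (j x) = x"
    by (metis retractE)
  show ?thesis
    by (rule retractI[OF ds2_map[OF *(1,4)] ds2_map[OF *(2,5)]]) (use * in auto)
qed

lemma mono_ds2:
  assumes "f \<in> Monic M M'" "g \<in> Monic N N'"
  shows "(\<lambda>z. (f (fst z), g (snd z))) \<in> Monic (direct_sum2 M N) (direct_sum2 M' N')"
  by (rule injI_mono[OF ds2_map]) (use assms in \<open>auto intro!: inj_onI simp: mono_eq\<close>)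

lemma epi_ds2:
  assumes f: "f \<in> Epic M M'" and g: "g \<in> Epic N N'"
  shows "(\<lambda>z. (f (fst z), g (snd z))) \<in> Epic (direct_sum2 M N) (direct_sum2 M' N')"
proof (rule epiI[OF ds2_map])
  fix y assume "y \<in> carrier (direct_sum2 M' N')"
  then obtain u v where y: "y = (u, v)" "u \<in> carrier M'" "v \<in> carrier N'" by auto
  obtain a b where "a \<in> carrier M" "f a = u" "b \<in> carrier N" "g b = v"
    using epi_ex[OF f y(2)] epi_ex[OF g y(3)] by blast
  then show "\<exists>x\<in>carrier (direct_sum2 M N). (f (fst x), g (snd x)) = y"
    by (intro bexI[of _ "(a, b)"]) (simp_all add: y)
qed (use assms in simp_all)

lemma ses_ds2_map:
  assumes s: "ses L f M g N" and s': "ses L' f' M' g' N'"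
  shows "ses (direct_sum2 L L') (\<lambda>z. (f (fst z), f' (snd z))) (direct_sum2 M M')
    (\<lambda>z. (g (fst z), g' (snd z))) (direct_sum2 N N')"
proof (rule sesI[OF mono_ds2[OF ses_mono[OF s] ses_mono[OF s']] epi_ds2[OF ses_epi[OF s] ses_epi[OF s']]], goal_cases)
  case (1 x)
  then show ?case using ses_comp[OF s] ses_comp[OF s'] by auto
next
  case (2 y)
  then obtain u v where y: "y = (u, v)" "u \<in> carrier M" "v \<in> carrier M'" "g u = \<zero>\<^bsub>N\<^esub>" "g' v = \<zero>\<^bsub>N'\<^esub>"
    by auto
  obtain a b where "a \<in> carrier L" "u = f a" "b \<in> carrier L'" "v = f' b"
    using ses_exact[OF s y(2,4)] ses_exact[OF s' y(3,5)] by blast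
  then show ?case by (intro image_eqI[of _ _ "(a, b)"]) (simp_all add: y(1))
qed

lemma proj_ds2:
  assumes P: "proj P" and Q: "proj Q"
  shows "proj (direct_sum2 P Q)"
proof (rule projI)
  have lm: "lm P" "lm Q" using proj_fg[OF P] proj_fg[OF Q] by simp_all
  show "fg (direct_sum2 P Q)" using proj_fg[OF P] proj_fg[OF Q] by simp
  fix M N :: "'a umod" and g h
  assume *: "fg M" "fg N" "g \<in> Epic M N" "h \<in> Hom (direct_sum2 P Q) N"
  obtain k where k: "k \<in> Hom P M" "\<forall>x\<in>carrier P. g (k x) = h (x, \<zero>\<^bsub>Q\<^esub>)"
    using proj_lift[OF P *(1-3) hom_comp[OF ds2_inl *(4)]] lm by blast
  obtain l where l: "l \<in> Hom Q M" "\<forall>x\<in>carrier Q. g (l x) = h (\<zero>\<^bsub>P\<^esub>, x)"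
    using proj_lift[OF Q *(1-3) hom_comp[OF ds2_inr *(4)]] lm by blast
  have "g (k (fst z) \<oplus>\<^bsub>M\<^esub> l (snd z)) = h z" if z0: "z \<in> carrier (direct_sum2 P Q)" for z
  proof -
    obtain x y where z: "z = (x, y)" "x \<in> carrier P" "y \<in> carrier Q" using z0 by auto
    have "g (k x \<oplus>\<^bsub>M\<^esub> l y) = h (x, \<zero>\<^bsub>Q\<^esub>) \<oplus>\<^bsub>N\<^esub> h (\<zero>\<^bsub>P\<^esub>, y)"
      using k l z hom_add[OF epi_hom[OF *(3)] hom_closed[OF k(1) z(2)] hom_closed[OF l(1) z(3)]] by simp
    also have "\<dots> = h ((x, \<zero>\<^bsub>Q\<^esub>) \<oplus>\<^bsub>direct_sum2 P Q\<^esub> (\<zero>\<^bsub>P\<^esub>, y))"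
      by (rule hom_add[OF *(4), symmetric]) (use z lm in auto)
    finally show ?thesis using z lm by simp
  qed
  then show "\<exists>k\<in>Hom (direct_sum2 P Q) M. \<forall>x\<in>carrier (direct_sum2 P Q). g (k x) = h x"
    using ds2_copair[OF k(1) l(1)] *(1) by (intro bexI[of _ "\<lambda>z. k (fst z) \<oplus>\<^bsub>M\<^esub> l (snd z)"]) simp_all
qed

lemma inje_ds2:
  assumes P: "inje P" and Q: "inje Q"
  shows "inje (direct_sum2 P Q)"
proof (rule injeI)
  show "fg (direct_sum2 P Q)" using inje_fg[OF P] inje_fg[OF Q] by simp
  fix M N :: "'a umod" and g h
  assume *: "fg M" "fg N" "g \<in> Monic M N" "h \<in> Hom M (direct_sum2 P Q)"
  obtain k where k: "k \<in> Hom N P" "\<forall>x\<in>carrier M. k (g x) = fst (h x)"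
    using inje_extend[OF P *(1-3) hom_comp[OF *(4) ds2_fst]] by blast
  obtain l where l: "l \<in> Hom N Q" "\<forall>x\<in>carrier M. l (g x) = snd (h x)"
    using inje_extend[OF Q *(1-3) hom_comp[OF *(4) ds2_snd]] by blast
  show "\<exists>k\<in>Hom N (direct_sum2 P Q). \<forall>x\<in>carrier M. k (g x) = h x"
    by (rule bexI[OF _ ds2_pair[OF k(1) l(1)]]) (use k(2) l(2) in simp)
qed


subsection \<open>Finite direct sums\<close>

lemma ds_simps:
  "carrier (direct_sum n X) = (\<Pi>\<^sub>E i\<in>{..<n}. carrier (X i))"
  "\<zero>\<^bsub>direct_sum n X\<^esub> = (\<lambda>i\<in>{..<n}. \<zero>\<^bsub>X i\<^esub>)"
  "u \<oplus>\<^bsub>direct_sum n X\<^esub> v = (\<lambda>i\<in>{..<n}. u i \<oplus>\<^bsub>X i\<^esub> v i)"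
  "a \<odot>\<^bsub>direct_sum n X\<^esub> u = (\<lambda>i\<in>{..<n}. a \<odot>\<^bsub>X i\<^esub> u i)"
  by (simp_all add: direct_sum_def)

lemma ds_carrier: "u \<in> carrier (direct_sum n X) \<longleftrightarrow>
    u \<in> extensional {..<n} \<and> (\<forall>i<n. u i \<in> carrier (X i))"
  by (auto simp: ds_simps PiE_def)

lemma ds_component: "\<lbrakk>u \<in> carrier (direct_sum n X); i < n\<rbrakk> \<Longrightarrow> u i \<in> carrier (X i)"
  by (simp add: ds_carrier)

lemma ds_eqI:
  assumes "u \<in> carrier (direct_sum n X)" "v \<in> carrier (direct_sum n X)" "\<And>i. i < n \<Longrightarrow> u i = v i"
  shows "u = v"
  by (rule extensionalityI[of _ "{..<n}"]) (use assms in \<open>auto simp: ds_carrier\<close>)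

lemma ds_restrict_closed:
  "(\<And>i. i < n \<Longrightarrow> f i \<in> carrier (X i)) \<Longrightarrow> (\<lambda>i\<in>{..<n}. f i) \<in> carrier (direct_sum n X)"
  by (simp add: ds_carrier)

lemma lm_ds:
  assumes X: "\<And>i. i < n \<Longrightarrow> lm (X i)"
  shows "lm (direct_sum n X)"
proof (rule lmI, goal_cases)
  case (6 u)
  have "(\<lambda>i\<in>{..<n}. \<ominus>\<^bsub>X i\<^esub> u i) \<in> carrier (direct_sum n X)"
    by (rule ds_restrict_closed) (use m_neg_closed[OF X ds_component[OF 6]] in simp)
  moreover have "(\<lambda>i\<in>{..<n}. \<ominus>\<^bsub>X i\<^esub> u i) \<oplus>\<^bsub>direct_sum n X\<^esub> u = \<zero>\<^bsub>direct_sum n X\<^esub>"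
    unfolding ds_simps(2,3) by (rule restrict_ext) (use X ds_component[OF 6] in simp)
  ultimately show ?case by blast
next
  case (5 u)
  then show ?case
    unfolding ds_simps(2,3)
    by (intro extensionalityI[of _ "{..<n}"]) (auto simp: ds_carrier X)
next
  case (11 u)
  then show ?case
    unfolding ds_simps(4)
    by (intro extensionalityI[of _ "{..<n}"]) (auto simp: ds_carrier X)
next
  case (3 u v w)
  then show ?case
    unfolding ds_simps(3) by (intro restrict_ext) (simp add: ds_carrier X m_assoc)
next
  case (4 u v)
  then show ?case
    unfolding ds_simps(3) by (intro restrict_ext) (simp add: ds_carrier X m_comm)
next
  case (8 a b u)
  then show ?case
    unfolding ds_simps(3,4) by (intro restrict_ext) (simp add: ds_carrier X m_smult_l_distr)
next
  case (9 a u v)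
  then show ?case
    unfolding ds_simps(3,4) by (intro restrict_ext) (simp add: ds_carrier X m_smult_r_distr)
next
  case (10 a b u)
  then show ?case
    unfolding ds_simps(4) by (intro restrict_ext) (simp add: ds_carrier X m_smult_assoc)
qed (simp_all add: ds_carrier ds_simps(2-4) X)

lemma ds_proj_hom: "i < n \<Longrightarrow> (\<lambda>u. u i) \<in> Hom (direct_sum n X) (X i)"
  by (rule homI) (simp_all add: ds_carrier ds_simps(3,4))

lemma ds_tuple:
  assumes "\<And>i. i < n \<Longrightarrow> f i \<in> Hom M (X i)"
  shows "(\<lambda>m. \<lambda>i\<in>{..<n}. f i m) \<in> Hom M (direct_sum n X)"
proof (rule homI)
  show "(\<lambda>i\<in>{..<n}. f i x) \<in> carrier (direct_sum n X)" if "x \<in> carrier M" for x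
    by (rule ds_restrict_closed) (rule hom_closed[OF assms that])
qed (auto simp: ds_simps(3,4) intro!: restrict_ext hom_add[OF assms] hom_smult[OF assms])

lemma ds_map:
  assumes "\<And>i. i < n \<Longrightarrow> f i \<in> Hom (X i) (Y i)"
  shows "(\<lambda>u. \<lambda>i\<in>{..<n}. f i (u i)) \<in> Hom (direct_sum n X) (direct_sum n Y)"
  by (rule ds_tuple) (rule hom_comp[OF ds_proj_hom assms])

lemma ds_map_mono:
  assumes "\<And>i. i < n \<Longrightarrow> f i \<in> Monic (X i) (Y i)"
  shows "(\<lambda>u. \<lambda>i\<in>{..<n}. f i (u i)) \<in> Monic (direct_sum n X) (direct_sum n Y)"
proof (rule injI_mono[OF ds_map])
  show "f i \<in> Hom (X i) (Y i)" if "i < n" for i using assms[OF that] by simp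
  show "inj_on (\<lambda>u. \<lambda>i\<in>{..<n}. f i (u i)) (carrier (direct_sum n X))"
  proof (rule inj_onI)
    fix u v assume uv: "u \<in> carrier (direct_sum n X)" "v \<in> carrier (direct_sum n X)"
      "(\<lambda>i\<in>{..<n}. f i (u i)) = (\<lambda>i\<in>{..<n}. f i (v i))"
    show "u = v"
    proof (rule ds_eqI[OF uv(1,2)])
      fix i assume i: "i < n"
      have "f i (u i) = f i (v i)" using fun_cong[OF uv(3), of i] i by simp
      then show "u i = v i"
        using mono_eq[OF assms[OF i] ds_component[OF uv(1) i] ds_component[OF uv(2) i]] by blast
    qed
  qed
qed

lemma ds_map_epi:
  assumes f: "\<And>i. i < n \<Longrightarrow> f i \<in> Epic (X i) (Y i)"
  shows "(\<lambda>u. \<lambda>i\<in>{..<n}. f i (u i)) \<in> Epic (direct_sum n X) (direct_sum n Y)"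
proof (rule epiI[OF ds_map])
  show "f i \<in> Hom (X i) (Y i)" if "i < n" for i using f[OF that] by simp
  fix v assume v: "v \<in> carrier (direct_sum n Y)"
  have "\<exists>x. x \<in> carrier (X i) \<and> f i x = v i" if "i < n" for i
    using epi_ex[OF f[OF that] ds_component[OF v that]] by blast
  then obtain u where u: "\<And>i. i < n \<Longrightarrow> u i \<in> carrier (X i) \<and> f i (u i) = v i"
    by metis
  show "\<exists>u\<in>carrier (direct_sum n X). (\<lambda>i\<in>{..<n}. f i (u i)) = v"
  proof (rule bexI[of _ "\<lambda>i\<in>{..<n}. u i"])
    show "(\<lambda>i\<in>{..<n}. u i) \<in> carrier (direct_sum n X)"
      by (rule ds_restrict_closed) (use u in blast)
    show "(\<lambda>i\<in>{..<n}. f i ((\<lambda>i\<in>{..<n}. u i) i)) = v"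
      by (rule extensionalityI[of _ "{..<n}"]) (use v u in \<open>auto simp: ds_carrier\<close>)
  qed
qed

lemma ds_append_iso:
  assumes X: "\<And>i. i < n \<Longrightarrow> lm (X i)" and Y: "\<And>i. i < m \<Longrightarrow> lm (Y i)"
  shows "isomorphic_modules A (direct_sum2 (direct_sum n X) (direct_sum m Y))
    (direct_sum (n + m) (\<lambda>i. if i < n then X i else Y (i - n)))"
    (is "isomorphic_modules A ?L ?R")
proof -
  define h where "h z = (\<lambda>i\<in>{..<n + m}. if i < n then fst z i else snd z (i - n))"
    for z :: "(nat \<Rightarrow> 'b) \<times> (nat \<Rightarrow> 'b)"
  have hom: "h \<in> Hom ?L ?R"
    unfolding h_def
  proof (rule ds_tuple)
    fix i assume i: "i < n + m"
    show "(\<lambda>z. if i < n then fst z i else snd z (i - n)) \<in> Hom ?L (if i < n then X i else Y (i - n))"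
      using hom_comp[OF ds2_fst ds_proj_hom, of i n X "direct_sum m Y"]
        hom_comp[OF ds2_snd ds_proj_hom, of "i - n" m "direct_sum n X" Y] i by (cases "i < n") simp_all
  qed
  have "h \<in> Monic ?L ?R"
  proof (rule injI_mono[OF hom], rule inj_onI)
    fix z w assume zw: "z \<in> carrier ?L" "w \<in> carrier ?L" "h z = h w"
    have e: "h z i = h w i" for i using zw by simp
    have "fst z i = fst w i" if "i < n" for i
      using e[of i] that by (simp add: h_def)
    then have "fst z = fst w"
      by (intro ds_eqI[of _ n X]) (use zw(1,2) in auto)
    moreover have "snd z i = snd w i" if "i < m" for i
      using e[of "n + i"] that by (simp add: h_def)
    then have "snd z = snd w"
      by (intro ds_eqI[of _ m Y]) (use zw(1,2) in auto)
    ultimately show "z = w" by (simp add: prod_eq_iff)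
  qed
  moreover have "h \<in> Epic ?L ?R"
  proof (rule epiI[OF hom])
    fix u assume u: "u \<in> carrier ?R"
    have ui: "u i \<in> carrier (X i)" if "i < n" for i
      using ds_component[OF u, of i] that by simp
    have uj: "u (n + i) \<in> carrier (Y i)" if "i < m" for i
      using ds_component[OF u, of "n + i"] that by simp
    show "\<exists>z\<in>carrier ?L. h z = u"
    proof (rule bexI[of _ "(\<lambda>i\<in>{..<n}. u i, \<lambda>i\<in>{..<m}. u (n + i))"])
      show "(\<lambda>i\<in>{..<n}. u i, \<lambda>i\<in>{..<m}. u (n + i)) \<in> carrier ?L"
        by (simp add: ui uj ds_restrict_closed)
      show "h (\<lambda>i\<in>{..<n}. u i, \<lambda>i\<in>{..<m}. u (n + i)) = u"
        by (rule extensionalityI[of _ "{..<n + m}"]) (use u in \<open>auto simp: h_def ds_carrier\<close>)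
    qed
  qed
  ultimately show ?thesis unfolding isomorphic_modules_def using mono_epi_iso by blast
qed

lemma ds_one_iso:
  assumes "lm (X 0)"
  shows "isomorphic_modules A (X 0) (direct_sum 1 X)"
proof -
  have "(\<lambda>x. \<lambda>i\<in>{..<1}. x) \<in> Iso (X 0) (direct_sum 1 X)"
  proof (rule mono_epi_iso)
    have h: "(\<lambda>x. \<lambda>i\<in>{..<1}. x) \<in> Hom (X 0) (direct_sum 1 X)"
      by (rule ds_tuple) simp
    show "(\<lambda>x. \<lambda>i\<in>{..<1}. x) \<in> Monic (X 0) (direct_sum 1 X)"
      by (rule injI_mono[OF h]) (auto intro!: inj_onI dest: fun_cong[of _ _ 0])
    show "(\<lambda>x. \<lambda>i\<in>{..<1}. x) \<in> Epic (X 0) (direct_sum 1 X)"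
    proof (rule epiI[OF h])
      fix u assume u: "u \<in> carrier (direct_sum 1 X)"
      show "\<exists>x\<in>carrier (X 0). (\<lambda>i\<in>{..<1}. x) = u"
        by (rule bexI[of _ "u 0"], rule extensionalityI[of _ "{..<1}"]) (use u in \<open>auto simp: ds_carrier\<close>)
    qed
  qed
  then show ?thesis unfolding isomorphic_modules_def by blast
qed

lemma ds2_map_iso:
  assumes "isomorphic_modules A M M'" "isomorphic_modules A N N'"
  shows "isomorphic_modules A (direct_sum2 M N) (direct_sum2 M' N')"
proof -
  obtain f g where "f \<in> Iso M M'" "g \<in> Iso N N'"
    using assms unfolding isomorphic_modules_def by blast
  then have "(\<lambda>z. (f (fst z), g (snd z))) \<in> Iso (direct_sum2 M N) (direct_sum2 M' N')"
    by (intro mono_epi_iso mono_ds2 epi_ds2) simp_all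
  then show ?thesis unfolding isomorphic_modules_def by blast
qed

lemma ds_cong: "(\<And>i. i < n \<Longrightarrow> X i = Y i) \<Longrightarrow> direct_sum n X = direct_sum n Y"
proof -
  assume e: "\<And>i. i < n \<Longrightarrow> X i = Y i"
  have "(\<Pi>\<^sub>E i\<in>{..<n}. carrier (X i)) = (\<Pi>\<^sub>E i\<in>{..<n}. carrier (Y i))"
    by (rule PiE_cong) (simp add: e)
  moreover have "(\<lambda>i\<in>{..<n}. F (X i) i) = (\<lambda>i\<in>{..<n}. F (Y i) i)" for F
    by (rule restrict_ext) (simp add: e)
  ultimately show ?thesis
    unfolding direct_sum_def
    by (intro module.equality) (simp_all add: fun_eq_iff restrict_def e)
qed

lemma ds_Suc_iso:
  assumes X: "\<And>i. i \<le> n \<Longrightarrow> lm (X i)"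
  shows "isomorphic_modules A (direct_sum2 (direct_sum n X) (X n)) (direct_sum (Suc n) X)"
proof -
  have "isomorphic_modules A (direct_sum2 (direct_sum n X) (X n))
      (direct_sum2 (direct_sum n X) (direct_sum 1 (\<lambda>_. X n)))"
    by (rule ds2_map_iso[OF isomorphic_refl ds_one_iso]) (simp add: X)
  also have "isomorphic_modules A \<dots> (direct_sum (n + 1) (\<lambda>i. if i < n then X i else X n))"
    by (rule ds_append_iso) (simp_all add: X)
  also (isomorphic_trans) have "direct_sum (n + 1) (\<lambda>i. if i < n then X i else X n) = direct_sum (Suc n) X"
    by simp (rule ds_cong, auto simp: less_Suc_eq)
  finally show ?thesis .
qed

lemma zero_module_proj: "\<lbrakk>fg M; zero_module M\<rbrakk> \<Longrightarrow> proj M"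
proof (rule projI)
  fix K N :: "'a umod" and g h
  assume *: "fg M" "zero_module M" "fg K" "fg N" "g \<in> Epic K N" "h \<in> Hom M N"
  then have lm: "lm M" "lm K" "lm N" by simp_all
  show "\<exists>k\<in>Hom M K. \<forall>x\<in>carrier M. g (k x) = h x"
    by (rule bexI[OF _ hom_const_zero[OF lm(2)]])
       (use *(2) hom_zero[OF *(6) lm(1,3)] hom_zero[OF epi_hom[OF *(5)] lm(2,3)] in \<open>simp add: zero_module_def\<close>)
qed

lemma zero_module_inje: "\<lbrakk>fg M; zero_module M\<rbrakk> \<Longrightarrow> inje M"
proof (rule injeI)
  fix K N :: "'a umod" and g h
  assume *: "fg M" "zero_module M" "fg K" "fg N" "g \<in> Monic K N" "h \<in> Hom K M"
  then have lm: "lm M" by simp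
  show "\<exists>k\<in>Hom N M. \<forall>x\<in>carrier K. k (g x) = h x"
    by (rule bexI[OF _ hom_const_zero[OF lm]])
       (use *(2) hom_closed[OF *(6)] in \<open>simp add: zero_module_def\<close>)
qed

lemma zero_module_fg: "\<lbrakk>lm M; zero_module M\<rbrakk> \<Longrightarrow> fg M"
  unfolding fg_iff_generators zero_module_def
  by (intro conjI exI[of _ "{}"]) (auto dest: sub_zero sub_subset)

lemma zero_ds: "zero_module (direct_sum 0 X)"
  by (auto simp: zero_module_def ds_simps)

lemma lm_ds0: "lm (direct_sum 0 X)"
  by (rule lm_ds) simp

text \<open>\<open>P\<close> speaks of a single carrier type, which the binary sum of
  \<open>direct_sum k X\<close> and \<open>X k\<close> does not have. The step therefore passes
  through a module \<open>M\<close> isomorphic to that sum, and every use needs invariance of the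
  property under isomorphism.\<close>

lemma ds_induct:
  assumes X: "\<And>i. i < n \<Longrightarrow> lm (X i)"
    and zero: "\<And>M :: ('a, nat \<Rightarrow> 'm) module. \<lbrakk>lm M; zero_module M\<rbrakk> \<Longrightarrow> P M"
    and step: "\<And>k M. \<lbrakk>k < n; P (direct_sum k X); lm M;
      isomorphic_modules A (direct_sum2 (direct_sum k X) (X k)) M\<rbrakk> \<Longrightarrow> P M"
  shows "P (direct_sum n X)"
proof -
  have "P (direct_sum k X)" if "k \<le> n" for k
    using that
  proof (induction k)
    case 0
    show ?case by (rule zero[OF lm_ds0 zero_ds])
  next
    case (Suc k)
    show ?case
    proof (rule step)
      show "isomorphic_modules A (direct_sum2 (direct_sum k X) (X k)) (direct_sum (Suc k) X)"
        by (rule ds_Suc_iso) (use X Suc in simp)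
      show "lm (direct_sum (Suc k) X)" by (rule lm_ds) (use X Suc in simp)
    qed (use Suc in simp_all)
  qed
  then show ?thesis by simp
qed

lemma fg_ds:
  assumes X: "\<And>i. i < n \<Longrightarrow> fg (X i)"
  shows "fg (direct_sum n X)"
  by (rule ds_induct) (use X fg_iso[OF fg_ds2] zero_module_fg in auto)

lemma proj_ds:
  assumes X: "\<And>i. i < n \<Longrightarrow> proj (X i)"
  shows "proj (direct_sum n X)"
proof (rule ds_induct)
  fix k M assume *: "k < n" "proj (direct_sum k X)" "lm M" "isomorphic_modules A (direct_sum2 (direct_sum k X) (X k)) M"
  have P: "proj (direct_sum2 (direct_sum k X) (X k))" using proj_ds2[OF *(2) X[OF *(1)]] .
  show "proj M"
    by (rule retract_proj[OF retract_iso(2)[OF *(4) fg_lm[OF proj_fg[OF P]] *(3)] P *(3)])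
qed (use fg_lm[OF proj_fg[OF X]] zero_module_proj zero_module_fg in auto)

lemma inje_ds:
  assumes X: "\<And>i. i < n \<Longrightarrow> inje (X i)"
  shows "inje (direct_sum n X)"
proof (rule ds_induct)
  fix k M assume *: "k < n" "inje (direct_sum k X)" "lm M" "isomorphic_modules A (direct_sum2 (direct_sum k X) (X k)) M"
  have P: "inje (direct_sum2 (direct_sum k X) (X k))" using inje_ds2[OF *(2) X[OF *(1)]] .
  show "inje M"
    by (rule retract_inje[OF retract_iso(2)[OF *(4) fg_lm[OF inje_fg[OF P]] *(3)] P *(3)])
qed (use fg_lm[OF inje_fg[OF X]] zero_module_inje zero_module_fg in auto)

text \<open>Each further generator \<open>s\<close> is reached by adjoining one copy of the regular
  module, mapped by \<open>a |-> a s\<close>. The induction only puts \<open>S\<close> into the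
  image; the image is then a submodule containing the generators.\<close>

lemma free_cover:
  fixes M :: "('a, 'm) module"
  assumes M: "fg M"
  obtains m f where "f \<in> Epic (power_module (regular_module A) m) M"
proof -
  obtain S where S: "finite S" "S \<subseteq> carrier M" "\<And>H. sub H M \<Longrightarrow> S \<subseteq> H \<Longrightarrow> H = carrier M"
    using M by (auto simp: fg_iff_generators)
  have lmM: "lm M" using M by simp
  have lmF: "lm (power_module (regular_module A) m)" for m by (rule lm_ds) simp
  have "\<exists>m. \<exists>f\<in>Hom (power_module (regular_module A) m) M. S \<subseteq> f ` carrier (power_module (regular_module A) m)"
    using S(1,2)
  proof (induction S)
    case empty
    then show ?case using hom_const_zero[OF lmM] by blast
  next
    case (insert s S)
    then obtain m f where f: "f \<in> Hom (power_module (regular_module A) m) M"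
      "S \<subseteq> f ` carrier (power_module (regular_module A) m)" by auto
    let ?D = "direct_sum2 (power_module (regular_module A) m) (regular_module A)"
    have s: "s \<in> carrier M" using insert by simp
    define g where "g z = f (fst z) \<oplus>\<^bsub>M\<^esub> snd z \<odot>\<^bsub>M\<^esub> s" for z
    have g: "g \<in> Hom ?D M"
      unfolding g_def by (rule ds2_copair[OF f(1) hom_from_regular[OF lmM s] lmM])
    obtain h where h: "h \<in> Iso ?D (power_module (regular_module A) (Suc m))"
      using ds_Suc_iso[of m "\<lambda>_. regular_module A"] unfolding isomorphic_modules_def by auto
    obtain k where k: "k \<in> Iso (power_module (regular_module A) (Suc m)) ?D"
      "\<forall>x\<in>carrier ?D. k (h x) = x"
      using iso_inverse[OF h lm_ds2[OF lmF lm_regular] lmF] by blast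
    have im: "g z \<in> (\<lambda>x. g (k x)) ` carrier (power_module (regular_module A) (Suc m))"
      if z: "z \<in> carrier ?D" for z
      using hom_closed[OF iso_hom[OF h] z] bspec[OF k(2) z] by (metis image_eqI)
    have "t \<in> (\<lambda>x. g (k x)) ` carrier (power_module (regular_module A) (Suc m))"
      if t: "t \<in> insert s S" for t
    proof (cases "t = s")
      case True
      have "g (\<zero>\<^bsub>power_module (regular_module A) m\<^esub>, \<one>) = s"
        unfolding g_def using f(1) lmM lmF s by simp
      then show ?thesis
        using im[of "(\<zero>\<^bsub>power_module (regular_module A) m\<^esub>, \<one>)"] lmF True by simp
    next
      case False
      then obtain x where x: "x \<in> carrier (power_module (regular_module A) m)" "t = f x"
        using f(2) t by blast
      have "g (x, \<zero>) = t" unfolding g_def using x f(1) lmM s by simp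
      then show ?thesis using im[of "(x, \<zero>)"] x by simp
    qed
    then show ?case
      using hom_comp[OF iso_hom[OF k(1)] g] by (intro exI[of _ "Suc m"] bexI[of _ "\<lambda>x. g (k x)"]) blast+
  qed
  then obtain m f where f: "f \<in> Hom (power_module (regular_module A) m) M"
    "S \<subseteq> f ` carrier (power_module (regular_module A) m)" by blast
  have "f ` carrier (power_module (regular_module A) m) = carrier M"
    by (rule S(3)[OF sub_range[OF f(1) lmF lmM] f(2)])
  then show ?thesis using that imageI_epi[OF f(1)] by blast
qed

lemma proj_free: "proj (power_module (regular_module A) m)"
  by (rule proj_ds) simp


subsection \<open>Additive closures\<close>

text \<open>Membership in add T for modules of any carrier type. Over a noetherian ring and for
  finitely generated \<open>T\<close> it agrees with \<open>add_closure\<close> on the universe, see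
  \<open>in_add_iff_add_closure\<close>.\<close>

definition in_add :: "('a, 'm) module \<Rightarrow> ('a, 'n) module \<Rightarrow> bool" where
  "in_add T X \<longleftrightarrow> (\<exists>n. retract X (power_module T n))"

lemma in_add_self: "lm T \<Longrightarrow> in_add T T"
  unfolding in_add_def using retract_iso(1)[OF ds_one_iso[of "\<lambda>_. T"]] lm_ds[of 1 "\<lambda>_. T"] by blast

lemma in_add_retract: "\<lbrakk>retract X Y; in_add T Y\<rbrakk> \<Longrightarrow> in_add T X"
  unfolding in_add_def using retract_trans by blast

lemma in_add_ds2:
  assumes T: "lm T" and "in_add T X" "in_add T Y"
  shows "in_add T (direct_sum2 X Y)"
proof -
  obtain n m where "retract X (power_module T n)" "retract Y (power_module T m)"
    using assms unfolding in_add_def by blast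
  then have "retract (direct_sum2 X Y) (direct_sum2 (power_module T n) (power_module T m))"
    by (rule retract_ds2)
  also have "retract (direct_sum2 (power_module T n) (power_module T m)) (power_module T (n + m))"
    using retract_iso(1)[OF ds_append_iso[of n "\<lambda>_. T" m "\<lambda>_. T"]] T by (simp add: lm_ds)
  finally (retract_trans) show ?thesis unfolding in_add_def by blast
qed

lemma in_add_ds:
  assumes T: "lm T" and X: "\<And>i. i < n \<Longrightarrow> in_add T (X i)" "\<And>i. i < n \<Longrightarrow> lm (X i)"
  shows "in_add T (direct_sum n X)"
proof (rule ds_induct[OF X(2)])
  fix M :: "('a, nat \<Rightarrow> 'c) module" assume M: "lm M" "zero_module M"
  have "retract M (power_module T 0)"
    by (rule retractI[OF hom_const_zero[OF lm_ds0] hom_const_zero[OF M(1)]])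
       (use M in \<open>simp add: zero_module_def\<close>)
  then show "in_add T M" unfolding in_add_def by blast
next
  fix k and M :: "('a, nat \<Rightarrow> 'c) module"
  assume *: "k < n" "in_add T (direct_sum k X)" "lm M" "isomorphic_modules A (direct_sum2 (direct_sum k X) (X k)) M"
  have "lm (direct_sum2 (direct_sum k X) (X k))" using * X(2) by (simp add: lm_ds)
  from in_add_retract[OF retract_iso(2)[OF *(4) this *(3)] in_add_ds2[OF T *(2) X(1)[OF *(1)]]]
  show "in_add T M" .
qed



subsection \<open>Vanishing of the first extension group\<close>

text \<open>Vanishing of the first extension group, expressed as splitting of all extensions; for
  finitely generated modules \<open>Ext1_singleton_iff\<close> identifies it with triviality of
  \<open>Ext1\<close>.\<close>

definition ext_van :: "('a, 'm) module \<Rightarrow> ('a, 'n) module \<Rightarrow> bool" where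
  "ext_van M N \<longleftrightarrow> (\<forall>(E :: 'a umod) f g. fg E \<longrightarrow> ses N f E g M \<longrightarrow>
     (\<exists>s\<in>Hom M E. \<forall>x\<in>carrier M. g (s x) = x))"

lemma ext_van_section:
  assumes van: "ext_van M N" and E: "fg E" and s: "ses N f E g M"
  shows "\<exists>s\<in>Hom M E. \<forall>x\<in>carrier M. g (s x) = x"
proof -
  obtain E' :: "'a umod" and h k where h: "fg E'" "h \<in> Iso E E'" "k \<in> Iso E' E"
    "\<forall>x\<in>carrier E. k (h x) = x" "\<forall>y\<in>carrier E'. h (k y) = y"
    using umod_ex[OF E] .
  have "ses N (\<lambda>x. h (f x)) E' (\<lambda>y. g (k y)) M"
    by (rule ses_iso_middle[OF s h(2,3)]) (use h(4,5) in simp_all)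
  then obtain t where t: "t \<in> Hom M E'" "\<forall>x\<in>carrier M. g (k (t x)) = x"
    using van h(1) unfolding ext_van_def by blast
  show ?thesis
    by (rule bexI[OF _ hom_comp[OF t(1) iso_hom[OF h(3)]]]) (rule t(2))
qed

lemma ext_van_retraction:
  assumes van: "ext_van M N" and E: "fg E" and s: "ses N f E g M" and lm: "lm M" "lm N"
  shows "\<exists>r\<in>Hom E N. \<forall>x\<in>carrier N. r (f x) = x"
proof -
  obtain t where "t \<in> Hom M E" "\<forall>x\<in>carrier M. g (t x) = x"
    using ext_van_section[OF van E s] by blast
  then show ?thesis
    using section_imp_retraction[OF s lm(2) fg_lm[OF E] lm(1), of t] by blast
qed

text \<open>The splitting of the pushout of the given sequence along the homomorphism yields the
  extension.\<close>

lemma ext_extend: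
  assumes van: "ext_van M N" and M: "fg M" and N: "fg N" and s: "ses K i P p M"
    and P: "fg P" and K: "lm K" and f: "f \<in> Hom K N"
  shows "\<exists>h\<in>Hom P N. \<forall>k\<in>carrier K. h (i k) = f k"
proof -
  have lm: "lm M" "lm N" "lm P" using M N P by simp_all
  have i: "i \<in> Hom K P" and p: "p \<in> Hom P M" using s by simp_all
  define D where "D = direct_sum2 N P"
  \<comment> \<open>The pushout is \<open>direct_sum2 N P\<close> modulo this antidiagonal image of
    \<open>K\<close>. The sign makes the class of \<open>(0, i k)\<close> equal to
    \<open>j (f k)\<close>.\<close>
  define d where "d k = (f k, \<ominus>\<^bsub>P\<^esub> i k)" for k
  have D: "fg D" "lm D" using N P by (simp_all add: D_def)
  have d: "d \<in> Hom K D" unfolding D_def d_def using ds2_pair[OF f hom_uminus[OF i lm(3)]] .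
  define H where "H = d ` carrier K"
  have H: "sub H D" unfolding H_def by (rule sub_range[OF d K D(2)])
  define E where "E = quot D H"
  define q where "q = qrep D H"
  have E: "fg E" "lm E" using fg_quot[OF D(1) H] unfolding E_def by simp_all
  have q: "q \<in> Epic D E" "q \<in> Hom D E" unfolding q_def E_def using qrep_epi[OF D(2) H] by simp_all
  have q0: "q z = \<zero>\<^bsub>E\<^esub> \<longleftrightarrow> z \<in> H" if "z \<in> carrier D" for z
    unfolding q_def E_def using qrep_zero_iff[OF D(2) H that] .
  have qd: "q (d k) = \<zero>\<^bsub>E\<^esub>" if "k \<in> carrier K" for k
    using q0[of "d k"] hom_closed[OF d that] that by (simp add: H_def)
  define j where "j n = q (n, \<zero>\<^bsub>P\<^esub>)" for n
  have j: "j \<in> Hom N E"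
    unfolding j_def using hom_comp[OF ds2_inl[OF lm(3)] q(2)[unfolded D_def]] .
  have jm: "j \<in> Monic N E"
  proof (rule monoI[OF j lm(2) E(2)])
    fix n assume n: "n \<in> carrier N" "j n = \<zero>\<^bsub>E\<^esub>"
    then have "(n, \<zero>\<^bsub>P\<^esub>) \<in> H" using q0[of "(n, \<zero>\<^bsub>P\<^esub>)"] lm by (simp add: D_def j_def)
    then obtain k where k: "k \<in> carrier K" "n = f k" "\<ominus>\<^bsub>P\<^esub> i k = \<zero>\<^bsub>P\<^esub>"
      by (auto simp: H_def d_def)
    then have "k = \<zero>\<^bsub>K\<^esub>" using mono_zero_iff[OF ses_mono[OF s] K lm(3)] i lm by simp
    then show "n = \<zero>\<^bsub>N\<^esub>" using k f lm K by simp
  qed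
  have ps: "(\<lambda>z. p (snd z)) \<in> Hom D M" unfolding D_def by (rule hom_comp[OF ds2_snd p])
  have "p (snd z) = \<zero>\<^bsub>M\<^esub>" if "z \<in> carrier D" "q z = \<zero>\<^bsub>E\<^esub>" for z
  proof -
    from that have "z \<in> H" by (simp add: q0)
    then obtain k where "k \<in> carrier K" "z = d k" by (auto simp: H_def)
    then show ?thesis using ses_comp[OF s] p i lm by (simp add: d_def)
  qed
  then obtain c where c: "c \<in> Hom E M" "\<forall>z\<in>carrier D. c (q z) = p (snd z)"
    using epi_factor[OF q(1) ps D(2) E(2) lm(1)] by blast
  have cq: "c (q (n, x)) = p x" if "n \<in> carrier N" "x \<in> carrier P" for n x
    using bspec[OF c(2), of "(n, x)"] that by (simp add: D_def)
  have "ses N j E c M"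
  proof (rule sesI[OF jm])
    show "c \<in> Epic E M"
    proof (rule epiI[OF c(1)])
      fix y assume "y \<in> carrier M"
      then obtain x where x: "x \<in> carrier P" "p x = y" using epi_ex[OF ses_epi[OF s]] by blast
      show "\<exists>e\<in>carrier E. c e = y"
        by (rule bexI[of _ "q (\<zero>\<^bsub>N\<^esub>, x)"]) (use x cq lm hom_closed[OF q(2)] in \<open>simp_all add: D_def\<close>)
    qed
    show "c (j n) = \<zero>\<^bsub>M\<^esub>" if "n \<in> carrier N" for n
      using cq[OF that, of "\<zero>\<^bsub>P\<^esub>"] p lm by (simp add: j_def)
    show "e \<in> j ` carrier N" if e: "e \<in> carrier E" "c e = \<zero>\<^bsub>M\<^esub>" for e
    proof -
      obtain z where z0: "z \<in> carrier D" "q z = e" using epi_ex[OF q(1) e(1)] by blast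
      then obtain n x where z: "n \<in> carrier N" "x \<in> carrier P" "e = q (n, x)" by (auto simp: D_def)
      then obtain k where k: "k \<in> carrier K" "x = i k"
        using ses_exact[OF s z(2)] cq[OF z(1,2)] e(2) by auto
      have "q ((n, x) \<oplus>\<^bsub>D\<^esub> d k) = q (n, x) \<oplus>\<^bsub>E\<^esub> q (d k)"
        by (rule hom_add[OF q(2)]) (use z hom_closed[OF d k(1)] in \<open>simp_all add: D_def\<close>)
      also have "\<dots> = e" using qd[OF k(1)] e(1) E z by simp
      finally have "e = j (n \<oplus>\<^bsub>N\<^esub> f k)"
        using k z lm i by (simp add: D_def d_def j_def)
      then show ?thesis using z k f lm by (intro image_eqI[of _ _ "n \<oplus>\<^bsub>N\<^esub> f k"]) simp_all
    qed
  qed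
  then obtain r where r: "r \<in> Hom E N" "\<forall>n\<in>carrier N. r (j n) = n"
    using ext_van_retraction[OF van E(1) _ lm(1,2)] by blast
  have qr: "(\<lambda>x. q (\<zero>\<^bsub>N\<^esub>, x)) \<in> Hom P E"
    using hom_comp[OF ds2_inr[OF lm(2)] q(2)[unfolded D_def]] .
  have "r (q (\<zero>\<^bsub>N\<^esub>, i k)) = f k" if k: "k \<in> carrier K" for k
  proof -
    have ik: "i k \<in> carrier P" "f k \<in> carrier N" using k i f by simp_all
    have "q ((\<zero>\<^bsub>N\<^esub>, i k) \<oplus>\<^bsub>D\<^esub> d k) = q (\<zero>\<^bsub>N\<^esub>, i k) \<oplus>\<^bsub>E\<^esub> q (d k)"
      by (rule hom_add[OF q(2)]) (use ik lm hom_closed[OF d k(1)] in \<open>simp_all add: D_def\<close>)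
    also have "\<dots> = q (\<zero>\<^bsub>N\<^esub>, i k)" using qd[OF k] hom_closed[OF qr ik(1)] E by simp
    finally have "q (\<zero>\<^bsub>N\<^esub>, i k) = j (f k)" using ik lm by (simp add: D_def d_def j_def)
    then show ?thesis using r(2) ik by simp
  qed
  then show ?thesis using hom_comp[OF qr r(1)] by (intro bexI[of _ "\<lambda>x. r (q (\<zero>\<^bsub>N\<^esub>, x))"]) simp_all
qed

text \<open>Dual to \<open>ext_extend\<close>: the pullback of \<open>q\<close> along
  \<open>f\<close> is an extension of \<open>M\<close> by \<open>N\<close>, and its section followed
  by the projection to \<open>I\<close> is the lift.\<close>

lemma ext_lift:
  assumes van: "ext_van M N" and M: "fg M" and N: "fg N" and s: "ses N j I q C"
    and I: "lm I" and C: "lm C" and f: "f \<in> Hom M C"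
  shows "\<exists>h\<in>Hom M I. \<forall>m\<in>carrier M. q (h m) = f m"
proof -
  have lm: "lm M" "lm N" using M N by simp_all
  have j: "j \<in> Hom N I" and q: "q \<in> Hom I C" using s by simp_all
  define D where "D = direct_sum2 I M"
  have D: "lm D" using I lm by (simp add: D_def)
  define d where "d z = q (fst z) \<ominus>\<^bsub>C\<^esub> f (snd z)" for z
  have d: "d \<in> Hom D C"
    unfolding d_def D_def by (rule hom_diff[OF hom_comp[OF ds2_fst q] hom_comp[OF ds2_snd f] C])
  define H where "H = hom_kernel D C d"
  have H: "sub H D" unfolding H_def by (rule sub_kernel[OF d D C])
  have Hiff: "(x, m) \<in> H \<longleftrightarrow> x \<in> carrier I \<and> m \<in> carrier M \<and> q x = f m" for x m
    using hom_closed[OF q] hom_closed[OF f] C by (auto simp: H_def hom_kernel_def D_def d_def)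
  define E where "E = submod D H"
  have E: "lm E" "carrier E = H" unfolding E_def using D H by simp_all
  have i: "(\<lambda>n. (j n, \<zero>\<^bsub>M\<^esub>)) \<in> Hom N E"
    unfolding E_def hom_into_submod[OF H] unfolding D_def
    using hom_comp[OF j ds2_inl[OF lm(1)]] ses_comp[OF s] hom_closed[OF j] lm f C
    by (auto simp: Hiff)
  have fE: "fst \<in> Hom E I" "snd \<in> Hom E M"
    unfolding E_def by (rule hom_from_submod[OF _ H], simp add: D_def)+
  have s': "ses N (\<lambda>n. (j n, \<zero>\<^bsub>M\<^esub>)) E snd M"
  proof (rule sesI)
    show "(\<lambda>n. (j n, \<zero>\<^bsub>M\<^esub>)) \<in> Monic N E"
      by (rule injI_mono[OF i]) (use mono_inj[OF ses_mono[OF s]] in \<open>auto simp: inj_on_def\<close>)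
    show "snd \<in> Epic E M"
    proof (rule epiI[OF fE(2)])
      fix m assume m: "m \<in> carrier M"
      obtain x where x: "x \<in> carrier I" "q x = f m"
        using epi_ex[OF ses_epi[OF s] hom_closed[OF f m]] by blast
      then show "\<exists>z\<in>carrier E. snd z = m"
        by (intro bexI[of _ "(x, m)"]) (simp_all add: E Hiff m)
    qed
    show "z \<in> (\<lambda>n. (j n, \<zero>\<^bsub>M\<^esub>)) ` carrier N" if z: "z \<in> carrier E" "snd z = \<zero>\<^bsub>M\<^esub>" for z
    proof -
      obtain x where "z = (x, \<zero>\<^bsub>M\<^esub>)" using z(2) by (cases z) simp
      then have x: "z = (x, \<zero>\<^bsub>M\<^esub>)" "x \<in> carrier I" "q x = f \<zero>\<^bsub>M\<^esub>"
        using z(1) Hiff[of x "\<zero>\<^bsub>M\<^esub>"] by (simp_all add: E)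
      then show ?thesis using ses_exact[OF s x(2)] f lm C by auto
    qed
  qed simp
  have "fg E"
    by (rule fg_extension[OF N M E(1) i ses_epi[OF s']]) (use ses_ker[OF s'] in simp)
  then obtain t where t: "t \<in> Hom M E" "\<forall>m\<in>carrier M. snd (t m) = m"
    using ext_van_section[OF van _ s'] by blast
  have "q (fst (t m)) = f m" if "m \<in> carrier M" for m
    using hom_closed[OF t(1) that] bspec[OF t(2) that] Hiff[of "fst (t m)" "snd (t m)"] by (cases "t m") (simp add: E)
  then show ?thesis using hom_comp[OF t(1) fE(1)] by (intro bexI[of _ "\<lambda>m. fst (t m)"]) simp_all
qed

text \<open>Converse of \<open>ext_extend\<close> for a projective presentation. A lift
  \<open>u\<close> of \<open>p\<close> to the extension \<open>E\<close> restricts to a map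
  \<open>v\<close> from \<open>K\<close> to \<open>N\<close>. Subtracting an extension
  \<open>h\<close> of \<open>v\<close> to \<open>P\<close> makes it vanish on \<open>K\<close>, so
  it descends to a section.\<close>

lemma ext_vanI_proj:
  assumes s: "ses K i P p M" and P: "proj P" and K: "lm K" and M: "fg M" and N: "lm N"
    and ext: "\<And>f. f \<in> Hom K N \<Longrightarrow> \<exists>h\<in>Hom P N. \<forall>k\<in>carrier K. h (i k) = f k"
  shows "ext_van M N"
  unfolding ext_van_def
proof (intro allI impI)
  fix E :: "'a umod" and j g assume E: "fg E" and s': "ses N j E g M"
  have lm: "lm P" "lm E" "lm M" using proj_fg[OF P] E M by simp_all
  have i: "i \<in> Hom K P" and p: "p \<in> Hom P M" and j: "j \<in> Hom N E" and g: "g \<in> Hom E M"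
    using s s' by simp_all
  obtain u where u: "u \<in> Hom P E" "\<forall>x\<in>carrier P. g (u x) = p x"
    using proj_lift[OF P E M ses_epi[OF s'] p] by blast
  have "u (i k) \<in> j ` carrier N" if k: "k \<in> carrier K" for k
    by (rule ses_exact[OF s']) (use k u i ses_comp[OF s k] in simp_all)
  then obtain v where v: "v \<in> Hom K N" "\<forall>k\<in>carrier K. j (v k) = u (i k)"
    using mono_factor[OF ses_mono[OF s'] hom_comp[OF i u(1)] K lm(2) N] by blast
  obtain h where h: "h \<in> Hom P N" "\<forall>k\<in>carrier K. h (i k) = v k"
    using ext[OF v(1)] by blast
  define w where "w x = u x \<ominus>\<^bsub>E\<^esub> j (h x)" for x
  have w: "w \<in> Hom P E" unfolding w_def by (rule hom_diff[OF u(1) hom_comp[OF h(1) j] lm(2)])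
  have w0: "w x = \<zero>\<^bsub>E\<^esub>" if x: "x \<in> carrier P" "p x = \<zero>\<^bsub>M\<^esub>" for x
  proof -
    obtain k where "k \<in> carrier K" "x = i k" using ses_exact[OF s x] by blast
    then show ?thesis using h(2) v(2) hom_closed[OF hom_comp[OF i u(1)]] lm by (simp add: w_def)
  qed
  obtain t where t: "t \<in> Hom M E" "\<forall>x\<in>carrier P. t (p x) = w x"
    using epi_factor[OF ses_epi[OF s] w lm(1,3,2) w0] by blast
  have "g (t y) = y" if y: "y \<in> carrier M" for y
  proof -
    obtain x where x: "x \<in> carrier P" "p x = y" using epi_ex[OF ses_epi[OF s] y] by blast
    have hx: "h x \<in> carrier N" "u x \<in> carrier E" using x h(1) u(1) by simp_all
    have "g (t y) = g (w x)" using x t(2) by auto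
    also have "\<dots> = p x" using hx x u(2) g j ses_comp[OF s' hx(1)] lm p hom_closed[OF p x(1)] by (simp add: w_def)
    finally show ?thesis using x y lm by simp
  qed
  with t(1) show "\<exists>s\<in>Hom M E. \<forall>x\<in>carrier M. g (s x) = x" by blast
qed

text \<open>The dual criterion. An extension \<open>u\<close> of \<open>j\<close> to
  \<open>E\<close> induces a map \<open>v\<close> from \<open>M\<close> to \<open>C\<close>;
  subtracting a lift of \<open>v\<close> leaves a map with values in \<open>N\<close>, which is a
  retraction.\<close>

lemma ext_vanI_inje:
  assumes s: "ses N j I q C" and I: "inje I" and C: "lm C" and M: "lm M" and N: "fg N"
    and lift: "\<And>f. f \<in> Hom M C \<Longrightarrow> \<exists>h\<in>Hom M I. \<forall>m\<in>carrier M. q (h m) = f m"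
  shows "ext_van M N"
  unfolding ext_van_def
proof (intro allI impI)
  fix E :: "'a umod" and i g assume E: "fg E" and s': "ses N i E g M"
  have lm: "lm I" "lm E" "lm N" using inje_fg[OF I] E N by simp_all
  have i: "i \<in> Hom N E" and g: "g \<in> Hom E M" and j: "j \<in> Hom N I" and q: "q \<in> Hom I C"
    using s s' by simp_all
  obtain u where u: "u \<in> Hom E I" "\<forall>x\<in>carrier N. u (i x) = j x"
    using inje_extend[OF I N E ses_mono[OF s'] j] by blast
  have "q (u e) = \<zero>\<^bsub>C\<^esub>" if e: "e \<in> carrier E" "g e = \<zero>\<^bsub>M\<^esub>" for e
  proof -
    obtain x where "x \<in> carrier N" "e = i x" using ses_exact[OF s' e] by blast
    then show ?thesis using u(2) ses_comp[OF s] by simp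
  qed
  then obtain v where v: "v \<in> Hom M C" "\<forall>e\<in>carrier E. v (g e) = q (u e)"
    using epi_factor[OF ses_epi[OF s'] hom_comp[OF u(1) q] lm(2) M C] by blast
  obtain h where h: "h \<in> Hom M I" "\<forall>m\<in>carrier M. q (h m) = v m"
    using lift[OF v(1)] by blast
  define w where "w e = u e \<ominus>\<^bsub>I\<^esub> h (g e)" for e
  have w: "w \<in> Hom E I" unfolding w_def by (rule hom_diff[OF u(1) hom_comp[OF g h(1)] lm(1)])
  have "w e \<in> j ` carrier N" if e: "e \<in> carrier E" for e
  proof (rule ses_exact[OF s])
    show "w e \<in> carrier I" using w e by simp
    have c: "u e \<in> carrier I" "h (g e) \<in> carrier I" "g e \<in> carrier M" "q (u e) \<in> carrier C"
      using u h g q e by simp_all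
    then show "q (w e) = \<zero>\<^bsub>C\<^esub>" using h(2) v(2) q e lm C by (simp add: w_def)
  qed
  then obtain r where r: "r \<in> Hom E N" "\<forall>e\<in>carrier E. j (r e) = w e"
    using mono_factor[OF ses_mono[OF s] w lm(2,1,3)] by blast
  have "r (i x) = x" if x: "x \<in> carrier N" for x
  proof -
    have "j (r (i x)) = w (i x)" using r(2) x i by simp
    also have "\<dots> = j x" using u(2) x ses_comp[OF s' x] h(1) lm M hom_closed[OF j x] by (simp add: w_def)
    finally show ?thesis using mono_eq[OF ses_mono[OF s], of "r (i x)" x] x r(1) i by simp
  qed
  then show "\<exists>t\<in>Hom M E. \<forall>x\<in>carrier M. g (t x) = x"
    using retraction_imp_section[OF s' lm(3,2) M r(1)] by blast
qed

lemma ext_van_inje: "\<lbrakk>inje N; lm M\<rbrakk> \<Longrightarrow> ext_van M N"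
  unfolding ext_van_def
proof (intro allI impI)
  fix E :: "'a umod" and f g assume *: "inje N" "lm M" "fg E" "ses N f E g M"
  obtain r where "r \<in> Hom E N" "\<forall>x\<in>carrier N. r (f x) = x"
    using mono_from_inje_retraction[OF *(1,3) ses_mono[OF *(4)]] by blast
  then show "\<exists>s\<in>Hom M E. \<forall>x\<in>carrier M. g (s x) = x"
    using retraction_imp_section[OF *(4) fg_lm[OF inje_fg[OF *(1)]] fg_lm[OF *(3)] *(2), of r] by blast
qed

lemma ext_van_retract_left:
  assumes van: "ext_van M N" and r: "retract M0 M" and fg: "fg M" "fg N" and lm: "lm M0"
  shows "ext_van M0 N"
  unfolding ext_van_def
proof (intro allI impI)
  fix E :: "'a umod" and f g assume *: "fg E" "ses N f E g M0"
  obtain i p where ip: "i \<in> Hom M0 M" "p \<in> Hom M M0" "\<forall>x\<in>carrier M0. p (i x) = x"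
    using r by (rule retractE)
  obtain h where h: "h \<in> Hom M E" "\<forall>x\<in>carrier M. g (h x) = p x"
    using ext_lift[OF van fg *(2) fg_lm[OF *(1)] lm ip(2)] by blast
  show "\<exists>s\<in>Hom M0 E. \<forall>x\<in>carrier M0. g (s x) = x"
    by (rule bexI[OF _ hom_comp[OF ip(1) h(1)]]) (use h(2) ip(3) hom_closed[OF ip(1)] in simp)
qed

lemma ext_van_retract_right:
  assumes van: "ext_van M N" and r: "retract N0 N" and fg: "fg M" "fg N" and lm: "lm N0"
  shows "ext_van M N0"
  unfolding ext_van_def
proof (intro allI impI)
  fix E :: "'a umod" and f g assume *: "fg E" "ses N0 f E g M"
  obtain i p where ip: "i \<in> Hom N0 N" "p \<in> Hom N N0" "\<forall>x\<in>carrier N0. p (i x) = x"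
    using r by (rule retractE)
  obtain h where h: "h \<in> Hom E N" "\<forall>x\<in>carrier N0. h (f x) = i x"
    using ext_extend[OF van fg *(2,1) lm ip(1)] by blast
  have "\<exists>r\<in>Hom E N0. \<forall>x\<in>carrier N0. r (f x) = x"
    by (rule bexI[OF _ hom_comp[OF h(1) ip(2)]]) (use h(2) ip(3) in simp)
  then show "\<exists>s\<in>Hom M E. \<forall>x\<in>carrier M. g (s x) = x"
    using retraction_imp_section[OF *(2) lm fg_lm[OF *(1)] fg_lm[OF fg(1)]] by blast
qed

lemma ext_van_ds2_right:
  assumes van: "ext_van M N" "ext_van M N'" and fg: "fg M" "fg N" "fg N'"
  shows "ext_van M (direct_sum2 N N')"
  unfolding ext_van_def
proof (intro allI impI)
  fix E :: "'a umod" and f g assume *: "fg E" "ses (direct_sum2 N N') f E g M"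
  have lm: "lm (direct_sum2 N N')" using fg by simp
  obtain h where h: "h \<in> Hom E N" "\<forall>x\<in>carrier (direct_sum2 N N'). h (f x) = fst x"
    using ext_extend[OF van(1) fg(1,2) *(2,1) lm ds2_fst] by blast
  obtain h' where h': "h' \<in> Hom E N'" "\<forall>x\<in>carrier (direct_sum2 N N'). h' (f x) = snd x"
    using ext_extend[OF van(2) fg(1,3) *(2,1) lm ds2_snd] by blast
  have "\<exists>r\<in>Hom E (direct_sum2 N N'). \<forall>x\<in>carrier (direct_sum2 N N'). r (f x) = x"
    by (rule bexI[OF _ ds2_pair[OF h(1) h'(1)]]) (use h(2) h'(2) in \<open>simp del: ds2_simps\<close>)
  then show "\<exists>s\<in>Hom M E. \<forall>x\<in>carrier M. g (s x) = x"
    using retraction_imp_section[OF *(2) lm fg_lm[OF *(1)] fg_lm[OF fg(1)]] by blast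
qed

lemma ext_van_ds_right:
  fixes M :: "('a, 'm) module" and N :: "nat \<Rightarrow> ('a, 'n) module"
  assumes van: "\<And>i. i < n \<Longrightarrow> ext_van M (N i)" and fg: "fg M" "\<And>i. i < n \<Longrightarrow> fg (N i)"
  shows "ext_van M (direct_sum n N)"
proof -
  have "fg (direct_sum n N) \<and> ext_van M (direct_sum n N)"
  proof (rule ds_induct)
    fix k and L :: "('a, nat \<Rightarrow> 'n) module" assume *: "k < n" "fg (direct_sum k N) \<and> ext_van M (direct_sum k N)" "lm L"
      "isomorphic_modules A (direct_sum2 (direct_sum k N) (N k)) L"
    have fgD: "fg (direct_sum2 (direct_sum k N) (N k))" using * fg by simp
    have "ext_van M (direct_sum2 (direct_sum k N) (N k))"
      by (rule ext_van_ds2_right) (use * van fg in simp_all)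
    from ext_van_retract_right[OF this retract_iso(2)[OF *(4) fg_lm[OF fgD] *(3)] fg(1) fgD *(3)]
    show "fg L \<and> ext_van M L" using fg_iso[OF fgD *(4,3)] by simp
  next
    fix L :: "('a, nat \<Rightarrow> 'n) module" assume *: "lm L" "zero_module L"
    show "fg L \<and> ext_van M L"
      using zero_module_fg[OF *] ext_van_inje[OF zero_module_inje[OF zero_module_fg[OF *] *(2)] fg_lm[OF fg(1)]]
      by simp
  qed (use fg in simp)
  then show ?thesis by simp
qed

lemma in_add_fg: "\<lbrakk>in_add T X; fg T; lm X\<rbrakk> \<Longrightarrow> fg X"
  unfolding in_add_def using retract_fg[OF _ fg_ds[of _ "\<lambda>_. T"]] by blast

lemma ext_van_in_add_right:
  assumes "ext_van M T" "in_add T X" "fg M" "fg T" "lm X"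
  shows "ext_van M X"
proof -
  obtain n where n: "retract X (power_module T n)" using assms(2) unfolding in_add_def by blast
  have "ext_van M (power_module T n)" by (rule ext_van_ds_right) (use assms in simp_all)
  from ext_van_retract_right[OF this n assms(3) fg_ds[OF assms(4)] assms(5)] show ?thesis .
qed

text \<open>If there is one class only, every extension is equivalent to the split one and inherits
  its section. Conversely, two split extensions are matched on their summands \<open>N\<close> and
  \<open>M\<close>.\<close>

lemma Ext1_singleton_iff:
  fixes M :: "('a, 'm) module" and N :: "('a, 'n) module"
  assumes M: "fg M" and N: "fg N"
  shows "is_singleton (Ext1 A M N) \<longleftrightarrow> ext_van M N"
proof -
  have lm: "lm M" "lm N" using M N by simp_all
  let ?X = "extensions A M N" and ?r = "extension_equiv A M N"
  have ext: "(E, f, g) \<in> ?X \<longleftrightarrow> fg E \<and> ses N f E g M" for E f g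
    by (simp add: extensions_def)
  have refl: "(x, x) \<in> ?r" if "x \<in> ?X" for x
  proof -
    obtain E f g where x: "x = (E, f, g)" by (cases x)
    have "id \<in> Iso E E" by (intro mono_epi_iso injI_mono imageI_epi) simp_all
    then show ?thesis using that unfolding x extension_equiv_def by (auto intro!: bexI[of _ id])
  qed
  \<comment> \<open>The split extension, moved to the universe; it also shows that there is a class
    at all.\<close>
  obtain E0 :: "'a umod" and h k where h: "fg E0" "h \<in> Iso (direct_sum2 N M) E0" "k \<in> Iso E0 (direct_sum2 N M)"
    "\<forall>x\<in>carrier (direct_sum2 N M). k (h x) = x" "\<forall>y\<in>carrier E0. h (k y) = y"
    using umod_ex[OF fg_ds2[OF N M]] .
  define f0 where "f0 n = h (n, \<zero>\<^bsub>M\<^esub>)" for n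
  define g0 where "g0 y = snd (k y)" for y
  have "ses N f0 E0 g0 M"
    unfolding f0_def g0_def by (rule ses_iso_middle[OF ses_ds2[OF lm(2,1)] h(2,3)]) (use h(4,5) in blast)+
  then have x0: "(E0, f0, g0) \<in> ?X" using h(1) ext by simp
  show ?thesis
  proof
    assume "is_singleton (Ext1 A M N)"
    then obtain c where c: "?X // ?r = {c}" unfolding is_singleton_def Ext1_def by blast
    show "ext_van M N"
      unfolding ext_van_def
    proof (intro allI impI)
      fix E :: "'a umod" and f g assume "fg E" "ses N f E g M"
      then have x: "(E, f, g) \<in> ?X" using ext by simp
      have "?r `` {(E, f, g)} = c" "?r `` {(E0, f0, g0)} = c"
        using quotientI[OF x, of ?r] quotientI[OF x0, of ?r] unfolding c by simp_all
      then have "(E, f, g) \<in> ?r `` {(E0, f0, g0)}" using refl[OF x] by blast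
      then obtain l where l: "l \<in> Iso E0 E" "\<forall>y\<in>carrier E0. g (l y) = g0 y"
        unfolding extension_equiv_def by auto
      have i: "(\<lambda>m. h (\<zero>\<^bsub>N\<^esub>, m)) \<in> Hom M E0"
        by (rule hom_comp[OF ds2_inr[OF lm(2)] iso_hom[OF h(2)]])
      show "\<exists>s\<in>Hom M E. \<forall>x\<in>carrier M. g (s x) = x"
      proof (rule bexI[OF _ hom_comp[OF i iso_hom[OF l(1)]]], rule ballI)
        fix m assume m: "m \<in> carrier M"
        show "g (l (h (\<zero>\<^bsub>N\<^esub>, m))) = m"
          using l(2) hom_closed[OF i m] bspec[OF h(4), of "(\<zero>\<^bsub>N\<^esub>, m)"] m lm by (simp add: g0_def)
      qed
    qed
  next
    assume van: "ext_van M N"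
    have "(x, x') \<in> ?r" if xx: "x \<in> ?X" "x' \<in> ?X" for x x'
    proof -
      obtain E f g E' f' g' where x: "x = (E, f, g)" "x' = (E', f', g')" by (cases x; cases x')
      have s: "fg E" "ses N f E g M" "fg E'" "ses N f' E' g' M" using xx x ext by simp_all
      have E: "lm E" "lm E'" using s by simp_all
      have hs: "f \<in> Hom N E" "g \<in> Hom E M" "f' \<in> Hom N E'" "g' \<in> Hom E' M" using s by simp_all
      obtain t where t: "t \<in> Hom M E" "\<forall>x\<in>carrier M. g (t x) = x"
        using ext_van_section[OF van s(1,2)] by blast
      obtain t' where t': "t' \<in> Hom M E'" "\<forall>x\<in>carrier M. g' (t' x) = x"
        using ext_van_section[OF van s(3,4)] by blast
      obtain r where r: "r \<in> Hom E N" "\<forall>x\<in>carrier N. r (f x) = x" "\<forall>y\<in>carrier E. f (r y) = y \<ominus>\<^bsub>E\<^esub> t (g y)"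
        using section_imp_retraction[OF s(2) lm(2) E(1) lm(1) t(1)] t(2) by blast
      obtain r' where r': "r' \<in> Hom E' N" "\<forall>x\<in>carrier N. r' (f' x) = x" "\<forall>y\<in>carrier E'. f' (r' y) = y \<ominus>\<^bsub>E'\<^esub> t' (g' y)"
        using section_imp_retraction[OF s(4) lm(2) E(2) lm(1) t'(1)] t'(2) by blast
      \<comment> \<open>On \<open>N\<close> this map follows \<open>f'\<close>, on the image of the
        section \<open>t\<close> it follows \<open>t'\<close>: it identifies the two
        splittings.\<close>
      define l where "l e = f' (r e) \<oplus>\<^bsub>E'\<^esub> t' (g e)" for e
      have l: "l \<in> Hom E E'"
        unfolding l_def by (rule hom_plus[OF hom_comp[OF r(1) hs(3)] hom_comp[OF hs(2) t'(1)] E(2)])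
      have gl: "g' (l e) = g e" if e: "e \<in> carrier E" for e
      proof -
        have c: "r e \<in> carrier N" "g e \<in> carrier M" using e r hs by simp_all
        show ?thesis
          unfolding l_def using hom_add[OF hs(4), of "f' (r e)" "t' (g e)"] ses_comp[OF s(4) c(1)] c t' lm
            hom_closed[OF hs(3) c(1)] hom_closed[OF t'(1) c(2)] by simp
      qed
      have l0: "e = \<zero>\<^bsub>E\<^esub>" if e: "e \<in> carrier E" "l e = \<zero>\<^bsub>E'\<^esub>" for e
      proof -
        have ge: "g e = \<zero>\<^bsub>M\<^esub>" using gl[OF e(1)] e(2) hs(4) E lm by simp
        have re: "r e \<in> carrier N" using r(1) e(1) by simp
        have "f' (r e) = \<zero>\<^bsub>E'\<^esub>" using e(2) ge t'(1) lm E hom_closed[OF hs(3) re] by (simp add: l_def)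
        then have "r e = \<zero>\<^bsub>N\<^esub>" using mono_zero_iff[OF ses_mono[OF s(4)] lm(2) E(2) re] by simp
        then have "e \<ominus>\<^bsub>E\<^esub> t (g e) = \<zero>\<^bsub>E\<^esub>" using r(3) e(1) hs(1) lm E by (metis hom_zero)
        then show ?thesis using ge t(1) lm E e(1) by simp
      qed
      have lf: "l (f n) = f' n" if n: "n \<in> carrier N" for n
        unfolding l_def using r(2) n ses_comp[OF s(2) n] t'(1) lm E hom_closed[OF hs(3) n] by simp
      have "l \<in> Epic E E'"
      proof (rule epiI[OF l])
        fix y assume y: "y \<in> carrier E'"
        have c: "r' y \<in> carrier N" "g' y \<in> carrier M" using y r' hs by simp_all
        have tc: "t (g' y) \<in> carrier E" "f (r' y) \<in> carrier E" using c t hs by simp_all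
        have lt: "l (t (g' y)) = t' (g' y)"
        proof -
          have "f (r (t (g' y))) = \<zero>\<^bsub>E\<^esub>" using r(3) tc(1) t(2) c(2) E by simp
          then have "r (t (g' y)) = \<zero>\<^bsub>N\<^esub>"
            using mono_zero_iff[OF ses_mono[OF s(2)] lm(2) E(1) hom_closed[OF r(1) tc(1)]] by simp
          then show ?thesis
            unfolding l_def using t(2) c(2) hom_zero[OF hs(3) lm(2) E(2)] E hom_closed[OF t'(1) c(2)] by simp
        qed
        have "l (f (r' y) \<oplus>\<^bsub>E\<^esub> t (g' y)) = f' (r' y) \<oplus>\<^bsub>E'\<^esub> t' (g' y)"
          using hom_add[OF l tc(2,1)] lf[OF c(1)] lt by simp
        also have "\<dots> = y" using r'(3) y E hom_closed[OF t'(1) c(2)] by simp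
        finally show "\<exists>e\<in>carrier E. l e = y" using tc E by (intro bexI[of _ "f (r' y) \<oplus>\<^bsub>E\<^esub> t (g' y)"]) simp_all
      qed
      then have "l \<in> Iso E E'" using monoI[OF l E l0] mono_epi_iso by blast
      then show ?thesis
        using xx lf gl unfolding x extension_equiv_def by (auto intro!: bexI[of _ l])
    qed
    then have "?r `` {x} = ?X" if "x \<in> ?X" for x
      using that by (auto simp: extension_equiv_def)
    then have "?X // ?r = {?X}" using x0 unfolding quotient_def by auto
    then show "is_singleton (Ext1 A M N)" unfolding Ext1_def by simp
  qed
qed


subsection \<open>Comparing resolutions\<close>

text \<open>Schanuel's lemma, in a form that also compares a module with a direct summand.\<close>

lemma syzygy_retract:
  assumes r: "retract T T'" and s: "ses K i P p T" and s': "ses K' i' P' p' T'"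
    and P: "proj P" "proj P'" and T: "fg T" "fg T'" and K: "lm K" "lm K'"
  shows "retract K (direct_sum2 K' P)"
proof -
  have fg: "fg P" "fg P'" using P by (simp_all add: proj_fg)
  then have lm: "lm P" "lm P'" "lm T" "lm T'" using T by simp_all
  have i: "i \<in> Hom K P" "p \<in> Hom P T" "i' \<in> Hom K' P'" "p' \<in> Hom P' T'" using s s' by simp_all
  obtain a b where ab: "a \<in> Hom T T'" "b \<in> Hom T' T" "\<forall>x\<in>carrier T. b (a x) = x"
    using r by (rule retractE)
  obtain \<alpha> where \<alpha>: "\<alpha> \<in> Hom P P'" "\<forall>x\<in>carrier P. p' (\<alpha> x) = a (p x)"
    using proj_lift[OF P(1) fg(2) T(2) ses_epi[OF s'] hom_comp[OF i(2) ab(1)]] by blast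
  obtain \<beta> where \<beta>: "\<beta> \<in> Hom P' P" "\<forall>x\<in>carrier P'. p (\<beta> x) = b (p' x)"
    using proj_lift[OF P(2) fg(1) T(1) ses_epi[OF s] hom_comp[OF i(4) ab(2)]] by blast
  have c: "\<alpha> x \<in> carrier P'" "\<beta> (\<alpha> x) \<in> carrier P" "p x \<in> carrier T" if "x \<in> carrier P" for x
    using that \<alpha> \<beta> i by simp_all
  \<comment> \<open>As \<open>b\<close> after \<open>a\<close> is the identity of \<open>T\<close>,
    the difference of \<open>\<beta> \<circ> \<alpha>\<close> and the identity maps \<open>P\<close>
    into the kernel of \<open>p\<close>. It therefore factors through \<open>K\<close> as
    \<open>d\<close>, which is the correction term in the retraction below.\<close>
  have "(\<lambda>x. \<beta> (\<alpha> x) \<ominus>\<^bsub>P\<^esub> x) \<in> Hom P P"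
    by (rule hom_diff[OF hom_comp[OF \<alpha>(1) \<beta>(1)] _ lm(1)]) simp
  moreover have "\<beta> (\<alpha> x) \<ominus>\<^bsub>P\<^esub> x \<in> i ` carrier K" if x: "x \<in> carrier P" for x
    by (rule ses_exact[OF s]) (use c[OF x] x \<alpha>(2) \<beta>(2) ab(3) i(2) lm in simp_all)
  ultimately obtain d where d: "d \<in> Hom P K" "\<forall>x\<in>carrier P. i (d x) = \<beta> (\<alpha> x) \<ominus>\<^bsub>P\<^esub> x"
    using mono_factor[OF ses_mono[OF s] _ lm(1,1) K(1)] by blast
  have "\<alpha> (i k) \<in> i' ` carrier K'" if k: "k \<in> carrier K" for k
    by (rule ses_exact[OF s']) (use k i \<alpha> ses_comp[OF s k] ab(1) lm in simp_all)
  then obtain u where u: "u \<in> Hom K K'" "\<forall>k\<in>carrier K. i' (u k) = \<alpha> (i k)"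
    using mono_factor[OF ses_mono[OF s'] hom_comp[OF i(1) \<alpha>(1)] K(1) lm(2) K(2)] by blast
  have "\<beta> (i' k) \<in> i ` carrier K" if k: "k \<in> carrier K'" for k
    by (rule ses_exact[OF s]) (use k i \<beta> ses_comp[OF s' k] ab(2) lm in simp_all)
  then obtain v where v: "v \<in> Hom K' K" "\<forall>k\<in>carrier K'. i (v k) = \<beta> (i' k)"
    using mono_factor[OF ses_mono[OF s] hom_comp[OF i(3) \<beta>(1)] K(2) lm(1) K(1)] by blast
  show ?thesis
  proof (rule retractI[OF ds2_pair[OF u(1) i(1)] hom_diff[OF hom_comp[OF ds2_fst v(1)] hom_comp[OF ds2_snd d(1)] K(1)]])
    fix k assume k: "k \<in> carrier K"
    have m: "v (u k) \<in> carrier K" "d (i k) \<in> carrier K" "u k \<in> carrier K'" "i k \<in> carrier P"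
      using k u v d i by simp_all
    have "i (v (u k) \<ominus>\<^bsub>K\<^esub> d (i k)) = \<beta> (\<alpha> (i k)) \<ominus>\<^bsub>P\<^esub> (\<beta> (\<alpha> (i k)) \<ominus>\<^bsub>P\<^esub> i k)"
      using hom_minus[OF i(1) K(1) lm(1) m(1,2)] u(2) v(2) d(2) m k by simp
    also have "\<dots> = i k" using c[OF m(4)] m(4) lm by simp
    finally show "v (fst (u k, i k)) \<ominus>\<^bsub>K\<^esub> d (snd (u k, i k)) = k"
      using mono_eq[OF ses_mono[OF s], of "v (u k) \<ominus>\<^bsub>K\<^esub> d (i k)" k] m k K by simp
  qed
qed

text \<open>The dual of \<open>syzygy_retract\<close> for cokernels: now
  \<open>\<beta> \<circ> \<alpha>\<close> minus the identity vanishes on the image of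
  \<open>T\<close> and so factors through \<open>C\<close> as \<open>d\<close>. The retraction is
  \<open>v\<close> on \<open>C'\<close> minus \<open>q\<close> on \<open>I\<close>.\<close>

lemma cosyzygy_retract:
  assumes r: "retract T T'" and s: "ses T j I q C" and s': "ses T' j' I' q' C'"
    and I: "inje I" "inje I'" and T: "fg T" "fg T'" and C: "lm C" "lm C'"
  shows "retract C (direct_sum2 C' I)"
proof -
  have fg: "fg I" "fg I'" using I by (simp_all add: inje_fg)
  then have lm: "lm I" "lm I'" "lm T" "lm T'" using T by simp_all
  have h: "j \<in> Hom T I" "q \<in> Hom I C" "j' \<in> Hom T' I'" "q' \<in> Hom I' C'" using s s' by simp_all
  obtain a b where ab: "a \<in> Hom T T'" "b \<in> Hom T' T" "\<forall>x\<in>carrier T. b (a x) = x"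
    using r by (rule retractE)
  obtain \<alpha> where \<alpha>: "\<alpha> \<in> Hom I I'" "\<forall>x\<in>carrier T. \<alpha> (j x) = j' (a x)"
    using inje_extend[OF I(2) T(1) fg(1) ses_mono[OF s] hom_comp[OF ab(1) h(3)]] by blast
  obtain \<beta> where \<beta>: "\<beta> \<in> Hom I' I" "\<forall>x\<in>carrier T'. \<beta> (j' x) = j (b x)"
    using inje_extend[OF I(1) T(2) fg(2) ses_mono[OF s'] hom_comp[OF ab(2) h(1)]] by blast
  have c: "\<alpha> x \<in> carrier I'" "\<beta> (\<alpha> x) \<in> carrier I" if "x \<in> carrier I" for x
    using that \<alpha> \<beta> by simp_all
  have "(\<lambda>x. \<beta> (\<alpha> x) \<ominus>\<^bsub>I\<^esub> x) \<in> Hom I I"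
    by (rule hom_diff[OF hom_comp[OF \<alpha>(1) \<beta>(1)] _ lm(1)]) simp
  moreover have "\<beta> (\<alpha> x) \<ominus>\<^bsub>I\<^esub> x = \<zero>\<^bsub>I\<^esub>" if x: "x \<in> carrier I" "q x = \<zero>\<^bsub>C\<^esub>" for x
  proof -
    obtain t where "t \<in> carrier T" "x = j t" using ses_exact[OF s x] by blast
    then show ?thesis using \<alpha>(2) \<beta>(2) ab hom_closed[OF ab(1)] h(1) lm by simp
  qed
  ultimately obtain d where d: "d \<in> Hom C I" "\<forall>x\<in>carrier I. d (q x) = \<beta> (\<alpha> x) \<ominus>\<^bsub>I\<^esub> x"
    using epi_factor[OF ses_epi[OF s] _ lm(1) C(1) lm(1)] by blast
  have "q' (\<alpha> x) = \<zero>\<^bsub>C'\<^esub>" if x: "x \<in> carrier I" "q x = \<zero>\<^bsub>C\<^esub>" for x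
  proof -
    obtain t where "t \<in> carrier T" "x = j t" using ses_exact[OF s x] by blast
    then show ?thesis using \<alpha>(2) hom_closed[OF ab(1)] ses_comp[OF s'] by simp
  qed
  then obtain u where u: "u \<in> Hom C C'" "\<forall>x\<in>carrier I. u (q x) = q' (\<alpha> x)"
    using epi_factor[OF ses_epi[OF s] hom_comp[OF \<alpha>(1) h(4)] lm(1) C] by blast
  have "q (\<beta> x) = \<zero>\<^bsub>C\<^esub>" if x: "x \<in> carrier I'" "q' x = \<zero>\<^bsub>C'\<^esub>" for x
  proof -
    obtain t where "t \<in> carrier T'" "x = j' t" using ses_exact[OF s' x] by blast
    then show ?thesis using \<beta>(2) hom_closed[OF ab(2)] ses_comp[OF s] by simp
  qed
  then obtain v where v: "v \<in> Hom C' C" "\<forall>x\<in>carrier I'. v (q' x) = q (\<beta> x)"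
    using epi_factor[OF ses_epi[OF s'] hom_comp[OF \<beta>(1) h(2)] lm(2) C(2,1)] by blast
  show ?thesis
  proof (rule retractI[OF ds2_pair[OF u(1) d(1)] hom_diff[OF hom_comp[OF ds2_fst v(1)] hom_comp[OF ds2_snd h(2)] C(1)]])
    fix y assume y: "y \<in> carrier C"
    obtain x where x: "x \<in> carrier I" "q x = y" using epi_ex[OF ses_epi[OF s] y] by blast
    have e: "v (u (q x)) = q (\<beta> (\<alpha> x))" using u(2) v(2) x(1) c(1) by simp
    have e': "q (d (q x)) = q (\<beta> (\<alpha> x)) \<ominus>\<^bsub>C\<^esub> q x"
      using d(2) x(1) hom_minus[OF h(2) lm(1) C(1) c(2)[OF x(1)] x(1)] by simp
    have "v (u (q x)) \<ominus>\<^bsub>C\<^esub> q (d (q x)) = q x"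
      unfolding e e' using hom_closed[OF h(2) c(2)[OF x(1)]] hom_closed[OF h(2) x(1)] C by simp
    then show "v (fst (u y, d y)) \<ominus>\<^bsub>C\<^esub> q (snd (u y, d y)) = y" using x by simp
  qed
qed

lemma quot_kernel_iso:
  assumes g: "g \<in> Epic M N" and lm: "lm M" "lm N"
  shows "isomorphic_modules A (quot M (hom_kernel M N g)) N"
proof -
  let ?K = "hom_kernel M N g"
  have K: "sub ?K M" by (rule sub_kernel) (use g lm in simp_all)
  have z: "g x = \<zero>\<^bsub>N\<^esub>" if "x \<in> carrier M" "qrep M ?K x = \<zero>\<^bsub>quot M ?K\<^esub>" for x
    using that qrep_zero_iff[OF lm(1) K that(1)] by (simp add: hom_kernel_def)
  obtain h where h: "h \<in> Hom (quot M ?K) N" "\<forall>x\<in>carrier M. h (qrep M ?K x) = g x"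
    using epi_factor[OF qrep_epi[OF lm(1) K] epi_hom[OF g] lm(1) lm_quot[OF lm(1) K] lm(2) z] by blast
  have "h \<in> Monic (quot M ?K) N"
  proof (rule monoI[OF h(1) lm_quot[OF lm(1) K] lm(2)])
    fix y assume y: "y \<in> carrier (quot M ?K)" "h y = \<zero>\<^bsub>N\<^esub>"
    obtain x where x: "x \<in> carrier M" "qrep M ?K x = y" using epi_ex[OF qrep_epi[OF lm(1) K] y(1)] by blast
    then have "x \<in> ?K" using h(2) y(2) by (auto simp: hom_kernel_def)
    then show "y = \<zero>\<^bsub>quot M ?K\<^esub>" using qrep_zero_iff[OF lm(1) K x(1)] x(2) by simp
  qed
  moreover have "h \<in> Epic (quot M ?K) N"
  proof (rule epiI[OF h(1)])
    fix y assume "y \<in> carrier N"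
    then obtain x where "x \<in> carrier M" "g x = y" using epi_ex[OF g] by blast
    then show "\<exists>x\<in>carrier (quot M ?K). h x = y"
      using h(2) hom_closed[OF qrep_hom[OF lm(1) K]] by (intro bexI[of _ "qrep M ?K x"]) simp_all
  qed
  ultimately show ?thesis unfolding isomorphic_modules_def using mono_epi_iso by blast
qed

end

section \<open>Ascending chains: finitely generated kernels, injective envelopes, existence of
  decompositions\<close>

section \<open>Modules over a left noetherian ring\<close>

text \<open>A locale assumption is fixed to one carrier type, so the chain condition is demanded in
  the universe; \<open>acc\<close> transports it to finitely generated modules of every
  type.\<close>

locale noetherian_modules = modules_over +
  assumes acc_umod: "\<And>(M :: 'a umod) H. \<lbrakk>fg M; \<And>n :: nat. sub (H n) M; \<And>n. H n \<subseteq> H (Suc n)\<rbrakk> \<Longrightarrow>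
    \<exists>N. \<forall>n\<ge>N. H n = H N"
begin

lemma acc:
  fixes H :: "nat \<Rightarrow> 'm set"
  assumes M: "fg M" and H: "\<And>n. sub (H n) M" "\<And>n. H n \<subseteq> H (Suc n)"
  shows "\<exists>N. \<forall>n\<ge>N. H n = H N"
proof -
  obtain M' :: "'a umod" and h k where h: "fg M'" "h \<in> Iso M M'" "k \<in> Iso M' M"
    "\<forall>x\<in>carrier M. k (h x) = x" "\<forall>y\<in>carrier M'. h (k y) = y"
    using umod_ex[OF M] .
  have "sub (h ` H n) M'" for n
    by (rule sub_image[OF iso_hom[OF h(2)]]) (use M h H in simp_all)
  moreover have "h ` H n \<subseteq> h ` H (Suc n)" for n using H(2) by blast
  ultimately obtain N where N: "\<forall>n\<ge>N. h ` H n = h ` H N"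
    using acc_umod[OF h(1), of "\<lambda>n. h ` H n"] by blast
  have "k ` h ` H n = H n" for n
    using h(4) sub_subset[OF H(1)] by (force simp: image_image)
  then show ?thesis using N by metis
qed

lemma maximal_sub:
  assumes M: "fg M" and S: "S0 \<in> S" "\<And>H. H \<in> S \<Longrightarrow> sub H M"
  obtains H where "H \<in> S" "\<And>K. \<lbrakk>K \<in> S; H \<subseteq> K\<rbrakk> \<Longrightarrow> K = H"
proof (rule ccontr)
  assume "\<not> thesis"
  then have *: "\<exists>K. K \<in> S \<and> H \<subset> K" if "H \<in> S" for H
    using that \<open>(\<And>H. \<lbrakk>H \<in> S; \<And>K. \<lbrakk>K \<in> S; H \<subseteq> K\<rbrakk> \<Longrightarrow> K = H\<rbrakk> \<Longrightarrow> thesis)\<close> by blast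
  obtain F where F: "\<And>n :: nat. F n \<in> S" "\<And>n. F n \<subset> F (Suc n)"
    using dependent_nat_choice[of "\<lambda>_ H. H \<in> S" "\<lambda>_ H K. H \<subset> K"] S(1) * by metis
  obtain N where "\<forall>n\<ge>N. F n = F N" using acc[OF M, of F, OF S(2)[OF F(1)] psubset_imp_subset[OF F(2)]] by blast
  then have "F (Suc N) = F N" using le_SucI[OF order_refl] by blast
  with F(2) show False by blast
qed

text \<open>Take a maximal one among the finitely generated submodules of \<open>H\<close>. Adding
  one more element of \<open>H\<close> to its generators cannot enlarge it, so it is
  \<open>H\<close>.\<close>

lemma fg_submod:
  assumes M: "fg M" and H: "sub H M"
  shows "fg (submod M H)"
proof -
  have lmM: "lm M" using M by simp
  define span where "span T = \<Inter>{K. sub K M \<and> T \<subseteq> K}" for T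
  have span: "sub (span T) M" if "T \<subseteq> carrier M" for T
    by (rule subI[OF lmM]) (use lmM that in \<open>auto simp: span_def\<close>)
  have sp: "T \<subseteq> span T" "sub K M \<Longrightarrow> T \<subseteq> K \<Longrightarrow> span T \<subseteq> K" for T K by (auto simp: span_def)
  have HM: "H \<subseteq> carrier M" by (rule sub_subset[OF H])
  define S where "S = {span T | T. finite T \<and> T \<subseteq> H}"
  have "span {} \<in> S" unfolding S_def by blast
  moreover have "sub K M" if "K \<in> S" for K using that span HM unfolding S_def by blast
  ultimately obtain N where N: "N \<in> S" "\<And>K. \<lbrakk>K \<in> S; N \<subseteq> K\<rbrakk> \<Longrightarrow> K = N"
    using maximal_sub[OF M] by metis
  then obtain T where T: "finite T" "T \<subseteq> H" "N = span T" unfolding S_def by blast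
  have "x \<in> N" if x: "x \<in> H" for x
  proof -
    have "span (insert x T) \<in> S" unfolding S_def using T x by blast
    moreover have "N \<subseteq> span (insert x T)"
      unfolding T(3) by (rule sp(2)[OF span]) (use T x HM sp(1)[of "insert x T"] in auto)
    ultimately show ?thesis using N(2) sp(1)[of "insert x T"] by blast
  qed
  then have HN: "H \<subseteq> N" by blast
  have "K = carrier (submod M H)" if K: "sub K (submod M H)" "T \<subseteq> K" for K
  proof -
    have "sub K M" "K \<subseteq> H" using K(1) sub_submod[OF lmM H] by simp_all
    then show ?thesis using sp(2)[of K T] K(2) HN T(3) by auto
  qed
  then show ?thesis
    unfolding fg_iff_generators using T lmM H by (intro conjI exI[of _ T]) simp_all
qed

lemma fg_kernel: "\<lbrakk>f \<in> Hom M N; fg M; lm N\<rbrakk> \<Longrightarrow> fg (submod M (hom_kernel M N f))"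
  by (rule fg_submod) (simp_all add: sub_kernel)

lemma fg_mono:
  assumes f: "f \<in> Monic M N" and N: "fg N" and M: "lm M"
  shows "fg M"
proof -
  have H: "sub (f ` carrier M) N" by (rule sub_range) (use assms in simp_all)
  have "f \<in> Hom M (submod N (f ` carrier M))"
    using hom_into_submod[OF H, of f M] f by simp
  then have "f \<in> Iso M (submod N (f ` carrier M))"
    by (intro mono_epi_iso injI_mono imageI_epi) (use mono_inj[OF f] in simp_all)
  then have "isomorphic_modules A (submod N (f ` carrier M)) M"
    using isomorphic_sym[of M "submod N (f ` carrier M)"] M N H unfolding isomorphic_modules_def by auto
  then show ?thesis using fg_iso[OF fg_submod[OF N H]] M by blast
qed

text \<open>The envelope is a maximal essential extension inside the given injective module.\<close>

lemma injective_envelope_retract: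
  fixes M :: "('a, 'm) module" and E :: "('a, 'n) module"
  assumes M: "lm M" and E: "inje E" and f: "f \<in> Monic M E"
  obtains I :: "'a umod" and e where "inje I" "e \<in> Monic M I"
    "essential_submodule A (e ` carrier M) I" "retract I E"
proof -
  have fgE: "fg E" and lmE: "lm E" using inje_fg[OF E] by simp_all
  define N0 where "N0 = f ` carrier M"
  have N0: "sub N0 E" unfolding N0_def by (rule sub_range) (use f M lmE in simp_all)
  \<comment> \<open>The essential extensions of \<open>N0\<close> inside \<open>E\<close>;
    \<open>N\<close> will be a maximal one and the carrier of the envelope.\<close>
  define S where "S = {N. sub N E \<and> N0 \<subseteq> N \<and>
    (\<forall>H. sub H E \<longrightarrow> H \<subseteq> N \<longrightarrow> H \<inter> N0 = {\<zero>\<^bsub>E\<^esub>} \<longrightarrow> H = {\<zero>\<^bsub>E\<^esub>})}"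
  have "N0 \<in> S" unfolding S_def using N0 by (auto simp: Int_absorb2)
  then obtain N where N: "N \<in> S" "\<And>K. \<lbrakk>K \<in> S; N \<subseteq> K\<rbrakk> \<Longrightarrow> K = N"
    by (rule maximal_sub[OF fgE]) (auto simp: S_def)
  have N': "sub N E" "N0 \<subseteq> N" "\<And>H. \<lbrakk>sub H E; H \<subseteq> N; H \<inter> N0 = {\<zero>\<^bsub>E\<^esub>}\<rbrakk> \<Longrightarrow> H = {\<zero>\<^bsub>E\<^esub>}"
    using N(1) unfolding S_def by blast+
  \<comment> \<open>A maximal submodule \<open>H\<close> meeting \<open>N\<close> trivially makes
    \<open>N\<close> embed into \<open>quot E H\<close>. Injectivity of \<open>E\<close> extends the
    inclusion of \<open>N\<close> along this embedding to \<open>\<phi>\<close>, so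
    \<open>\<psi>\<close> fixes \<open>N\<close> and kills \<open>H\<close>.\<close>
  define U where "U = {H. sub H E \<and> H \<inter> N = {\<zero>\<^bsub>E\<^esub>}}"
  have "{\<zero>\<^bsub>E\<^esub>} \<in> U" unfolding U_def using lmE sub_zero[OF N'(1)] by auto
  then obtain H where H: "H \<in> U" "\<And>K. \<lbrakk>K \<in> U; H \<subseteq> K\<rbrakk> \<Longrightarrow> K = H"
    by (rule maximal_sub[OF fgE]) (auto simp: U_def)
  have H': "sub H E" "H \<inter> N = {\<zero>\<^bsub>E\<^esub>}" using H(1) unfolding U_def by blast+
  define q where "q = qrep E H"
  have q: "q \<in> Hom E (quot E H)" unfolding q_def using lmE H' by simp
  have qm: "q \<in> Monic (submod E N) (quot E H)"
  proof (rule monoI[OF hom_from_submod[OF q N'(1)]])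
    fix x assume x: "x \<in> carrier (submod E N)" "q x = \<zero>\<^bsub>quot E H\<^esub>"
    then have "x \<in> H \<inter> N"
      using qrep_zero_iff[OF lmE H'(1), of x] sub_carrier[OF N'(1)] by (simp add: q_def)
    then show "x = \<zero>\<^bsub>submod E N\<^esub>" using H'(2) by simp
  qed (use lmE N' H' in simp_all)
  obtain \<phi> where \<phi>: "\<phi> \<in> Hom (quot E H) E" "\<forall>x\<in>carrier (submod E N). \<phi> (q x) = x"
    using inje_extend[OF E fg_submod[OF fgE N'(1)] fg_quot[OF fgE H'(1)] qm, of "\<lambda>x. x"]
      mono_hom[OF submod_incl[OF N'(1)]] by blast
  define \<psi> where "\<psi> x = \<phi> (q x)" for x
  have \<psi>: "\<psi> \<in> Hom E E" unfolding \<psi>_def by (rule hom_comp[OF q \<phi>(1)])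
  have \<psi>N: "\<psi> x = x" if "x \<in> N" for x using \<phi>(2) that by (simp add: \<psi>_def)
  \<comment> \<open>The preimage of \<open>L\<close> under \<open>\<psi>\<close> meets
    \<open>N\<close> trivially and contains \<open>H\<close>, so it equals \<open>H\<close>.
    Comparison with the zero submodule shows that a submodule of the image of \<open>\<psi>\<close>
    meeting \<open>N\<close> trivially is zero.\<close>
  have pre: "{x \<in> carrier E. \<psi> x \<in> L} = H" if L: "sub L E" "L \<inter> N = {\<zero>\<^bsub>E\<^esub>}" for L
  proof (rule H(2))
    have "{x \<in> carrier E. \<psi> x \<in> L} \<inter> N = {\<zero>\<^bsub>E\<^esub>}"
      using \<psi>N L(2) sub_carrier[OF N'(1)] by auto
    then show "{x \<in> carrier E. \<psi> x \<in> L} \<in> U"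
      unfolding U_def using sub_preimage[OF \<psi> lmE lmE L(1)] by blast
    show "H \<subseteq> {x \<in> carrier E. \<psi> x \<in> L}"
    proof
      fix x assume x: "x \<in> H"
      then have "\<psi> x = \<zero>\<^bsub>E\<^esub>"
        using qrep_zero_iff[OF lmE H'(1), of x] sub_carrier[OF H'(1) x] hom_zero[OF \<phi>(1)] lmE H'(1)
        by (simp add: \<psi>_def q_def)
      then show "x \<in> {x \<in> carrier E. \<psi> x \<in> L}" using sub_carrier[OF H'(1) x] sub_zero[OF L(1)] by simp
    qed
  qed
  \<comment> \<open>The image of \<open>\<psi>\<close> is again an essential extension of
    \<open>N0\<close>; maximality of \<open>N\<close> turns \<open>\<psi>\<close> into a retraction
    of \<open>E\<close> onto \<open>N\<close>, and \<open>N\<close> inherits injectivity.\<close>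
  have "\<psi> ` carrier E = N"
  proof (rule N(2))
    have "N \<subseteq> \<psi> ` carrier E" using \<psi>N sub_carrier[OF N'(1)] by (metis image_eqI subsetI)
    then show "N \<subseteq> \<psi> ` carrier E" .
    have "L = {\<zero>\<^bsub>E\<^esub>}" if L: "sub L E" "L \<subseteq> \<psi> ` carrier E" "L \<inter> N0 = {\<zero>\<^bsub>E\<^esub>}" for L
    proof -
      have "L \<inter> N = {\<zero>\<^bsub>E\<^esub>}"
        by (rule N'(3)[OF sub_Int[OF lmE L(1) N'(1)]]) (use L(3) N'(2) in auto)
      then have e: "{x \<in> carrier E. \<psi> x \<in> L} = H" "{x \<in> carrier E. \<psi> x \<in> {\<zero>\<^bsub>E\<^esub>}} = H"
        using pre[OF L(1)] pre[of "{\<zero>\<^bsub>E\<^esub>}"] lmE sub_zero[OF N'(1)] by auto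
      have "y = \<zero>\<^bsub>E\<^esub>" if y: "y \<in> L" for y
      proof -
        obtain x where "x \<in> carrier E" "y = \<psi> x" using L(2) y by blast
        then show ?thesis using e y by blast
      qed
      then show ?thesis using sub_zero[OF L(1)] by blast
    qed
    then show "\<psi> ` carrier E \<in> S"
      unfolding S_def using \<open>N \<subseteq> \<psi> ` carrier E\<close> N'(2) sub_range[OF \<psi> lmE lmE] by blast
  qed
  then have \<psi>N': "\<psi> \<in> Hom E (submod E N)" using hom_into_submod[OF N'(1), of \<psi> E] \<psi> by simp
  have rN: "retract (submod E N) E"
    by (rule retractI[OF mono_hom[OF submod_incl[OF N'(1)]] \<psi>N']) (simp add: \<psi>N)
  have injN: "inje (submod E N)" by (rule retract_inje[OF rN E]) (use lmE N' in simp)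
  have lmN: "lm (submod E N)" using lmE N' by simp
  obtain I :: "'a umod" and h k where h: "fg I" "h \<in> Iso (submod E N) I" "k \<in> Iso I (submod E N)"
    "\<forall>x\<in>carrier (submod E N). k (h x) = x" "\<forall>y\<in>carrier I. h (k y) = y"
    using umod_ex[OF inje_fg[OF injN]] .
  have rI: "retract I (submod E N)" by (rule retractI[OF iso_hom[OF h(3)] iso_hom[OF h(2)]]) (use h(5) in simp)
  have f': "f \<in> Monic M (submod E N)"
    by (rule injI_mono) (use hom_into_submod[OF N'(1), of f M] f N'(2) mono_inj[OF f] in \<open>simp_all add: N0_def\<close>)
  show ?thesis
  proof (rule that)
    show "inje I" using retract_inje[OF rI injN] h(1) by simp
    show "(\<lambda>x. h (f x)) \<in> Monic M I" by (rule mono_comp[OF f' iso_mono[OF h(2)]])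
    show "retract I E" by (rule retract_trans[OF rI rN])
    have im: "(\<lambda>x. h (f x)) ` carrier M = h ` N0" unfolding N0_def by (simp add: image_image)
    have hh: "h \<in> Hom (submod E N) I" using h(2) by simp
    show "essential_submodule A ((\<lambda>x. h (f x)) ` carrier M) I"
      unfolding essential_submodule_def im
    proof (intro conjI allI impI)
      show "sub (h ` N0) I"
        by (rule sub_image[OF hh lmN]) (use h(1) sub_submod[OF lmE N'(1)] N0 N'(2) in simp_all)
      fix L assume L: "sub L I" "L \<inter> h ` N0 = {\<zero>\<^bsub>I\<^esub>}"
      let ?L = "{x \<in> carrier (submod E N). h x \<in> L}"
      have h0: "h x = \<zero>\<^bsub>I\<^esub> \<longleftrightarrow> x = \<zero>\<^bsub>E\<^esub>" if "x \<in> N" for x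
        using mono_zero_iff[OF iso_mono[OF h(2)] lmN _] h(1) that by simp
      have L': "sub ?L E" "?L \<subseteq> N"
        using sub_preimage[OF hh lmN _ L(1)] h(1) sub_submod[OF lmE N'(1)] by simp_all
      have "?L \<inter> N0 = {\<zero>\<^bsub>E\<^esub>}"
      proof (intro equalityI subsetI)
        fix x assume "x \<in> ?L \<inter> N0"
        then show "x \<in> {\<zero>\<^bsub>E\<^esub>}" using L(2) h0[of x] by auto
      qed (use sub_zero[OF L'(1)] sub_zero[OF N0] in auto)
      then have e: "?L = {\<zero>\<^bsub>E\<^esub>}" by (rule N'(3)[OF L'])
      have "y = \<zero>\<^bsub>I\<^esub>" if y: "y \<in> L" for y
      proof -
        have yI: "y \<in> carrier I" by (rule sub_carrier[OF L(1) y])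
        then have "k y \<in> ?L" using hom_closed[OF iso_hom[OF h(3)] yI] h(5) y by simp
        then have "h (k y) = \<zero>\<^bsub>I\<^esub>" using e h0[of "k y"] by auto
        then show ?thesis using h(5) yI by simp
      qed
      then show "L = {\<zero>\<^bsub>I\<^esub>}" using sub_zero[OF L(1)] by blast
    qed
  qed
qed

subsection \<open>Decomposition into indecomposable modules\<close>

definition decomposable :: "('a, 'm) module \<Rightarrow> bool" where
  "decomposable M \<longleftrightarrow> (\<exists>n (X :: nat \<Rightarrow> 'a umod). (\<forall>i<n. indecomposable_module A (X i)) \<and>
     isomorphic_modules A M (direct_sum n X))"

lemma decomposable_iso: "\<lbrakk>isomorphic_modules A M N; decomposable N\<rbrakk> \<Longrightarrow> decomposable M"
  unfolding decomposable_def using isomorphic_trans by blast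

lemma indecomposable_fg: "indecomposable_module A X \<Longrightarrow> fg X"
  by (simp add: indecomposable_module_def)

lemma decomposable_ds2:
  assumes "decomposable M" "decomposable N"
  shows "decomposable (direct_sum2 M N)"
proof -
  obtain n and X :: "nat \<Rightarrow> 'a umod" where X: "\<forall>i<n. indecomposable_module A (X i)"
    "isomorphic_modules A M (direct_sum n X)"
    using assms(1) unfolding decomposable_def by blast
  obtain m and Y :: "nat \<Rightarrow> 'a umod" where Y: "\<forall>i<m. indecomposable_module A (Y i)"
    "isomorphic_modules A N (direct_sum m Y)"
    using assms(2) unfolding decomposable_def by blast
  have "isomorphic_modules A (direct_sum2 (direct_sum n X) (direct_sum m Y))
      (direct_sum (n + m) (\<lambda>i. if i < n then X i else Y (i - n)))"
    by (rule ds_append_iso) (use X(1) Y(1) indecomposable_fg fg_lm in blast)+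
  with ds2_map_iso[OF X(2) Y(2)] have "isomorphic_modules A (direct_sum2 M N)
      (direct_sum (n + m) (\<lambda>i. if i < n then X i else Y (i - n)))"
    by (rule isomorphic_trans)
  then show ?thesis
    unfolding decomposable_def using X(1) Y(1)
    by (intro exI[of _ "n + m"] exI[of _ "\<lambda>i. if i < n then X i else Y (i - n)"]) simp
qed

lemma decomposable_zero:
  assumes "zero_module M" "lm M"
  shows "decomposable M"
proof -
  have "(\<lambda>_. \<zero>\<^bsub>direct_sum 0 X\<^esub>) \<in> Iso M (direct_sum 0 X)" for X :: "nat \<Rightarrow> 'a umod"
    by (intro mono_epi_iso injI_mono imageI_epi hom_const_zero lm_ds0)
       (use assms zero_ds[of X] in \<open>auto simp: zero_module_def\<close>)
  then show ?thesis unfolding decomposable_def isomorphic_modules_def by blast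
qed

lemma decomposable_indecomposable:
  fixes M :: "'a umod"
  assumes "indecomposable_module A M"
  shows "decomposable M"
  unfolding decomposable_def
  using assms ds_one_iso[of "\<lambda>_. M"] indecomposable_fg[OF assms]
  by (intro exI[of _ 1] exI[of _ "\<lambda>_. M"]) simp

text \<open>Noetherian induction on quotients. For \<open>N\<close> maximal with
  \<open>quot M N\<close> not decomposable, that quotient is nonzero and not indecomposable, so it
  is a sum of nonzero \<open>X\<close> and \<open>Y\<close>. Both are proper quotients of it, hence
  decomposable.\<close>

lemma decomposable_umod:
  fixes M :: "'a umod"
  assumes M: "fg M"
  shows "decomposable M"
proof (rule ccontr)
  assume nd: "\<not> decomposable M"
  have lmM: "lm M" using M by simp
  define S where "S = {N. sub N M \<and> \<not> decomposable (quot M N)}"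
  have "{\<zero>\<^bsub>M\<^esub>} \<in> S"
  proof -
    have "id \<in> Epic M M" by (rule imageI_epi) simp_all
    moreover have "hom_kernel M M id = {\<zero>\<^bsub>M\<^esub>}" using lmM by (auto simp: hom_kernel_def)
    ultimately have "isomorphic_modules A (quot M {\<zero>\<^bsub>M\<^esub>}) M"
      using quot_kernel_iso[of id M M] lmM by simp
    then have "isomorphic_modules A M (quot M {\<zero>\<^bsub>M\<^esub>})"
      by (rule isomorphic_sym) (use lmM in simp_all)
    then show ?thesis unfolding S_def using nd decomposable_iso lmM by auto
  qed
  then obtain N where N: "N \<in> S" "\<And>K. \<lbrakk>K \<in> S; N \<subseteq> K\<rbrakk> \<Longrightarrow> K = N"
    by (rule maximal_sub[OF M]) (auto simp: S_def)
  have N': "sub N M" "\<not> decomposable (quot M N)" using N(1) by (simp_all add: S_def)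
  have fgQ: "fg (quot M N)" using fg_quot[OF M N'(1)] .
  have "\<not> zero_module (quot M N)" using N'(2) decomposable_zero[of "quot M N"] fgQ by auto
  moreover have "\<not> indecomposable_module A (quot M N)" using N'(2) decomposable_indecomposable by blast
  ultimately obtain X Y :: "'a umod" where XY: "fg X" "fg Y" "\<not> zero_module X" "\<not> zero_module Y"
    "isomorphic_modules A (quot M N) (direct_sum2 X Y)"
    using fgQ unfolding indecomposable_module_def by blast
  have lm: "lm X" "lm Y" "lm (quot M N)" using XY fgQ by simp_all
  obtain h where h: "h \<in> Iso (quot M N) (direct_sum2 X Y)" using XY(5) unfolding isomorphic_modules_def by blast
  define g where "g x = h (qrep M N x)" for x
  have g: "g \<in> Epic M (direct_sum2 X Y)"
    unfolding g_def by (rule epi_comp[OF qrep_epi[OF lmM N'(1)] iso_epi[OF h]])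
  have gN: "g x = \<zero>\<^bsub>direct_sum2 X Y\<^esub> \<longleftrightarrow> x \<in> N" if "x \<in> carrier M" for x
    using mono_zero_iff[OF iso_mono[OF h] lm(3) lm_ds2[OF lm(1,2)] hom_closed[OF qrep_hom[OF lmM N'(1)] that]]
      qrep_zero_iff[OF lmM N'(1) that] by (simp add: g_def)
  \<comment> \<open>A quotient \<open>Z\<close> of the sum that kills some nonzero \<open>w\<close>
    is the quotient of \<open>M\<close> by a submodule strictly larger than \<open>N\<close>, so
    maximality applies to it.\<close>
  have key: "decomposable Z"
    if p: "p \<in> Epic (direct_sum2 X Y) Z" and Z: "fg Z"
      and z: "w \<in> carrier (direct_sum2 X Y)" "p w = \<zero>\<^bsub>Z\<^esub>" "w \<noteq> \<zero>\<^bsub>direct_sum2 X Y\<^esub>"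
    for Z :: "'a umod" and p w
  proof (rule ccontr)
    assume ndZ: "\<not> decomposable Z"
    have gp: "(\<lambda>x. p (g x)) \<in> Epic M Z" by (rule epi_comp[OF g p])
    let ?K = "hom_kernel M Z (\<lambda>x. p (g x))"
    have K: "sub ?K M" by (rule sub_kernel) (use gp lmM Z in simp_all)
    have qZ: "isomorphic_modules A (quot M ?K) Z" by (rule quot_kernel_iso[OF gp lmM]) (use Z in simp)
    then have "isomorphic_modules A Z (quot M ?K)"
      by (rule isomorphic_sym) (use lmM K Z in simp_all)
    then have "?K \<in> S" unfolding S_def using K ndZ decomposable_iso by blast
    moreover have "N \<subseteq> ?K"
    proof
      fix x assume x: "x \<in> N"
      then have "g x = \<zero>\<^bsub>direct_sum2 X Y\<^esub>" "x \<in> carrier M" using gN sub_carrier[OF N'(1)] by simp_all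
      moreover have "p \<zero>\<^bsub>direct_sum2 X Y\<^esub> = \<zero>\<^bsub>Z\<^esub>"
        by (rule hom_zero[OF epi_hom[OF p] lm_ds2[OF lm(1,2)] fg_lm[OF Z]])
      ultimately show "x \<in> ?K" by (simp add: hom_kernel_def)
    qed
    ultimately have KN: "?K = N" by (rule N(2))
    obtain x where x: "x \<in> carrier M" "g x = w" using epi_ex[OF g z(1)] by blast
    then have "x \<in> ?K" using z(2) by (simp add: hom_kernel_def)
    then show False using KN gN[OF x(1)] x(2) z(3) by simp
  qed
  obtain x where x: "x \<in> carrier X" "x \<noteq> \<zero>\<^bsub>X\<^esub>" using XY(3) lm(1) unfolding zero_module_def by auto
  obtain y where y: "y \<in> carrier Y" "y \<noteq> \<zero>\<^bsub>Y\<^esub>" using XY(4) lm(2) unfolding zero_module_def by auto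
  have "decomposable X"
    by (rule key[of fst X "(\<zero>\<^bsub>X\<^esub>, y)"]) (use XY lm y in \<open>auto intro!: epiI bexI[of _ "(_, \<zero>\<^bsub>Y\<^esub>)"]\<close>)
  moreover have "decomposable Y"
    by (rule key[of snd Y "(x, \<zero>\<^bsub>Y\<^esub>)"]) (use XY lm x in \<open>auto intro!: epiI bexI[of _ "(\<zero>\<^bsub>X\<^esub>, _)"]\<close>)
  ultimately have "decomposable (quot M N)"
    using decomposable_iso[OF XY(5)] decomposable_ds2 by blast
  with N'(2) show False ..
qed

end

context modules_over
begin

section \<open>Projective and injective dimension through iterated short exact sequences; splicing
  of minimal resolutions\<close>

section \<open>Homological dimensions\<close>

lemma ex_zero_umod: obtains Z :: "'a umod" where "fg Z" "zero_module Z"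
proof -
  let ?D = "direct_sum 0 (\<lambda>_. regular_module A)"
  have lmD: "lm ?D" by (rule lm_ds0)
  obtain Z :: "'a umod" and h k where h: "fg Z" "h \<in> Iso ?D Z" "k \<in> Iso Z ?D"
    "\<forall>x\<in>carrier ?D. k (h x) = x" "\<forall>y\<in>carrier Z. h (k y) = y"
    using umod_ex[OF zero_module_fg[OF lmD zero_ds]] .
  have "carrier Z = h ` {\<zero>\<^bsub>?D\<^esub>}"
    using epi_image[OF iso_epi[OF h(2)]] zero_ds[of "\<lambda>_. regular_module A"] by (simp add: zero_module_def)
  then have "zero_module Z" using h(1,2) lmD by (simp add: zero_module_def)
  with h(1) show ?thesis by (rule that)
qed

lemma kernel_comp_mono:
  assumes "i \<in> Monic L N" "lm L" "lm N" "f \<in> Hom M L"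
  shows "hom_kernel M N (\<lambda>x. i (f x)) = hom_kernel M L f"
  using mono_zero_iff[OF assms(1-3)] hom_closed[OF assms(4)] by (auto simp: hom_kernel_def)

text \<open>Projective dimension at most \<open>n\<close>, unwound into short exact sequences so
  that proofs can go by induction on \<open>n\<close>; over a noetherian ring
  \<open>projdim_le_iff\<close> ties it to \<open>projdim\<close>.\<close>

primrec pd_le :: "nat \<Rightarrow> 'a umod \<Rightarrow> bool" where
  "pd_le 0 M \<longleftrightarrow> proj M"
| "pd_le (Suc n) M \<longleftrightarrow> (\<exists>(P :: 'a umod) (K :: 'a umod) i p. proj P \<and> fg K \<and> ses K i P p M \<and> pd_le n K)"

lemma pd_le_Suc: "\<lbrakk>pd_le n M; fg M\<rbrakk> \<Longrightarrow> pd_le (Suc n) M"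
proof (induction n arbitrary: M)
  case 0
  then have M: "lm M" "proj M" by simp_all
  let ?Z = "submod M {\<zero>\<^bsub>M\<^esub>}"
  have Z: "lm ?Z" "zero_module ?Z" using M by (simp_all add: zero_module_def)
  have "(\<lambda>x. x) \<in> Monic ?Z M" by (rule submod_incl) (use M in simp)
  moreover have "id \<in> Epic M M" by (rule imageI_epi) simp_all
  ultimately have "ses ?Z (\<lambda>x. x) M id M" by (rule sesI) simp_all
  then show ?case using M(2) zero_module_fg[OF Z] zero_module_proj[OF zero_module_fg[OF Z] Z(2)] by auto
next
  case (Suc n)
  then show ?case by (metis pd_le.simps(2))
qed

lemma pd_le_mono: "\<lbrakk>pd_le m M; fg M; m \<le> n\<rbrakk> \<Longrightarrow> pd_le n M"
  by (induction n) (auto simp: le_Suc_eq simp del: pd_le.simps intro: pd_le_Suc)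

lemma pd_le_resolution:
  "\<lbrakk>pd_le n M; fg M\<rbrakk> \<Longrightarrow> \<exists>P e d. projective_resolution A M P e d \<and> (\<forall>i>n. zero_module (P i))"
proof (induction n arbitrary: M)
  case 0
  then have M: "lm M" "proj M" by simp_all
  obtain Z :: "'a umod" where Z: "fg Z" "zero_module Z" by (rule ex_zero_umod)
  \<comment> \<open>The resolution is padded with zero modules. As \<open>d i\<close> goes from
    \<open>P (Suc i)\<close> to \<open>P i\<close>, its constant value is the zero of
    \<open>P i\<close>.\<close>
  let ?P = "case_nat M (\<lambda>_. Z)" and ?d = "\<lambda>i _. \<zero>\<^bsub>case_nat M (\<lambda>_. Z) i\<^esub>"
  have "projective_resolution A M ?P id ?d"
    unfolding projective_resolution_def
  proof (intro conjI allI)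
    show "proj (?P i)" for i using M(2) zero_module_proj[OF Z] by (cases i) simp_all
    show "id \<in> Epic (?P 0) M" by (rule imageI_epi) simp_all
    show "?d i \<in> Hom (?P (Suc i)) (?P i)" for i
      by (rule hom_const_zero) (use M Z in \<open>cases i, simp_all\<close>)
    show "?d 0 ` carrier (?P 1) = hom_kernel (?P 0) M id"
      using Z(2) M by (auto simp: hom_kernel_def zero_module_def)
    show "?d (Suc i) ` carrier (?P (Suc (Suc i))) = hom_kernel (?P (Suc i)) (?P i) (?d i)" for i
      using Z(2) by (auto simp: hom_kernel_def zero_module_def)
  qed
  moreover have "\<forall>i>0. zero_module (?P i)" using Z(2) by (auto split: nat.split)
  ultimately show ?case by blast
next
  case (Suc n)
  then obtain P0 K :: "'a umod" and i p where P0: "proj P0" "fg K" "ses K i P0 p M" "pd_le n K" by auto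
  obtain P e d where res: "projective_resolution A K P e d" and z: "\<forall>i>n. zero_module (P i)"
    using Suc.IH[OF P0(4,2)] by blast
  have lm: "lm K" "lm P0" "lm M" using P0(2) proj_fg[OF P0(1)] Suc.prems(2) by simp_all
  have r: "proj (P j)" "e \<in> Epic (P 0) K" "d j \<in> Hom (P (Suc j)) (P j)"
    "d 0 ` carrier (P 1) = hom_kernel (P 0) K e"
    "d (Suc j) ` carrier (P (Suc (Suc j))) = hom_kernel (P (Suc j)) (P j) (d j)" for j
    using res by (simp_all only: projective_resolution_def)
  have i: "i \<in> Hom K P0" using P0(3) by simp
  let ?P = "case_nat P0 P" and ?d = "case_nat (\<lambda>x. i (e x)) d"
  have "projective_resolution A M ?P p ?d"
    unfolding projective_resolution_def
  proof (intro conjI allI)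
    show "proj (?P j)" for j using P0(1) r(1) by (cases j) simp_all
    show "p \<in> Epic (?P 0) M" using ses_epi[OF P0(3)] by simp
    show "?d j \<in> Hom (?P (Suc j)) (?P j)" for j
      using hom_comp[OF epi_hom[OF r(2)] i] r(3) by (cases j) simp_all
    have "(\<lambda>x. i (e x)) ` carrier (P 0) = i ` carrier K"
      using epi_image[OF r(2)] by (metis image_image)
    then show "?d 0 ` carrier (?P 1) = hom_kernel (?P 0) M p"
      using ses_ker[OF P0(3)] by simp
    show "?d (Suc j) ` carrier (?P (Suc (Suc j))) = hom_kernel (?P (Suc j)) (?P j) (?d j)" for j
    proof (cases j)
      case 0
      then show ?thesis
        using r(4) kernel_comp_mono[OF ses_mono[OF P0(3)] lm(1,2) epi_hom[OF r(2)]] by simp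
    next
      case (Suc j')
      then show ?thesis using r(5) by simp
    qed
  qed
  moreover have "\<forall>j>Suc n. zero_module (?P j)" using z by (auto split: nat.split)
  ultimately show ?case by blast
qed

end

context noetherian_modules
begin

text \<open>The shifted complex resolves the kernel of \<open>e\<close>, which is finitely generated
  because the ring is noetherian. For \<open>n = 0\<close> the vanishing of \<open>P 1\<close> makes
  \<open>e\<close> an isomorphism.\<close>

lemma resolution_pd_le:
  "\<lbrakk>projective_resolution A M P e d; \<forall>i>n. zero_module (P i); fg M\<rbrakk> \<Longrightarrow> pd_le n M"
proof (induction n arbitrary: M P e d)
  case 0
  have r': "proj (P j)" "e \<in> Epic (P 0) M" "d j \<in> Hom (P (Suc j)) (P j)"
    "d 0 ` carrier (P 1) = hom_kernel (P 0) M e" for j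
    using 0(1) by (simp_all only: projective_resolution_def)
  note r = r'(1)[of 0] r'(1)[of 1] r'(2) r'(3)[of 0, folded One_nat_def] r'(4)
  have lm: "lm (P 0)" "lm (P 1)" "lm M" using proj_fg[OF r(1)] proj_fg[OF r(2)] 0(3) by simp_all
  have "hom_kernel (P 0) M e = {\<zero>\<^bsub>P 0\<^esub>}"
    using r(4,5) 0(2) lm by (auto simp: zero_module_def)
  then have "e \<in> Monic (P 0) M"
    by (intro monoI) (use r(3) lm in \<open>auto simp: hom_kernel_def\<close>)
  then have "isomorphic_modules A (P 0) M"
    unfolding isomorphic_modules_def using r(3) mono_epi_iso by blast
  then show ?case
    using retract_proj[OF retract_iso(2)[OF _ lm(1,3)] r(1) lm(3)] by simp
next
  case (Suc n)
  have r: "proj (P j)" "e \<in> Epic (P 0) M" "d j \<in> Hom (P (Suc j)) (P j)"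
    "d 0 ` carrier (P 1) = hom_kernel (P 0) M e"
    "d (Suc j) ` carrier (P (Suc (Suc j))) = hom_kernel (P (Suc j)) (P j) (d j)" for j
    using Suc(2) by (simp_all only: projective_resolution_def)
  have lm: "lm (P j)" "lm M" for j using proj_fg[OF r(1)] Suc.prems(3) by simp_all
  let ?K = "submod (P 0) (hom_kernel (P 0) M e)"
  have K: "sub (hom_kernel (P 0) M e) (P 0)" by (rule sub_kernel) (use r(2) lm in simp_all)
  have fgK: "fg ?K" by (rule fg_kernel) (use r(2) proj_fg[OF r(1)] lm in simp_all)
  have s: "ses ?K (\<lambda>x. x) (P 0) e M" by (rule ses_submod[OF r(2) lm(1,2)])
  have d0: "d 0 \<in> Hom (P 1) (P 0)" using r(3)[of 0] by simp
  have "projective_resolution A ?K (\<lambda>i. P (Suc i)) (d 0) (\<lambda>i. d (Suc i))"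
    unfolding projective_resolution_def
  proof (intro conjI allI)
    show "d 0 \<in> Epic (P (Suc 0)) ?K"
      by (rule imageI_epi) (use hom_into_submod[OF K, of "d 0" "P 1"] d0 r(4) in simp_all)
    show "d (Suc 0) ` carrier (P (Suc 1)) = hom_kernel (P (Suc 0)) ?K (d 0)"
      using r(5)[of 0] by (simp add: hom_kernel_def)
  qed (use r in simp_all)
  moreover have "\<forall>i>n. zero_module (P (Suc i))" using Suc.prems(2) by simp
  ultimately have "pd_le n ?K" using Suc.IH fgK by blast
  then show ?case using r(1) fgK s by auto
qed

lemma projdim_le_iff:
  assumes M: "fg M"
  shows "projdim A M \<le> enat n \<longleftrightarrow> pd_le n M"
proof
  assume "projdim A M \<le> enat n"
  \<comment> \<open>With the strict bound \<open>Suc n\<close>, \<open>Inf_less_iff\<close> yields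
    an actual resolution of some length \<open>m \<le> n\<close>.\<close>
  then have "projdim A M < enat (Suc n)" by (simp add: order_le_less_trans)
  then obtain m P e d where "enat m < enat (Suc n)" "projective_resolution A M P e d" "\<forall>i>m. zero_module (P i)"
    unfolding projdim_def Inf_less_iff by blast
  then show "pd_le n M" using resolution_pd_le pd_le_mono M by (metis enat_ord_simps(2) less_Suc_eq_le)
next
  assume "pd_le n M"
  then show "projdim A M \<le> enat n"
    unfolding projdim_def using pd_le_resolution[OF _ M] by (intro Inf_lower) blast
qed

lemma gldim_le_iff: "gldim A \<le> enat n \<longleftrightarrow> (\<forall>M :: 'a umod. fg M \<longrightarrow> pd_le n M)"
  unfolding gldim_def Sup_le_iff using projdim_le_iff by auto

lemma gldim_finite:
  assumes "gldim A < \<infinity>"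
  obtains n where "\<forall>M :: 'a umod. fg M \<longrightarrow> pd_le n M"
proof -
  obtain n where "gldim A = enat n" using assms by auto
  then have "gldim A \<le> enat n" by simp
  then show ?thesis using that unfolding gldim_le_iff by blast
qed

lemma presentation:
  fixes M :: "('a, 'm) module"
  assumes M: "fg M"
  obtains P K :: "'a umod" and i p where "proj P" "fg K" "ses K i P p M"
proof -
  obtain m f where f: "f \<in> Epic (power_module (regular_module A) m) M" by (rule free_cover[OF M])
  let ?F = "power_module (regular_module A) m"
  have F: "proj ?F" "fg ?F" "lm ?F" using proj_free[of m] proj_fg[OF proj_free[of m]] by simp_all
  obtain P :: "'a umod" and h k where h: "fg P" "h \<in> Iso ?F P" "k \<in> Iso P ?F"
    "\<forall>x\<in>carrier ?F. k (h x) = x" "\<forall>y\<in>carrier P. h (k y) = y"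
    using umod_ex[OF F(2)] .
  have P: "proj P"
    by (rule retract_proj[OF retractI[OF iso_hom[OF h(3)] iso_hom[OF h(2)]] F(1)]) (use h in simp_all)
  have g: "(\<lambda>x. f (k x)) \<in> Epic P M" by (rule epi_comp[OF iso_epi[OF h(3)] f])
  let ?K = "submod P (hom_kernel P M (\<lambda>x. f (k x)))"
  have "fg ?K" by (rule fg_kernel) (use g h(1) M in simp_all)
  moreover have "ses ?K (\<lambda>x. x) P (\<lambda>x. f (k x)) M" by (rule ses_submod[OF g]) (use h(1) M in simp_all)
  ultimately show ?thesis using P that by blast
qed

text \<open>The bound on the dimension provides one pair of presentations with projective second
  syzygy \<open>L2\<close>. Schanuel's lemma applied twice makes \<open>K1\<close> a summand of
  \<open>L1 + P0\<close> and then \<open>K2\<close> a summand of \<open>L2 + 0 + P1\<close>.\<close>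

lemma second_syzygy_projective:
  fixes M :: "'a umod" and K2 :: "('a, 'k2) module"
  assumes pd: "pd_le 2 M" and fg: "fg M" "fg K1" "lm K2"
    and s1: "ses K1 i1 P0 p0 M" and s2: "ses K2 i2 P1 p1 K1" and P: "proj P0" "proj P1"
  shows "proj K2"
proof -
  obtain Q0 Q1 L1 L2 :: "'a umod" and j1 q0 j2 q1 where Q: "proj Q0" "fg L1" "ses L1 j1 Q0 q0 M"
    "proj Q1" "fg L2" "ses L2 j2 Q1 q1 L1" "proj L2"
    using pd by (auto simp: numeral_2_eq_2)
  have lm: "lm K1" "lm L1" "lm L2" "lm P0" "lm P1" using fg Q proj_fg[OF P(1)] proj_fg[OF P(2)] by simp_all
  have r1: "retract K1 (direct_sum2 L1 P0)"
    by (rule syzygy_retract[OF retract_refl s1 Q(3) P(1) Q(1) fg(1,1) lm(1,2)])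
  let ?Z = "submod P0 {\<zero>\<^bsub>P0\<^esub>}"
  \<comment> \<open>The identity of \<open>P0\<close> as a presentation with zero kernel; added to
    the presentation of \<open>L1\<close> it presents \<open>L1 + P0\<close> without enlarging the
    syzygy \<open>L2\<close>.\<close>
  have id: "ses ?Z (\<lambda>x. x) P0 (\<lambda>x. x) P0"
    by (rule sesI[OF submod_incl]) (use lm in \<open>auto intro: imageI_epi\<close>)
  have Z: "lm ?Z" "zero_module ?Z" using lm by (simp_all add: zero_module_def)
  have s: "ses (direct_sum2 L2 ?Z) (\<lambda>z. (j2 (fst z), snd z)) (direct_sum2 Q1 P0)
      (\<lambda>z. (q1 (fst z), snd z)) (direct_sum2 L1 P0)"
    using ses_ds2_map[OF Q(6) id] by simp
  have "retract K2 (direct_sum2 (direct_sum2 L2 ?Z) P1)"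
    by (rule syzygy_retract[OF r1 s2 s P(2) proj_ds2[OF Q(4) P(1)]])
       (use fg Q proj_fg[OF P(1)] Z in simp_all)
  moreover have "proj (direct_sum2 (direct_sum2 L2 ?Z) P1)"
    by (intro proj_ds2 Q P zero_module_proj zero_module_fg Z)
  ultimately show ?thesis using retract_proj fg(3) by blast
qed

text \<open>If all terms from \<open>I 2\<close> on vanish, exactness at \<open>I 1\<close> makes
  \<open>d 0\<close> surjective. Conversely, the short exact sequence is padded with zero
  modules.\<close>

lemma injdim_le_1_iff:
  fixes T :: "('a, 't) module"
  assumes T: "lm T"
  shows "injdim A T \<le> 1 \<longleftrightarrow> (\<exists>(I :: 'a umod) (I' :: 'a umod) j q. inje I \<and> inje I' \<and> ses T j I q I')"
proof
  assume "injdim A T \<le> 1"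
  then have "injdim A T < enat 2" by (simp add: order_le_less_trans one_enat_def)
  then obtain m I e d where m: "enat m < enat 2" "injective_resolution A T I e d" "\<forall>i>m. zero_module (I i)"
    unfolding injdim_def Inf_less_iff by blast
  have r: "inje (I i)" "e \<in> Monic T (I 0)" "d i \<in> Hom (I i) (I (Suc i))"
    "e ` carrier T = hom_kernel (I 0) (I 1) (d 0)"
    "d i ` carrier (I i) = hom_kernel (I (Suc i)) (I (Suc (Suc i))) (d (Suc i))" for i
    using m(2) by (simp_all only: injective_resolution_def)
  have "zero_module (I 2)" using m(1,3) by simp
  then have "hom_kernel (I 1) (I 2) (d 1) = carrier (I 1)"
    using hom_closed[OF r(3)[of 1]] by (auto simp: hom_kernel_def zero_module_def numeral_2_eq_2)
  then have "d 0 \<in> Epic (I 0) (I 1)"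
    by (intro imageI_epi) (use r(3)[of 0] r(5)[of 0] in \<open>simp_all add: numeral_2_eq_2\<close>)
  then have "ses T e (I 0) (d 0) (I 1)" using r(2,4) by (simp add: short_exact_def)
  then show "\<exists>(I :: 'a umod) (I' :: 'a umod) j q. inje I \<and> inje I' \<and> ses T j I q I'"
    using r(1) by blast
next
  assume "\<exists>(I :: 'a umod) (I' :: 'a umod) j q. inje I \<and> inje I' \<and> ses T j I q I'"
  then obtain I I' :: "'a umod" and j q where I: "inje I" "inje I'" "ses T j I q I'" by blast
  obtain Z :: "'a umod" where Z: "fg Z" "zero_module Z" by (rule ex_zero_umod)
  let ?I = "case_nat I (case_nat I' (\<lambda>_. Z))" and ?d = "case_nat q (\<lambda>_ _. \<zero>\<^bsub>Z\<^esub>)"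
  have lmI: "lm I'" using inje_fg[OF I(2)] by simp
  have q: "q \<in> Hom I I'" using I(3) by simp
  have "injective_resolution A T ?I j ?d"
    unfolding injective_resolution_def
  proof (intro conjI allI)
    show "inje (?I i)" for i using I zero_module_inje[OF Z] by (auto split: nat.split)
    show "j \<in> Monic T (?I 0)" using ses_mono[OF I(3)] by simp
    show "?d i \<in> Hom (?I i) (?I (Suc i))" for i
      using q hom_const_zero[OF fg_lm[OF Z(1)]] by (cases i) simp_all
    show "j ` carrier T = hom_kernel (?I 0) (?I 1) (?d 0)" using ses_ker[OF I(3)] by simp
    show "?d i ` carrier (?I i) = hom_kernel (?I (Suc i)) (?I (Suc (Suc i))) (?d (Suc i))" for i
    proof (cases i)
      case 0
      then show ?thesis using epi_image[OF ses_epi[OF I(3)]] by (simp add: hom_kernel_def)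
    next
      case (Suc i')
      have "carrier I' \<noteq> {}" using m_zero_closed[OF lmI] by blast
      then show ?thesis using Suc Z(2) by (auto simp: hom_kernel_def zero_module_def split: nat.split)
    qed
  qed
  moreover have "\<forall>i>1. zero_module (?I i)" using Z(2) by (auto split: nat.split)
  ultimately have "injdim A T \<le> enat 1" unfolding injdim_def by (intro Inf_lower) blast
  then show "injdim A T \<le> 1" by (simp add: one_enat_def)
qed

subsection \<open>Minimal injective resolutions\<close>

text \<open>Puts a chosen envelope in front of a minimal resolution of its cokernel; two
  applications prescribe the terms \<open>I 0\<close> and \<open>I 1\<close>.\<close>

lemma minimal_injective_resolution_step:
  fixes M :: "('a, 'm) module" and X I0 :: "'a umod"
  assumes s: "ses M e0 I0 p X" and I0: "inje I0" and X: "lm X"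
    and ess: "essential_submodule A (e0 ` carrier M) I0"
    and res: "minimal_injective_resolution A X I e d"
  shows "minimal_injective_resolution A M (case_nat I0 I) e0 (case_nat (\<lambda>x. e (p x)) d)"
proof -
  have r: "inje (I i)" "e \<in> Monic X (I 0)" "d i \<in> Hom (I i) (I (Suc i))"
    "e ` carrier X = hom_kernel (I 0) (I 1) (d 0)"
    "d i ` carrier (I i) = hom_kernel (I (Suc i)) (I (Suc (Suc i))) (d (Suc i))" for i
    using res by (simp_all only: minimal_injective_resolution_def injective_resolution_def)
  have ess': "essential_submodule A (e ` carrier X) (I 0)"
    "essential_submodule A (d i ` carrier (I i)) (I (Suc i))" for i
    using res by (simp_all only: minimal_injective_resolution_def)
  let ?I = "case_nat I0 I" and ?d = "case_nat (\<lambda>x. e (p x)) d"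
  have p: "p \<in> Hom I0 X" using s by simp
  have im: "(\<lambda>x. e (p x)) ` carrier I0 = e ` carrier X"
    using epi_image[OF ses_epi[OF s]] by (metis image_image)
  show ?thesis
    unfolding minimal_injective_resolution_def injective_resolution_def
  proof (intro conjI allI)
    show "inje (?I i)" for i using I0 r(1) by (cases i) simp_all
    show "e0 \<in> Monic M (?I 0)" using ses_mono[OF s] by simp
    show "?d i \<in> Hom (?I i) (?I (Suc i))" for i
      using hom_comp[OF p mono_hom[OF r(2)]] r(3) by (cases i) simp_all
    show "e0 ` carrier M = hom_kernel (?I 0) (?I 1) (?d 0)"
      using ses_ker[OF s] kernel_comp_mono[OF r(2) X fg_lm[OF inje_fg[OF r(1)]] p] by simp
    show "?d i ` carrier (?I i) = hom_kernel (?I (Suc i)) (?I (Suc (Suc i))) (?d (Suc i))" for i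
      using r(4) r(5) im by (cases i) simp_all
    show "essential_submodule A (e0 ` carrier M) (?I 0)" using ess by simp
    show "essential_submodule A (?d i ` carrier (?I i)) (?I (Suc i))" for i
      using ess' im by (cases i) simp_all
  qed
qed

text \<open>\<open>domdim\<close> speaks of complete resolutions, so the two prescribed terms need a
  tail. It arises by iterating "envelope, then cokernel", with envelopes fixed by the choice
  functions \<open>J\<close> and \<open>\<epsilon>\<close>; since \<open>quot\<close> keeps the
  carrier type, the iteration stays in the universe.\<close>

lemma minimal_injective_resolution_ex:
  fixes M :: "'a umod"
  assumes enough: "\<And>M :: 'a umod. fg M \<Longrightarrow> \<exists>(E :: 'a umod) f. inje E \<and> f \<in> Monic M E"
    and M: "fg M"
  shows "\<exists>I e d. minimal_injective_resolution A M I e d"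
proof -
  have "\<exists>(I :: 'a umod) e. inje I \<and> e \<in> Monic X I \<and> essential_submodule A (e ` carrier X) I"
    if X: "fg X" for X :: "'a umod"
  proof -
    obtain E :: "'a umod" and f where E: "inje E" "f \<in> Monic X E" using enough[OF X] by blast
    show ?thesis using injective_envelope_retract[OF fg_lm[OF X] E] by metis
  qed
  then obtain J :: "'a umod \<Rightarrow> 'a umod" and \<epsilon> where J: "\<And>X. fg X \<Longrightarrow> inje (J X)"
    "\<And>X. fg X \<Longrightarrow> \<epsilon> X \<in> Monic X (J X)" "\<And>X. fg X \<Longrightarrow> essential_submodule A (\<epsilon> X ` carrier X) (J X)"
    by metis
  define C where "C X = quot (J X) (\<epsilon> X ` carrier X)" for X
  define \<pi> where "\<pi> X = qrep (J X) (\<epsilon> X ` carrier X)" for X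
  have C: "fg (C X)" "ses X (\<epsilon> X) (J X) (\<pi> X) (C X)" if X: "fg X" for X
  proof -
    show "ses X (\<epsilon> X) (J X) (\<pi> X) (C X)"
      unfolding C_def \<pi>_def by (rule ses_quot[OF J(2)[OF X]]) (use X inje_fg[OF J(1)[OF X]] in simp_all)
    have "sub (\<epsilon> X ` carrier X) (J X)"
      by (rule sub_range) (use J(2)[OF X] X inje_fg[OF J(1)[OF X]] in simp_all)
    then show "fg (C X)" unfolding C_def using inje_fg[OF J(1)[OF X]] by simp
  qed
  define X where "X n = (C ^^ n) M" for n
  have X: "X 0 = M" "X (Suc n) = C (X n)" "fg (X n)" for n
    unfolding X_def using M C(1) by (induction n) simp_all
  have Ce: "ses (X n) (\<epsilon> (X n)) (J (X n)) (\<pi> (X n)) (X (Suc n))" for n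
    using C(2)[OF X(3)[of n]] X(2) by simp
  have im: "(\<lambda>x. \<epsilon> (X (Suc n)) (\<pi> (X n) x)) ` carrier (J (X n)) = \<epsilon> (X (Suc n)) ` carrier (X (Suc n))" for n
    using epi_image[OF ses_epi[OF Ce[of n]]] by (metis image_image)
  have ker: "hom_kernel (J (X n)) (J (X (Suc n))) (\<lambda>x. \<epsilon> (X (Suc n)) (\<pi> (X n) x)) = \<epsilon> (X n) ` carrier (X n)" for n
    using kernel_comp_mono[OF J(2)[OF X(3)[of "Suc n"]] _ _ ses_hom2[OF Ce[of n]]] ses_ker[OF Ce[of n]]
      X(3) inje_fg[OF J(1)[OF X(3)]] by simp
  have "minimal_injective_resolution A M (\<lambda>n. J (X n)) (\<epsilon> M) (\<lambda>n x. \<epsilon> (X (Suc n)) (\<pi> (X n) x))"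
    unfolding minimal_injective_resolution_def injective_resolution_def
  proof (intro conjI allI)
    show "inje (J (X n))" for n using J(1) X(3) by blast
    show "\<epsilon> M \<in> Monic M (J (X 0))" using J(2)[OF M] X(1) by simp
    show "(\<lambda>x. \<epsilon> (X (Suc n)) (\<pi> (X n) x)) \<in> Hom (J (X n)) (J (X (Suc n)))" for n
      by (rule hom_comp[OF ses_hom2[OF Ce] mono_hom[OF J(2)[OF X(3)]]])
    show "\<epsilon> M ` carrier M = hom_kernel (J (X 0)) (J (X 1)) (\<lambda>x. \<epsilon> (X (Suc 0)) (\<pi> (X 0) x))"
      using ker[of 0] X(1) by simp
    show "(\<lambda>x. \<epsilon> (X (Suc n)) (\<pi> (X n) x)) ` carrier (J (X n)) =
        hom_kernel (J (X (Suc n))) (J (X (Suc (Suc n)))) (\<lambda>x. \<epsilon> (X (Suc (Suc n))) (\<pi> (X (Suc n)) x))" for n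
      using im[of n] ker[of "Suc n"] by simp
    show "essential_submodule A (\<epsilon> M ` carrier M) (J (X 0))" using J(3)[OF M] X(1) by simp
    show "essential_submodule A ((\<lambda>x. \<epsilon> (X (Suc n)) (\<pi> (X n) x)) ` carrier (J (X n))) (J (X (Suc n)))" for n
      using im[of n] J(3)[OF X(3)[of "Suc n"]] by simp
  qed
  then show ?thesis by blast
qed

lemma domdim_ge_2_iff: "2 \<le> domdim A \<longleftrightarrow>
  (\<exists>I e d. minimal_injective_resolution A (regular_module A) I e d \<and> proj (I 0) \<and> proj (I 1))"
proof
  assume "2 \<le> domdim A"
  \<comment> \<open>\<open>domdim\<close> is a supremum: the strict inequality above 1 is what
    yields a resolution with some \<open>k > 1\<close> projective terms.\<close>
  then have "enat 1 < domdim A"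
    by (metis enat_ord_simps(2) numeral_eq_enat one_less_numeral_iff order_less_le_trans semiring_norm(76))
  then obtain k I e d where "enat 1 < enat k" "minimal_injective_resolution A (regular_module A) I e d"
    "\<forall>i<k. proj (I i)"
    unfolding domdim_def less_Sup_iff by blast
  then show "\<exists>I e d. minimal_injective_resolution A (regular_module A) I e d \<and> proj (I 0) \<and> proj (I 1)"
    by (metis enat_ord_simps(2) less_trans zero_less_one)
next
  assume "\<exists>I e d. minimal_injective_resolution A (regular_module A) I e d \<and> proj (I 0) \<and> proj (I 1)"
  then obtain I e d where I: "minimal_injective_resolution A (regular_module A) I e d" "proj (I 0)" "proj (I 1)"
    by blast
  then have "\<forall>i<2. proj (I i)" by (auto simp: less_2_cases_iff)
  then have "enat 2 \<le> domdim A" unfolding domdim_def using I(1) by (intro Sup_upper) blast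
  then show "2 \<le> domdim A" by (simp add: numeral_eq_enat)
qed

end

context modules_over
begin

section \<open>Transfer of both chain conditions from the ring to its finitely generated
  modules\<close>

section \<open>Chain conditions\<close>

text \<open>One definition for both directions, selected by \<open>up\<close>, so that the transfer
  lemmas are proved once: descending chains are needed in the dualizing module, ascending ones over
  R and over \<Lambda>.\<close>

definition chain_cond :: "bool \<Rightarrow> ('a, 'm) module \<Rightarrow> bool" where
  "chain_cond up M \<longleftrightarrow> (\<forall>H :: nat \<Rightarrow> 'm set. (\<forall>n. sub (H n) M) \<longrightarrow>
     (\<forall>n. if up then H n \<subseteq> H (Suc n) else H (Suc n) \<subseteq> H n) \<longrightarrow> (\<exists>N. \<forall>n\<ge>N. H n = H N))"

lemma chain_condD:
  fixes H :: "nat \<Rightarrow> 'm set" and M :: "('a, 'm) module"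
  assumes "chain_cond up M" "\<And>n. sub (H n) M" "\<And>n. if up then H n \<subseteq> H (Suc n) else H (Suc n) \<subseteq> H n"
  shows "\<exists>N. \<forall>n\<ge>N. H n = H N"
  using assms unfolding chain_cond_def by simp

lemma chain_mono:
  fixes H :: "nat \<Rightarrow> 'm set"
  assumes "\<And>n. if up then H n \<subseteq> H (Suc n) else H (Suc n) \<subseteq> H n" "N \<le> n"
  shows "H N \<subseteq> H n \<or> H n \<subseteq> H N"
proof (cases up)
  case True
  then have "\<And>n. H n \<subseteq> H (Suc n)" using assms(1) by simp
  then have "H N \<subseteq> H n" using assms(2) by (rule lift_Suc_mono_le)
  then show ?thesis ..
next
  case False
  then have "\<And>n. H (Suc n) \<subseteq> H n" using assms(1) by simp
  then have "H n \<subseteq> H N" using assms(2) by (rule lift_Suc_antimono_le)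
  then show ?thesis ..
qed

text \<open>Preimages form a chain in \<open>M\<close>, and surjectivity of \<open>g\<close>
  recovers each submodule as the image of its preimage.\<close>

lemma chain_cond_epi:
  fixes M :: "('a, 'm) module" and N :: "('a, 'n) module"
  assumes c: "chain_cond up M" and g: "g \<in> Epic M N" and lm: "lm M" "lm N"
  shows "chain_cond up N"
  unfolding chain_cond_def
proof (intro allI impI)
  fix H :: "nat \<Rightarrow> 'n set"
  assume H: "\<forall>n. sub (H n) N" "\<forall>n. if up then H n \<subseteq> H (Suc n) else H (Suc n) \<subseteq> H n"
  have "\<exists>k. \<forall>n\<ge>k. {x \<in> carrier M. g x \<in> H n} = {x \<in> carrier M. g x \<in> H k}"
    by (rule chain_condD[OF c sub_preimage[OF epi_hom[OF g] lm spec[OF H(1)]]])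
       (use H(2) in \<open>auto split: if_splits\<close>)
  then obtain k where k: "\<And>n. n \<ge> k \<Longrightarrow> {x \<in> carrier M. g x \<in> H n} = {x \<in> carrier M. g x \<in> H k}"
    by blast
  have im: "g ` {x \<in> carrier M. g x \<in> H n} = H n" for n
  proof
    show "H n \<subseteq> g ` {x \<in> carrier M. g x \<in> H n}"
    proof
      fix y assume y: "y \<in> H n"
      obtain x where "x \<in> carrier M" "g x = y"
        using epi_ex[OF g sub_carrier[OF spec[OF H(1)] y]] by blast
      then show "y \<in> g ` {x \<in> carrier M. g x \<in> H n}" using y by (intro image_eqI[of _ _ x]) simp_all
    qed
  qed (rule image_subsetI, simp)
  have "H n = H k" if n: "n \<ge> k" for n
    using im[of n, symmetric] arg_cong[OF k[OF n], of "image g"] im[of k] by (rule trans[OF trans])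
  then show "\<exists>k. \<forall>n\<ge>k. H n = H k" by blast
qed

text \<open>For \<open>y\<close> in \<open>H'\<close> some \<open>h\<close> in \<open>H\<close> has
  the same image in \<open>N\<close>. The difference comes from \<open>L\<close> and lies in
  \<open>H'\<close>, hence in \<open>H\<close>.\<close>

lemma sub_eq_of_exact:
  assumes s: "ses L f M g N" and lm: "lm L" "lm M" "lm N" and H: "sub H M" "sub H' M" "H \<subseteq> H'"
    and P: "{x \<in> carrier L. f x \<in> H} = {x \<in> carrier L. f x \<in> H'}" and Q: "g ` H = g ` H'"
  shows "H = H'"
proof
  have gh: "g \<in> Hom M N" using s by simp
  show "H' \<subseteq> H"
  proof
    fix y assume y: "y \<in> H'"
    then have "g y \<in> g ` H" using Q by blast
    then obtain h where h: "h \<in> H" "g y = g h" by blast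
    then have h': "h \<in> H'" using H(3) by blast
    have c: "y \<in> carrier M" "h \<in> carrier M" using sub_carrier[OF H(2)] y h' by simp_all
    have "g (y \<ominus>\<^bsub>M\<^esub> h) = \<zero>\<^bsub>N\<^esub>" using h(2) c gh lm by simp
    then obtain x where x: "x \<in> carrier L" "y \<ominus>\<^bsub>M\<^esub> h = f x"
      using ses_exact[OF s m_minus_closed[OF lm(2) c]] by blast
    have "f x \<in> H'" unfolding x(2)[symmetric] by (rule sub_minus[OF H(2) y h'])
    then have "f x \<in> H" using P x(1) by blast
    then have "(y \<ominus>\<^bsub>M\<^esub> h) \<oplus>\<^bsub>M\<^esub> h \<in> H" unfolding x(2) by (rule sub_add[OF H(1) _ h(1)])
    then show "y \<in> H" using c lm by simp
  qed
qed (rule H(3))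

text \<open>Beyond the index where traces on \<open>L\<close> and images in \<open>N\<close> are
  both constant, \<open>sub_eq_of_exact\<close> applies; \<open>chain_mono\<close> supplies the
  nesting in either direction.\<close>

lemma chain_cond_extension:
  fixes L :: "('a, 'l) module" and M :: "('a, 'm) module" and N :: "('a, 'n) module"
  assumes s: "ses L f M g N" and lm: "lm L" "lm M" "lm N" and c: "chain_cond up L" "chain_cond up N"
  shows "chain_cond up M"
  unfolding chain_cond_def
proof (intro allI impI)
  fix H :: "nat \<Rightarrow> 'm set"
  assume H: "\<forall>n. sub (H n) M" "\<forall>n. if up then H n \<subseteq> H (Suc n) else H (Suc n) \<subseteq> H n"
  have fg: "f \<in> Hom L M" "g \<in> Hom M N" using s by simp_all
  have "\<exists>k. \<forall>n\<ge>k. {x \<in> carrier L. f x \<in> H n} = {x \<in> carrier L. f x \<in> H k}"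
    by (rule chain_condD[OF c(1) sub_preimage[OF fg(1) lm(1,2) spec[OF H(1)]]])
       (use H(2) in \<open>auto split: if_splits\<close>)
  then obtain k1 where k1: "\<And>n. n \<ge> k1 \<Longrightarrow> {x \<in> carrier L. f x \<in> H n} = {x \<in> carrier L. f x \<in> H k1}"
    by blast
  have "\<exists>k. \<forall>n\<ge>k. g ` H n = g ` H k"
    by (rule chain_condD[OF c(2) sub_image[OF fg(2) lm(2,3) spec[OF H(1)]]])
       (use H(2) in \<open>auto split: if_splits\<close>)
  then obtain k2 where k2: "\<And>n. n \<ge> k2 \<Longrightarrow> g ` H n = g ` H k2" by blast
  have "H n = H (max k1 k2)" if n: "n \<ge> max k1 k2" for n
  proof -
    have e: "{x \<in> carrier L. f x \<in> H n} = {x \<in> carrier L. f x \<in> H (max k1 k2)}" "g ` H n = g ` H (max k1 k2)"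
      using k1[of n] k1[of "max k1 k2"] k2[of n] k2[of "max k1 k2"] n by simp_all
    have "H (max k1 k2) \<subseteq> H n \<or> H n \<subseteq> H (max k1 k2)" by (rule chain_mono[OF _ n]) (use H(2) in blast)
    then show ?thesis
      using sub_eq_of_exact[OF s lm spec[OF H(1), of n] spec[OF H(1), of "max k1 k2"]]
        sub_eq_of_exact[OF s lm spec[OF H(1), of "max k1 k2"] spec[OF H(1), of n]] e by metis
  qed
  then show "\<exists>k. \<forall>n\<ge>k. H n = H k" by blast
qed

lemma chain_cond_fg:
  fixes M :: "('a, 'm) module"
  assumes c: "chain_cond up (regular_module A)" and M: "fg M"
  shows "chain_cond up M"
proof -
  obtain m f where f: "f \<in> Epic (power_module (regular_module A) m) M" by (rule free_cover[OF M])
  have "lm (power_module (regular_module A) m) \<and> chain_cond up (power_module (regular_module A) m)"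
  proof (rule ds_induct)
    fix Z :: "('a, nat \<Rightarrow> 'a) module" assume Z: "lm Z" "zero_module Z"
    have "H = carrier Z" if "sub H Z" for H
      using sub_subset[OF that] sub_zero[OF that] Z(2) by (auto simp: zero_module_def)
    then show "lm Z \<and> chain_cond up Z" using Z(1) unfolding chain_cond_def by metis
  next
    fix k and L :: "('a, nat \<Rightarrow> 'a) module"
    assume *: "lm (power_module (regular_module A) k) \<and> chain_cond up (power_module (regular_module A) k)"
      "lm L" "isomorphic_modules A (direct_sum2 (power_module (regular_module A) k) (regular_module A)) L"
    let ?D = "direct_sum2 (power_module (regular_module A) k) (regular_module A)"
    have lmD: "lm ?D" using * by simp
    have "chain_cond up ?D"
      by (rule chain_cond_extension[OF ses_ds2 _ lmD]) (use * c in simp_all)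
    moreover obtain h where "h \<in> Iso ?D L" using *(3) unfolding isomorphic_modules_def by blast
    ultimately show "lm L \<and> chain_cond up L"
      using chain_cond_epi[OF _ iso_epi lmD *(2)] *(2) by blast
  qed simp
  then show ?thesis using chain_cond_epi[OF _ f] M by simp
qed

lemma noetherian_modulesI:
  assumes "chain_cond True (regular_module A)"
  shows "noetherian_modules A"
proof
  fix M :: "'a umod" and H :: "nat \<Rightarrow> (nat \<Rightarrow> 'a) set set"
  assume "fg M" "\<And>n. sub (H n) M" "\<And>n. H n \<subseteq> H (Suc n)"
  then show "\<exists>N. \<forall>n\<ge>N. H n = H N"
    using chain_condD[OF chain_cond_fg[OF assms], of M H] by simp
qed

lemma minimal_sub:
  assumes c: "chain_cond False M" and S: "S0 \<in> S" "\<And>H. H \<in> S \<Longrightarrow> sub H M"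
  obtains H where "H \<in> S" "\<And>K. \<lbrakk>K \<in> S; K \<subseteq> H\<rbrakk> \<Longrightarrow> K = H"
proof (rule ccontr)
  assume "\<not> thesis"
  then have *: "\<exists>K. K \<in> S \<and> K \<subset> H" if "H \<in> S" for H
    using that \<open>(\<And>H. \<lbrakk>H \<in> S; \<And>K. \<lbrakk>K \<in> S; K \<subseteq> H\<rbrakk> \<Longrightarrow> K = H\<rbrakk> \<Longrightarrow> thesis)\<close> by blast
  obtain F where F: "\<And>n :: nat. F n \<in> S" "\<And>n. F (Suc n) \<subset> F n"
    using dependent_nat_choice[of "\<lambda>_ H. H \<in> S" "\<lambda>_ H K. K \<subset> H"] S(1) * by metis
  have "\<exists>N. \<forall>n\<ge>N. F n = F N"
    by (rule chain_condD[OF c S(2)[OF F(1)]]) (use F(2) in auto)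
  then obtain N where "\<forall>n\<ge>N. F n = F N" by blast
  then have "F (Suc N) = F N" using le_SucI[OF order_refl] by blast
  with F(2) show False by blast
qed

text \<open>The annihilator condition makes \<open>s x |-> s j\<close> well defined on the cyclic
  submodule generated by \<open>x\<close>; injectivity extends it to \<open>X\<close>.\<close>

lemma inje_hom_to:
  fixes X :: "('a, 'm) module" and J :: "('a, 'j) module"
  assumes J: "inje J" and X: "fg X" and x: "x \<in> carrier X" and j: "j \<in> carrier J"
    and ann: "\<And>s. \<lbrakk>s \<in> carrier A; s \<odot>\<^bsub>X\<^esub> x = \<zero>\<^bsub>X\<^esub>\<rbrakk> \<Longrightarrow> s \<odot>\<^bsub>J\<^esub> j = \<zero>\<^bsub>J\<^esub>"
  shows "\<exists>f\<in>Hom X J. f x = j"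
proof -
  have lm: "lm X" "lm J" using X inje_fg[OF J] by simp_all
  define g where "g s = s \<odot>\<^bsub>X\<^esub> x" for s
  have g: "g \<in> Hom (regular_module A) X" unfolding g_def by (rule hom_from_regular[OF lm(1) x])
  define G where "G = g ` carrier (regular_module A)"
  have G: "sub G X" unfolding G_def by (rule sub_range[OF g lm_regular lm(1)])
  let ?G = "submod X G"
  have gG: "g \<in> Epic (regular_module A) ?G"
    by (rule imageI_epi) (use hom_into_submod[OF G, of g "regular_module A"] g in \<open>simp_all add: G_def\<close>)
  have lmG: "lm ?G" using lm G by simp
  have fgG: "fg ?G" by (rule fg_epi[OF fg_regular gG lmG])
  have "s \<odot>\<^bsub>J\<^esub> j = \<zero>\<^bsub>J\<^esub>" if "s \<in> carrier (regular_module A)" "g s = \<zero>\<^bsub>?G\<^esub>" for s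
    using ann[of s] that by (simp add: g_def)
  then obtain h where h: "h \<in> Hom ?G J" "\<forall>s\<in>carrier (regular_module A). h (g s) = s \<odot>\<^bsub>J\<^esub> j"
    using epi_factor[OF gG hom_from_regular[OF lm(2) j] lm_regular lmG lm(2)] by blast
  obtain k where k: "k \<in> Hom X J" "\<forall>y\<in>carrier ?G. k y = h y"
    using inje_extend[OF J fgG X submod_incl[OF G] h(1)] by blast
  have "x = g \<one>" using lm x by (simp add: g_def)
  moreover have "g \<one> \<in> carrier ?G" using hom_closed[OF epi_hom[OF gG], of \<one>] by simp
  ultimately have "k x = h (g \<one>)" using k(2) by simp
  also have "\<dots> = j" using h(2) j lm by simp
  finally show ?thesis using k(1) by blast
qed

end

section \<open>The dualizing module as an injective cogenerator, and the ascending chain condition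
  for R\<close>

section \<open>Commutative artinian rings and their dualizing modules\<close>

locale artinian_dualizing = modules_over R for R :: "('r, 'x) ring_scheme" (structure) +
  fixes J :: "('r, 'j) module"
  assumes artinian: "artinian_cring R" and dualizing: "dualizing_module R J"
begin

lemma cring_R: "cring R"
  using artinian by (simp add: artinian_cring_def)

lemma inje_J: "inje J"
  using dualizing by (simp add: dualizing_module_def injective_envelope_def)

lemma fg_J: "fg J"
  by (rule inje_fg[OF inje_J])

text \<open>Commutativity makes left submodules of the regular module two-sided ideals, which
  connects the module-theoretic chain lemmas with \<open>artinian_cring\<close>.\<close>

lemma sub_regular_iff: "sub I (regular_module R) \<longleftrightarrow> ideal I R"
proof
  assume I: "sub I (regular_module R)"
  show "ideal I R"
  proof (rule idealI[OF A.ring_axioms])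
    show "subgroup I (add_monoid R)"
      using I by (auto simp: submodule_def subgroup_def a_inv_def m_inv_def)
    show "x \<otimes> a \<in> I" if "a \<in> I" "x \<in> carrier R" for a x
      using sub_smult[OF I that(2,1)] by simp
    then show "a \<otimes> x \<in> I" if "a \<in> I" "x \<in> carrier R" for a x
      using that sub_carrier[OF I] cring.cring_simprules(14)[OF cring_R] by simp
  qed
next
  assume "ideal I R"
  then interpret ideal I R .
  show "sub I (regular_module R)"
    by (rule subI) (simp_all add: a_subset I_l_closed)
qed

lemma dcc_R: "chain_cond False (regular_module R)"
  unfolding chain_cond_def sub_regular_iff using artinian by (auto simp: artinian_cring_def)

text \<open>Take \<open>(a)\<close> minimal among the principal ideals not contained in \<open>m\<close>: for \<open>b \<in> m' - m\<close> also \<open>(ba)\<close> is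
  one of these, so \<open>a \<in> (ba) \<subseteq> m'\<close>.\<close>

lemma maximal_separator:
  assumes m: "maximalideal m R"
  obtains a where "a \<in> carrier R" "a \<notin> m" "\<forall>m'. maximalideal m' R \<longrightarrow> m' \<noteq> m \<longrightarrow> a \<in> m'"
proof -
  interpret m: maximalideal m R by fact
  interpret p: primeideal m R using cring.maximalideal_prime[OF cring_R m] .
  define pr where "pr a = (\<lambda>r. r \<otimes> a) ` carrier R" for a
  have pr: "sub (pr a) (regular_module R)" if "a \<in> carrier R" for a
    using sub_range[OF hom_from_regular[OF lm_regular, of a] lm_regular lm_regular] that
    by (simp add: pr_def)
  have one: "\<one> \<in> carrier R" "\<one> \<notin> m" using m.one_imp_carrier m.I_notcarr by auto
  obtain H where H: "H \<in> {pr a | a. a \<in> carrier R \<and> a \<notin> m}"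
    "\<And>K. \<lbrakk>K \<in> {pr a | a. a \<in> carrier R \<and> a \<notin> m}; K \<subseteq> H\<rbrakk> \<Longrightarrow> K = H"
    by (rule minimal_sub[OF dcc_R, of "pr \<one>" "{pr a | a. a \<in> carrier R \<and> a \<notin> m}"])
       (use one pr in blast)+
  then obtain a where a: "a \<in> carrier R" "a \<notin> m" "H = pr a" by blast
  show ?thesis
  proof (rule that[OF a(1,2)], intro allI impI)
    fix m' assume m': "maximalideal m' R" "m' \<noteq> m"
    interpret m': maximalideal m' R by fact
    have "\<not> m' \<subseteq> m"
      using m'.I_maximal[OF m.ideal_axioms] m'(2) m.I_notcarr m.a_subset by auto
    then obtain b where b: "b \<in> m'" "b \<notin> m" by blast
    have bR: "b \<in> carrier R" using b(1) m'.a_subset by blast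
    have "b \<otimes> a \<notin> m" using p.I_prime[OF bR a(1)] b(2) a(2) by blast
    moreover have "pr (b \<otimes> a) \<subseteq> pr a"
      using a(1) bR by (auto simp: pr_def A.m_assoc[symmetric])
    ultimately have "pr (b \<otimes> a) = pr a"
      using H(2)[of "pr (b \<otimes> a)"] a bR by auto
    moreover have "a \<in> pr a" unfolding pr_def using a(1) by (intro image_eqI[of _ _ \<one>]) simp_all
    ultimately obtain r where r: "r \<in> carrier R" "a = r \<otimes> (b \<otimes> a)" unfolding pr_def by auto
    have "r \<otimes> (b \<otimes> a) \<in> m'" using m'.I_l_closed[OF m'.I_r_closed[OF b(1) a(1)] r(1)] .
    then show "a \<in> m'" using r(2) by simp
  qed
qed

text \<open>For \<open>a\<close> outside \<open>m\<close> but in all other maximal ideals,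
  \<open>m a\<close> lies in the Jacobson radical. The class of \<open>a\<close> modulo the radical
  is thus nonzero and killed by \<open>m\<close>, and the quotient by the radical embeds in
  \<open>J\<close>.\<close>

lemma maximal_annihilates:
  assumes m: "maximalideal m R"
  obtains w where "w \<in> carrier J" "w \<noteq> \<zero>\<^bsub>J\<^esub>" "\<forall>s\<in>m. s \<odot>\<^bsub>J\<^esub> w = \<zero>\<^bsub>J\<^esub>"
proof -
  interpret m: maximalideal m R by fact
  let ?r = "jacobson_radical R"
  let ?Q = "quotient_module R ?r"
  have max: "ideal I R" if "maximalideal I R" for I using that by (simp add: maximalideal_def)
  have r: "?r = \<Inter>{I. maximalideal I R}"
    unfolding jacobson_radical_def using m m.a_subset by blast
  interpret r: ideal ?r R
    unfolding r by (rule A.i_Intersect) (use max m in auto)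
  interpret Q: ring "R Quot ?r" by (rule r.quotient_is_ring)
  obtain e where e: "e \<in> Monic ?Q J"
    using dualizing by (auto simp: dualizing_module_def injective_envelope_def)
  have QQ: "carrier ?Q = carrier (R Quot ?r)" "add ?Q = add (R Quot ?r)" "zero ?Q = zero (R Quot ?r)"
    "zero ?Q = ?r" "a \<odot>\<^bsub>?Q\<^esub> X = (?r +> a) \<otimes>\<^bsub>R Quot ?r\<^esub> X" for a X
    by (simp_all add: quotient_module_def FactRing_def)
  have eh: "e \<in> Hom ?Q J" using e by simp
  have lmJ: "lm J" using fg_J by simp
  \<comment> \<open>\<open>hom_zero\<close> would need \<open>quotient_module\<close> to be a left
    module; additivity of \<open>e\<close> at the zero element gives the same conclusion.\<close>
  have "e \<zero>\<^bsub>?Q\<^esub> \<oplus>\<^bsub>J\<^esub> e \<zero>\<^bsub>?Q\<^esub> = e \<zero>\<^bsub>?Q\<^esub>"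
    using hom_add[OF eh, of "\<zero>\<^bsub>?Q\<^esub>" "\<zero>\<^bsub>?Q\<^esub>"] by (simp add: QQ(1,2,3))
  moreover have e0c: "e \<zero>\<^bsub>?Q\<^esub> \<in> carrier J" by (rule hom_closed[OF eh]) (simp add: QQ(1,3))
  ultimately have e0: "e \<zero>\<^bsub>?Q\<^esub> = \<zero>\<^bsub>J\<^esub>" using m_add_diff[OF lmJ e0c e0c] lmJ e0c by simp
  obtain a where a: "a \<in> carrier R" "a \<notin> m" "\<forall>m'. maximalideal m' R \<longrightarrow> m' \<noteq> m \<longrightarrow> a \<in> m'"
    by (rule maximal_separator[OF m])
  have cl: "?r +> x \<in> carrier (R Quot ?r)" if "x \<in> carrier R" for x
    using that r.a_subset A.a_rcosetsI by (simp add: FactRing_def)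
  show ?thesis
  proof (rule that)
    show "e (?r +> a) \<in> carrier J" by (rule hom_closed[OF eh]) (simp add: QQ(1) cl a(1))
    show "e (?r +> a) \<noteq> \<zero>\<^bsub>J\<^esub>"
    proof
      assume "e (?r +> a) = \<zero>\<^bsub>J\<^esub>"
      then have "?r +> a = \<zero>\<^bsub>?Q\<^esub>"
        using mono_eq[OF e, of "?r +> a" "\<zero>\<^bsub>?Q\<^esub>"] e0 cl[OF a(1)] by (simp add: QQ(1,3))
      then have "a \<in> ?r" using r.rcos_const_imp_mem[OF a(1)] by (simp add: QQ(4))
      then show False using a(2) m by (auto simp: r)
    qed
    show "\<forall>s\<in>m. s \<odot>\<^bsub>J\<^esub> e (?r +> a) = \<zero>\<^bsub>J\<^esub>"
    proof
      fix s assume s: "s \<in> m"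
      then have sR: "s \<in> carrier R" using m.a_subset by blast
      have "s \<otimes> a \<in> m'" if m': "maximalideal m' R" for m'
      proof (cases "m' = m")
        case True
        then show ?thesis using m.I_r_closed[OF s a(1)] by simp
      next
        case False
        interpret m': maximalideal m' R by fact
        show ?thesis using m'.I_l_closed[OF a(3)[rule_format, OF m' False] sR] .
      qed
      then have sa: "s \<otimes> a \<in> ?r" by (simp add: r)
      have "s \<odot>\<^bsub>J\<^esub> e (?r +> a) = e (s \<odot>\<^bsub>?Q\<^esub> (?r +> a))"
        by (rule hom_smult[OF eh, symmetric]) (simp_all add: sR QQ(1) cl a(1))
      also have "s \<odot>\<^bsub>?Q\<^esub> (?r +> a) = ?r +> (s \<otimes> a)"
        using r.rcoset_mult_add[OF sR a(1)] by (simp add: quotient_module_def FactRing_def)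
      also have "\<dots> = \<zero>\<^bsub>?Q\<^esub>" using A.a_rcos_zero[OF r.ideal_axioms sa] by (simp add: QQ(4))
      finally show "s \<odot>\<^bsub>J\<^esub> e (?r +> a) = \<zero>\<^bsub>J\<^esub>" using e0 by simp
    qed
  qed
qed

text \<open>By Zorn's lemma, because the ascending chain condition for R is itself derived from this
  result, through \<open>ideal_separator\<close>.\<close>

lemma maximal_ideal_above:
  assumes I: "ideal I R" "\<one> \<notin> I"
  obtains m where "maximalideal m R" "I \<subseteq> m"
proof -
  let ?S = "{K. ideal K R \<and> I \<subseteq> K \<and> \<one> \<notin> K}"
  have "\<exists>m\<in>?S. \<forall>X\<in>?S. m \<subseteq> X \<longrightarrow> X = m"
  proof (rule subset_Zorn_nonempty)
    show "?S \<noteq> {}" using I by blast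
    fix C assume C: "C \<noteq> {}" "subset.chain ?S C"
    have CS: "C \<subseteq> ?S" and ch: "\<And>X Y. X \<in> C \<Longrightarrow> Y \<in> C \<Longrightarrow> X \<subseteq> Y \<or> Y \<subseteq> X"
      using C(2) unfolding subset.chain_def by auto
    have subC: "sub K (regular_module R)" if "K \<in> C" for K
      using CS that by (auto simp: sub_regular_iff)
    have "sub (\<Union>C) (regular_module R)"
    proof (rule subI[OF lm_regular])
      show "\<Union>C \<subseteq> carrier (regular_module R)" using sub_subset[OF subC] by blast
      obtain K where "K \<in> C" using C(1) by blast
      then show "\<zero>\<^bsub>regular_module R\<^esub> \<in> \<Union>C" using sub_zero[OF subC] by blast
      show "x \<oplus>\<^bsub>regular_module R\<^esub> y \<in> \<Union>C" if xy: "x \<in> \<Union>C" "y \<in> \<Union>C" for x y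
      proof -
        obtain X Y where XY: "X \<in> C" "x \<in> X" "Y \<in> C" "y \<in> Y" using xy by blast
        then obtain Z where "Z \<in> C" "x \<in> Z" "y \<in> Z" using ch[OF XY(1,3)] by blast
        then show ?thesis using sub_add[OF subC] by blast
      qed
      show "a \<odot>\<^bsub>regular_module R\<^esub> x \<in> \<Union>C" if "a \<in> carrier R" "x \<in> \<Union>C" for a x
        using that sub_smult[OF subC] by blast
    qed
    then show "\<Union>C \<in> ?S" using CS C(1) by (auto simp: sub_regular_iff)
  qed
  then obtain m where m: "ideal m R" "I \<subseteq> m" "\<one> \<notin> m" "\<forall>X\<in>?S. m \<subseteq> X \<longrightarrow> X = m" by blast
  have "maximalideal m R"
  proof (rule maximalidealI[OF m(1)])
    show "carrier R \<noteq> m" using m(3) by auto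
    show "K = m \<or> K = carrier R" if "ideal K R" "m \<subseteq> K" "K \<subseteq> carrier R" for K
      using that m(2,4) ideal.one_imp_carrier[OF that(1)] by blast
  qed
  then show ?thesis using m(2) that by blast
qed

text \<open>The ideal \<open>(I : r)\<close> is proper and annihilates the class of \<open>r\<close>
  modulo \<open>I\<close>. A nonzero \<open>w\<close> in \<open>J\<close> killed by a maximal ideal
  above it is then a possible value at that class. The resulting map on the quotient by
  \<open>I\<close> sends the class of \<open>\<one>\<close> to the wanted \<open>j\<close>.\<close>

lemma ideal_separator:
  assumes I: "ideal I R" and r: "r \<in> carrier R" "r \<notin> I"
  obtains j where "j \<in> carrier J" "\<And>s. s \<in> I \<Longrightarrow> s \<odot>\<^bsub>J\<^esub> j = \<zero>\<^bsub>J\<^esub>" "r \<odot>\<^bsub>J\<^esub> j \<noteq> \<zero>\<^bsub>J\<^esub>"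
proof -
  let ?A = "regular_module R"
  have subI': "sub I ?A" using I by (simp add: sub_regular_iff)
  let ?Q = "quot ?A I"
  have Q: "fg ?Q" "lm ?Q" using fg_quot[OF fg_regular subI'] by simp_all
  let ?q = "qrep ?A I"
  have q: "?q \<in> Hom ?A ?Q" using subI' by simp
  have q0: "?q s = \<zero>\<^bsub>?Q\<^esub> \<longleftrightarrow> s \<in> I" if "s \<in> carrier R" for s
    using qrep_zero_iff[OF lm_regular subI', of s] that by simp
  have qs: "s \<odot>\<^bsub>?Q\<^esub> ?q x = ?q (s \<otimes> x)" if "s \<in> carrier R" "x \<in> carrier R" for s x
    using hom_smult[OF q, of s x] that by simp
  let ?C = "{s \<in> carrier R. s \<otimes> r \<in> I}"
  have "sub ?C ?A"
    using sub_preimage[OF hom_from_regular[OF lm_regular, of r] lm_regular lm_regular subI'] r by simp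
  then have "ideal ?C R" by (simp add: sub_regular_iff)
  moreover have "\<one> \<notin> ?C" using r by simp
  ultimately obtain m where m: "maximalideal m R" "?C \<subseteq> m" by (rule maximal_ideal_above)
  obtain w where w: "w \<in> carrier J" "w \<noteq> \<zero>\<^bsub>J\<^esub>" "\<forall>s\<in>m. s \<odot>\<^bsub>J\<^esub> w = \<zero>\<^bsub>J\<^esub>"
    by (rule maximal_annihilates[OF m(1)])
  have qr: "?q r \<in> carrier ?Q" using hom_closed[OF q, of r] r by simp
  have "s \<odot>\<^bsub>J\<^esub> w = \<zero>\<^bsub>J\<^esub>" if "s \<in> carrier R" "s \<odot>\<^bsub>?Q\<^esub> ?q r = \<zero>\<^bsub>?Q\<^esub>" for s
    using that m(2) w(3) q0[of "s \<otimes> r"] qs[of s r] r by auto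
  then obtain f where f: "f \<in> Hom ?Q J" "f (?q r) = w"
    using inje_hom_to[OF inje_J Q(1) qr w(1)] by blast
  have q1: "?q \<one> \<in> carrier ?Q" using hom_closed[OF q, of \<one>] by simp
  have fs: "s \<odot>\<^bsub>J\<^esub> f (?q \<one>) = f (?q s)" if "s \<in> carrier R" for s
    using hom_smult[OF f(1) that q1] qs[OF that, of \<one>] that by simp
  show ?thesis
  proof (rule that[of "f (?q \<one>)"])
    show "f (?q \<one>) \<in> carrier J" using f(1) q1 by simp
    show "r \<odot>\<^bsub>J\<^esub> f (?q \<one>) \<noteq> \<zero>\<^bsub>J\<^esub>" using fs[OF r(1)] f(2) w(2) by simp
    fix s assume "s \<in> I"
    moreover from this have "s \<in> carrier R" using sub_carrier[OF subI'] by simp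
    ultimately show "s \<odot>\<^bsub>J\<^esub> f (?q \<one>) = \<zero>\<^bsub>J\<^esub>"
      using fs[of s] q0[of s] hom_zero[OF f(1) Q(2) fg_lm[OF fg_J]] by simp
  qed
qed

text \<open>Apply \<open>ideal_separator\<close> to the annihilator of \<open>x\<close> and to
  \<open>\<one>\<close>, which is outside it as \<open>x\<close> is nonzero; the element
  \<open>j\<close> found there is an admissible value at \<open>x\<close>.\<close>

lemma cogenerator_J:
  fixes X :: "('r, 'm) module"
  assumes X: "fg X" and x: "x \<in> carrier X" "x \<noteq> \<zero>\<^bsub>X\<^esub>"
  shows "\<exists>f\<in>Hom X J. f x \<noteq> \<zero>\<^bsub>J\<^esub>"
proof -
  have lm: "lm X" "lm J" using X fg_J by simp_all
  let ?I = "{s \<in> carrier R. s \<odot>\<^bsub>X\<^esub> x = \<zero>\<^bsub>X\<^esub>}"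
  have "sub ?I (regular_module R)"
    using sub_preimage[OF hom_from_regular[OF lm(1) x(1)] lm_regular lm(1) sub_zero_self[OF lm(1)]] by simp
  then have "ideal ?I R" by (simp add: sub_regular_iff)
  then obtain j where j: "j \<in> carrier J" "\<And>s. s \<in> ?I \<Longrightarrow> s \<odot>\<^bsub>J\<^esub> j = \<zero>\<^bsub>J\<^esub>" "\<one> \<odot>\<^bsub>J\<^esub> j \<noteq> \<zero>\<^bsub>J\<^esub>"
    by (rule ideal_separator[of ?I \<one>]) (use lm x in simp_all)
  obtain f where "f \<in> Hom X J" "f x = j"
    using inje_hom_to[OF inje_J X x(1) j(1)] j(2) by blast
  then show ?thesis using j lm by auto
qed

text \<open>Matlis duality: an ideal is recovered from its annihilator in \<open>J\<close>, so the descending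
  chain condition on \<open>J\<close> turns into the ascending one on \<open>R\<close>.\<close>

lemma acc_R: "chain_cond True (regular_module R)"
  unfolding chain_cond_def sub_regular_iff
proof (intro allI impI)
  fix I :: "nat \<Rightarrow> 'r set"
  assume I: "\<forall>n. ideal (I n) R" "\<forall>n. if True then I n \<subseteq> I (Suc n) else I (Suc n) \<subseteq> I n"
  have lm: "lm J" using fg_J by simp
  have IR: "s \<in> carrier R" if "s \<in> I n" for s n
    using I(1) that ideal.Icarr by metis
  define B where "B n = {j \<in> carrier J. \<forall>s\<in>I n. s \<odot>\<^bsub>J\<^esub> j = \<zero>\<^bsub>J\<^esub>}" for n
  have subB: "sub (B n) J" for n
  proof (rule subI[OF lm])
    show "a \<odot>\<^bsub>J\<^esub> x \<in> B n" if a: "a \<in> carrier R" and x: "x \<in> B n" for a x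
    proof -
      have "s \<odot>\<^bsub>J\<^esub> (a \<odot>\<^bsub>J\<^esub> x) = \<zero>\<^bsub>J\<^esub>" if s: "s \<in> I n" for s
      proof -
        have "s \<otimes> a \<in> I n" using ideal.I_r_closed[OF spec[OF I(1), of n] s a] .
        then have "(s \<otimes> a) \<odot>\<^bsub>J\<^esub> x = \<zero>\<^bsub>J\<^esub>" using x by (simp add: B_def)
        moreover have "x \<in> carrier J" using x by (simp add: B_def)
        ultimately show ?thesis using m_smult_assoc[OF lm IR[OF s] a] by simp
      qed
      then show ?thesis using a x lm by (simp add: B_def)
    qed
    show "a \<oplus>\<^bsub>J\<^esub> b \<in> B n" if "a \<in> B n" "b \<in> B n" for a b
      using that lm IR[of _ n] by (simp add: B_def m_smult_r_distr)
    show "B n \<subseteq> carrier J" by (auto simp: B_def)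
    show "\<zero>\<^bsub>J\<^esub> \<in> B n" using lm IR[of _ n] by (simp add: B_def)
  qed
  \<comment> \<open>\<open>J\<close> is finitely generated because \<open>injective_module\<close>
    includes this, so it inherits the descending chain condition from R.\<close>
  have "\<exists>N. \<forall>n\<ge>N. B n = B N"
    by (rule chain_condD[OF chain_cond_fg[OF dcc_R fg_J] subB]) (use I(2) in \<open>auto simp: B_def\<close>)
  then obtain N where N: "\<And>n. n \<ge> N \<Longrightarrow> B n = B N" by blast
  have "I n = I N" if n: "n \<ge> N" for n
  proof
    show "I N \<subseteq> I n" using I(2) lift_Suc_mono_le[OF _ n, of I] by simp
    show "I n \<subseteq> I N"
    proof
      fix r assume r: "r \<in> I n"
      show "r \<in> I N"
      proof (rule ccontr)
        assume "r \<notin> I N"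
        then obtain j where j: "j \<in> carrier J" "\<And>s. s \<in> I N \<Longrightarrow> s \<odot>\<^bsub>J\<^esub> j = \<zero>\<^bsub>J\<^esub>" "r \<odot>\<^bsub>J\<^esub> j \<noteq> \<zero>\<^bsub>J\<^esub>"
          using ideal_separator[OF spec[OF I(1), of N] IR[OF r]] by blast
        then have "j \<in> B N" by (simp add: B_def)
        then have "j \<in> B n" using N[OF n] by simp
        then show False using r j(3) by (simp add: B_def)
      qed
    qed
  qed
  then show "\<exists>N. \<forall>n\<ge>N. I n = I N" by blast
qed

end

sublocale artinian_dualizing \<subseteq> noetherian_modules R
  by (rule noetherian_modulesI[OF acc_R])

section \<open>Restriction of scalars, the duality, and D\<Lambda> as an injective cogenerator;
  basic modules\<close>

section \<open>Artin algebras\<close>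

lemma artin_algebra_rings:
  assumes "artin_algebra R \<phi> \<Lambda>"
  shows "ring R" "ring \<Lambda>"
  using assms by (auto simp: artin_algebra_def artinian_cring_def cring_def)

locale dualized_artin_algebra = R: artinian_dualizing R J + S: modules_over \<Lambda>
  for R :: "('r, 'x) ring_scheme" and J :: "('r, 'j) module" and \<Lambda> :: "('a, 'y) ring_scheme" +
  fixes \<phi> :: "'r \<Rightarrow> 'a"
  assumes artin: "artin_algebra R \<phi> \<Lambda>"
begin

abbreviation "res \<equiv> restrict_scalars \<phi>"

lemma res_simps [simp]: "carrier (res M) = carrier M" "add (res M) = add M" "zero (res M) = zero M"
  "r \<odot>\<^bsub>res M\<^esub> x = \<phi> r \<odot>\<^bsub>M\<^esub> x"
  by (simp_all add: restrict_scalars_def)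

lemma
  shows phi_closed [simp]: "r \<in> carrier R \<Longrightarrow> \<phi> r \<in> carrier \<Lambda>"
    and phi_add: "\<lbrakk>r \<in> carrier R; s \<in> carrier R\<rbrakk> \<Longrightarrow> \<phi> (r \<oplus>\<^bsub>R\<^esub> s) = \<phi> r \<oplus>\<^bsub>\<Lambda>\<^esub> \<phi> s"
    and phi_mult: "\<lbrakk>r \<in> carrier R; s \<in> carrier R\<rbrakk> \<Longrightarrow> \<phi> (r \<otimes>\<^bsub>R\<^esub> s) = \<phi> r \<otimes>\<^bsub>\<Lambda>\<^esub> \<phi> s"
    and phi_one [simp]: "\<phi> \<one>\<^bsub>R\<^esub> = \<one>\<^bsub>\<Lambda>\<^esub>"
    and phi_central: "\<lbrakk>r \<in> carrier R; a \<in> carrier \<Lambda>\<rbrakk> \<Longrightarrow> \<phi> r \<otimes>\<^bsub>\<Lambda>\<^esub> a = a \<otimes>\<^bsub>\<Lambda>\<^esub> \<phi> r"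
    and fg_res_regular: "R.fg (res (regular_module \<Lambda>))"
  using artin by (auto simp: artin_algebra_def ring_hom_def)

lemma lm_res [simp]: "S.lm M \<Longrightarrow> R.lm (res M)"
  by (rule R.lmI)
     (simp_all add: S.m_ac phi_add phi_mult S.m_smult_l_distr S.m_smult_r_distr S.m_smult_assoc,
      metis S.m_l_neg S.m_neg_closed S.m_comm)

lemma hom_res: "f \<in> S.Hom M N \<Longrightarrow> f \<in> R.Hom (res M) (res N)"
  by (rule R.homI) simp_all

lemma sub_res: "\<lbrakk>S.lm M; S.sub H M\<rbrakk> \<Longrightarrow> R.sub H (res M)"
  by (rule R.subI) (simp_all add: S.sub_subset)

lemma res_ds: "res (direct_sum n X) = direct_sum n (\<lambda>i. res (X i))"
  by (simp add: restrict_scalars_def direct_sum_def)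

lemma fg_res:
  assumes M: "S.fg M"
  shows "R.fg (res M)"
proof -
  obtain m f where f: "f \<in> S.Epic (power_module (regular_module \<Lambda>) m) M" by (rule S.free_cover[OF M])
  have 1: "f \<in> R.Epic (res (power_module (regular_module \<Lambda>) m)) (res M)"
    by (rule R.imageI_epi[OF hom_res[OF S.epi_hom[OF f]]]) (use S.epi_image[OF f] in simp)
  have 2: "R.fg (res (power_module (regular_module \<Lambda>) m))"
    unfolding res_ds by (rule R.fg_ds) (rule fg_res_regular)
  show ?thesis by (rule R.fg_epi[OF 2 1]) (use M in simp)
qed

lemma fg_of_res:
  assumes M: "S.lm M" and fg: "R.fg (res M)"
  shows "S.fg M"
proof -
  obtain T where T: "finite T" "T \<subseteq> carrier (res M)" "\<forall>H. R.sub H (res M) \<longrightarrow> T \<subseteq> H \<longrightarrow> H = carrier (res M)"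
    using fg unfolding R.fg_iff_generators by blast
  show ?thesis
    unfolding S.fg_iff_generators
    by (rule conjI[OF M], rule exI[of _ T]) (use T sub_res[OF M] in simp)
qed

text \<open>A chain of left ideals of \<Lambda> is a chain of R-submodules of \<Lambda>, which is
  finitely generated over the noetherian ring R.\<close>

lemma acc_S: "S.chain_cond True (regular_module \<Lambda>)"
  unfolding S.chain_cond_def
proof (intro allI impI)
  fix H :: "nat \<Rightarrow> 'a set"
  assume H: "\<forall>n. S.sub (H n) (regular_module \<Lambda>)" "\<forall>n. if True then H n \<subseteq> H (Suc n) else H (Suc n) \<subseteq> H n"
  show "\<exists>N. \<forall>n\<ge>N. H n = H N"
    by (rule R.acc[OF fg_res_regular sub_res[OF S.lm_regular spec[OF H(1)]]]) (use H(2) in simp)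
qed

end

sublocale dualized_artin_algebra \<subseteq> S: noetherian_modules \<Lambda>
  by (rule S.noetherian_modulesI[OF acc_S])

context dualized_artin_algebra begin

subsection \<open>The standard duality\<close>

abbreviation "dual \<equiv> standard_dual R \<phi> J"

lemma dual_simps:
  "carrier (dual X) = R.Hom (res X) J \<inter> extensional (carrier X)"
  "\<zero>\<^bsub>dual X\<^esub> = (\<lambda>x\<in>carrier X. \<zero>\<^bsub>J\<^esub>)"
  "f \<oplus>\<^bsub>dual X\<^esub> g = (\<lambda>x\<in>carrier X. f x \<oplus>\<^bsub>J\<^esub> g x)"
  "b \<odot>\<^bsub>dual X\<^esub> f = (\<lambda>x\<in>carrier X. f (b \<odot>\<^bsub>X\<^esub> x))"
  by (simp_all add: standard_dual_def)

lemma lm_J [simp]: "R.lm J"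
  using R.fg_J by simp

text \<open>Only the action of \<open>R\<close> on \<open>X\<close> matters here: \<open>X\<close> will be a module over \<open>\<Lambda>\<close> or over its opposite.\<close>

lemma restrict_hom:
  assumes "R.lm (res X)" "f \<in> R.Hom (res X) J"
  shows "(\<lambda>x\<in>carrier X. f x) \<in> carrier (dual X)"
  unfolding dual_simps using R.hom_cong[OF assms(2) _ assms(1), of "\<lambda>x\<in>carrier X. f x"] by simp

lemma lm_res_dual:
  assumes X: "R.lm (res X)"
  shows "R.lm (res (dual X))"
proof -
  have add: "f \<oplus>\<^bsub>dual X\<^esub> g \<in> carrier (dual X)" if "f \<in> carrier (dual X)" "g \<in> carrier (dual X)" for f g
    unfolding dual_simps(3) by (rule restrict_hom[OF X R.hom_plus]) (use that in \<open>simp_all add: dual_simps(1)\<close>)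
  have c: "f x \<in> carrier J" if "f \<in> carrier (dual X)" "x \<in> carrier X" for f x
    using that R.hom_closed[of f "res X" J x] by (simp add: dual_simps(1))
  have e: "f x = undefined" if "f \<in> carrier (dual X)" "x \<notin> carrier X" for f x
    using that by (auto simp: dual_simps(1) extensional_def)
  \<comment> \<open>By R-linearity of \<open>f\<close>, a scalar acting on the argument also acts on
    the value. In this form the module laws of the dual reduce to those of \<open>J\<close>.\<close>
  have sm: "\<phi> r \<odot>\<^bsub>dual X\<^esub> f = (\<lambda>x\<in>carrier X. r \<odot>\<^bsub>J\<^esub> f x)" if "r \<in> carrier R" "f \<in> carrier (dual X)" for r f
    unfolding dual_simps(4)
    by (rule restrict_ext) (use that R.hom_smult[of f "res X" J r] in \<open>simp add: dual_simps(1)\<close>)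
  have rX: "\<phi> r \<odot>\<^bsub>X\<^esub> x \<in> carrier X" if "r \<in> carrier R" "x \<in> carrier X" for r x
    using R.m_smult_closed[OF X, of r x] that by simp
  have smc: "\<phi> r \<odot>\<^bsub>dual X\<^esub> f \<in> carrier (dual X)" if r: "r \<in> carrier R" and f: "f \<in> carrier (dual X)" for r f
  proof -
    have fh: "f \<in> R.Hom (res X) J" using f by (simp add: dual_simps(1))
    have "(\<lambda>x. r \<odot>\<^bsub>J\<^esub> f x) \<in> R.Hom (res X) J"
    proof (rule R.homI)
      show "r \<odot>\<^bsub>J\<^esub> f (a \<odot>\<^bsub>res X\<^esub> x) = a \<odot>\<^bsub>J\<^esub> (r \<odot>\<^bsub>J\<^esub> f x)" if "a \<in> carrier R" "x \<in> carrier (res X)" for a x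
        using R.hom_smult[OF fh that] R.hom_closed[OF fh that(2)] r that(1)
          cring.cring_simprules(14)[OF R.cring_R r that(1)]
        by (simp add: R.m_smult_assoc[symmetric] del: res_simps)
    qed (use fh r R.hom_add[OF fh] R.hom_closed[OF fh] in \<open>simp_all add: R.m_smult_r_distr\<close>)
    then show ?thesis unfolding sm[OF r f] by (rule restrict_hom[OF X])
  qed
  have z: "\<zero>\<^bsub>dual X\<^esub> \<in> carrier (dual X)"
    unfolding dual_simps(2) by (rule restrict_hom[OF X R.hom_const_zero]) simp
  show ?thesis
  proof (rule R.lmI, unfold res_simps, goal_cases)
    case (1 f g)
    then show ?case by (rule add)
  next
    case 2
    then show ?case by (rule z)
  next
    case (3 f g h)
    then show ?case unfolding dual_simps(3) by (intro restrict_ext) (simp add: c R.m_assoc)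
  next
    case (4 f g)
    then show ?case unfolding dual_simps(3) by (intro restrict_ext) (simp add: c R.m_comm)
  next
    case (5 f)
    then show ?case unfolding dual_simps(2,3)
      by (intro extensionalityI[of _ "carrier X"]) (simp_all add: c, simp add: dual_simps(1))
  next
    case (6 f)
    then have fh: "f \<in> R.Hom (res X) J" by (simp add: dual_simps(1))
    show ?case
      by (rule bexI[OF _ restrict_hom[OF X R.hom_uminus[OF fh lm_J]]])
         (unfold dual_simps(2,3), rule restrict_ext, simp add: c[OF 6])
  next
    case (7 r f)
    then show ?case by (rule smc)
  next
    case (8 r s f)
    then show ?case
      using sm[OF R.A.a_closed[OF 8(1,2)] 8(3)] sm[OF 8(1,3)] sm[OF 8(2,3)]
      by (simp add: phi_add dual_simps(3)) (rule restrict_ext, simp add: c R.m_smult_l_distr)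
  next
    case (9 r f g)
    then show ?case
      using sm[OF 9(1) add[OF 9(2,3)]] sm[OF 9(1,2)] sm[OF 9(1,3)]
      by (simp add: dual_simps(3)) (rule restrict_ext, simp add: c R.m_smult_r_distr)
  next
    case (10 r s f)
    then show ?case
      using sm[OF R.A.m_closed[OF 10(1,2)] 10(3)] sm[OF 10(2,3)] sm[OF 10(1) smc[OF 10(2,3)]]
      by (simp add: phi_mult) (rule restrict_ext, simp add: c R.m_smult_assoc)
  next
    case (11 f)
    have "(\<lambda>x\<in>carrier X. \<one>\<^bsub>R\<^esub> \<odot>\<^bsub>J\<^esub> f x) = f"
      by (rule extensionalityI[of _ "carrier X"]) (use 11 in \<open>simp_all add: c, simp add: dual_simps(1)\<close>)
    then show ?case using sm[OF R.A.one_closed 11] by simp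
  qed
qed

text \<open>Evaluation at \<open>n\<close> generators of \<open>X\<close> embeds the dual into the
  \<open>n\<close>-th power of \<open>J\<close>, a finitely generated module over a noetherian
  ring.\<close>

lemma fg_res_dual:
  fixes X :: "('a, 'm) module"
  assumes X: "R.fg (res X)"
  shows "R.fg (res (dual X))"
proof -
  have lmX: "R.lm (res X)" using X by simp
  obtain T where T: "finite T" "T \<subseteq> carrier (res X)" "\<And>H. R.sub H (res X) \<Longrightarrow> T \<subseteq> H \<Longrightarrow> H = carrier (res X)"
    using X unfolding R.fg_iff_generators by blast
  obtain n and t :: "nat \<Rightarrow> 'm" where t: "T = t ` {i. i < n}"
    using finite_imp_nat_seg_image_inj_on[OF T(1)] by blast
  have tX: "t i \<in> carrier X" if "i < n" for i using T(2) t that by auto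
  have lmD: "R.lm (res (dual X))" by (rule lm_res_dual[OF lmX])
  define ev where "ev f = (\<lambda>i\<in>{..<n}. f (t i))" for f :: "'m \<Rightarrow> 'j"
  have lmP: "R.lm (power_module J n)" by (rule R.lm_ds) simp
  have "ev \<in> R.Hom (res (dual X)) (power_module J n)"
    unfolding ev_def
  proof (rule R.ds_tuple)
    fix i assume i: "i < n"
    show "(\<lambda>f. f (t i)) \<in> R.Hom (res (dual X)) J"
    proof (rule R.homI)
      show "f (t i) \<in> carrier J" if "f \<in> carrier (res (dual X))" for f
        using that tX[OF i] R.hom_closed[of f "res X" J] by (simp add: dual_simps)
      show "(f \<oplus>\<^bsub>res (dual X)\<^esub> g) (t i) = f (t i) \<oplus>\<^bsub>J\<^esub> g (t i)" for f g
        using tX[OF i] by (simp add: dual_simps)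
      show "(r \<odot>\<^bsub>res (dual X)\<^esub> f) (t i) = r \<odot>\<^bsub>J\<^esub> f (t i)"
        if "r \<in> carrier R" "f \<in> carrier (res (dual X))" for r f
        using that tX[OF i] R.hom_smult[of f "res X" J r "t i"] by (simp add: dual_simps)
    qed
  qed
  then have "ev \<in> R.Monic (res (dual X)) (power_module J n)"
  proof (rule R.monoI[OF _ lmD lmP])
    fix f assume f: "f \<in> carrier (res (dual X))" "ev f = \<zero>\<^bsub>power_module J n\<^esub>"
    have fh: "f \<in> R.Hom (res X) J" "f \<in> extensional (carrier X)" using f(1) by (simp_all add: dual_simps)
    have ft: "f (t i) = \<zero>\<^bsub>J\<^esub>" if "i < n" for i
      using fun_cong[OF f(2), of i] that by (simp add: ev_def R.ds_simps)
    have "{x \<in> carrier (res X). f x \<in> {\<zero>\<^bsub>J\<^esub>}} = carrier (res X)"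
      by (rule T(3)[OF R.sub_preimage[OF fh(1) lmX lm_J R.sub_zero_self[OF lm_J]]]) (use t ft tX in auto)
    then have "f x = \<zero>\<^bsub>J\<^esub>" if "x \<in> carrier X" for x using that by auto
    then show "f = \<zero>\<^bsub>res (dual X)\<^esub>"
      using fh(2) by (intro extensionalityI[of _ "carrier X"]) (simp_all add: dual_simps)
  qed
  then show ?thesis using R.fg_mono[OF _ R.fg_ds[OF R.fg_J] lmD] by blast
qed

abbreviation "D\<Lambda> \<equiv> dual_of_algebra R \<phi> J \<Lambda>"

lemma op_simps [simp]: "carrier (regular_module (opposite_ring \<Lambda>)) = carrier \<Lambda>"
  "add (regular_module (opposite_ring \<Lambda>)) = add \<Lambda>"
  "zero (regular_module (opposite_ring \<Lambda>)) = zero \<Lambda>"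
  "b \<odot>\<^bsub>regular_module (opposite_ring \<Lambda>)\<^esub> x = x \<otimes>\<^bsub>\<Lambda>\<^esub> b"
  by (simp_all add: regular_module_def opposite_ring_def)

text \<open>The image of \<open>\<phi>\<close> is central, so the identity map is R-linear between
  \<Lambda> as a left and as a right module over itself.\<close>

lemma fg_res_op: "R.fg (res (regular_module (opposite_ring \<Lambda>)))"
proof -
  let ?A = "res (regular_module \<Lambda>)" and ?B = "res (regular_module (opposite_ring \<Lambda>))"
  have "R.lm ?B"
    by (rule R.lm_image[of ?A "\<lambda>x. x"]) (simp_all add: phi_central)
  moreover have "(\<lambda>x. x) \<in> R.Epic ?A ?B"
    by (rule R.imageI_epi, rule R.homI) (simp_all add: phi_central)
  ultimately show ?thesis using R.fg_epi[OF fg_res_regular] by blast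
qed

lemma lm_res_op: "R.lm (res (regular_module (opposite_ring \<Lambda>)))"
  using fg_res_op by simp

lemma D\<Lambda>_simps:
  "carrier D\<Lambda> = R.Hom (res (regular_module (opposite_ring \<Lambda>))) J \<inter> extensional (carrier \<Lambda>)"
  "\<zero>\<^bsub>D\<Lambda>\<^esub> = (\<lambda>x\<in>carrier \<Lambda>. \<zero>\<^bsub>J\<^esub>)"
  "f \<oplus>\<^bsub>D\<Lambda>\<^esub> g = (\<lambda>x\<in>carrier \<Lambda>. f x \<oplus>\<^bsub>J\<^esub> g x)"
  "b \<odot>\<^bsub>D\<Lambda>\<^esub> f = (\<lambda>x\<in>carrier \<Lambda>. f (x \<otimes>\<^bsub>\<Lambda>\<^esub> b))"
  by (simp_all add: dual_of_algebra_def dual_simps)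

lemma lm_D\<Lambda>: "S.lm D\<Lambda>"
proof -
  have RD: "R.lm (res D\<Lambda>)" unfolding dual_of_algebra_def by (rule lm_res_dual[OF lm_res_op])
  \<comment> \<open>The additive group is the same as for the R-module structure; only the laws for
    the action of \<Lambda> remain.\<close>
  note ag = R.m_add_closed[OF RD] R.m_zero_closed[OF RD] R.m_assoc[OF RD] R.m_comm[OF RD]
    R.m_l_zero[OF RD] R.m_l_neg[OF RD] R.m_neg_closed[OF RD]
  note ag = ag[unfolded res_simps]
  have hm: "f \<in> R.Hom (res (regular_module (opposite_ring \<Lambda>))) J" if "f \<in> carrier D\<Lambda>" for f
    using that by (simp add: D\<Lambda>_simps)
  have fc: "f x \<in> carrier J" if "f \<in> carrier D\<Lambda>" "x \<in> carrier \<Lambda>" for f x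
    using R.hom_closed[OF hm[OF that(1)], of x] that(2) by simp
  have fadd: "f (x \<oplus>\<^bsub>\<Lambda>\<^esub> y) = f x \<oplus>\<^bsub>J\<^esub> f y" if "f \<in> carrier D\<Lambda>" "x \<in> carrier \<Lambda>" "y \<in> carrier \<Lambda>" for f x y
    using R.hom_add[OF hm[OF that(1)], of x y] that(2,3) by simp
  have fsm: "f (x \<otimes>\<^bsub>\<Lambda>\<^esub> \<phi> r) = r \<odot>\<^bsub>J\<^esub> f x" if "f \<in> carrier D\<Lambda>" "x \<in> carrier \<Lambda>" "r \<in> carrier R" for f x r
    using R.hom_smult[OF hm[OF that(1)], of r x] that(2,3) by simp
  have ring: "\<And>a b c. \<lbrakk>a \<in> carrier \<Lambda>; b \<in> carrier \<Lambda>; c \<in> carrier \<Lambda>\<rbrakk> \<Longrightarrow>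
      (a \<oplus>\<^bsub>\<Lambda>\<^esub> b) \<otimes>\<^bsub>\<Lambda>\<^esub> c = a \<otimes>\<^bsub>\<Lambda>\<^esub> c \<oplus>\<^bsub>\<Lambda>\<^esub> b \<otimes>\<^bsub>\<Lambda>\<^esub> c"
    by (rule S.A.l_distr)
  show ?thesis
  proof (rule S.lmI, goal_cases)
    case (1 f g)
    then show ?case by (rule ag(1))
  next
    case 2
    show ?case by (rule ag(2))
  next
    case (3 f g h)
    then show ?case by (rule ag(3))
  next
    case (4 f g)
    then show ?case by (rule ag(4))
  next
    case (5 f)
    then show ?case by (rule ag(5))
  next
    case (6 f)
    show ?case by (rule bexI, rule ag(6)[OF 6], rule ag(7)[OF 6])
  next
    case (7 b f)
    have "(\<lambda>x. f (x \<otimes>\<^bsub>\<Lambda>\<^esub> b)) \<in> R.Hom (res (regular_module (opposite_ring \<Lambda>))) J"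
    proof (rule R.homI)
      show "f (r \<odot>\<^bsub>res (regular_module (opposite_ring \<Lambda>))\<^esub> x \<otimes>\<^bsub>\<Lambda>\<^esub> b) = r \<odot>\<^bsub>J\<^esub> f (x \<otimes>\<^bsub>\<Lambda>\<^esub> b)"
        if r: "r \<in> carrier R" and x: "x \<in> carrier (res (regular_module (opposite_ring \<Lambda>)))" for r x
      proof -
        have "x \<otimes>\<^bsub>\<Lambda>\<^esub> \<phi> r \<otimes>\<^bsub>\<Lambda>\<^esub> b = x \<otimes>\<^bsub>\<Lambda>\<^esub> b \<otimes>\<^bsub>\<Lambda>\<^esub> \<phi> r"
          using phi_central[OF r 7(1)] r x 7(1) by (simp add: S.A.m_assoc)
        then show ?thesis using fsm[OF 7(2), of "x \<otimes>\<^bsub>\<Lambda>\<^esub> b" r] r x 7(1) by simp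
      qed
    qed (use 7 in \<open>simp_all add: fc fadd S.A.l_distr\<close>)
    from restrict_hom[OF lm_res_op this] show ?case
      unfolding D\<Lambda>_simps(4) by (simp add: dual_of_algebra_def)
  next
    case (8 a b f)
    then show ?case
      unfolding D\<Lambda>_simps(3,4) by (intro restrict_ext) (simp add: S.A.r_distr fadd)
  next
    case (9 a f g)
    then show ?case
      unfolding D\<Lambda>_simps(3,4) by (intro restrict_ext) simp
  next
    case (10 a b f)
    then show ?case
      unfolding D\<Lambda>_simps(3,4) by (intro restrict_ext) (simp add: S.A.m_assoc)
  next
    case (11 f)
    then show ?case
      unfolding D\<Lambda>_simps(4) by (intro extensionalityI[of _ "carrier \<Lambda>"]) (simp_all, simp add: D\<Lambda>_simps)
  qed
qed

lemma fg_D\<Lambda>: "S.fg D\<Lambda>"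
  by (rule fg_of_res[OF lm_D\<Lambda>]) (unfold dual_of_algebra_def, rule fg_res_dual[OF fg_res_op])

text \<open>One direction of the adjunction between R-linear maps \<open>N -> J\<close> and
  \<Lambda>-linear maps from \<open>N\<close> to the dual of \<Lambda>; the other direction is
  evaluation at the identity of \<Lambda>.\<close>

lemma hom_to_D\<Lambda>:
  assumes N: "S.lm N" and k: "k \<in> R.Hom (res N) J"
  shows "(\<lambda>y. \<lambda>a\<in>carrier \<Lambda>. k (a \<odot>\<^bsub>N\<^esub> y)) \<in> S.Hom N D\<Lambda>"
proof (rule S.homI)
  fix y assume y: "y \<in> carrier N"
  have "(\<lambda>a. k (a \<odot>\<^bsub>N\<^esub> y)) \<in> R.Hom (res (regular_module (opposite_ring \<Lambda>))) J"
  proof (rule R.homI)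
    show "k (a \<odot>\<^bsub>N\<^esub> y) \<in> carrier J" if "a \<in> carrier (res (regular_module (opposite_ring \<Lambda>)))" for a
      using R.hom_closed[OF k, of "a \<odot>\<^bsub>N\<^esub> y"] that y N by simp
    show "k ((a \<oplus>\<^bsub>res (regular_module (opposite_ring \<Lambda>))\<^esub> b) \<odot>\<^bsub>N\<^esub> y) = k (a \<odot>\<^bsub>N\<^esub> y) \<oplus>\<^bsub>J\<^esub> k (b \<odot>\<^bsub>N\<^esub> y)"
      if "a \<in> carrier (res (regular_module (opposite_ring \<Lambda>)))" "b \<in> carrier (res (regular_module (opposite_ring \<Lambda>)))" for a b
    proof -
      have ab: "a \<in> carrier \<Lambda>" "b \<in> carrier \<Lambda>" using that by simp_all
      have c: "a \<odot>\<^bsub>N\<^esub> y \<in> carrier (res N)" "b \<odot>\<^bsub>N\<^esub> y \<in> carrier (res N)" using ab y N by simp_all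
      show ?thesis using R.hom_add[OF k c] S.m_smult_l_distr[OF N ab y] by simp
    qed
    show "k ((r \<odot>\<^bsub>res (regular_module (opposite_ring \<Lambda>))\<^esub> a) \<odot>\<^bsub>N\<^esub> y) = r \<odot>\<^bsub>J\<^esub> k (a \<odot>\<^bsub>N\<^esub> y)"
      if "r \<in> carrier R" "a \<in> carrier (res (regular_module (opposite_ring \<Lambda>)))" for r a
      using R.hom_smult[OF k, of r "a \<odot>\<^bsub>N\<^esub> y"] that y N
      by (simp add: phi_central[symmetric] S.m_smult_assoc)
  qed
  then show "(\<lambda>a\<in>carrier \<Lambda>. k (a \<odot>\<^bsub>N\<^esub> y)) \<in> carrier D\<Lambda>"
    using restrict_hom[OF lm_res_op] by (simp add: dual_of_algebra_def)
next
  fix y z assume yz: "y \<in> carrier N" "z \<in> carrier N"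
  show "(\<lambda>a\<in>carrier \<Lambda>. k (a \<odot>\<^bsub>N\<^esub> (y \<oplus>\<^bsub>N\<^esub> z))) =
      (\<lambda>a\<in>carrier \<Lambda>. k (a \<odot>\<^bsub>N\<^esub> y)) \<oplus>\<^bsub>D\<Lambda>\<^esub> (\<lambda>a\<in>carrier \<Lambda>. k (a \<odot>\<^bsub>N\<^esub> z))"
    unfolding D\<Lambda>_simps(3)
  proof (rule restrict_ext)
    fix a assume a: "a \<in> carrier \<Lambda>"
    have c: "a \<odot>\<^bsub>N\<^esub> y \<in> carrier (res N)" "a \<odot>\<^bsub>N\<^esub> z \<in> carrier (res N)" using a yz N by simp_all
    show "k (a \<odot>\<^bsub>N\<^esub> (y \<oplus>\<^bsub>N\<^esub> z)) =
        (\<lambda>a\<in>carrier \<Lambda>. k (a \<odot>\<^bsub>N\<^esub> y)) a \<oplus>\<^bsub>J\<^esub> (\<lambda>a\<in>carrier \<Lambda>. k (a \<odot>\<^bsub>N\<^esub> z)) a"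
      using R.hom_add[OF k c] S.m_smult_r_distr[OF N a yz] a by simp
  qed
next
  fix b y assume by': "b \<in> carrier \<Lambda>" "y \<in> carrier N"
  show "(\<lambda>a\<in>carrier \<Lambda>. k (a \<odot>\<^bsub>N\<^esub> (b \<odot>\<^bsub>N\<^esub> y))) = b \<odot>\<^bsub>D\<Lambda>\<^esub> (\<lambda>a\<in>carrier \<Lambda>. k (a \<odot>\<^bsub>N\<^esub> y))"
    unfolding D\<Lambda>_simps(4) by (rule restrict_ext) (use by' N in \<open>simp add: S.m_smult_assoc\<close>)
qed

text \<open>By the adjunction, extending \<open>h\<close> amounts to extending the R-linear map
  \<open>m |-> h m 1\<close>, and \<open>J\<close> is injective over R. The extension
  \<open>k\<close> is translated back by \<open>hom_to_D\<Lambda>\<close>.\<close>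

lemma inje_D\<Lambda>: "S.inje D\<Lambda>"
proof (rule S.injeI[OF fg_D\<Lambda>])
  fix M N :: "'a umod" and g h
  assume *: "S.fg M" "S.fg N" "g \<in> S.Monic M N" "h \<in> S.Hom M D\<Lambda>"
  have lm: "S.lm M" "S.lm N" using * by simp_all
  have hc: "h m \<in> carrier D\<Lambda>" if "m \<in> carrier M" for m using S.hom_closed[OF *(4) that] .
  have h0: "(\<lambda>m. h m \<one>\<^bsub>\<Lambda>\<^esub>) \<in> R.Hom (res M) J"
  proof (rule R.homI)
    fix m assume m: "m \<in> carrier (res M)"
    have hh: "h m \<in> R.Hom (res (regular_module (opposite_ring \<Lambda>))) J" using hc[of m] m by (simp add: D\<Lambda>_simps)
    then show "h m \<one>\<^bsub>\<Lambda>\<^esub> \<in> carrier J" using R.hom_closed[OF hh, of "\<one>\<^bsub>\<Lambda>\<^esub>"] by simp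
    show "h (m \<oplus>\<^bsub>res M\<^esub> m') \<one>\<^bsub>\<Lambda>\<^esub> = h m \<one>\<^bsub>\<Lambda>\<^esub> \<oplus>\<^bsub>J\<^esub> h m' \<one>\<^bsub>\<Lambda>\<^esub>" if "m' \<in> carrier (res M)" for m'
      using S.hom_add[OF *(4), of m m'] m that by (simp add: D\<Lambda>_simps)
    show "h (r \<odot>\<^bsub>res M\<^esub> m) \<one>\<^bsub>\<Lambda>\<^esub> = r \<odot>\<^bsub>J\<^esub> h m \<one>\<^bsub>\<Lambda>\<^esub>" if "r \<in> carrier R" for r
      using S.hom_smult[OF *(4), of "\<phi> r" m] R.hom_smult[OF hh that, of "\<one>\<^bsub>\<Lambda>\<^esub>"] m that
      by (simp add: D\<Lambda>_simps)
  qed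
  have gm: "g \<in> R.Monic (res M) (res N)"
    by (rule R.injI_mono[OF hom_res[OF S.mono_hom[OF *(3)]]]) (use S.mono_inj[OF *(3)] in simp)
  obtain k where k: "k \<in> R.Hom (res N) J" "\<forall>m\<in>carrier (res M). k (g m) = h m \<one>\<^bsub>\<Lambda>\<^esub>"
    using R.inje_extend[OF R.inje_J fg_res[OF *(1)] fg_res[OF *(2)] gm h0] by blast
  show "\<exists>k\<in>S.Hom N D\<Lambda>. \<forall>x\<in>carrier M. k (g x) = h x"
  proof (rule bexI[OF _ hom_to_D\<Lambda>[OF lm(2) k(1)]], rule ballI)
    fix m assume m: "m \<in> carrier M"
    show "(\<lambda>a\<in>carrier \<Lambda>. k (a \<odot>\<^bsub>N\<^esub> g m)) = h m"
    proof (rule extensionalityI[of _ "carrier \<Lambda>"])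
      show "h m \<in> extensional (carrier \<Lambda>)" using hc[OF m] by (simp add: D\<Lambda>_simps)
      fix a assume a: "a \<in> carrier \<Lambda>"
      have "k (a \<odot>\<^bsub>N\<^esub> g m) = k (g (a \<odot>\<^bsub>M\<^esub> m))"
        using S.hom_smult[OF S.mono_hom[OF *(3)] a m] by simp
      also have "\<dots> = h (a \<odot>\<^bsub>M\<^esub> m) \<one>\<^bsub>\<Lambda>\<^esub>" using k(2) m a lm by simp
      also have "\<dots> = h m a"
        using S.hom_smult[OF *(4) a m] a by (simp add: D\<Lambda>_simps)
      finally show "(\<lambda>a\<in>carrier \<Lambda>. k (a \<odot>\<^bsub>N\<^esub> g m)) a = h m a" using a by simp
    qed simp
  qed
qed

text \<open>Generators of the \<open>R\<close>-module of all maps to \<open>J\<close> separate points.\<close>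

lemma mono_to_power_D\<Lambda>:
  fixes X :: "('a, 'm) module"
  assumes X: "S.fg X"
  obtains m f where "f \<in> S.Monic X (power_module D\<Lambda> m)"
proof -
  have lmX: "S.lm X" "R.lm (res X)" using X by simp_all
  have "R.fg (res (dual X))" by (rule fg_res_dual[OF fg_res[OF X]])
  then obtain T where T: "finite T" "T \<subseteq> carrier (res (dual X))"
      "\<And>H. R.sub H (res (dual X)) \<Longrightarrow> T \<subseteq> H \<Longrightarrow> H = carrier (res (dual X))"
    unfolding R.fg_iff_generators by blast
  obtain n and t :: "nat \<Rightarrow> 'm \<Rightarrow> 'j" where t: "T = t ` {i. i < n}"
    using finite_imp_nat_seg_image_inj_on[OF T(1)] by blast
  have th: "t i \<in> R.Hom (res X) J" if "i < n" for i
    using T(2) t that by (auto simp: dual_simps)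
  define F where "F x = (\<lambda>i\<in>{..<n}. \<lambda>a\<in>carrier \<Lambda>. t i (a \<odot>\<^bsub>X\<^esub> x))" for x
  have lmP: "S.lm (power_module D\<Lambda> n)" by (rule S.lm_ds) (rule lm_D\<Lambda>)
  have "F \<in> S.Hom X (power_module D\<Lambda> n)"
    unfolding F_def by (rule S.ds_tuple) (rule hom_to_D\<Lambda>[OF lmX(1) th])
  then have "F \<in> S.Monic X (power_module D\<Lambda> n)"
  proof (rule S.monoI[OF _ lmX(1) lmP])
    fix x assume x: "x \<in> carrier X" "F x = \<zero>\<^bsub>power_module D\<Lambda> n\<^esub>"
    have tx: "t i x = \<zero>\<^bsub>J\<^esub>" if i: "i < n" for i
    proof -
      have "(\<lambda>a\<in>carrier \<Lambda>. t i (a \<odot>\<^bsub>X\<^esub> x)) = \<zero>\<^bsub>D\<Lambda>\<^esub>"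
        using fun_cong[OF x(2), of i] i by (simp add: F_def S.ds_simps)
      from fun_cong[OF this, of "\<one>\<^bsub>\<Lambda>\<^esub>"] show ?thesis using x(1) lmX by (simp add: D\<Lambda>_simps)
    qed
    have lmD: "R.lm (res (dual X))" by (rule lm_res_dual[OF lmX(2)])
    \<comment> \<open>The functionals vanishing at \<open>x\<close> form an R-submodule containing
      the generators \<open>T\<close>, hence all functionals vanish at \<open>x\<close>, and
      \<open>cogenerator_J\<close> forces \<open>x\<close> to be zero.\<close>
    have "{f \<in> carrier (res (dual X)). f x = \<zero>\<^bsub>J\<^esub>} = carrier (res (dual X))"
    proof (rule T(3))
      show "R.sub {f \<in> carrier (res (dual X)). f x = \<zero>\<^bsub>J\<^esub>} (res (dual X))"
      proof (rule R.subI[OF lmD])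
        show "\<zero>\<^bsub>res (dual X)\<^esub> \<in> {f \<in> carrier (res (dual X)). f x = \<zero>\<^bsub>J\<^esub>}"
          using R.m_zero_closed[OF lmD] x(1) by (simp add: dual_simps(2))
        show "f \<oplus>\<^bsub>res (dual X)\<^esub> g \<in> {f \<in> carrier (res (dual X)). f x = \<zero>\<^bsub>J\<^esub>}"
          if "f \<in> {f \<in> carrier (res (dual X)). f x = \<zero>\<^bsub>J\<^esub>}" "g \<in> {f \<in> carrier (res (dual X)). f x = \<zero>\<^bsub>J\<^esub>}" for f g
          using R.m_add_closed[OF lmD, of f g] that x(1) by (simp add: dual_simps(3))
        show "r \<odot>\<^bsub>res (dual X)\<^esub> f \<in> {f \<in> carrier (res (dual X)). f x = \<zero>\<^bsub>J\<^esub>}"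
          if r: "r \<in> carrier R" and "f \<in> {f \<in> carrier (res (dual X)). f x = \<zero>\<^bsub>J\<^esub>}" for r f
          using R.m_smult_closed[OF lmD, of r f] R.hom_smult[of f "res X" J r x] that x(1)
          by (simp add: dual_simps(1,4))
      qed auto
      show "T \<subseteq> {f \<in> carrier (res (dual X)). f x = \<zero>\<^bsub>J\<^esub>}" using T(2) t tx by auto
    qed
    then have all: "f x = \<zero>\<^bsub>J\<^esub>" if "f \<in> carrier (dual X)" for f using that by auto
    show "x = \<zero>\<^bsub>X\<^esub>"
    proof (rule ccontr)
      assume "x \<noteq> \<zero>\<^bsub>X\<^esub>"
      then obtain f where f: "f \<in> R.Hom (res X) J" "f x \<noteq> \<zero>\<^bsub>J\<^esub>"
        using R.cogenerator_J[OF fg_res[OF X], of x] x(1) by auto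
      show False using all[OF restrict_hom[OF lmX(2) f(1)]] f(2) x(1) by simp
    qed
  qed
  then show ?thesis by (rule that)
qed

lemma enough_injectives:
  fixes X :: "'a umod"
  assumes X: "S.fg X"
  shows "\<exists>(E :: 'a umod) f. S.inje E \<and> f \<in> S.Monic X E"
proof -
  obtain m f where f: "f \<in> S.Monic X (power_module D\<Lambda> m)" by (rule mono_to_power_D\<Lambda>[OF X])
  have P: "S.inje (power_module D\<Lambda> m)" by (rule S.inje_ds) (rule inje_D\<Lambda>)
  obtain I :: "'a umod" and e where "S.inje I" "e \<in> S.Monic X I"
    by (rule S.injective_envelope_retract[OF S.fg_lm[OF X] P f])
  then show ?thesis by blast
qed

end

context noetherian_modules
begin

text \<open>A complement of a retract is the kernel of its projection \<open>p\<close>. The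
  noetherian hypothesis makes this kernel finitely generated, so it has a copy \<open>Y\<close> in
  the universe as \<open>add_closure\<close> demands.\<close>

lemma in_add_iff_add_closure:
  fixes T :: "('a, 't) module" and X :: "'a umod"
  assumes T: "fg T"
  shows "X \<in> add_closure A T \<longleftrightarrow> fg X \<and> in_add T X"
proof
  assume "X \<in> add_closure A T"
  then obtain n and Y :: "'a umod" where X: "fg X" "fg Y"
    "isomorphic_modules A (direct_sum2 X Y) (power_module T n)"
    unfolding add_closure_def by blast
  have "lm (power_module T n)" by (rule lm_ds) (use T in simp)
  then have "retract (direct_sum2 X Y) (power_module T n)"
    using retract_iso(1)[OF X(3)] X by simp
  then show "fg X \<and> in_add T X"
    unfolding in_add_def using retract_trans[OF retract_ds2_left] X fg_lm by blast
next
  assume X: "fg X \<and> in_add T X"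
  then obtain n where n: "retract X (power_module T n)" unfolding in_add_def by blast
  let ?T = "power_module T n"
  have fgT: "fg ?T" by (rule fg_ds) (rule T)
  have lm: "lm X" "lm ?T" using X fgT by simp_all
  obtain i p where ip: "i \<in> Hom X ?T" "p \<in> Hom ?T X" "\<forall>x\<in>carrier X. p (i x) = x"
    using n by (rule retractE)
  let ?K = "submod ?T (hom_kernel ?T X p)"
  have fgK: "fg ?K" by (rule fg_kernel[OF ip(2) fgT lm(1)])
  obtain Y :: "'a umod" and h k where Y: "fg Y" "h \<in> Iso ?K Y" "k \<in> Iso Y ?K"
    "\<forall>x\<in>carrier ?K. k (h x) = x" "\<forall>y\<in>carrier Y. h (k y) = y"
    using umod_ex[OF fgK] .
  have kK: "k y \<in> carrier ?T" "p (k y) = \<zero>\<^bsub>X\<^esub>" if "y \<in> carrier Y" for y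
    using hom_closed[OF iso_hom[OF Y(3)] that] by (simp_all add: hom_kernel_def)
  have kT: "k \<in> Hom Y ?T"
    by (rule homI) (use kK hom_add[OF iso_hom[OF Y(3)]] hom_smult[OF iso_hom[OF Y(3)]] in simp_all)
  define l where "l z = i (fst z) \<oplus>\<^bsub>?T\<^esub> k (snd z)" for z
  have l: "l \<in> Hom (direct_sum2 X Y) ?T" unfolding l_def by (rule ds2_copair[OF ip(1) kT lm(2)])
  have pl: "p (l z) = fst z" if "z \<in> carrier (direct_sum2 X Y)" for z
  proof -
    have c: "fst z \<in> carrier X" "snd z \<in> carrier Y" using that by auto
    show ?thesis
      unfolding l_def
      using hom_add[OF ip(2) hom_closed[OF ip(1) c(1)] kK(1)[OF c(2)]] kK(2)[OF c(2)] ip(3) c lm by simp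
  qed
  have "l \<in> Monic (direct_sum2 X Y) ?T"
  proof (rule monoI[OF l _ lm(2)])
    show "lm (direct_sum2 X Y)" using lm Y by simp
    fix z assume z: "z \<in> carrier (direct_sum2 X Y)" "l z = \<zero>\<^bsub>?T\<^esub>"
    then have f: "fst z = \<zero>\<^bsub>X\<^esub>" using pl[OF z(1)] hom_zero[OF ip(2) lm(2,1)] by simp
    have c: "snd z \<in> carrier Y" using z(1) by auto
    have "k (snd z) = \<zero>\<^bsub>?T\<^esub>"
      using z(2) f hom_zero[OF ip(1) lm] kK(1)[OF c] lm(2) by (simp add: l_def)
    then have "snd z = \<zero>\<^bsub>Y\<^esub>"
      using mono_zero_iff[OF iso_mono[OF Y(3)] fg_lm[OF Y(1)] fg_lm[OF fgK] c] by simp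
    then show "z = \<zero>\<^bsub>direct_sum2 X Y\<^esub>" using f by (simp add: prod_eq_iff)
  qed
  moreover have "l \<in> Epic (direct_sum2 X Y) ?T"
  proof (rule epiI[OF l])
    fix t assume t: "t \<in> carrier ?T"
    have c: "p t \<in> carrier X" "i (p t) \<in> carrier ?T"
      using hom_closed[OF ip(2) t] hom_closed[OF ip(1) hom_closed[OF ip(2) t]] by simp_all
    have d: "t \<ominus>\<^bsub>?T\<^esub> i (p t) \<in> carrier ?K"
      using t c hom_minus[OF ip(2) lm(2,1) t c(2)] ip(3) lm by (simp add: hom_kernel_def)
    have e: "k (h (t \<ominus>\<^bsub>?T\<^esub> i (p t))) = t \<ominus>\<^bsub>?T\<^esub> i (p t)" using Y(4) d by blast
    have "l (p t, h (t \<ominus>\<^bsub>?T\<^esub> i (p t))) = i (p t) \<oplus>\<^bsub>?T\<^esub> (t \<ominus>\<^bsub>?T\<^esub> i (p t))"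
      by (simp add: l_def e)
    also have "\<dots> = (t \<ominus>\<^bsub>?T\<^esub> i (p t)) \<oplus>\<^bsub>?T\<^esub> i (p t)"
      by (rule m_comm[OF lm(2)]) (use t c lm in simp_all)
    also have "\<dots> = t" using t c lm by simp
    finally show "\<exists>z\<in>carrier (direct_sum2 X Y). l z = t"
      using c(1) hom_closed[OF iso_hom[OF Y(2)] d]
      by (intro bexI[of _ "(p t, h (t \<ominus>\<^bsub>?T\<^esub> i (p t)))"]) simp_all
  qed
  ultimately have "isomorphic_modules A (direct_sum2 X Y) ?T"
    unfolding isomorphic_modules_def using mono_epi_iso by blast
  then show "X \<in> add_closure A T" unfolding add_closure_def using X Y(1) by blast
qed

lemma in_add_umod:
  fixes X :: "('a, 'm) module" and T :: "('a, 't) module"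
  assumes X: "in_add T X" and T: "fg T" and lmX: "lm X"
  obtains X' :: "'a umod" and h k where "X' \<in> add_closure A T" "h \<in> Iso X X'" "k \<in> Iso X' X"
    "\<forall>x\<in>carrier X. k (h x) = x" "\<forall>y\<in>carrier X'. h (k y) = y"
proof -
  have fgX: "fg X" by (rule in_add_fg[OF X T lmX])
  obtain X' :: "'a umod" and h k where h: "fg X'" "h \<in> Iso X X'" "k \<in> Iso X' X"
    "\<forall>x\<in>carrier X. k (h x) = x" "\<forall>y\<in>carrier X'. h (k y) = y"
    using umod_ex[OF fgX] .
  have "retract X' X" by (rule retractI[OF iso_hom[OF h(3)] iso_hom[OF h(2)]]) (use h(5) in simp)
  then have "X' \<in> add_closure A T"
    using in_add_iff_add_closure[OF T] h(1) in_add_retract X by blast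
  then show ?thesis using that h by blast
qed

lemma mono_power:
  assumes "f \<in> Monic X Y"
  shows "(\<lambda>u. \<lambda>i\<in>{..<n}. f (u i)) \<in> Monic (power_module X n) (power_module Y n)"
  by (rule ds_map_mono) (rule assms)

lemma ses_power:
  fixes L :: "('a, 'l) module" and M :: "('a, 'm) module" and N :: "('a, 'n) module"
  assumes s: "ses L f M g N" and lm: "lm L" "lm M" "lm N"
  shows "ses (power_module L n) (\<lambda>u. \<lambda>i\<in>{..<n}. f (u i)) (power_module M n)
    (\<lambda>u. \<lambda>i\<in>{..<n}. g (u i)) (power_module N n)"
proof (rule sesI[OF mono_power[OF ses_mono[OF s]] ds_map_epi])
  show "g \<in> Epic M N" by (rule ses_epi[OF s])
  show "(\<lambda>i\<in>{..<n}. g ((\<lambda>i\<in>{..<n}. f (u i)) i)) = \<zero>\<^bsub>power_module N n\<^esub>"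
    if u: "u \<in> carrier (power_module L n)" for u
    unfolding ds_simps(2) by (rule restrict_ext) (use ses_comp[OF s ds_component[OF u]] in simp)
  show "v \<in> (\<lambda>u. \<lambda>i\<in>{..<n}. f (u i)) ` carrier (power_module L n)"
    if v: "v \<in> carrier (power_module M n)" "(\<lambda>i\<in>{..<n}. g (v i)) = \<zero>\<^bsub>power_module N n\<^esub>" for v
  proof -
    have "\<exists>x. x \<in> carrier L \<and> v i = f x" if i: "i < n" for i
    proof -
      have "g (v i) = \<zero>\<^bsub>N\<^esub>" using fun_cong[OF v(2), of i] i by (simp add: ds_simps)
      then show ?thesis using ses_exact[OF s ds_component[OF v(1) i]] by blast
    qed
    then obtain u where u: "\<And>i. i < n \<Longrightarrow> u i \<in> carrier L \<and> v i = f (u i)" by metis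
    have c: "(\<lambda>i\<in>{..<n}. u i) \<in> carrier (power_module L n)"
      by (rule ds_restrict_closed) (use u in blast)
    have "v = (\<lambda>i\<in>{..<n}. f ((\<lambda>i\<in>{..<n}. u i) i))"
      by (rule extensionalityI[of _ "{..<n}"]) (use v(1) u in \<open>auto simp: ds_carrier\<close>)
    then show ?thesis using c by blast
  qed
qed

lemma proj_retract_free:
  assumes P: "proj P"
  obtains m where "retract P (power_module (regular_module A) m)"
proof -
  obtain m f where f: "f \<in> Epic (power_module (regular_module A) m) P"
    by (rule free_cover[OF proj_fg[OF P]])
  obtain s where "s \<in> Hom P (power_module (regular_module A) m)" "\<forall>x\<in>carrier P. f (s x) = x"
    using epi_to_proj_section[OF P proj_fg[OF proj_free] f] by blast
  then have "retract P (power_module (regular_module A) m)" using f by (intro retractI[of s _ _ f]) simp_all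
  then show ?thesis by (rule that)
qed

lemma retract_component:
  assumes X: "\<And>i. i < n \<Longrightarrow> lm (X i)" and j: "j < n"
  shows "retract (X j) (direct_sum n X)"
proof (rule retractI)
  show "(\<lambda>x. \<lambda>i\<in>{..<n}. if i = j then x else \<zero>\<^bsub>X i\<^esub>) \<in> Hom (X j) (direct_sum n X)"
  proof (rule ds_tuple)
    fix i assume i: "i < n"
    show "(\<lambda>x. if i = j then x else \<zero>\<^bsub>X i\<^esub>) \<in> Hom (X j) (X i)"
      using X[OF i] by (cases "i = j") simp_all
  qed
  show "(\<lambda>u. u j) \<in> Hom (direct_sum n X) (X j)" by (rule ds_proj_hom[OF j])
qed (use j in simp)

subsection \<open>Basic modules\<close>

text \<open>Keep one summand from each isomorphism class in a decomposition of \<open>M\<close>. The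
  smaller sum is a retract of \<open>M\<close>, and each discarded summand is isomorphic to one that
  was kept, so both modules have the same additive closure.\<close>

lemma basic_version:
  fixes M :: "('a, 'm) module"
  assumes M: "fg M"
  obtains T :: "'a umod" where "fg T" "basic_module A T" "retract T M" "in_add T M"
proof -
  obtain M' :: "'a umod" and a b where M': "fg M'" "a \<in> Iso M M'" "b \<in> Iso M' M"
    "\<forall>x\<in>carrier M. b (a x) = x" "\<forall>y\<in>carrier M'. a (b y) = y"
    using umod_ex[OF M] .
  obtain n and X :: "nat \<Rightarrow> 'a umod" where X: "\<forall>i<n. indecomposable_module A (X i)"
    "isomorphic_modules A M' (direct_sum n X)"
    using decomposable_umod[OF M'(1)] unfolding decomposable_def by blast
  have iso: "isomorphic_modules A M (direct_sum n X)"
    using isomorphic_trans[OF _ X(2)] M'(2) unfolding isomorphic_modules_def by blast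
  have fgX: "fg (X i)" if "i < n" for i using X(1) that indecomposable_fg by blast
  have lmX: "lm (X i)" if "i < n" for i using fgX[OF that] by simp
  have fgD: "fg (direct_sum n X)" by (rule fg_ds[OF fgX])
  \<comment> \<open>Indices that come first in their isomorphism class: existence and uniqueness of
    representatives are then both read off from the order of the indices.\<close>
  define S where "S = {i. i < n \<and> (\<forall>j<i. \<not> isomorphic_modules A (X j) (X i))}"
  have finS: "finite S" by (simp add: S_def)
  then obtain f where f: "bij_betw f {..<card S} S"
    using ex_bij_betw_nat_finite[OF finS] by (auto simp: lessThan_atLeast0)
  have fS: "f l \<in> S" "f l < n" if "l < card S" for l
    using bij_betwE[OF f] that by (auto simp: S_def)
  define B where "B = direct_sum (card S) (\<lambda>l. X (f l))"
  have fgB: "fg B" unfolding B_def by (rule fg_ds) (use fgX fS in blast)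
  obtain T :: "'a umod" and h k where T: "fg T" "h \<in> Iso B T" "k \<in> Iso T B"
    "\<forall>x\<in>carrier B. k (h x) = x" "\<forall>y\<in>carrier T. h (k y) = y"
    using umod_ex[OF fgB] .
  have TB: "isomorphic_modules A T B" using T(3) unfolding isomorphic_modules_def by blast
  have basic: "basic_module A T"
    unfolding basic_module_def
  proof (intro exI conjI allI impI)
    show "isomorphic_modules A T (direct_sum (card S) (\<lambda>l. X (f l)))" using TB by (simp add: B_def)
    show "indecomposable_module A (X (f i))" if "i < card S" for i using X(1) fS(2)[OF that] by blast
    fix i j assume ij: "i < card S" "j < card S" "i \<noteq> j"
    show "\<not> isomorphic_modules A (X (f i)) (X (f j))"
    proof
      assume iso_ij: "isomorphic_modules A (X (f i)) (X (f j))"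
      have "f i \<noteq> f j" using f ij unfolding bij_betw_def inj_on_def by auto
      moreover have "\<not> f i < f j" using fS(1)[OF ij(2)] iso_ij unfolding S_def by blast
      moreover have "\<not> f j < f i"
        using fS(1)[OF ij(1)] isomorphic_sym[OF iso_ij lmX[OF fS(2)[OF ij(1)]] lmX[OF fS(2)[OF ij(2)]]]
        unfolding S_def by blast
      ultimately show False by simp
    qed
  qed
  have inS: "\<exists>l<card S. isomorphic_modules A (X i) (X (f l))" if i: "i < n" for i
  proof -
    \<comment> \<open>The least index of the class of \<open>X i\<close>; by transitivity it is also
      least in its own class, hence in \<open>S\<close>.\<close>
    define j where "j = (LEAST j. isomorphic_modules A (X j) (X i))"
    have j: "isomorphic_modules A (X j) (X i)" unfolding j_def by (rule LeastI[OF isomorphic_refl])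
    have ji: "j \<le> i" unfolding j_def by (rule Least_le[OF isomorphic_refl])
    have "\<not> isomorphic_modules A (X m) (X j)" if "m < j" for m
      using not_less_Least[OF that[unfolded j_def]] isomorphic_trans[OF _ j] by blast
    then have "j \<in> S" unfolding S_def using ji i by simp
    then have "j \<in> f ` {..<card S}" using bij_betw_imp_surj_on[OF f] by simp
    then obtain l where "l < card S" "f l = j" by auto
    moreover have "isomorphic_modules A (X i) (X j)"
      by (rule isomorphic_sym[OF j]) (use lmX ji i in simp_all)
    ultimately show ?thesis by blast
  qed
  have lmT: "lm T" using T(1) by simp
  have rTB: "retract T B" "retract B T" using retract_iso[OF TB] T(1) fgB by simp_all
  have rB: "retract (X (f l)) B" if "l < card S" for l
    unfolding B_def by (rule retract_component[of "card S" "\<lambda>l. X (f l)"]) (use that lmX fS in simp_all)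
  have Xadd: "in_add T (X i)" if i: "i < n" for i
  proof -
    obtain l where l: "l < card S" "isomorphic_modules A (X i) (X (f l))" using inS[OF i] by blast
    have "retract (X i) (X (f l))" by (rule retract_iso(1)[OF l(2)]) (use lmX i fS(2)[OF l(1)] in simp_all)
    from retract_trans[OF retract_trans[OF this rB[OF l(1)]] rTB(2)] have "retract (X i) T" .
    then show ?thesis using in_add_retract in_add_self[OF lmT] by blast
  qed
  have "in_add T (direct_sum n X)" by (rule in_add_ds[OF lmT Xadd lmX])
  then have Madd: "in_add T M"
    using in_add_retract[OF retract_iso(1)[OF iso]] M fgD by simp
  have "retract B (direct_sum n X)"
  proof (rule retractI)
    define g where "g i = (THE l. l < card S \<and> f l = i)" for i
    have gf: "g (f l) = l" if "l < card S" for l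
      unfolding g_def using that f unfolding bij_betw_def inj_on_def by (intro the_equality) auto
    have g: "g i < card S" "f (g i) = i" if "i \<in> S" for i
    proof -
      have "i \<in> f ` {..<card S}" using bij_betw_imp_surj_on[OF f] \<open>i \<in> S\<close> by simp
      then obtain l where "l < card S" "f l = i" by auto
      then show "g i < card S" "f (g i) = i" using gf by auto
    qed
    show "(\<lambda>u. \<lambda>i\<in>{..<n}. if i \<in> S then u (g i) else \<zero>\<^bsub>X i\<^esub>) \<in> Hom B (direct_sum n X)"
    proof (rule ds_tuple)
      fix i assume i: "i < n"
      show "(\<lambda>u. if i \<in> S then u (g i) else \<zero>\<^bsub>X i\<^esub>) \<in> Hom B (X i)"
        using lmX[OF i] ds_proj_hom[of "g i" "card S" "\<lambda>l. X (f l)"] g[of i] unfolding B_def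
        by (cases "i \<in> S") simp_all
    qed
    show "(\<lambda>v. \<lambda>l\<in>{..<card S}. v (f l)) \<in> Hom (direct_sum n X) B"
      unfolding B_def by (rule ds_tuple) (rule ds_proj_hom[OF fS(2)])
    show "(\<lambda>l\<in>{..<card S}. (\<lambda>i\<in>{..<n}. if i \<in> S then u (g i) else \<zero>\<^bsub>X i\<^esub>) (f l)) = u" if u: "u \<in> carrier B" for u
      by (rule extensionalityI[of _ "{..<card S}"]) (use u fS gf in \<open>auto simp: B_def ds_carrier\<close>)
  qed
  then have "retract B M" using retract_trans[OF _ retract_iso(2)[OF iso]] M fgD by simp
  then have "retract T M" using rTB(1) retract_trans by blast
  then show ?thesis using that T(1) basic Madd by blast
qed


section \<open>A tilting-cotilting module in the subcategory bounds both dimensions\<close>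

section \<open>From tilting-cotilting modules to Auslander algebras\<close>

abbreviation "pinj M \<equiv> proj M \<and> inje M"

lemma pi_power: "pinj M \<Longrightarrow> pinj (power_module M n)"
  by (simp add: proj_ds inje_ds)

lemma mono_from_in_add:
  assumes X: "in_add T X" and E: "f \<in> Monic T E"
  obtains n g where "g \<in> Monic X (power_module E n)"
proof -
  obtain n where "retract X (power_module T n)" using X unfolding in_add_def by blast
  then obtain i p where "i \<in> Hom X (power_module T n)" "\<forall>x\<in>carrier X. p (i x) = x"
    by (metis retractE)
  then have "i \<in> Monic X (power_module T n)" using retract_mono by blast
  then show ?thesis using that mono_comp mono_power[OF E] by blast
qed

text \<open>This is vanishing of the second extension group of \<open>M\<close> with values in
  \<open>T\<close>, shifted to the syzygy \<open>K\<close>. A map from \<open>K\<close> to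
  \<open>I'\<close> extends to \<open>P\<close> because \<open>I'\<close> is injective, and lifts to
  \<open>I\<close> because \<open>P\<close> is projective.\<close>

lemma ext_van_syzygy:
  fixes T :: "('a, 't) module"
  assumes T: "fg T" and s: "ses T j I q I'" "inje I" "inje I'"
    and p: "ses K i P p M" "proj P" "fg K"
  shows "ext_van K T"
proof (rule ext_vanI_inje[OF s(1,2) fg_lm[OF inje_fg[OF s(3)]] fg_lm[OF p(3)] T])
  fix f assume f: "f \<in> Hom K I'"
  have fgP: "fg P" by (rule proj_fg[OF p(2)])
  obtain u where u: "u \<in> Hom P I'" "\<forall>x\<in>carrier K. u (i x) = f x"
    using inje_extend[OF s(3) p(3) fgP ses_mono[OF p(1)] f] by blast
  obtain v where v: "v \<in> Hom P I" "\<forall>x\<in>carrier P. q (v x) = u x"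
    using proj_lift[OF p(2) inje_fg[OF s(2)] inje_fg[OF s(3)] ses_epi[OF s(1)] u(1)] by blast
  show "\<exists>h\<in>Hom K I. \<forall>m\<in>carrier K. q (h m) = f m"
    by (rule bexI[OF _ hom_comp[OF ses_hom1[OF p(1)] v(1)]])
       (use u(2) v(2) hom_closed[OF ses_hom1[OF p(1)]] in simp)
qed

text \<open>In the long exact sequence the group for \<open>(K2, L)\<close> lies between maps
  \<open>K2 -> T1\<close> and the zero group for \<open>(K2, T0)\<close>. The connecting map is
  zero: a map \<open>K2 -> T1\<close> extends to \<open>P\<close>, since the group for
  \<open>(K1, T1)\<close> vanishes, and then lifts to \<open>T0\<close>. The proof carries this out
  on a presentation of \<open>K2\<close>.\<close>

lemma ext_van_second_syzygy:
  fixes L :: "('a, 'l) module" and T0 :: "('a, 't0) module" and T1 :: "('a, 't1) module"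
  assumes t: "ses L t T0 g T1" "fg L" "fg T0" "fg T1"
    and s: "ses K2 i P p K1" "proj P" "fg K1" "fg K2"
    and van: "ext_van K1 T1" "ext_van K2 T0"
  shows "ext_van K2 L"
proof -
  obtain P' K3 :: "'a umod" and i' p' where s': "proj P'" "fg K3" "ses K3 i' P' p' K2"
    by (rule presentation[OF s(4)])
  have fgP: "fg P" "fg P'" using s(2) s'(1) by (simp_all add: proj_fg)
  have lm: "lm L" "lm T0" "lm T1" "lm K1" "lm K2" "lm K3" "lm P" "lm P'" using t s s' fgP by simp_all
  have h: "t \<in> Hom L T0" "g \<in> Hom T0 T1" "i \<in> Hom K2 P" "p \<in> Hom P K1" "i' \<in> Hom K3 P'" "p' \<in> Hom P' K2"
    using t s s' by simp_all
  show ?thesis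
  proof (rule ext_vanI_proj[OF s'(3,1) lm(6) s(4) lm(1)])
    fix f assume f: "f \<in> Hom K3 L"
    obtain u where u: "u \<in> Hom P' T0" "\<forall>x\<in>carrier K3. u (i' x) = t (f x)"
      using ext_extend[OF van(2) s(4) t(3) s'(3) fgP(2) lm(6) hom_comp[OF f h(1)]] by blast
    have "g (u x) = \<zero>\<^bsub>T1\<^esub>" if x: "x \<in> carrier P'" "p' x = \<zero>\<^bsub>K2\<^esub>" for x
    proof -
      obtain k where "k \<in> carrier K3" "x = i' k" using ses_exact[OF s'(3) x] by blast
      then show ?thesis using u(2) ses_comp[OF t(1)] hom_closed[OF f] by simp
    qed
    \<comment> \<open>\<open>v\<close> is the obstruction to \<open>u\<close> having values in
      \<open>L\<close>.\<close>
    then obtain v where v: "v \<in> Hom K2 T1" "\<forall>x\<in>carrier P'. v (p' x) = g (u x)"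
      using epi_factor[OF ses_epi[OF s'(3)] hom_comp[OF u(1) h(2)] lm(8,5,3)] by blast
    obtain w where w: "w \<in> Hom P T1" "\<forall>x\<in>carrier K2. w (i x) = v x"
      using ext_extend[OF van(1) s(3) t(4) s(1) fgP(1) lm(5) v(1)] by blast
    obtain y where y: "y \<in> Hom P T0" "\<forall>x\<in>carrier P. g (y x) = w x"
      using proj_lift[OF s(2) t(3,4) ses_epi[OF t(1)] w(1)] by blast
    \<comment> \<open>The lift \<open>y\<close> of the extended obstruction is subtracted. The
      correction passes through \<open>p'\<close>, so it vanishes on \<open>K3\<close> and leaves
      the values prescribed by \<open>f\<close> there unchanged.\<close>
    define z where "z x = u x \<ominus>\<^bsub>T0\<^esub> y (i (p' x))" for x
    have yip: "(\<lambda>x. y (i (p' x))) \<in> Hom P' T0"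
      by (rule hom_comp[OF h(6) hom_comp[OF h(3) y(1)]])
    have z: "z \<in> Hom P' T0" unfolding z_def by (rule hom_diff[OF u(1) yip lm(2)])
    have "z x \<in> t ` carrier L" if x: "x \<in> carrier P'" for x
    proof (rule ses_exact[OF t(1) hom_closed[OF z x]])
      have c: "p' x \<in> carrier K2" "i (p' x) \<in> carrier P" using h x by simp_all
      have "g (y (i (p' x))) = g (u x)" using y(2) w(2) v(2) c x by simp
      then show "g (z x) = \<zero>\<^bsub>T1\<^esub>"
        unfolding z_def using hom_minus[OF h(2) lm(2,3) hom_closed[OF u(1) x] hom_closed[OF yip x]]
          hom_closed[OF h(2) hom_closed[OF u(1) x]] lm by simp
    qed
    then obtain r where r: "r \<in> Hom P' L" "\<forall>x\<in>carrier P'. t (r x) = z x"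
      using mono_factor[OF ses_mono[OF t(1)] z lm(8,2,1)] by blast
    have "r (i' k) = f k" if k: "k \<in> carrier K3" for k
    proof -
      have c: "i' k \<in> carrier P'" "f k \<in> carrier L" using h k f by simp_all
      have "y (i (p' (i' k))) = \<zero>\<^bsub>T0\<^esub>"
        using ses_comp[OF s'(3) k] hom_zero[OF h(3) lm(5,7)] hom_zero[OF y(1) lm(7,2)] by simp
      then have "t (r (i' k)) = t (f k)"
        using r(2) c u(2) k hom_closed[OF h(1) c(2)] lm by (simp add: z_def)
      then show ?thesis
        using mono_eq[OF ses_mono[OF t(1)] hom_closed[OF r(1) c(1)] c(2)] by simp
    qed
    with r(1) show "\<exists>h\<in>Hom P' L. \<forall>k\<in>carrier K3. h (i' k) = f k" by blast
  qed
qed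

text \<open>Second syzygies are closed under syzygies, so a finite projective resolution of a second
  syzygy can be split off step by step from its left end.\<close>

lemma second_syzygy_splits:
  fixes K :: "'a umod"
  assumes van: "\<And>(M :: 'a umod) (K1 :: 'a umod) (K2 :: 'a umod) (P0 :: 'a umod) (P1 :: 'a umod) i1 p0 i2 p1.
      \<lbrakk>fg M; fg K1; fg K2; proj P0; proj P1; ses K1 i1 P0 p0 M; ses K2 i2 P1 p1 K1\<rbrakk> \<Longrightarrow>
        ext_van K2 (regular_module A)"
  shows "\<lbrakk>pd_le n K; fg (M :: 'a umod); fg (K1 :: 'a umod); fg K; proj (P0 :: 'a umod); proj (P1 :: 'a umod);
    ses K1 i1 P0 p0 M; ses K i2 P1 p1 K1\<rbrakk> \<Longrightarrow> proj K"
proof (induction n arbitrary: K M K1 P0 P1 i1 p0 i2 p1)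
  case 0
  then show ?case by simp
next
  case (Suc n)
  obtain P K' :: "'a umod" and i p where P: "proj P" "fg K'" "ses K' i P p K" "pd_le n K'"
    using Suc.prems(1) by auto
  \<comment> \<open>\<open>K'\<close> is a second syzygy of \<open>K1\<close>, by way of
    \<open>K\<close>, and its resolution is shorter. Once it is projective it is a summand of a free
    module, so the vanishing for the regular module passes to it; the extension of \<open>K\<close>
    by \<open>K'\<close> splits and \<open>K\<close> is a summand of \<open>P\<close>.\<close>
  have K': "proj K'"
    by (rule Suc.IH[OF P(4) Suc.prems(3,4) P(2) Suc.prems(6) P(1) Suc.prems(8) P(3)])
  obtain m where m: "retract K' (power_module (regular_module A) m)" by (rule proj_retract_free[OF K'])
  have "ext_van K (regular_module A)" by (rule van[OF Suc.prems(2,3,4,5,6,7,8)])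
  then have "ext_van K (power_module (regular_module A) m)"
    by (intro ext_van_ds_right) (use Suc.prems in simp_all)
  then have "ext_van K K'"
    using ext_van_retract_right[OF _ m Suc.prems(4) proj_fg[OF proj_free] fg_lm[OF P(2)]] by blast
  then obtain s where "s \<in> Hom K P" "\<forall>x\<in>carrier K. p (s x) = x"
    using ext_van_section[OF _ proj_fg[OF P(1)] P(3)] by blast
  then have "retract K P" using P(3) by (intro retractI[of s K P p]) simp_all
  then show ?case using retract_proj[OF _ P(1) fg_lm[OF Suc.prems(4)]] by blast
qed

lemma gldim_le_2_of_tilting:
  fixes T T0 T1 :: "'a umod"
  assumes fin: "gldim A < \<infinity>" and T: "fg T" "injdim A T \<le> 1"
    and add: "in_add T T0" "in_add T T1" "fg T0" "fg T1" and s: "ses (regular_module A) t T0 g T1"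
  shows "gldim A \<le> 2"
proof -
  obtain n where "\<forall>M :: 'a umod. fg M \<longrightarrow> pd_le n M" by (rule gldim_finite[OF fin])
  then have n: "\<And>M :: 'a umod. fg M \<Longrightarrow> pd_le n M" by blast
  obtain I I' :: "'a umod" and j q where I: "inje I" "inje I'" "ses T j I q I'"
    using injdim_le_1_iff[of T] T by auto
  \<comment> \<open>Vanishing of the second extension group with values in add T, read on first
    syzygies. It is applied to \<open>K1\<close> with \<open>T1\<close> and to \<open>K2\<close>
    with \<open>T0\<close>.\<close>
  have vanT: "ext_van K X" if "ses K i P p M" "proj P" "fg K" "in_add T X" "fg X"
    for K M P X :: "'a umod" and i p
    by (rule ext_van_in_add_right[OF ext_van_syzygy[OF T(1) I(3,1,2) that(1,2,3)] that(4,3) T(1)])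
       (use that in simp)
  have van: "ext_van K2 (regular_module A)"
    if "fg M" "fg K1" "fg K2" "proj P0" "proj P1" "ses K1 i1 P0 p0 M" "ses K2 i2 P1 p1 K1"
    for M K1 K2 P0 P1 :: "'a umod" and i1 p0 i2 p1
    by (rule ext_van_second_syzygy[OF s fg_regular add(3,4) that(7,5,2,3)
          vanT[OF that(6,4,2) add(2,4)] vanT[OF that(7,5,3) add(1,3)]])
  have "pd_le 2 M" if M: "fg M" for M :: "'a umod"
  proof -
    obtain P0 K1 :: "'a umod" and i1 p0 where 1: "proj P0" "fg K1" "ses K1 i1 P0 p0 M"
      by (rule presentation[OF M])
    obtain P1 K2 :: "'a umod" and i2 p1 where 2: "proj P1" "fg K2" "ses K2 i2 P1 p1 K1"
      by (rule presentation[OF 1(2)])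
    have "proj K2" by (rule second_syzygy_splits[OF van n[OF 2(2)] M 1(2) 2(2) 1(1) 2(1) 1(3) 2(3)])
    then have "pd_le (Suc 0) K1" unfolding pd_le.simps using 2 by blast
    then have "pd_le (Suc (Suc 0)) M" unfolding pd_le.simps(2)[of "Suc 0"] using 1 by blast
    then show ?thesis by (simp add: numeral_2_eq_2)
  qed
  then show ?thesis using gldim_le_iff[of 2] by (simp add: numeral_eq_enat)
qed

text \<open>\<open>D\<close> plays the part of the dual of \<Lambda>, entering through the cotilting
  sequence and through embeddings into its powers. Membership of \<open>T\<close> in the subcategory
  is encoded by the embedding \<open>a\<close> and the epimorphism \<open>b\<close>.\<close>

lemma domdim_ge_2_of_tilting:
  fixes T T0 T1 :: "'a umod" and D :: "('a, 'd) module" and E :: "('a, 'e) module" and E' :: "('a, 'f) module"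
  assumes enough: "\<And>X :: 'a umod. fg X \<Longrightarrow> \<exists>(E :: 'a umod) f. inje E \<and> f \<in> Monic X E"
    and D: "fg D" and cogen: "\<And>X :: 'a umod. fg X \<Longrightarrow> \<exists>m f. f \<in> Monic X (power_module D m)"
    and T: "fg T" and E: "pinj E" "a \<in> Monic T E" and E': "pinj E'" "b \<in> Epic E' T"
    and t: "ses (regular_module A) t T0 g T1" "in_add T T0" "fg T0"
    and c: "ses C0 c C1 d D" "in_add T C0" "in_add T C1" "fg C0" "fg C1"
  shows "2 \<le> domdim A"
proof -
  obtain n h where h: "h \<in> Monic T0 (power_module E n)" by (rule mono_from_in_add[OF t(2) E(2)])
  have G: "pinj (power_module E n)" by (rule pi_power[OF E(1)])
  \<comment> \<open>The regular module embeds in \<open>T0\<close>, hence in a power of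
    \<open>E\<close>; the envelope taken inside that power is a summand of it and inherits
    projectivity.\<close>
  obtain I0 :: "'a umod" and e0 where I0: "inje I0" "e0 \<in> Monic (regular_module A) I0"
    "essential_submodule A (e0 ` carrier (regular_module A)) I0" "retract I0 (power_module E n)"
    by (rule injective_envelope_retract[OF lm_regular conjunct2[OF G] mono_comp[OF ses_mono[OF t(1)] h]])
  have fgI0: "fg I0" by (rule inje_fg[OF I0(1)])
  have pI0: "proj I0" by (rule retract_proj[OF I0(4) conjunct1[OF G]]) (use fgI0 in simp)
  define X where "X = quot I0 (e0 ` carrier (regular_module A))"
  define q where "q = qrep I0 (e0 ` carrier (regular_module A))"
  have sX: "ses (regular_module A) e0 I0 q X"
    unfolding X_def q_def by (rule ses_quot[OF I0(2)]) (use fgI0 in simp_all)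
  have fgX: "fg X"
    unfolding X_def by (rule fg_quot[OF fgI0 sub_range[OF mono_hom[OF I0(2)]]]) (use fgI0 in simp_all)
  have van: "ext_van X T"
  proof (rule ext_vanI_proj[OF sX pI0 lm_regular fgX fg_lm[OF T]])
    fix f assume f: "f \<in> Hom (regular_module A) T"
    obtain u where u: "u \<in> Hom (regular_module A) E'" "\<forall>x\<in>carrier (regular_module A). b (u x) = f x"
      using proj_lift[OF proj_regular proj_fg[OF conjunct1[OF E'(1)]] T E'(2) f] by blast
    obtain v where v: "v \<in> Hom I0 E'" "\<forall>x\<in>carrier (regular_module A). v (e0 x) = u x"
      using inje_extend[OF conjunct2[OF E'(1)] fg_regular fgI0 I0(2) u(1)] by blast
    show "\<exists>h\<in>Hom I0 T. \<forall>k\<in>carrier (regular_module A). h (e0 k) = f k"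
      by (rule bexI[OF _ hom_comp[OF v(1) epi_hom[OF E'(2)]]]) (use u(2) v(2) in simp)
  qed
  have vanC: "ext_van X C0" by (rule ext_van_in_add_right[OF van c(2) fgX T]) (use c in simp)
  obtain m F where F: "F \<in> Monic X (power_module D m)" using cogen[OF fgX] by blast
  have lm: "lm X" "lm D" "lm C1" "lm (power_module D m)" "lm (power_module C1 m)"
    using fgX D c(5) by (simp_all add: lm_ds)
  \<comment> \<open>The coordinates of an embedding \<open>F\<close> of \<open>X\<close> into a
    power of \<open>D\<close> lift along \<open>C1 -> D\<close>, as extensions of \<open>X\<close>
    by \<open>C0\<close> split. The lifts are jointly injective because the coordinates of
    \<open>F\<close> are.\<close>
  have "\<exists>k. k \<in> Hom X C1 \<and> (\<forall>x\<in>carrier X. d (k x) = F x i)" if i: "i < m" for i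
    using ext_lift[OF vanC fgX c(4,1) lm(3,2) hom_comp[OF mono_hom[OF F] ds_proj_hom[OF i]]] by blast
  then obtain k where k: "\<And>i. i < m \<Longrightarrow> k i \<in> Hom X C1" "\<And>i. i < m \<Longrightarrow> \<forall>x\<in>carrier X. d (k i x) = F x i"
    by metis
  define K where "K x = (\<lambda>i\<in>{..<m}. k i x)" for x
  have "K \<in> Hom X (power_module C1 m)" unfolding K_def by (rule ds_tuple[OF k(1)])
  then have K: "K \<in> Monic X (power_module C1 m)"
  proof (rule monoI[OF _ lm(1,5)])
    fix x assume x: "x \<in> carrier X" "K x = \<zero>\<^bsub>power_module C1 m\<^esub>"
    have "F x i = \<zero>\<^bsub>D\<^esub>" if i: "i < m" for i
    proof -
      have "k i x = \<zero>\<^bsub>C1\<^esub>" using fun_cong[OF x(2), of i] i by (simp add: K_def ds_simps)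
      then show ?thesis using k(2)[OF i] x(1) hom_zero[OF ses_hom2[OF c(1)] lm(3,2)] by metis
    qed
    then have "F x = \<zero>\<^bsub>power_module D m\<^esub>"
      using hom_closed[OF mono_hom[OF F] x(1)] lm(4)
      by (intro ds_eqI[of _ m "\<lambda>_. D"]) (simp_all add: ds_simps(2) m_zero_closed[OF lm(4), unfolded ds_simps(2)])
    then show "x = \<zero>\<^bsub>X\<^esub>" using mono_zero_iff[OF F lm(1,4) x(1)] by simp
  qed
  obtain n' h' where h': "h' \<in> Monic C1 (power_module E n')" by (rule mono_from_in_add[OF c(3) E(2)])
  let ?G = "power_module (power_module E n') m"
  have G': "pinj ?G" by (intro pi_power E(1))
  obtain I1 :: "'a umod" and e1 where I1: "inje I1" "e1 \<in> Monic X I1"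
    "essential_submodule A (e1 ` carrier X) I1" "retract I1 ?G"
    by (rule injective_envelope_retract[OF lm(1) conjunct2[OF G'] mono_comp[OF K mono_power[OF h']]])
  have fgI1: "fg I1" by (rule inje_fg[OF I1(1)])
  have pI1: "proj I1" by (rule retract_proj[OF I1(4) conjunct1[OF G']]) (use fgI1 in simp)
  define X2 where "X2 = quot I1 (e1 ` carrier X)"
  define q2 where "q2 = qrep I1 (e1 ` carrier X)"
  have sX2: "ses X e1 I1 q2 X2"
    unfolding X2_def q2_def by (rule ses_quot[OF I1(2)]) (use fgI1 fgX in simp_all)
  have fgX2: "fg X2"
    unfolding X2_def by (rule fg_quot[OF fgI1 sub_range[OF mono_hom[OF I1(2)]]]) (use fgI1 fgX in simp_all)
  \<comment> \<open>Any minimal resolution of the remaining cokernel serves as the tail; the two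
    steps below put \<open>I1\<close> and \<open>I0\<close> in front.\<close>
  obtain I e d' where res: "minimal_injective_resolution A X2 I e d'"
    using minimal_injective_resolution_ex[OF enough fgX2] by blast
  note res1 = minimal_injective_resolution_step[OF sX2 I1(1) fg_lm[OF fgX2] I1(3) res]
  note res0 = minimal_injective_resolution_step[OF sX I0(1) lm(1) I0(3) res1]
  show ?thesis
    unfolding domdim_ge_2_iff
    by (rule exI[of _ "case_nat I0 (case_nat I1 I)"], intro exI conjI, rule res0) (simp_all add: pI0 pI1)
qed


section \<open>Construction of the tilting-cotilting module, and elimination of the representatives
  Q\<close>

section \<open>From Auslander algebras to tilting-cotilting modules\<close>

text \<open>The obstruction to extending a map along \<open>g\<close> lies in the extensions of the
  cokernel of \<open>g\<close>. That cokernel has its carrier in the universe, because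
  \<open>quot\<close> picks representatives instead of cosets.\<close>

lemma injeI_ext:
  fixes W :: "('a, 'w) module"
  assumes W: "fg W" and van: "\<And>C :: 'a umod. fg C \<Longrightarrow> ext_van C W"
  shows "inje W"
proof (rule injeI[OF W])
  fix M N :: "'a umod" and g h assume *: "fg M" "fg N" "g \<in> Monic M N" "h \<in> Hom M W"
  have lm: "lm M" "lm N" using * by simp_all
  let ?C = "quot N (g ` carrier M)"
  have C: "fg ?C" by (rule fg_quot[OF *(2) sub_range[OF mono_hom[OF *(3)] lm]])
  show "\<exists>k\<in>Hom N W. \<forall>x\<in>carrier M. k (g x) = h x"
    by (rule ext_extend[OF van[OF C] C W ses_quot[OF *(3) lm] *(2) lm(1) *(4)])
qed

text \<open>A map from \<open>K2\<close> to \<open>T\<close> lifts to \<open>E\<close> by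
  projectivity of \<open>K2\<close>, and the lift extends to \<open>P\<close> by injectivity of
  \<open>E\<close>.\<close>

lemma ext_van_quotient_of_inje:
  fixes T :: "('a, 't) module" and E :: "('a, 'e) module"
  assumes s: "ses K2 i P p K1" "proj P" "proj K2" "fg K1" and E: "inje E" "b \<in> Epic E T" "fg T"
  shows "ext_van K1 T"
proof (rule ext_vanI_proj[OF s(1,2) fg_lm[OF proj_fg[OF s(3)]] s(4) fg_lm[OF E(3)]])
  fix f assume f: "f \<in> Hom K2 T"
  obtain u where u: "u \<in> Hom K2 E" "\<forall>x\<in>carrier K2. b (u x) = f x"
    using proj_lift[OF s(3) inje_fg[OF E(1)] E(3,2) f] by blast
  obtain v where v: "v \<in> Hom P E" "\<forall>x\<in>carrier K2. v (i x) = u x"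
    using inje_extend[OF E(1) proj_fg[OF s(3)] proj_fg[OF s(2)] ses_mono[OF s(1)] u(1)] by blast
  show "\<exists>h\<in>Hom P T. \<forall>k\<in>carrier K2. h (i k) = f k"
    by (rule bexI[OF _ hom_comp[OF v(1) epi_hom[OF E(2)]]]) (use u(2) v(2) in simp)
qed

text \<open>The cosyzygy \<open>E/T\<close> is injective: extensions of \<open>C\<close> by it
  correspond to second extensions of \<open>C\<close> by \<open>T\<close>, hence to extensions of
  the first syzygy \<open>K1\<close> by \<open>T\<close>. These split because \<open>K1\<close> has
  projective dimension at most 1 and \<open>T\<close> is a quotient of an injective module.\<close>

lemma injdim_le_1_of_gldim:
  fixes T E :: "'a umod" and E' :: "('a, 'e) module"
  assumes gl: "\<And>M :: 'a umod. fg M \<Longrightarrow> pd_le 2 M"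
    and T: "fg T" and E: "inje E" "a \<in> Monic T E" and E': "inje E'" "b \<in> Epic E' T"
  shows "injdim A T \<le> 1"
proof -
  have fgE: "fg E" by (rule inje_fg[OF E(1)])
  let ?W = "quot E (a ` carrier T)" and ?q = "qrep E (a ` carrier T)"
  have s: "ses T a E ?q ?W" by (rule ses_quot[OF E(2)]) (use T fgE in simp_all)
  have W: "fg ?W" by (rule fg_quot[OF fgE sub_range[OF mono_hom[OF E(2)]]]) (use T fgE in simp_all)
  have "inje ?W"
  proof (rule injeI_ext[OF W])
    fix C :: "'a umod" assume C: "fg C"
    obtain P0 K1 :: "'a umod" and i1 p0 where 1: "proj P0" "fg K1" "ses K1 i1 P0 p0 C"
      by (rule presentation[OF C])
    obtain P1 K2 :: "'a umod" and i2 p1 where 2: "proj P1" "fg K2" "ses K2 i2 P1 p1 K1"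
      by (rule presentation[OF 1(2)])
    have "proj K2"
      by (rule second_syzygy_projective[OF gl[OF C] C 1(2) fg_lm[OF 2(2)] 1(3) 2(3) 1(1) 2(1)])
    then have van: "ext_van K1 T" by (rule ext_van_quotient_of_inje[OF 2(3,1) _ 1(2) E' T])
    show "ext_van C ?W"
    proof (rule ext_vanI_proj[OF 1(3,1) fg_lm[OF 1(2)] C fg_lm[OF W]])
      fix f assume f: "f \<in> Hom K1 ?W"
      obtain u where u: "u \<in> Hom K1 E" "\<forall>x\<in>carrier K1. ?q (u x) = f x"
        using ext_lift[OF van 1(2) T s fg_lm[OF fgE] fg_lm[OF W] f] by blast
      obtain v where v: "v \<in> Hom P0 E" "\<forall>x\<in>carrier K1. v (i1 x) = u x"
        using inje_extend[OF E(1) 1(2) proj_fg[OF 1(1)] ses_mono[OF 1(3)] u(1)] by blast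
      show "\<exists>h\<in>Hom P0 ?W. \<forall>k\<in>carrier K1. h (i1 k) = f k"
        by (rule bexI[OF _ hom_comp[OF v(1) ses_hom2[OF s]]]) (use u(2) v(2) in simp)
    qed
  qed
  then show ?thesis using injdim_le_1_iff[OF fg_lm[OF T]] E(1) s by blast
qed


text \<open>\<open>P\<close> is a summand of a free module of some rank \<open>m\<close>. Comparing
  its embedding into \<open>E\<close> with the \<open>m\<close>-th power of the embedding of the
  regular module into \<open>I0\<close> makes \<open>Y\<close> a summand of
  \<open>X^m + E\<close>.\<close>

lemma in_add_cokernel:
  fixes T :: "('a, 't) module" and I0 :: "('a, 'i) module" and X :: "('a, 'x0) module"
    and P :: "('a, 'p) module" and E :: "('a, 'e) module" and Y :: "('a, 'y) module"
  assumes s: "ses (regular_module A) e I0 q X" and I0: "inje I0" and X: "fg X"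
    and T: "fg T" "in_add T X" and E: "inje E" "in_add T E" and P: "proj P"
    and sY: "ses P j E p Y" and Y: "lm Y"
  shows "in_add T Y"
proof -
  obtain m where m: "retract P (power_module (regular_module A) m)" by (rule proj_retract_free[OF P])
  have lm: "lm I0" "lm X" "lm T" using inje_fg[OF I0] X T by simp_all
  have lmX: "lm (power_module X m)" by (rule lm_ds) (rule lm(2))
  have "retract Y (direct_sum2 (power_module X m) E)"
    by (rule cosyzygy_retract[OF m sY ses_power[OF s lm_regular lm(1,2)] E(1) inje_ds[OF I0]
          proj_fg[OF P] proj_fg[OF proj_free] Y lmX])
  moreover have "in_add T (direct_sum2 (power_module X m) E)"
    by (rule in_add_ds2[OF lm(3) in_add_ds[OF lm(3)] E(2)]) (use T(2) lm in simp_all)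
  ultimately show ?thesis by (rule in_add_retract)
qed

lemma pinj_umod:
  fixes E :: "('a, 'e) module"
  assumes E: "pinj E"
  obtains E' :: "'a umod" and h k where "pinj E'" "h \<in> Iso E E'" "k \<in> Iso E' E"
proof -
  have fgE: "fg E" using E inje_fg by blast
  obtain E' :: "'a umod" and h k where h: "fg E'" "h \<in> Iso E E'" "k \<in> Iso E' E"
    "\<forall>x\<in>carrier E. k (h x) = x" "\<forall>y\<in>carrier E'. h (k y) = y"
    using umod_ex[OF fgE] .
  have r: "retract E' E" by (rule retractI[OF iso_hom[OF h(3)] iso_hom[OF h(2)]]) (use h(5) in simp)
  have "pinj E'" using retract_proj[OF r _ fg_lm[OF h(1)]] retract_inje[OF r _ fg_lm[OF h(1)]] E by blast
  then show ?thesis using that h by blast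
qed

lemma cotilting_sequence:
  fixes T :: "('a, 't) module" and I0 :: "('a, 'i) module" and X :: "('a, 'x0) module"
    and D :: "('a, 'd) module" and G :: "('a, 'g) module"
  assumes gl: "\<And>M :: 'a umod. fg M \<Longrightarrow> pd_le 2 M"
    and s: "ses (regular_module A) e I0 q X" and I0: "pinj I0" and X: "fg X"
    and T: "fg T" "in_add T I0" "in_add T X" and G: "pinj G" "a \<in> Monic T G"
    and D: "inje D"
  obtains C0 C1 :: "'a umod" and f g where "C0 \<in> add_closure A T" "C1 \<in> add_closure A T" "ses C0 f C1 g D"
proof -
  have lmT: "lm T" and fgD: "fg D" and fgI0: "fg I0"
    using T(1) inje_fg[OF D] inje_fg[OF conjunct2[OF I0]] by simp_all
  have lmI0: "lm I0" using fgI0 by simp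
  have powE: "pinj (power_module I0 m)" "in_add T (power_module I0 m)" "fg (power_module I0 m)"
    "lm (power_module I0 m)" for m
    using pi_power[OF I0] in_add_ds[OF lmT, of m "\<lambda>_. I0"] T(2) lmI0 fg_ds[of m "\<lambda>_. I0"] fgI0
    by (simp_all add: lm_ds)
  have e: "e \<in> Monic (regular_module A) I0" by (rule ses_mono[OF s])
  obtain m c where c: "c \<in> Epic (power_module (regular_module A) m) D" by (rule free_cover[OF fgD])
  obtain E1 :: "'a umod" and h1 k1 where E1: "E1 \<in> add_closure A T" "h1 \<in> Iso (power_module I0 m) E1"
    "k1 \<in> Iso E1 (power_module I0 m)" "\<forall>x\<in>carrier (power_module I0 m). k1 (h1 x) = x" "\<forall>y\<in>carrier E1. h1 (k1 y) = y"
    using in_add_umod[OF powE(2) T(1) powE(4)] .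
  have E1': "fg E1" "in_add T E1" using E1(1) in_add_iff_add_closure[OF T(1)] by simp_all
  have rE1: "retract E1 (power_module I0 m)"
    by (rule retractI[OF iso_hom[OF E1(3)] iso_hom[OF E1(2)]]) (use E1(5) in simp)
  have pE1: "pinj E1"
    using retract_proj[OF rE1 _ fg_lm[OF E1'(1)]] retract_inje[OF rE1 _ fg_lm[OF E1'(1)]] powE(1) by blast
  have e1: "(\<lambda>x. h1 (\<lambda>i\<in>{..<m}. e (x i))) \<in> Monic (power_module (regular_module A) m) E1"
    by (rule mono_comp[OF mono_power[OF e] iso_mono[OF E1(2)]])
  \<comment> \<open>A free cover \<open>c\<close> of \<open>D\<close> extends from the free module
    to \<open>E1\<close>, because \<open>D\<close> is injective, and stays onto. \<open>E1\<close>
    is a copy of the power of \<open>I0\<close> in the universe, as \<open>add_closure\<close>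
    requires.\<close>
  obtain w where w: "w \<in> Hom E1 D"
    "\<forall>x\<in>carrier (power_module (regular_module A) m). w (h1 (\<lambda>i\<in>{..<m}. e (x i))) = c x"
    using inje_extend[OF D proj_fg[OF proj_free] E1'(1) e1 epi_hom[OF c]] by blast
  have wepi: "w \<in> Epic E1 D"
  proof (rule epiI[OF w(1)])
    fix y assume "y \<in> carrier D"
    then obtain x where "x \<in> carrier (power_module (regular_module A) m)" "c x = y"
      using epi_ex[OF c] by blast
    then show "\<exists>x\<in>carrier E1. w x = y"
      using w(2) hom_closed[OF mono_hom[OF e1]] by (intro bexI[of _ "h1 (\<lambda>i\<in>{..<m}. e (x i))"]) simp_all
  qed
  have lmD: "lm D" and lmE1: "lm E1" using fgD E1' by simp_all
  define C0 where "C0 = submod E1 (hom_kernel E1 D w)"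
  have sC: "ses C0 (\<lambda>x. x) E1 w D" unfolding C0_def by (rule ses_submod[OF wepi lmE1 lmD])
  have fgC: "fg C0" unfolding C0_def by (rule fg_kernel[OF w(1) E1'(1) lmD])
  obtain P K :: "'a umod" and i p where P: "proj P" "fg K" "ses K i P p C0"
    by (rule presentation[OF fgC])
  \<comment> \<open>\<open>K\<close> is a second syzygy of \<open>D\<close>, by way of
    \<open>E1\<close> and \<open>P\<close>. The universe copy \<open>D'\<close> is what the bound
    \<open>gl\<close> speaks about.\<close>
  have pK: "proj K"
  proof -
    obtain D' :: "'a umod" and h k where D': "fg D'" "h \<in> Iso D D'" "k \<in> Iso D' D"
      "\<forall>x\<in>carrier D. k (h x) = x" "\<forall>y\<in>carrier D'. h (k y) = y"
      using umod_ex[OF fgD] .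
    have "ses C0 (\<lambda>x. x) E1 (\<lambda>x. h (w x)) D'"
      by (rule ses_iso_right[OF sC D'(2) lmD fg_lm[OF D'(1)]])
    then show ?thesis
      using second_syzygy_projective[OF gl[OF D'(1)] D'(1) fgC fg_lm[OF P(2)] _ P(3) conjunct1[OF pE1] P(1)] by blast
  qed
  obtain b where b: "retract P (power_module (regular_module A) b)" by (rule proj_retract_free[OF P(1)])
  then obtain u v where uv: "u \<in> Hom P (power_module (regular_module A) b)" "\<forall>x\<in>carrier P. v (u x) = x"
    by (metis retractE)
  let ?E = "power_module I0 b"
  define j where "j x = (\<lambda>i\<in>{..<b}. e (u x i))" for x
  have j: "j \<in> Monic P ?E"
    unfolding j_def by (rule mono_comp[OF retract_mono[of u _ _ v] mono_power[OF e]]) (use uv in simp_all)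
  have ji: "(\<lambda>x. j (i x)) \<in> Monic K ?E" by (rule mono_comp[OF ses_mono[OF P(3)] j])
  have lmP: "lm P" and lmK: "lm K" and lmC: "lm C0" using proj_fg[OF P(1)] P(2) fgC by simp_all
  define Y1 where "Y1 = quot ?E (j ` carrier P)"
  define q1 where "q1 = qrep ?E (j ` carrier P)"
  have s1: "ses P j ?E q1 Y1" unfolding Y1_def q1_def by (rule ses_quot[OF j lmP powE(4)])
  have fgY1: "fg Y1"
    unfolding Y1_def by (rule fg_quot[OF powE(3) sub_range[OF mono_hom[OF j] lmP powE(4)]])
  define Y2 where "Y2 = quot ?E ((\<lambda>x. j (i x)) ` carrier K)"
  define q2 where "q2 = qrep ?E ((\<lambda>x. j (i x)) ` carrier K)"
  have s2: "ses K (\<lambda>x. j (i x)) ?E q2 Y2" unfolding Y2_def q2_def by (rule ses_quot[OF ji lmK powE(4)])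
  have fgY2: "fg Y2"
    unfolding Y2_def by (rule fg_quot[OF powE(3) sub_range[OF mono_hom[OF ji] lmK powE(4)]])
  have lmY: "lm Y1" "lm Y2" using fgY1 fgY2 by simp_all
  \<comment> \<open>Applied to the cokernels of \<open>P\<close> and of \<open>K\<close> in the same
    module \<open>?E\<close>; projectivity of \<open>K\<close>, gained from the bound on the global
    dimension, is what admits the second application.\<close>
  note aY = in_add_cokernel[OF s conjunct2[OF I0] X T(1,3) conjunct2[OF powE(1)] powE(2)]
  have aY1: "in_add T Y1" by (rule aY[OF P(1) s1 lmY(1)])
  have aY2: "in_add T Y2" by (rule aY[OF pK s2 lmY(2)])
  have ph: "p \<in> Hom P C0" "i \<in> Hom K P" "j \<in> Hom P ?E" "q1 \<in> Hom ?E Y1" "q2 \<in> Hom ?E Y2"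
    using P(3) s1 s2 by simp_all
  have "q2 (j x) = \<zero>\<^bsub>Y2\<^esub>" if x: "x \<in> carrier P" "p x = \<zero>\<^bsub>C0\<^esub>" for x
  proof -
    obtain k where "k \<in> carrier K" "x = i k" using ses_exact[OF P(3) x] by blast
    then show ?thesis using ses_comp[OF s2] by simp
  qed
  then obtain \<alpha> where \<alpha>: "\<alpha> \<in> Hom C0 Y2" "\<forall>x\<in>carrier P. \<alpha> (p x) = q2 (j x)"
    using epi_factor[OF ses_epi[OF P(3)] hom_comp[OF ph(3,5)] lmP lmC lmY(2)] by blast
  have "q1 z = \<zero>\<^bsub>Y1\<^esub>" if z: "z \<in> carrier ?E" "q2 z = \<zero>\<^bsub>Y2\<^esub>" for z
  proof -
    obtain k where "k \<in> carrier K" "z = j (i k)" using ses_exact[OF s2, OF z] by blast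
    then show ?thesis using ses_comp[OF s1] hom_closed[OF ph(2)] by simp
  qed
  then obtain \<beta> where \<beta>: "\<beta> \<in> Hom Y2 Y1" "\<forall>z\<in>carrier ?E. \<beta> (q2 z) = q1 z"
    using epi_factor[OF ses_epi[OF s2] ph(4) powE(4) lmY(2,1)] by blast
  have jE: "j x \<in> carrier ?E" if "x \<in> carrier P" for x by (rule hom_closed[OF ph(3) that])
  have sY: "ses C0 \<alpha> Y2 \<beta> Y1"
  proof (rule sesI)
    show "\<alpha> \<in> Monic C0 Y2"
    proof (rule monoI[OF \<alpha>(1) lmC lmY(2)])
      fix y assume y: "y \<in> carrier C0" "\<alpha> y = \<zero>\<^bsub>Y2\<^esub>"
      obtain x where x: "x \<in> carrier P" "p x = y" using epi_ex[OF ses_epi[OF P(3)] y(1)] by blast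
      then have "q2 (j x) = \<zero>\<^bsub>Y2\<^esub>" using \<alpha>(2) y(2) by auto
      then obtain k where k: "k \<in> carrier K" "j x = j (i k)" using ses_exact[OF s2 jE[OF x(1)]] by blast
      then have "x = i k" using mono_eq[OF j x(1) hom_closed[OF ph(2) k(1)]] by simp
      then show "y = \<zero>\<^bsub>C0\<^esub>" using x(2) ses_comp[OF P(3) k(1)] by simp
    qed
    show "\<beta> \<in> Epic Y2 Y1"
    proof (rule epiI[OF \<beta>(1)])
      fix y assume "y \<in> carrier Y1"
      then obtain z where "z \<in> carrier ?E" "q1 z = y" using epi_ex[OF ses_epi[OF s1]] by blast
      then show "\<exists>x\<in>carrier Y2. \<beta> x = y"
        using \<beta>(2) hom_closed[OF ph(5)] by (intro bexI[of _ "q2 z"]) simp_all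
    qed
    show "\<beta> (\<alpha> y) = \<zero>\<^bsub>Y1\<^esub>" if y: "y \<in> carrier C0" for y
    proof -
      obtain x where x: "x \<in> carrier P" "p x = y" using epi_ex[OF ses_epi[OF P(3)] y] by blast
      have "\<beta> (\<alpha> (p x)) = q1 (j x)" using \<alpha>(2) \<beta>(2) x(1) jE by simp
      then show ?thesis using x ses_comp[OF s1 x(1)] by simp
    qed
    show "y \<in> \<alpha> ` carrier C0" if y: "y \<in> carrier Y2" "\<beta> y = \<zero>\<^bsub>Y1\<^esub>" for y
    proof -
      obtain z where z: "z \<in> carrier ?E" "q2 z = y" using epi_ex[OF ses_epi[OF s2] y(1)] by blast
      then have "q1 z = \<zero>\<^bsub>Y1\<^esub>" using \<beta>(2) y(2) by auto
      then obtain x where x: "x \<in> carrier P" "z = j x" using ses_exact[OF s1 z(1)] by blast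
      then have "y = \<alpha> (p x)" using \<alpha>(2) z(2) by simp
      then show ?thesis using hom_closed[OF ph(1) x(1)] by blast
    qed
  qed
  have "ext_van Y1 C0"
  proof (rule ext_vanI_inje[OF sC conjunct2[OF pE1] lmD lmY(1) fgC])
    fix f assume f: "f \<in> Hom Y1 D"
    obtain n g where g: "g \<in> Monic Y1 (power_module G n)" by (rule mono_from_in_add[OF aY1 G(2)])
    have pG: "pinj (power_module G n)" by (rule pi_power[OF G(1)])
    then have fgG: "fg (power_module G n)" using inje_fg by blast
    obtain x where x: "x \<in> Hom (power_module G n) D" "\<forall>y\<in>carrier Y1. x (g y) = f y"
      using inje_extend[OF D fgY1 fgG g f] by blast
    obtain y where y: "y \<in> Hom (power_module G n) E1" "\<forall>t\<in>carrier (power_module G n). w (y t) = x t"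
      using proj_lift[OF conjunct1[OF pG] E1'(1) fgD wepi x(1)] by blast
    show "\<exists>h\<in>Hom Y1 E1. \<forall>m\<in>carrier Y1. w (h m) = f m"
      by (rule bexI[OF _ hom_comp[OF mono_hom[OF g] y(1)]])
         (use x(2) y(2) hom_closed[OF mono_hom[OF g]] in simp)
  qed
  then obtain r where r: "r \<in> Hom Y2 C0" "\<forall>x\<in>carrier C0. r (\<alpha> x) = x"
    using ext_van_retraction[OF _ fgY2 sY lmY(1) lmC] by blast
  have "retract C0 Y2" by (rule retractI[OF \<alpha>(1) r(1)]) (use r(2) in simp)
  then have "in_add T C0" using aY2 by (rule in_add_retract)
  then have "C0 \<in> add_closure A T" using in_add_iff_add_closure[OF T(1)] fgC by blast
  then show ?thesis using that E1(1) sC by blast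
qed

text \<open>The universe modules \<open>E\<close> and \<open>E'\<close> are returned because
  \<open>Gen_Cogen_iff\<close> tests membership in the subcategory by such modules.\<close>

lemma tilting_cotilting_of_gldim_domdim:
  fixes D :: "('a, 'd) module"
  assumes gl: "gldim A \<le> 2" and dd: "2 \<le> domdim A" and D: "inje D"
  obtains T E E' :: "'a umod" and a b where "tilting_module A T" "injdim A T \<le> 1" "ext_van T T"
    "pinj E" "a \<in> Monic T E" "pinj E'" "b \<in> Epic E' T"
    "\<exists>C0\<in>add_closure A T. \<exists>C1\<in>add_closure A T. \<exists>f g. ses C0 f C1 g D"
proof -
  have pd: "pd_le 2 M" if "fg M" for M :: "'a umod"
    using gl gldim_le_iff[of 2] that by (simp add: numeral_eq_enat)
  obtain I e d where I: "minimal_injective_resolution A (regular_module A) I e d" "proj (I 0)" "proj (I 1)"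
    using dd unfolding domdim_ge_2_iff by blast
  have r: "inje (I i)" "e \<in> Monic (regular_module A) (I 0)" "d i \<in> Hom (I i) (I (Suc i))"
    "e ` carrier (regular_module A) = hom_kernel (I 0) (I 1) (d 0)" for i
    using I(1) by (simp_all only: minimal_injective_resolution_def injective_resolution_def)
  define I0 where "I0 = I 0"
  define I1 where "I1 = I 1"
  have p0: "pinj I0" and p1: "pinj I1" using I r(1) by (simp_all add: I0_def I1_def)
  have fgI: "fg I0" "fg I1" using p0 p1 inje_fg by blast+
  have lmI: "lm I0" "lm I1" using fgI by simp_all
  have d0: "d 0 \<in> Hom I0 I1" using r(3)[of 0] by (simp add: I0_def I1_def)
  have e0: "e \<in> Monic (regular_module A) I0" using r(2) by (simp add: I0_def)
  have ker: "e ` carrier (regular_module A) = hom_kernel I0 I1 (d 0)" using r(4) by (simp add: I0_def I1_def)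
  \<comment> \<open>The image of \<open>d 0\<close> serves as the cokernel of the regular module in
    \<open>I0\<close>, so its embedding into the projective module \<open>I1\<close> comes for
    free.\<close>
  define X where "X = submod I1 (d 0 ` carrier I0)"
  have subX: "sub (d 0 ` carrier I0) I1" by (rule sub_range[OF d0 lmI])
  have dX: "d 0 \<in> Epic I0 X"
    unfolding X_def
    by (rule imageI_epi) (use hom_into_submod[OF subX, of "d 0" I0] d0 in simp_all)
  have lmX: "lm X" unfolding X_def using lmI subX by simp
  have fgX: "fg X" by (rule fg_epi[OF fgI(1) dX lmX])
  have kerX: "hom_kernel I0 X (d 0) = hom_kernel I0 I1 (d 0)" by (simp add: hom_kernel_def X_def)
  have sX: "ses (regular_module A) e I0 (d 0) X"
    by (simp only: short_exact_def e0 dX ker kerX simp_thms)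
  have Xm: "(\<lambda>x. x) \<in> Monic X I1" unfolding X_def by (rule submod_incl[OF subX])
  define T' where "T' = direct_sum2 I0 X"
  have fgT': "fg T'" unfolding T'_def using fgI fgX by simp
  obtain T :: "'a umod" where T: "fg T" "basic_module A T" "retract T T'" "in_add T T'"
    by (rule basic_version[OF fgT'])
  have lmT: "lm T" using T(1) by simp
  have T0: "in_add T I0" "in_add T X"
    using in_add_retract[OF retract_ds2_left[OF lmX] T(4)[unfolded T'_def]]
      in_add_retract[OF retract_ds2_right[OF lmI(1)] T(4)[unfolded T'_def]] by simp_all
  obtain i p where ip: "i \<in> Hom T T'" "p \<in> Hom T' T" "\<forall>x\<in>carrier T. p (i x) = x"
    using T(3) by (rule retractE)
  define Z where "Z = submod I0 {\<zero>\<^bsub>I0\<^esub>}"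
  have Z: "lm Z" "zero_module Z" unfolding Z_def using lmI by (simp_all add: zero_module_def)
  have sZ: "ses Z (\<lambda>x. x) I0 (\<lambda>x. x) I0"
    unfolding Z_def by (rule sesI[OF submod_incl]) (use lmI in \<open>auto intro: imageI_epi\<close>)
  define E' where "E' = direct_sum2 I0 I0"
  define K where "K = direct_sum2 Z (regular_module A)"
  define k where "k z = (fst z, e (snd z))" for z :: "(nat \<Rightarrow> 'a) set \<times> 'a"
  define c where "c z = (fst z, d 0 (snd z))" for z :: "(nat \<Rightarrow> 'a) set \<times> (nat \<Rightarrow> 'a) set"
  \<comment> \<open>A projective resolution of length one of \<open>T'\<close> whose middle term is
    also injective. It makes \<open>T'\<close> a quotient of a projective-injective module, lets
    maps from \<open>K\<close> to \<open>T'\<close> extend over \<open>E'\<close>, and bounds the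
    projective dimension of the summand \<open>T\<close>.\<close>
  have sT': "ses K k E' c T'"
    unfolding K_def E'_def T'_def k_def c_def using ses_ds2_map[OF sZ sX] by simp
  have pE': "pinj E'" unfolding E'_def using p0 proj_ds2 inje_ds2 by blast
  have pK: "proj K"
    unfolding K_def by (rule proj_ds2[OF zero_module_proj[OF zero_module_fg[OF Z] Z(2)] proj_regular])
  have lmK: "lm K" and fgE': "fg E'" using proj_fg[OF pK] inje_fg[OF conjunct2[OF pE']] by simp_all
  have van': "ext_van T' T'"
  proof (rule ext_vanI_proj[OF sT' conjunct1[OF pE'] lmK fgT' fg_lm[OF fgT']])
    fix f assume f: "f \<in> Hom K T'"
    obtain u where u: "u \<in> Hom K E'" "\<forall>x\<in>carrier K. c (u x) = f x"
      using proj_lift[OF pK fgE' fgT' ses_epi[OF sT'] f] by blast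
    obtain v where v: "v \<in> Hom E' E'" "\<forall>x\<in>carrier K. v (k x) = u x"
      using inje_extend[OF conjunct2[OF pE'] proj_fg[OF pK] fgE' ses_mono[OF sT'] u(1)] by blast
    show "\<exists>h\<in>Hom E' T'. \<forall>x\<in>carrier K. h (k x) = f x"
      by (rule bexI[OF _ hom_comp[OF v(1) ses_hom2[OF sT']]]) (use u(2) v(2) in simp)
  qed
  have van: "ext_van T T"
    by (rule ext_van_retract_right[OF ext_van_retract_left[OF van' T(3) fgT' fgT' lmT] T(3) T(1) fgT' lmT])
  have pdT: "projdim A T \<le> 1"
  proof -
    obtain P L :: "'a umod" and l y where P: "proj P" "fg L" "ses L l P y T"
      by (rule presentation[OF T(1)])
    \<comment> \<open>The form of Schanuel's lemma for summands: the syzygy of \<open>T\<close> is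
      compared directly with that of \<open>T'\<close>.\<close>
    have "retract L (direct_sum2 K P)"
      by (rule syzygy_retract[OF T(3) P(3) sT' P(1) conjunct1[OF pE'] T(1) fgT' fg_lm[OF P(2)] lmK])
    then have "proj L" by (rule retract_proj[OF _ proj_ds2[OF pK P(1)] fg_lm[OF P(2)]])
    then have "pd_le 1 T" using P by auto
    then show ?thesis using projdim_le_iff[OF T(1), of 1] by (simp add: one_enat_def)
  qed
  have Tepi: "(\<lambda>x. p (c x)) \<in> Epic E' T"
    by (rule epi_comp[OF ses_epi[OF sT'] retract_epi[OF ip(1,2)]]) (use ip(3) in simp)
  have pE: "pinj (direct_sum2 I0 I1)" using p0 p1 proj_ds2 inje_ds2 by blast
  have "(\<lambda>x. x) \<in> Monic I0 I0" by (rule injI_mono) simp_all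
  from mono_ds2[OF this Xm] have m1: "(\<lambda>z. (fst z, snd z)) \<in> Monic T' (direct_sum2 I0 I1)" by (simp add: T'_def)
  have "i \<in> Monic T T'" by (rule retract_mono[OF ip(1), of p]) (use ip(3) in simp)
  from mono_comp[OF this m1] have Tm: "(\<lambda>x. (fst (i x), snd (i x))) \<in> Monic T (direct_sum2 I0 I1)" .
  obtain G :: "'a umod" and h h' where G: "pinj G" "h \<in> Iso (direct_sum2 I0 I1) G" "h' \<in> Iso G (direct_sum2 I0 I1)"
    by (rule pinj_umod[OF pE])
  obtain G' :: "'a umod" and g g' where G': "pinj G'" "g \<in> Iso E' G'" "g' \<in> Iso G' E'"
    by (rule pinj_umod[OF pE'])
  have a: "(\<lambda>x. h (fst (i x), snd (i x))) \<in> Monic T G" by (rule mono_comp[OF Tm iso_mono[OF G(2)]])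
  have b: "(\<lambda>x. p (c (g' x))) \<in> Epic G' T" by (rule epi_comp[OF iso_epi[OF G'(3)] Tepi])
  have "injdim A T \<le> 1"
    by (rule injdim_le_1_of_gldim[OF pd T(1) conjunct2[OF G(1)] a conjunct2[OF G'(1)] b])
  moreover have "tilting_module A T"
    unfolding tilting_module_def Ext1_singleton_iff[OF T(1) T(1)]
    using T(1,2) pdT van T0 fgI(1) fgX sX in_add_iff_add_closure[OF T(1)] by blast
  moreover obtain C0 C1 :: "'a umod" and f1 g1 where "C0 \<in> add_closure A T" "C1 \<in> add_closure A T" "ses C0 f1 C1 g1 D"
    by (rule cotilting_sequence[OF pd sX p0 fgX T(1) T0 G(1) a D])
  ultimately show ?thesis using that van G(1) a G'(1) b by blast
qed

subsection \<open>The subcategory determined by the projective-injective modules\<close>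

text \<open>Every indecomposable summand of \<open>P\<close> is again projective and injective,
  hence isomorphic to some \<open>Q j\<close>.\<close>

lemma pinj_in_add:
  fixes P :: "'a umod" and Q :: "nat \<Rightarrow> 'a umod"
  assumes Q: "indec_proj_inj_representatives A n Q" and P: "pinj P"
  shows "in_add (direct_sum n Q) P"
proof -
  have Qi: "proj (Q i)" "inje (Q i)" if "i < n" for i
    using Q that unfolding indec_proj_inj_representatives_def by blast+
  have lmQ: "lm (Q i)" if "i < n" for i using proj_fg[OF Qi(1)[OF that]] by simp
  have lmQt: "lm (direct_sum n Q)" by (rule lm_ds[OF lmQ])
  have fgP: "fg P" using P proj_fg by blast
  obtain k and X :: "nat \<Rightarrow> 'a umod" where X: "\<forall>i<k. indecomposable_module A (X i)"
    "isomorphic_modules A P (direct_sum k X)"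
    using decomposable_umod[OF fgP] unfolding decomposable_def by blast
  have fgX: "fg (X i)" if "i < k" for i using X(1) that indecomposable_fg by blast
  have lmX: "lm (X i)" if "i < k" for i using fgX[OF that] by simp
  have lmS: "lm (direct_sum k X)" by (rule lm_ds[OF lmX])
  have "in_add (direct_sum n Q) (X i)" if i: "i < k" for i
  proof -
    have r: "retract (X i) P"
      by (rule retract_trans[OF retract_component[of k X, OF lmX i] retract_iso(2)[OF X(2) fg_lm[OF fgP] lmS]])
    have "pinj (X i)" using retract_proj[OF r _ lmX[OF i]] retract_inje[OF r _ lmX[OF i]] P by blast
    moreover have "indecomposable_module A (X i)" using X(1) i by blast
    ultimately obtain j where j: "j < n" "isomorphic_modules A (X i) (Q j)"
      using Q unfolding indec_proj_inj_representatives_def by blast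
    have "retract (X i) (direct_sum n Q)"
      by (rule retract_trans[OF retract_iso(1)[OF j(2) lmX[OF i] lmQ[OF j(1)]] retract_component[of n Q, OF lmQ j(1)]])
    then show ?thesis using in_add_retract in_add_self[OF lmQt] by blast
  qed
  then have "in_add (direct_sum n Q) (direct_sum k X)" by (rule in_add_ds[OF lmQt _ lmX])
  with retract_iso(1)[OF X(2) fg_lm[OF fgP] lmS] show ?thesis by (rule in_add_retract)
qed

text \<open>Powers of the sum of the \<open>Q i\<close> are projective-injective, and every
  projective-injective module is a summand of such a power. The rest of the argument can therefore
  use arbitrary projective-injective modules.\<close>

lemma Gen_Cogen_iff:
  fixes T :: "'a umod" and Q :: "nat \<Rightarrow> 'a umod"
  assumes Q: "indec_proj_inj_representatives A n Q"
  shows "T \<in> Gen A (direct_sum n Q) \<inter> Cogen A (direct_sum n Q) \<longleftrightarrow>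
    fg T \<and> (\<exists>(E :: 'a umod) a. pinj E \<and> a \<in> Monic T E) \<and> (\<exists>(E :: 'a umod) b. pinj E \<and> b \<in> Epic E T)"
proof
  have "proj (Q i)" "inje (Q i)" if "i < n" for i
    using Q that unfolding indec_proj_inj_representatives_def by blast+
  then have "pinj (direct_sum n Q)" by (simp add: proj_ds inje_ds)
  then have pow: "pinj (power_module (direct_sum n Q) m)" for m by (rule pi_power)
  assume T: "T \<in> Gen A (direct_sum n Q) \<inter> Cogen A (direct_sum n Q)"
  then obtain m b where b: "b \<in> Epic (power_module (direct_sum n Q) m) T" unfolding Gen_def by blast
  obtain m' a where a: "a \<in> Monic T (power_module (direct_sum n Q) m')" using T unfolding Cogen_def by blast
  obtain G :: "'a umod" and h h' where G: "pinj G" "h \<in> Iso (power_module (direct_sum n Q) m) G"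
    "h' \<in> Iso G (power_module (direct_sum n Q) m)"
    by (rule pinj_umod[OF pow])
  obtain G' :: "'a umod" and g g' where G': "pinj G'" "g \<in> Iso (power_module (direct_sum n Q) m') G'"
    "g' \<in> Iso G' (power_module (direct_sum n Q) m')"
    by (rule pinj_umod[OF pow])
  show "fg T \<and> (\<exists>(E :: 'a umod) a. pinj E \<and> a \<in> Monic T E) \<and> (\<exists>(E :: 'a umod) b. pinj E \<and> b \<in> Epic E T)"
    using T G(1) G'(1) epi_comp[OF iso_epi[OF G(3)] b] mono_comp[OF a iso_mono[OF G'(2)]]
    unfolding Gen_def by blast
next
  assume "fg T \<and> (\<exists>(E :: 'a umod) a. pinj E \<and> a \<in> Monic T E) \<and> (\<exists>(E :: 'a umod) b. pinj E \<and> b \<in> Epic E T)"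
  then obtain E E' :: "'a umod" and a b where E: "fg T" "pinj E" "a \<in> Monic T E" "pinj E'" "b \<in> Epic E' T"
    by blast
  obtain m i p where 1: "i \<in> Hom E (power_module (direct_sum n Q) m)" "\<forall>x\<in>carrier E. p (i x) = x"
    using pinj_in_add[OF Q E(2)] unfolding in_add_def retract_def by blast
  have "i \<in> Monic E (power_module (direct_sum n Q) m)" by (rule retract_mono[OF 1(1), of p]) (use 1(2) in simp)
  from mono_comp[OF E(3) this] have "T \<in> Cogen A (direct_sum n Q)" unfolding Cogen_def using E(1) by blast
  moreover obtain m' i' p' where 2: "i' \<in> Hom E' (power_module (direct_sum n Q) m')"
    "p' \<in> Hom (power_module (direct_sum n Q) m') E'" "\<forall>x\<in>carrier E'. p' (i' x) = x"
    using pinj_in_add[OF Q E(4)] unfolding in_add_def retract_def by blast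
  have "p' \<in> Epic (power_module (direct_sum n Q) m') E'" by (rule retract_epi[OF 2(1,2)]) (use 2(3) in simp)
  from epi_comp[OF this E(5)] have "T \<in> Gen A (direct_sum n Q)" unfolding Gen_def using E(1) by blast
  ultimately show "T \<in> Gen A (direct_sum n Q) \<inter> Cogen A (direct_sum n Q)" by blast
qed

end

theorem corollary2p4p13:
  fixes R :: "'r ring" and \<phi> :: "'r \<Rightarrow> 'a" and \<Lambda> :: "'a ring" and J :: "('r, 'j) module"
    and n :: nat and Q :: "nat \<Rightarrow> 'a umod"
  assumes "artin_algebra R \<phi> \<Lambda>"
    and "dualizing_module R J"
    and "gldim \<Lambda> < \<infinity>"
    and "indec_proj_inj_representatives \<Lambda> n Q"
  defines "Qt \<equiv> direct_sum n Q"
  defines "\<C> \<equiv> Gen \<Lambda> Qt \<inter> Cogen \<Lambda> Qt"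
  shows "(\<exists>T\<in>\<C>. tilting_module \<Lambda> T \<and> cotilting_module R \<phi> J \<Lambda> T) \<longleftrightarrow> auslander_algebra R \<phi> \<Lambda>"
proof -
  interpret D: dualized_artin_algebra R J \<Lambda> \<phi>
    using assms(1,2) artin_algebra_rings[OF assms(1)]
    by (simp add: dualized_artin_algebra_def artinian_dualizing_def artinian_dualizing_axioms_def
        dualized_artin_algebra_axioms_def modules_over_def artin_algebra_def)
  let ?D = "dual_of_algebra R \<phi> J \<Lambda>"
  have C_iff: "T \<in> \<C> \<longleftrightarrow> fg_module \<Lambda> T \<and> (\<exists>(E :: 'a umod) a. D.S.pinj E \<and> a \<in> mod_mono \<Lambda> T E) \<and>
      (\<exists>(E :: 'a umod) b. D.S.pinj E \<and> b \<in> mod_epi \<Lambda> E T)" for T :: "'a umod"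
    unfolding \<C>_def Qt_def by (rule D.S.Gen_Cogen_iff[OF assms(4)])
  have cogen: "\<exists>m f. f \<in> mod_mono \<Lambda> X (power_module ?D m)" if X: "fg_module \<Lambda> X" for X :: "'a umod"
  proof -
    obtain m f where "f \<in> mod_mono \<Lambda> X (power_module ?D m)" by (rule D.mono_to_power_D\<Lambda>[OF X])
    then show ?thesis by blast
  qed
  show ?thesis
  proof
    assume "\<exists>T\<in>\<C>. tilting_module \<Lambda> T \<and> cotilting_module R \<phi> J \<Lambda> T"
    then obtain T where T: "T \<in> \<C>" "tilting_module \<Lambda> T" "cotilting_module R \<phi> J \<Lambda> T" by blast
    obtain E E' :: "'a umod" and a b where E: "D.S.pinj E" "a \<in> mod_mono \<Lambda> T E"
      "D.S.pinj E'" "b \<in> mod_epi \<Lambda> E' T"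
      using T(1) C_iff by blast
    have fgT: "fg_module \<Lambda> T" using T(2) by (simp add: tilting_module_def)
    obtain T0 T1 :: "'a umod" and t g where t: "T0 \<in> add_closure \<Lambda> T" "T1 \<in> add_closure \<Lambda> T"
      "short_exact \<Lambda> (regular_module \<Lambda>) t T0 g T1"
      using T(2) unfolding tilting_module_def by blast
    obtain C0 C1 :: "'a umod" and c d where c: "C0 \<in> add_closure \<Lambda> T" "C1 \<in> add_closure \<Lambda> T"
      "short_exact \<Lambda> C0 c C1 d ?D" and id: "injdim \<Lambda> T \<le> 1"
      using T(3) unfolding cotilting_module_def by blast
    have add: "fg_module \<Lambda> X" "D.S.in_add T X" if "X \<in> add_closure \<Lambda> T" for X
      using D.S.in_add_iff_add_closure[OF fgT] that by blast+
    have "gldim \<Lambda> \<le> 2"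
      by (rule D.S.gldim_le_2_of_tilting[OF assms(3) fgT id add(2)[OF t(1)] add(2)[OF t(2)]
            add(1)[OF t(1)] add(1)[OF t(2)] t(3)])
    moreover have "2 \<le> domdim \<Lambda>"
      by (rule D.S.domdim_ge_2_of_tilting[OF D.enough_injectives D.fg_D\<Lambda> cogen fgT E t(3) add(2,1)[OF t(1)]
            c(3) add(2)[OF c(1)] add(2)[OF c(2)] add(1)[OF c(1)] add(1)[OF c(2)]])
    ultimately show "auslander_algebra R \<phi> \<Lambda>"
      using assms(1) by (simp add: auslander_algebra_def)
  next
    assume "auslander_algebra R \<phi> \<Lambda>"
    then have dims: "gldim \<Lambda> \<le> 2" "2 \<le> domdim \<Lambda>" by (simp_all add: auslander_algebra_def)
    obtain T E E' :: "'a umod" and a b where T: "tilting_module \<Lambda> T" "injdim \<Lambda> T \<le> 1" "D.S.ext_van T T"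
      "D.S.pinj E" "a \<in> mod_mono \<Lambda> T E" "D.S.pinj E'" "b \<in> mod_epi \<Lambda> E' T"
      "\<exists>C0\<in>add_closure \<Lambda> T. \<exists>C1\<in>add_closure \<Lambda> T. \<exists>f g. short_exact \<Lambda> C0 f C1 g ?D"
      by (rule D.S.tilting_cotilting_of_gldim_domdim[OF dims D.inje_D\<Lambda>])
    have fgT: "fg_module \<Lambda> T" using T(1) by (simp add: tilting_module_def)
    have "T \<in> \<C>" using C_iff fgT T(4-7) by blast
    moreover have "cotilting_module R \<phi> J \<Lambda> T"
      unfolding cotilting_module_def D.S.Ext1_singleton_iff[OF fgT fgT] using fgT T(2,3,8) by blast
    ultimately show "\<exists>T\<in>\<C>. tilting_module \<Lambda> T \<and> cotilting_module R \<phi> J \<Lambda> T" using T(1) by blast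
  qed
qed

end
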